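(* Let $\gamma_1,\gamma_2>-1$ and let $h$ be a function analytic in a neighborhood of $[-1,1]$ and strictly positive on $[-1,1]$. Consider the orthogonal polynomial ensemble of size $n$ associated with the measure ${\rm d}\mu(x)=h(x)(1-x)^{\gamma_1}(1+x)^{\gamma_2}\,{\rm d}x$ on $[-1,1]$. Then for every $x_0\in(-1,1)$, every $f\in C^1_c(\mathbb{R})$ (continuously differentiable, compactly supported, real-valued) and every $0<\alpha<1$, $$X^{(n)}_{f,\alpha,x_0}-\mathbb{E}X^{(n)}_{f,\alpha,x_0}\to N(0,\sigma_f^2)$$ in distribution as $n\to\infty$, where $$\sigma_f^2=\frac{1}{4\pi^2}\iint_{\mathbb{R}^2}\left(\frac{f(x)-f(y)}{x-y}\right)^2{\rm d}x\,{\rm d}y.$$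
   Context: For a Borel measure $\mu$ on $\mathbb{R}$ with finite moments and $n\in\mathbb{N}$, the orthogonal polynomial ensemble (OPE) of size $n$ is the probability measure on $\mathbb{R}^n$ proportional to $\prod_{1\le i<j\le n}(x_i-x_j)^2\,{\rm d}\mu(x_1)\cdots{\rm d}\mu(x_n)$. For $x_0\in\mathbb{R}$, $0<\alpha<1$ and $f:\mathbb{R}\to\mathbb{R}$, the mesoscopic linear statistic is $X^{(n)}_{f,\alpha,x_0}=\sum_{j=1}^n f(n^\alpha(x_j-x_0))$, where $(x_1,\dots,x_n)$ is distributed according to the OPE; $\mathbb{E}$ denotes expectation with respect to the OPE. *)

theory Defs
  imports "HOL-Probability.Probability"
begin

definition real_analytic_on :: "(real \<Rightarrow> real) \<Rightarrow> real set \<Rightarrow> bool" where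
  "real_analytic_on h U \<longleftrightarrow>
     (\<forall>a\<in>U. \<exists>c::nat \<Rightarrow> real. \<exists>r>0. \<forall>y. \<bar>y - a\<bar> < r \<longrightarrow> (\<lambda>k. c k * (y - a) ^ k) sums h y)"

definition jacobi_type_measure :: "(real \<Rightarrow> real) \<Rightarrow> real \<Rightarrow> real \<Rightarrow> real measure" where
  "jacobi_type_measure h g1 g2 =
     density lborel (\<lambda>x. ennreal (indicator {-1..1} x * h x * (1 - x) powr g1 * (1 + x) powr g2))"

definition vandermonde_sq :: "nat \<Rightarrow> (nat \<Rightarrow> real) \<Rightarrow> real" where
  "vandermonde_sq n x = (\<Prod>j<n. \<Prod>i<j. (x i - x j)^2)"

definition OPE :: "real measure \<Rightarrow> nat \<Rightarrow> (nat \<Rightarrow> real) measure" where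
  "OPE \<mu> n =
     (let P = PiM {..<n} (\<lambda>_. \<mu>);
          Z = integral\<^sup>L P (vandermonde_sq n)
      in density P (\<lambda>x. ennreal (vandermonde_sq n x / Z)))"

definition meso_stat :: "(real \<Rightarrow> real) \<Rightarrow> real \<Rightarrow> real \<Rightarrow> nat \<Rightarrow> (nat \<Rightarrow> real) \<Rightarrow> real" where
  "meso_stat f \<alpha> x0 n x = (\<Sum>j<n. f (real n powr \<alpha> * (x j - x0)))"

definition normal_measure :: "real \<Rightarrow> real measure" where
  "normal_measure s2 =
     (if s2 = 0 then return borel 0 else density lborel (normal_density 0 (sqrt s2)))"

definition sigma_sq :: "(real \<Rightarrow> real) \<Rightarrow> real" where
  "sigma_sq f = 1 / (4 * pi^2) *
     integral\<^sup>L (lborel \<Otimes>\<^sub>M lborel) (\<lambda>(x, y). ((f x - f y) / (x - y))^2)"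

end

theory Submission
  imports Defs "HOL-Computational_Algebra.Polynomial" "HOL-Combinatorics.Permutations"
begin

text \<open>
  Put \<open>N = n powr \<alpha>\<close>, \<open>u = N * (x - x0)\<close> and write \<open>r\<^sub>\<zeta> u = 1 / (\<zeta> - u)\<close> for the resolvent. If
  \<open>g\<close> is \<open>M\<close>-Lipschitz in \<open>u\<close> for the chordal metric \<open>\<bar>u - v\<bar> / sqrt ((1 + u\<^sup>2) * (1 + v\<^sup>2))\<close>, the
  Christoffel--Darboux formula and the boundedness of the orthonormal polynomials near \<open>x0\<close>
  bound the variance of the linear statistic of \<open>g\<close> by \<open>C * M\<^sup>2\<close>, uniformly in \<open>n\<close>.

  For \<open>f\<close> a finite combination of resolvents and \<open>X\<close> its linear statistic, integrating the vector
  field \<open>(1 - x\<^sup>2) * r\<^sub>\<zeta>\<close> by parts against the joint density weighted by \<open>iexp (t * X)\<close> gives a loop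
  equation that is quadratic in \<open>R = (\<Sum>j<n. r\<^sub>\<zeta> (u j))\<close>. At \<open>t = 0\<close> it determines the limit of
  \<open>N / n * E R\<close>; linearised around \<open>E R\<close> it becomes, in the limit, the Gaussian equation
  \<open>\<phi>' t = - \<sigma>\<^sup>2 * t * \<phi> t\<close> for the characteristic function of the centred statistic. A general
  \<open>f\<close> is the limit, in the chordal Lipschitz seminorm, of Riemann sums of Poisson integrals, which
  are resolvent combinations; both the variance bound and \<open>sigma_sq\<close> are continuous in this seminorm.
\<close>

section \<open>Orthonormal polynomials\<close>

text \<open>The obstacle is two hard edges with arbitrary exponents and no asymptotics for the
  polynomials; the proof gets by with one uniform bound on \<open>OP n\<close> near
  \<open>x0\<close>. In the variance, Christoffel--Darboux cancels the factor \<open>x - y\<close>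
  of a Lipschitz bound, and the double integral splits into masses of \<open>OP n\<close> and
  \<open>OP (n - 1)\<close> under a Lorentzian of width \<open>1 / N\<close>, each of order
  \<open>1 / N\<close>; they absorb the factor N^2 from rescaling. The chordal seminorm, unlike the
  ordinary Lipschitz one, supplies this Lorentzian. Linearisation works because the coefficient of
  the fluctuation is of order \<open>n / N\<close>, which tends to infinity for \<alpha> < 1, while
  all fluctuating remainders stay bounded by the variance estimate. The equation for
  \<open>E R\<close> determines only a square; the sign comes from the imaginary part of a
  resolvent. The limiting variance emerges as a sum over pairs of poles in opposite half-planes, and
  \<open>sigma_sq\<close> of a resolvent combination evaluates to the same sum.\<close>

lemma poly_eq_lead_times_prod_roots:
  fixes Q :: "'a::idom poly"
  assumes "degree Q \<le> n" "inj_on a {..<n}" "\<And>i. i < n \<Longrightarrow> poly Q (a i) = 0"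
  shows "poly Q y = coeff Q n * (\<Prod>i<n. y - a i)"
proof -
  define R where "R = smult (coeff Q n) (\<Prod>i<n. [:- a i, 1:])"
  have d: "degree (\<Prod>i<n. [:- a i, 1:]) = n"
    by (subst degree_prod_eq_sum_degree) auto
  have "lead_coeff (\<Prod>i<n. [:- a i, 1:]) = 1"
    by (subst lead_coeff_prod) auto
  then have c: "coeff R n = coeff Q n"
    using d by (simp add: R_def)
  have "Q = R"
  proof (rule poly_eqI_degree_lead_coeff[where A = "a ` {..<n}"])
    show "coeff Q n = coeff R n" using c by simp
    show "n \<le> card (a ` {..<n})" using assms(2) by (simp add: card_image)
    show "degree R \<le> n" unfolding R_def by (rule order.trans[OF degree_smult_le]) (simp add: d)
    fix z assume "z \<in> a ` {..<n}"
    then obtain i where i: "i < n" "z = a i" by auto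
    then have "poly R z = 0"
      by (auto simp: R_def poly_prod)
    with i assms(3) show "poly Q z = poly R z" by simp
  qed (use assms in simp)
  then have "poly Q y = poly R y" by simp
  then show ?thesis by (simp add: R_def poly_prod)
qed

text \<open>The determinant of the matrix with entries \<open>P i\<close> at \<open>x j\<close>,
  kept as a Leibniz sum because its square is then a finite sum of products of one-variable
  functions, which integrate factor by factor.\<close>

definition leibniz_det :: "(nat \<Rightarrow> real poly) \<Rightarrow> nat \<Rightarrow> (nat \<Rightarrow> real) \<Rightarrow> real" where
  "leibniz_det P n x =
     (\<Sum>\<sigma> | \<sigma> permutes {..<n}. of_int (sign \<sigma>) * (\<Prod>j<n. poly (P (\<sigma> j)) (x j)))"

text \<open>Composition with the transposition of \<open>a\<close> and \<open>b\<close> reverses the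
  sign of every permutation but leaves its product unchanged, so the determinant equals its own
  negative.\<close>

lemma leibniz_det_eq_0:
  assumes "a < n" "b < n" "a \<noteq> b" "x a = x b"
  shows "leibniz_det P n x = 0"
proof -
  let ?t = "Transposition.transpose a b"
  have t: "?t permutes {..<n}" using assms by (intro permutes_swap_id) auto
  have "leibniz_det P n x = (\<Sum>\<sigma> | \<sigma> permutes {..<n}.
      of_int (sign (\<sigma> \<circ> ?t)) * (\<Prod>j<n. poly (P ((\<sigma> \<circ> ?t) j)) (x j)))"
    unfolding leibniz_det_def by (rule sum_permutations_compose_right[OF t])
  also have "\<dots> = (\<Sum>\<sigma> | \<sigma> permutes {..<n}. - (of_int (sign \<sigma>) * (\<Prod>j<n. poly (P (\<sigma> j)) (x j))))"
  proof (rule sum.cong[OF refl])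
    fix \<sigma> assume "\<sigma> \<in> {\<sigma>. \<sigma> permutes {..<n}}"
    then have s: "\<sigma> permutes {..<n}" by simp
    have "sign (\<sigma> \<circ> ?t) = - sign \<sigma>"
      using assms s t by (subst sign_compose) (auto simp: sign_swap_id permutation_permutes intro: permutation_swap_id)
    moreover have "(\<Prod>j<n. poly (P ((\<sigma> \<circ> ?t) j)) (x j)) = (\<Prod>j<n. poly (P ((\<sigma> \<circ> ?t) (?t j))) (x (?t j)))"
      using prod.permute[OF t, of "\<lambda>j. poly (P ((\<sigma> \<circ> ?t) j)) (x j)"] by (simp add: o_def)
    moreover have "x (?t j) = x j" for j
      using assms by (simp add: Transposition.transpose_def)
    ultimately show "of_int (sign (\<sigma> \<circ> ?t)) * (\<Prod>j<n. poly (P ((\<sigma> \<circ> ?t) j)) (x j)) =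
        - (of_int (sign \<sigma>) * (\<Prod>j<n. poly (P (\<sigma> j)) (x j)))"
      by simp
  qed
  also have "\<dots> = - leibniz_det P n x"
    by (simp add: leibniz_det_def sum_negf)
  finally show ?thesis by simp
qed

text \<open>With the other nodes frozen the determinant is a polynomial of degree at most
  \<open>n\<close> in the last node and vanishes at the \<open>n\<close> earlier ones, so it is its
  top coefficient times the product of linear factors. If two earlier nodes coincide, both sides are
  zero.\<close>

lemma leibniz_det_Suc:
  assumes deg: "\<And>k. degree (P k) = k"
  shows "leibniz_det P (Suc n) x = leibniz_det P n x * lead_coeff (P n) * (\<Prod>i<n. x n - x i)"
proof (cases "inj_on x {..<n}")
  case False
  then obtain a b where ab: "a < n" "b < n" "a \<noteq> b" "x a = x b"
    by (auto simp: inj_on_def)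
  then show ?thesis
    using leibniz_det_eq_0[of a n b x P] leibniz_det_eq_0[of a "Suc n" b x P] by simp
next
  case True
  define c where "c \<sigma> = of_int (sign \<sigma>) * (\<Prod>j<n. poly (P (\<sigma> j)) (x j))" for \<sigma>
  define Q where "Q = (\<Sum>\<sigma> | \<sigma> permutes {..<Suc n}. smult (c \<sigma>) (P (\<sigma> n)))"
  have Q: "poly Q y = leibniz_det P (Suc n) (x(n := y))" for y
  proof -
    have "(\<Prod>j<Suc n. poly (P (\<sigma> j)) ((x(n := y)) j)) = (\<Prod>j<n. poly (P (\<sigma> j)) (x j)) * poly (P (\<sigma> n)) y" for \<sigma>
      by (auto intro!: prod.cong simp: lessThan_Suc)
    then show ?thesis
      by (simp add: Q_def leibniz_det_def poly_sum c_def mult.assoc)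
  qed
  have lt: "\<sigma> n \<le> n" if "\<sigma> permutes {..<Suc n}" for \<sigma>
    using permutes_in_image[OF that, of n] by simp
  have "degree Q \<le> n"
    unfolding Q_def
    by (rule degree_sum_le) (auto simp: deg finite_permutations intro!: order.trans[OF degree_smult_le] lt)
  moreover have "poly Q (x i) = 0" if "i < n" for i
    unfolding Q using that by (intro leibniz_det_eq_0[of i _ n]) auto
  ultimately have "poly Q (x n) = coeff Q n * (\<Prod>i<n. x n - x i)"
    using True by (intro poly_eq_lead_times_prod_roots) auto
  moreover have "coeff Q n = leibniz_det P n x * lead_coeff (P n)"
  proof -
    have fixn: "{\<sigma>. \<sigma> permutes {..<Suc n} \<and> \<sigma> n = n} = {\<sigma>. \<sigma> permutes {..<n}}"
    proof (intro set_eqI iffI; clarsimp)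
      fix \<sigma> assume s: "\<sigma> permutes {..<Suc n}" "\<sigma> n = n"
      show "\<sigma> permutes {..<n}"
        by (rule permutes_superset[OF s(1)]) (use s(2) in \<open>auto simp: less_Suc_eq\<close>)
    next
      fix \<sigma> assume s: "\<sigma> permutes {..<n}"
      then show "\<sigma> permutes {..<Suc n} \<and> \<sigma> n = n"
        by (auto intro: permutes_subset simp: permutes_not_in)
    qed
    \<comment> \<open>A permutation that moves \<open>n\<close> puts a polynomial of degree below
      \<open>n\<close> at the last node, so only those fixing \<open>n\<close> reach the top
      coefficient; they are the permutations of the smaller set.\<close>
    have "coeff Q n = (\<Sum>\<sigma> | \<sigma> permutes {..<Suc n}. if \<sigma> n = n then c \<sigma> * lead_coeff (P n) else 0)"
      unfolding Q_def coeff_sum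
    proof (rule sum.cong[OF refl])
      fix \<sigma> assume "\<sigma> \<in> {\<sigma>. \<sigma> permutes {..<Suc n}}"
      then have "\<sigma> n \<noteq> n \<Longrightarrow> degree (P (\<sigma> n)) < n"
        using lt[of \<sigma>] by (auto simp: deg)
      then show "coeff (smult (c \<sigma>) (P (\<sigma> n))) n = (if \<sigma> n = n then c \<sigma> * lead_coeff (P n) else 0)"
        by (auto simp: coeff_eq_0 deg)
    qed
    also have "\<dots> = (\<Sum>\<sigma> | \<sigma> permutes {..<Suc n} \<and> \<sigma> n = n. c \<sigma> * lead_coeff (P n))"
      by (subst sum.inter_filter[symmetric]) (auto simp: finite_permutations)
    also have "\<dots> = leibniz_det P n x * lead_coeff (P n)"
      unfolding fixn by (simp add: leibniz_det_def c_def sum_distrib_right)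
    finally show ?thesis .
  qed
  ultimately show ?thesis
    using Q[of "x n"] by simp
qed

lemma leibniz_det_sq:
  assumes deg: "\<And>k. degree (P k) = k"
  shows "(leibniz_det P n x)\<^sup>2 = (\<Prod>k<n. lead_coeff (P k))\<^sup>2 * vandermonde_sq n x"
proof (induction n)
  case 0
  show ?case by (simp add: leibniz_det_def vandermonde_sq_def permutes_empty)
next
  case (Suc n)
  have "vandermonde_sq (Suc n) x = vandermonde_sq n x * (\<Prod>i<n. x n - x i)\<^sup>2"
    by (simp add: vandermonde_sq_def prod_power_distrib power2_commute)
  with Suc leibniz_det_Suc[OF deg, of n x] show ?case
    by (simp add: power_mult_distrib algebra_simps)
qed

text \<open>The permutation \<open>inv \<sigma> \<circ> \<tau>\<close> moves at most
  \<open>a\<close> and \<open>b\<close>. With \<open>a = b\<close> the transposition is the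
  identity, and a permutation is seen to be determined by all its values but one.\<close>

lemma permutes_agree_off_two:
  assumes "\<sigma> permutes A" "\<tau> permutes A" "a \<in> A" "b \<in> A" "\<And>j. j \<in> A \<Longrightarrow> j \<noteq> a \<Longrightarrow> j \<noteq> b \<Longrightarrow> \<tau> j = \<sigma> j"
  shows "\<tau> = \<sigma> \<or> \<tau> = \<sigma> \<circ> Transposition.transpose a b"
proof -
  define \<rho> where "\<rho> = inv \<sigma> \<circ> \<tau>"
  have bs: "bij \<sigma>" using assms(1) by (rule permutes_bij)
  have r: "\<rho> permutes A" unfolding \<rho>_def using assms by (intro permutes_compose permutes_inv)
  have ts: "\<tau> = \<sigma> \<circ> \<rho>" unfolding \<rho>_def using bs by (auto simp: fun_eq_iff bij_is_surj surj_f_inv_f)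
  have off: "\<rho> j = j" if "j \<noteq> a" "j \<noteq> b" for j
    using that assms(5)[of j] r bs unfolding \<rho>_def
    by (cases "j \<in> A") (auto simp: permutes_not_in[OF assms(2)] permutes_not_in[OF permutes_inv[OF assms(1)]] bij_is_inj)
  have "\<rho> permutes {a, b}"
    by (rule permutes_superset[OF r]) (use off in auto)
  then have "\<rho> = id \<or> \<rho> = Transposition.transpose a b"
    by (rule permutes_doubleton_iff[THEN iffD1])
  then show ?thesis using ts by auto
qed

text \<open>The exact formulas at finite \<open>n\<close> rest on these properties: support in the
  unit interval bounds the off-diagonal Jacobi coefficients by one, and \<open>nondeg\<close> keeps
  Gram--Schmidt from dividing by zero.\<close>

locale ope_measure =
  fixes \<mu> :: "real measure"
  assumes sets_mu [measurable_cong]: "sets \<mu> = sets borel"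
    and fin_mu: "finite_measure \<mu>"
    and supp_mu: "AE x in \<mu>. x \<in> {-1..1}"
    and nondeg: "\<And>p :: real poly. p \<noteq> 0 \<Longrightarrow> 0 < (\<integral>x. (poly p x)\<^sup>2 \<partial>\<mu>)"
begin

sublocale finite_measure \<mu> by (rule fin_mu)

lemma space_mu [simp]: "space \<mu> = UNIV"
  using sets_eq_imp_space_eq[OF sets_mu] by simp

lemma integrable_bounded_on:
  fixes f :: "real \<Rightarrow> 'b::{banach, second_countable_topology}"
  assumes "f \<in> borel_measurable borel" "\<And>x. x \<in> {-1..1} \<Longrightarrow> norm (f x) \<le> C"
  shows "integrable \<mu> f"
proof (rule integrable_const_bound[where B = C])
  show "AE x in \<mu>. norm (f x) \<le> C"
    using supp_mu by eventually_elim (use assms(2) in auto)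
  show "f \<in> borel_measurable \<mu>"
    using assms(1) by measurable
qed

lemma poly_bounded_on_unit: "\<exists>C. \<forall>x\<in>{-1..1::real}. \<bar>poly p x\<bar> \<le> C"
proof -
  have "bounded (poly p ` {-1..1})"
    by (intro compact_imp_bounded compact_continuous_image continuous_intros) auto
  then show ?thesis by (auto simp: bounded_iff)
qed

lemma borel_measurable_poly [measurable]: "poly p \<in> borel_measurable (borel :: real measure)"
  by (intro borel_measurable_continuous_onI continuous_intros)

lemma integrable_bounded_poly:
  fixes f :: "real \<Rightarrow> real"
  assumes [measurable]: "f \<in> borel_measurable borel" and "\<And>x. x \<in> {-1..1} \<Longrightarrow> \<bar>f x\<bar> \<le> C"
  shows "integrable \<mu> (\<lambda>x. f x * poly p x)"
proof -
  obtain K where K: "\<forall>x\<in>{-1..1::real}. \<bar>poly p x\<bar> \<le> K" using poly_bounded_on_unit by blast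
  show ?thesis
  proof (rule integrable_bounded_on)
    fix x :: real assume x: "x \<in> {-1..1}"
    have "\<bar>f x\<bar> * \<bar>poly p x\<bar> \<le> C * K"
      using assms(2)[OF x] K x by (intro mult_mono) force+
    then show "norm (f x * poly p x) \<le> C * K" by (simp add: abs_mult)
  qed measurable
qed

lemma integrable_poly: "integrable \<mu> (poly p)"
  using integrable_bounded_poly[of "\<lambda>_. 1" 1 p] by simp

lemma integrable_poly_mult: "integrable \<mu> (\<lambda>x. poly p x * poly q x)"
proof -
  have "(\<lambda>x. poly p x * poly q x) = poly (p * q)" by auto
  then show ?thesis using integrable_poly[of "p * q"] by simp
qed

section \<open>The inner product of the measure and its orthonormal basis\<close>

definition ip :: "real poly \<Rightarrow> real poly \<Rightarrow> real" where
  "ip p q = (\<integral>x. poly p x * poly q x \<partial>\<mu>)"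

lemma ip_commute: "ip p q = ip q p"
  by (simp add: ip_def mult.commute)

lemma ip_add_left: "ip (p + p') q = ip p q + ip p' q"
  unfolding ip_def by (simp add: distrib_right integrable_poly_mult)

lemma ip_diff_left: "ip (p - p') q = ip p q - ip p' q"
  unfolding ip_def by (simp add: left_diff_distrib integrable_poly_mult)

lemma ip_smult_left: "ip (smult c p) q = c * ip p q"
  unfolding ip_def by (simp add: mult.assoc)

lemma ip_0_left [simp]: "ip 0 q = 0"
  by (simp add: ip_def)

lemma ip_sum_left: "ip (\<Sum>k\<in>A. f k) q = (\<Sum>k\<in>A. ip (f k) q)"
  by (induction A rule: infinite_finite_induct) (auto simp: ip_add_left)

lemma ip_mult_swap: "ip (r * p) q = ip p (r * q)"
  by (simp add: ip_def algebra_simps)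

lemma ip_self_pos: "p \<noteq> 0 \<Longrightarrow> 0 < ip p p"
  using nondeg[of p] by (simp add: ip_def power2_eq_square)

lemma exists_orthonormal:
  "\<exists>P :: nat \<Rightarrow> real poly. \<forall>n. degree (P n) = n \<and> ip (P n) (P n) = 1 \<and> (\<forall>m<n. ip (P n) (P m) = 0)"
proof (rule dependent_wellorder_choice)
  fix n :: nat and P :: "nat \<Rightarrow> real poly"
  assume H: "\<And>y. y < n \<Longrightarrow> degree (P y) = y \<and> ip (P y) (P y) = 1 \<and> (\<forall>m<y. ip (P y) (P m) = 0)"
  define S where "S = (\<Sum>k<n. smult (ip (monom 1 n) (P k)) (P k))"
  define q where "q = monom 1 n - S"
  have orth: "ip (P k) (P m) = (if k = m then 1 else 0)" if "k < n" "m < n" for k m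
    using H that by (metis ip_commute linorder_neqE_nat)
  \<comment> \<open>For \<open>n = 0\<close> the sum \<open>S\<close> is empty and has degree 0,
    which is not below \<open>n\<close>; in both cases the coefficient of \<open>S\<close> at
    \<open>n\<close> vanishes, so \<open>q\<close> stays monic.\<close>
  have "n = 0 \<or> degree S < n"
  proof (cases "n = 0")
    case False
    have "degree S \<le> n - 1" unfolding S_def
      by (rule degree_sum_le) (use H in \<open>force intro!: order.trans[OF degree_smult_le]\<close>)+
    with False show ?thesis by simp
  qed simp
  then have cS: "coeff S n = 0"
    by (cases "n = 0") (auto simp: S_def coeff_eq_0)
  have dS: "degree S \<le> n" using \<open>n = 0 \<or> degree S < n\<close> by (auto simp: S_def)
  have cq: "coeff q n = 1" by (simp add: q_def cS)
  have "degree q \<le> n" unfolding q_def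
    by (rule degree_diff_le) (use dS in \<open>auto simp: degree_monom_le\<close>)
  then have dq: "degree q = n" using cq by (metis le_antisym le_degree zero_neq_one)
  have q0: "q \<noteq> 0" using cq by auto
  have qP: "ip q (P m) = 0" if "m < n" for m
    unfolding q_def S_def using that
    by (simp add: ip_diff_left ip_sum_left ip_smult_left orth if_distrib cong: if_cong)
  define r where "r = smult (1 / sqrt (ip q q)) q"
  have pos: "0 < ip q q" by (rule ip_self_pos[OF q0])
  have "degree r = n" using pos dq by (simp add: r_def)
  moreover have "ip r r = 1"
    using pos by (simp add: r_def ip_smult_left ip_commute[of q "smult _ _"] field_simps)
  moreover have "\<forall>m<n. ip r (P m) = 0"
    by (simp add: r_def ip_smult_left qP)
  ultimately show "\<exists>r. degree r = n \<and> ip r r = 1 \<and> (\<forall>m<n. ip r (P m) = 0)" by blast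
qed auto

definition OP :: "nat \<Rightarrow> real poly" where
  "OP = (SOME P. \<forall>n. degree (P n) = n \<and> ip (P n) (P n) = 1 \<and> (\<forall>m<n. ip (P n) (P m) = 0))"

lemma degree_OP [simp]: "degree (OP n) = n"
  and ip_OP: "ip (OP m) (OP n) = (if m = n then 1 else 0)"
proof -
  have *: "\<forall>n. degree (OP n) = n \<and> ip (OP n) (OP n) = 1 \<and> (\<forall>m<n. ip (OP n) (OP m) = 0)"
    unfolding OP_def by (rule someI_ex[OF exists_orthonormal])
  then show "degree (OP n) = n" by blast
  show "ip (OP m) (OP n) = (if m = n then 1 else 0)"
    using * by (metis ip_commute linorder_neqE_nat)
qed

lemma OP_neq_0 [simp]: "OP n \<noteq> 0"
  using ip_OP[of n n] by auto

text \<open>Induction on the degree bound strips off the leading term with a multiple of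
  \<open>OP (Suc m)\<close>; orthonormality then identifies the coefficients.\<close>

lemma OP_expansion:
  assumes "degree q \<le> m"
  shows "q = (\<Sum>j\<le>m. smult (ip q (OP j)) (OP j))"
proof -
  have "\<exists>c. q = (\<Sum>j\<le>m. smult (c j) (OP j))"
    using assms
  proof (induction m arbitrary: q)
    case 0
    from degree_eq_zeroE[OF degree_OP[of 0]] obtain a where a: "OP 0 = [:a:]" by auto
    from 0 obtain b where b: "q = [:b:]" by (auto elim: degree_eq_zeroE)
    have "a \<noteq> 0" using OP_neq_0[of 0] a by auto
    then show ?case by (intro exI[of _ "\<lambda>_. b / a"]) (simp add: a b)
  next
    case (Suc m)
    define c where "c = coeff q (Suc m) / lead_coeff (OP (Suc m))"
    have "lead_coeff (OP (Suc m)) \<noteq> 0" by (metis OP_neq_0 leading_coeff_0_iff)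
    then have "coeff (q - smult c (OP (Suc m))) (Suc m) = 0" by (simp add: c_def)
    moreover have "degree (q - smult c (OP (Suc m))) \<le> Suc m"
      using Suc.prems by (intro degree_diff_le) (auto intro: order.trans[OF degree_smult_le])
    ultimately have "degree (q - smult c (OP (Suc m))) \<le> m"
      by (metis degree_0 le0 le_SucE leading_coeff_0_iff)
    from Suc.IH[OF this] obtain d where d: "q - smult c (OP (Suc m)) = (\<Sum>j\<le>m. smult (d j) (OP j))" by blast
    show ?case
    proof (intro exI[of _ "d(Suc m := c)"])
      have "(\<Sum>j\<le>m. smult ((d(Suc m := c)) j) (OP j)) = (\<Sum>j\<le>m. smult (d j) (OP j))"
        by (intro sum.cong) auto
      with d show "q = (\<Sum>j\<le>Suc m. smult ((d(Suc m := c)) j) (OP j))"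
        by (simp add: algebra_simps)
    qed
  qed
  then obtain c where c: "q = (\<Sum>j\<le>m. smult (c j) (OP j))" by blast
  have "ip q (OP j) = c j" if "j \<le> m" for j
    by (subst c) (use that in \<open>simp add: ip_sum_left ip_smult_left ip_OP if_distrib cong: if_cong\<close>)
  then have "(\<Sum>j\<le>m. smult (ip q (OP j)) (OP j)) = (\<Sum>j\<le>m. smult (c j) (OP j))"
    by (intro sum.cong) auto
  with c show ?thesis by simp
qed

lemma ip_OP_eq_0:
  assumes "degree q < n"
  shows "ip q (OP n) = 0"
proof -
  have "q = (\<Sum>j\<le>degree q. smult (ip q (OP j)) (OP j))" by (rule OP_expansion) simp
  then have "ip q (OP n) = (\<Sum>j\<le>degree q. ip q (OP j) * ip (OP j) (OP n))"
    by (metis (no_types, lifting) ip_smult_left ip_sum_left sum.cong)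
  also have "\<dots> = 0" using assms by (intro sum.neutral) (auto simp: ip_OP)
  finally show ?thesis .
qed

text \<open>The kernel of the orthogonal projection onto polynomials of degree below
  \<open>n\<close>.\<close>

definition CDker :: "nat \<Rightarrow> real \<Rightarrow> real \<Rightarrow> real" where
  "CDker n x y = (\<Sum>k<n. poly (OP k) x * poly (OP k) y)"

text \<open>The off-diagonal entry of the Jacobi matrix in row \<open>n - 1\<close> and column
  \<open>n\<close>; at \<open>n = 0\<close> truncated subtraction makes it a diagonal entry.\<close>

definition ofd :: "nat \<Rightarrow> real" where
  "ofd n = ip ([:0, 1:] * OP (n - 1)) (OP n)"

text \<open>Multiplication by \<open>x\<close> has a symmetric matrix \<open>J\<close> in the basis
  \<open>OP\<close>. Contributions of index pairs inside the block cancel by antisymmetry, and of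
  the entries leaving the block only the one that couples \<open>n - 1\<close> to \<open>n\<close>
  can be nonzero.\<close>

lemma Christoffel_Darboux:
  assumes "n > 0"
  shows "(x - y) * CDker n x y =
    ofd n * (poly (OP n) x * poly (OP (n - 1)) y - poly (OP (n - 1)) x * poly (OP n) y)"
proof -
  define J where "J k j = ip ([:0, 1:] * OP k) (OP j)" for k j
  have J: "x * poly (OP k) x = (\<Sum>j\<le>n. J k j * poly (OP j) x)" if "k < n" for k x
  proof -
    have "degree ([:0, 1:] * OP k) \<le> n"
      using that by (intro order.trans[OF degree_mult_le]) auto
    from OP_expansion[OF this] have "poly ([:0, 1:] * OP k) x = poly (\<Sum>j\<le>n. smult (J k j) (OP j)) x"
      by (simp add: J_def)
    then show ?thesis by (simp add: poly_sum)
  qed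
  have sym: "J k j = J j k" for k j
    unfolding J_def by (metis ip_mult_swap ip_commute)
  have J0: "J k n = 0" if "k < n - 1" for k
    unfolding J_def using that by (intro ip_OP_eq_0 le_less_trans[OF degree_mult_le]) auto
  define A where "A k j = J k j * (poly (OP j) x * poly (OP k) y - poly (OP k) x * poly (OP j) y)" for k j
  have "(x - y) * CDker n x y = (\<Sum>k<n. (x * poly (OP k) x) * poly (OP k) y - poly (OP k) x * (y * poly (OP k) y))"
    by (simp add: CDker_def sum_distrib_left algebra_simps)
  also have "\<dots> = (\<Sum>k<n. \<Sum>j\<le>n. A k j)"
  proof (rule sum.cong[OF refl])
    fix k assume "k \<in> {..<n}"
    then have k: "k < n" by simp
    show "(x * poly (OP k) x) * poly (OP k) y - poly (OP k) x * (y * poly (OP k) y) = (\<Sum>j\<le>n. A k j)"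
      unfolding J[OF k] A_def by (simp add: sum_distrib_left sum_distrib_right sum_subtractf algebra_simps)
  qed
  also have "\<dots> = (\<Sum>k<n. \<Sum>j<n. A k j) + (\<Sum>k<n. A k n)"
    by (simp add: lessThan_Suc_atMost[symmetric] sum.distrib)
  also have "(\<Sum>k<n. \<Sum>j<n. A k j) = 0"
  proof -
    have "(\<Sum>k<n. \<Sum>j<n. A k j) = (\<Sum>k<n. \<Sum>j<n. A j k)" by (rule sum.swap)
    also have "\<dots> = (\<Sum>k<n. \<Sum>j<n. - A k j)"
      by (intro sum.cong refl) (simp add: A_def sym algebra_simps)
    finally show ?thesis by (simp add: sum_negf)
  qed
  also have "(\<Sum>k<n. A k n) = A (n - 1) n"
  proof -
    have "(\<Sum>k<n. A k n) = (\<Sum>k\<in>{n - 1}. A k n)"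
      using assms by (intro sum.mono_neutral_right) (auto simp: A_def J0)
    then show ?thesis by simp
  qed
  finally show ?thesis by (simp add: A_def J_def ofd_def)
qed

text \<open>On the support \<open>\<bar>x\<bar> \<le> 1\<close>, and a product of two functions of
  norm one is dominated by half the sum of their squares.\<close>

lemma ofd_bound: "\<bar>ofd n\<bar> \<le> 1"
proof -
  let ?p = "poly (OP (n - 1))" and ?q = "poly (OP n)"
  have "\<bar>ofd n\<bar> \<le> (\<integral>x. \<bar>poly ([:0, 1:] * OP (n - 1)) x * ?q x\<bar> \<partial>\<mu>)"
    unfolding ofd_def ip_def by (rule integral_abs_bound)
  also have "\<dots> \<le> (\<integral>x. (?p x * ?p x + ?q x * ?q x) / 2 \<partial>\<mu>)"
  proof (rule integral_mono_AE)
    show "AE x in \<mu>. \<bar>poly ([:0, 1:] * OP (n - 1)) x * ?q x\<bar> \<le> (?p x * ?p x + ?q x * ?q x) / 2"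
      using supp_mu
    proof eventually_elim
      case (elim x)
      have "\<bar>poly ([:0, 1:] * OP (n - 1)) x * ?q x\<bar> = \<bar>x\<bar> * (\<bar>?p x\<bar> * \<bar>?q x\<bar>)"
        by (simp add: abs_mult)
      also have "\<dots> \<le> 1 * (\<bar>?p x\<bar> * \<bar>?q x\<bar>)"
        using elim by (intro mult_right_mono) auto
      also have "\<dots> \<le> (?p x * ?p x + ?q x * ?q x) / 2"
        using sum_squares_bound[of "\<bar>?p x\<bar>" "\<bar>?q x\<bar>"] by (simp add: power2_eq_square)
      finally show ?case .
    qed
    show "integrable \<mu> (\<lambda>x. \<bar>poly ([:0, 1:] * OP (n - 1)) x * ?q x\<bar>)"
      by (intro integrable_abs integrable_poly_mult)
  qed (auto intro!: integrable_poly_mult Bochner_Integration.integrable_add)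
  also have "\<dots> = (ip (OP (n-1)) (OP (n-1)) + ip (OP n) (OP n)) / 2"
    by (simp add: ip_def integrable_poly_mult)
  finally show ?thesis by (simp add: ip_OP)
qed

end

section \<open>Mean and variance of linear statistics\<close>

text \<open>Every permutation runs once through all indices, so each of the \<open>fact n\<close>
  permutations contributes the same full sum.\<close>

lemma sum_perms_single:
  "(\<Sum>a<n. \<Sum>\<sigma> | \<sigma> permutes {..<n::nat}. F (\<sigma> a)) = fact n * (\<Sum>k<n. F k :: real)"
proof -
  have "(\<Sum>a<n. \<Sum>\<sigma> | \<sigma> permutes {..<n}. F (\<sigma> a)) = (\<Sum>\<sigma> | \<sigma> permutes {..<n}. \<Sum>a<n. F (\<sigma> a))"
    by (rule sum.swap)
  also have "\<dots> = (\<Sum>\<sigma> | \<sigma> permutes {..<n}. \<Sum>k<n. F k)"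
    by (rule sum.cong[OF refl]) (use sum.permute[of _ "{..<n}" F] in \<open>simp add: o_def\<close>)
  finally show ?thesis by (simp add: card_permutations)
qed

text \<open>As for a single index; injectivity of a permutation carries the excluded diagonal to the
  excluded diagonal.\<close>

lemma sum_perms_pair:
  "(\<Sum>a<n. \<Sum>b<n. if a = b then 0 else \<Sum>\<sigma> | \<sigma> permutes {..<n::nat}. F (\<sigma> a) (\<sigma> b)) =
     fact n * (\<Sum>k<n. \<Sum>l<n. if k = l then 0 else F k l :: real)"
proof -
  let ?S = "{\<sigma>. \<sigma> permutes {..<n}}"
  define H where "H k l = (if k = l then 0 else F k l)" for k l
  have inner: "(\<Sum>a<n. \<Sum>b<n. H (\<sigma> a) (\<sigma> b)) = (\<Sum>k<n. \<Sum>l<n. H k l)" if "\<sigma> permutes {..<n}" for \<sigma>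
  proof -
    have "(\<Sum>a<n. \<Sum>b<n. H (\<sigma> a) (\<sigma> b)) = (\<Sum>a<n. \<Sum>l<n. H (\<sigma> a) l)"
      using sum.permute[OF that, of "H (\<sigma> a)" for a] by (simp add: o_def)
    also have "\<dots> = (\<Sum>k<n. \<Sum>l<n. H k l)"
      using sum.permute[OF that, of "\<lambda>k. \<Sum>l<n. H k l"] by (simp add: o_def)
    finally show ?thesis .
  qed
  have "(\<Sum>a<n. \<Sum>b<n. if a = b then 0 else \<Sum>\<sigma>\<in>?S. F (\<sigma> a) (\<sigma> b)) = (\<Sum>a<n. \<Sum>b<n. \<Sum>\<sigma>\<in>?S. H (\<sigma> a) (\<sigma> b))"
  proof (intro sum.cong refl)
    fix a b
    have "(\<sigma> a = \<sigma> b) = (a = b)" if "\<sigma> \<in> ?S" for \<sigma>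
      using that permutes_inj[of \<sigma> "{..<n}"] by (auto simp: inj_eq)
    then show "(if a = b then 0 else \<Sum>\<sigma>\<in>?S. F (\<sigma> a) (\<sigma> b)) = (\<Sum>\<sigma>\<in>?S. H (\<sigma> a) (\<sigma> b))"
      by (auto simp: H_def intro!: sum.cong)
  qed
  also have "\<dots> = (\<Sum>a<n. \<Sum>\<sigma>\<in>?S. \<Sum>b<n. H (\<sigma> a) (\<sigma> b))"
    by (intro sum.cong refl) (rule sum.swap)
  also have "\<dots> = (\<Sum>\<sigma>\<in>?S. \<Sum>a<n. \<Sum>b<n. H (\<sigma> a) (\<sigma> b))"
    by (rule sum.swap)
  also have "\<dots> = (\<Sum>\<sigma>\<in>?S. \<Sum>k<n. \<Sum>l<n. H k l)"
    by (rule sum.cong[OF refl]) (use inner in auto)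
  finally show ?thesis by (simp add: card_permutations H_def)
qed

context ope_measure
begin

section \<open>Product measures and integrals of the squared determinant\<close>

abbreviation Pn :: "nat \<Rightarrow> (nat \<Rightarrow> real) measure" where
  "Pn n \<equiv> PiM {..<n} (\<lambda>_. \<mu>)"

sublocale PSF: product_sigma_finite "\<lambda>_::nat. \<mu>"
  by standard

lemma finite_measure_Pn: "finite_measure (Pn n)"
proof
  have "emeasure (Pn n) (Pi\<^sub>E {..<n} (\<lambda>_. UNIV)) = (\<Prod>i<n. emeasure \<mu> UNIV)"
    by (rule PSF.emeasure_PiM) (auto simp: sets_mu)
  also have "\<dots> \<noteq> \<infinity>"
    using emeasure_finite[of UNIV] power_less_top_ennreal[of "emeasure \<mu> UNIV" n]
    by (metis infinity_ennreal_def less_top prod_constant card_lessThan)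
  finally show "emeasure (Pn n) (space (Pn n)) \<noteq> \<infinity>"
    by (simp add: space_PiM)
qed

lemma AE_Pn: "AE x in Pn n. \<forall>j<n. x j \<in> {-1..1}"
proof -
  have "AE x in Pn n. x j \<in> {-1..1}" if "j < n" for j
  proof (rule AE_I)
    have n0: "emeasure \<mu> (- {-1..1}) = 0"
      using supp_mu by (subst (asm) AE_iff_measurable[of "- {-1..1}"]) (auto simp: sets_mu)
    let ?N = "Pi\<^sub>E {..<n} (\<lambda>i. if i = j then - {-1..1} else UNIV)"
    show "{x \<in> space (Pn n). \<not> x j \<in> {-1..1}} \<subseteq> ?N"
      by (auto simp: space_PiM PiE_def extensional_def)
    show "?N \<in> sets (Pn n)"
      by (intro sets_PiM_I_finite) (auto simp: sets_mu)
    have "emeasure (Pn n) ?N = (\<Prod>i<n. emeasure \<mu> (if i = j then - {-1..1} else UNIV))"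
      by (rule PSF.emeasure_PiM) (auto simp: sets_mu)
    also have "\<dots> = 0" using that n0 by (intro prod_zero) auto
    finally show "emeasure (Pn n) ?N = 0" .
  qed
  then show ?thesis by (subst AE_all_countable) auto
qed

lemma Pn_integrable_bounded:
  fixes f :: "(nat \<Rightarrow> real) \<Rightarrow> 'b::{banach, second_countable_topology}"
  assumes "f \<in> borel_measurable (Pn n)" "\<And>x. (\<And>j. j < n \<Longrightarrow> x j \<in> {-1..1}) \<Longrightarrow> norm (f x) \<le> C"
  shows "integrable (Pn n) f"
proof -
  interpret F: finite_measure "Pn n" by (rule finite_measure_Pn)
  show ?thesis
  proof (rule F.integrable_const_bound[where B = C])
    show "AE x in Pn n. norm (f x) \<le> C"
      using AE_Pn by eventually_elim (use assms(2) in auto)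
  qed (use assms in simp)
qed

lemma measurable_coordinate [measurable]: "j < n \<Longrightarrow> (\<lambda>x. x j) \<in> borel_measurable (Pn n)"
  using measurable_component_singleton[of j "{..<n}" "\<lambda>_. \<mu>"]
  by (simp add: measurable_cong_sets[OF refl sets_mu])

lemma measurable_vandermonde_sq [measurable]: "vandermonde_sq n \<in> borel_measurable (Pn n)"
proof -
  have "(\<lambda>x. \<Prod>j<n. \<Prod>i<j. (x i - x j)\<^sup>2) \<in> borel_measurable (Pn n)"
    by (intro borel_measurable_prod borel_measurable_power borel_measurable_diff measurable_coordinate) auto
  then show ?thesis by (simp add: vandermonde_sq_def[abs_def])
qed

text \<open>Matrix entries of multiplication by \<open>g\<close> in the orthonormal basis; mean and
  variance of a linear statistic become traces over the block of indices below
  \<open>n\<close>.\<close>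

definition gm :: "(real \<Rightarrow> real) \<Rightarrow> nat \<Rightarrow> nat \<Rightarrow> real" where
  "gm g k l = (\<integral>x. g x * (poly (OP k) x * poly (OP l) x) \<partial>\<mu>)"

lemma gm_1: "gm (\<lambda>_. 1) k l = (if k = l then 1 else 0)"
  using ip_OP[of k l] by (simp add: gm_def ip_def)

lemma gm_commute: "gm g k l = gm g l k"
  by (simp add: gm_def mult.commute)

text \<open>Boundedness is asked only on the unit interval, where \<mu> is concentrated, so that
  polynomials belong to the class.\<close>

definition bdd_fn :: "(real \<Rightarrow> real) \<Rightarrow> bool" where
  "bdd_fn g \<longleftrightarrow> g \<in> borel_measurable borel \<and> (\<exists>C. \<forall>x\<in>{-1..1}. \<bar>g x\<bar> \<le> C)"

lemma bdd_fn_const [simp]: "bdd_fn (\<lambda>_. c)"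
  by (auto simp: bdd_fn_def)

lemma bdd_fn_mult: "bdd_fn f \<Longrightarrow> bdd_fn g \<Longrightarrow> bdd_fn (\<lambda>x. f x * g x)"
proof -
  assume "bdd_fn f" "bdd_fn g"
  then obtain C D where "f \<in> borel_measurable borel" "g \<in> borel_measurable borel"
    and b: "\<And>x. x \<in> {-1..1} \<Longrightarrow> \<bar>f x\<bar> \<le> C" "\<And>x. x \<in> {-1..1} \<Longrightarrow> \<bar>g x\<bar> \<le> D"
    unfolding bdd_fn_def by blast
  moreover have "\<bar>f x * g x\<bar> \<le> C * D" if "x \<in> {-1..1}" for x
    unfolding abs_mult using b[OF that] by (intro mult_mono) auto
  ultimately show "bdd_fn (\<lambda>x. f x * g x)"
    unfolding bdd_fn_def by (intro conjI borel_measurable_times exI[of _ "C * D"] ballI) auto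
qed

lemma bdd_fn_poly: "bdd_fn (poly p)"
  using poly_bounded_on_unit[of p] borel_measurable_poly by (auto simp: bdd_fn_def)

lemma bdd_fn_integrable: "bdd_fn g \<Longrightarrow> integrable \<mu> g"
  unfolding bdd_fn_def by (auto intro!: integrable_bounded_on simp del: atLeastAtMost_iff)

lemma bdd_fn_gm_integrable:
  "bdd_fn g \<Longrightarrow> integrable \<mu> (\<lambda>x. g x * (poly (OP k) x * poly (OP l) x))"
  by (intro bdd_fn_integrable bdd_fn_mult bdd_fn_poly)

text \<open>Expanding the square gives a sum over pairs of permutations; each term is a product over
  coordinates and integrates to a product of matrix entries.\<close>

lemma integral_leibniz_sq:
  assumes G: "\<And>j. j < n \<Longrightarrow> bdd_fn (G j)"
  shows "integrable (Pn n) (\<lambda>x. (leibniz_det OP n x)\<^sup>2 * (\<Prod>j<n. G j (x j)))" (is ?A)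
    and "(\<integral>x. (leibniz_det OP n x)\<^sup>2 * (\<Prod>j<n. G j (x j)) \<partial>Pn n) =
      (\<Sum>\<sigma> | \<sigma> permutes {..<n}. \<Sum>\<tau> | \<tau> permutes {..<n}.
        of_int (sign \<sigma> * sign \<tau>) * (\<Prod>j<n. gm (G j) (\<sigma> j) (\<tau> j)))" (is ?B)
proof -
  let ?S = "{\<sigma>. \<sigma> permutes {..<n}}"
  define H where "H \<sigma> \<tau> j = (\<lambda>x. G j x * (poly (OP (\<sigma> j)) x * poly (OP (\<tau> j)) x))" for \<sigma> \<tau> :: "nat \<Rightarrow> nat" and j
  have eq: "(leibniz_det OP n x)\<^sup>2 * (\<Prod>j<n. G j (x j)) =
     (\<Sum>\<sigma>\<in>?S. \<Sum>\<tau>\<in>?S. of_int (sign \<sigma> * sign \<tau>) * (\<Prod>j<n. H \<sigma> \<tau> j (x j)))" for x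
  proof -
    define c where "c \<sigma> = of_int (sign \<sigma>) * (\<Prod>j<n. poly (OP (\<sigma> j)) (x j))" for \<sigma> :: "nat \<Rightarrow> nat"
    have "(leibniz_det OP n x)\<^sup>2 * (\<Prod>j<n. G j (x j)) = (\<Sum>\<sigma>\<in>?S. \<Sum>\<tau>\<in>?S. c \<sigma> * c \<tau>) * (\<Prod>j<n. G j (x j))"
      by (simp only: leibniz_det_def power2_eq_square sum_product c_def)
    also have "\<dots> = (\<Sum>\<sigma>\<in>?S. \<Sum>\<tau>\<in>?S. c \<sigma> * c \<tau> * (\<Prod>j<n. G j (x j)))"
      by (simp only: sum_distrib_right)
    also have "\<dots> = (\<Sum>\<sigma>\<in>?S. \<Sum>\<tau>\<in>?S. of_int (sign \<sigma> * sign \<tau>) * (\<Prod>j<n. H \<sigma> \<tau> j (x j)))"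
      by (intro sum.cong refl) (simp add: c_def H_def prod.distrib)
    finally show ?thesis .
  qed
  have i: "integrable \<mu> (H \<sigma> \<tau> j)" if "j < n" for \<sigma> \<tau> j
    unfolding H_def using bdd_fn_gm_integrable[OF G[OF that]] .
  have ii: "integrable (Pn n) (\<lambda>x. \<Prod>j<n. H \<sigma> \<tau> j (x j))" for \<sigma> \<tau>
    by (rule PSF.product_integrable_prod) (use i in auto)
  show ?A unfolding eq
    by (intro Bochner_Integration.integrable_sum integrable_mult_right ii)
  have "(\<integral>x. (\<Prod>j<n. H \<sigma> \<tau> j (x j)) \<partial>Pn n) = (\<Prod>j<n. gm (G j) (\<sigma> j) (\<tau> j))" for \<sigma> \<tau>
    by (subst PSF.product_integral_prod) (use i in \<open>auto simp: gm_def H_def\<close>)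
  then show ?B unfolding eq
    by (simp add: Bochner_Integration.integral_sum ii)
qed

text \<open>Every coordinate except \<open>a\<close> carries the constant one and forces
  \<open>\<tau> j = \<sigma> j\<close> by orthonormality; then
  \<open>\<tau> = \<sigma>\<close>.\<close>

lemma integral_leibniz_sq_single:
  assumes g: "bdd_fn g" and a: "a < n"
  shows "integrable (Pn n) (\<lambda>x. (leibniz_det OP n x)\<^sup>2 * g (x a))" (is ?A)
    and "(\<integral>x. (leibniz_det OP n x)\<^sup>2 * g (x a) \<partial>Pn n) = (\<Sum>\<sigma> | \<sigma> permutes {..<n}. gm g (\<sigma> a) (\<sigma> a))" (is ?B)
proof -
  let ?S = "{\<sigma>. \<sigma> permutes {..<n}}"
  define G where "G j = (if j = a then g else (\<lambda>_. 1))" for j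
  have G: "bdd_fn (G j)" for j using g by (simp add: G_def)
  have pr: "(\<Prod>j<n. G j (x j)) = g (x a)" for x
    using a by (subst prod.remove[of _ a]) (auto simp: G_def intro!: prod.neutral)
  show ?A using integral_leibniz_sq(1)[of n G, OF G] by (simp add: pr)
  have "(\<Sum>\<tau>\<in>?S. of_int (sign \<sigma> * sign \<tau>) * (\<Prod>j<n. gm (G j) (\<sigma> j) (\<tau> j))) = gm g (\<sigma> a) (\<sigma> a)" if s: "\<sigma> \<in> ?S" for \<sigma>
  proof -
    have "(\<Sum>\<tau>\<in>?S. of_int (sign \<sigma> * sign \<tau>) * (\<Prod>j<n. gm (G j) (\<sigma> j) (\<tau> j))) =
        (\<Sum>\<tau>\<in>{\<sigma>}. of_int (sign \<sigma> * sign \<tau>) * (\<Prod>j<n. gm (G j) (\<sigma> j) (\<tau> j)))"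
    proof (rule sum.mono_neutral_right)
      show "\<forall>\<tau>\<in>?S - {\<sigma>}. of_int (sign \<sigma> * sign \<tau>) * (\<Prod>j<n. gm (G j) (\<sigma> j) (\<tau> j)) = 0"
      proof
        fix \<tau> assume t: "\<tau> \<in> ?S - {\<sigma>}"
        have "\<exists>j<n. j \<noteq> a \<and> \<tau> j \<noteq> \<sigma> j"
        proof (rule ccontr)
          assume "\<not> ?thesis"
          then have "\<tau> = \<sigma> \<or> \<tau> = \<sigma> \<circ> Transposition.transpose a a"
            using s t a by (intro permutes_agree_off_two[where A = "{..<n}"]) auto
          with t show False by auto
        qed
        then obtain j where "j < n" "gm (G j) (\<sigma> j) (\<tau> j) = 0" by (auto simp: G_def gm_1)
        then show "of_int (sign \<sigma> * sign \<tau>) * (\<Prod>j<n. gm (G j) (\<sigma> j) (\<tau> j)) = 0"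
          by (auto intro!: prod_zero)
      qed
    qed (use s in \<open>auto simp: finite_permutations\<close>)
    also have "\<dots> = (\<Prod>j<n. gm (G j) (\<sigma> j) (\<sigma> j))" by simp
    also have "\<dots> = gm g (\<sigma> a) (\<sigma> a)"
      using a by (subst prod.remove[of _ a]) (auto simp: G_def gm_1 intro!: prod.neutral)
    finally show ?thesis .
  qed
  then show ?B using integral_leibniz_sq(2)[of n G, OF G] by (simp add: pr)
qed

text \<open>Two free coordinates leave exactly two choices of \<open>\<tau>\<close>, namely
  \<open>\<sigma>\<close> and \<open>\<sigma>\<close> composed with the swap, of opposite signs: the
  two-by-two minor of a determinantal two-point function.\<close>

lemma integral_leibniz_sq_pair:
  assumes g: "bdd_fn g" and a: "a < n" and b: "b < n" and ab: "a \<noteq> b"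
  shows "integrable (Pn n) (\<lambda>x. (leibniz_det OP n x)\<^sup>2 * (g (x a) * g (x b)))" (is ?A)
    and "(\<integral>x. (leibniz_det OP n x)\<^sup>2 * (g (x a) * g (x b)) \<partial>Pn n) =
      (\<Sum>\<sigma> | \<sigma> permutes {..<n}. gm g (\<sigma> a) (\<sigma> a) * gm g (\<sigma> b) (\<sigma> b) - (gm g (\<sigma> a) (\<sigma> b))\<^sup>2)" (is ?B)
proof -
  let ?S = "{\<sigma>. \<sigma> permutes {..<n}}"
  let ?t = "Transposition.transpose a b"
  define G where "G j = (if j \<in> {a, b} then g else (\<lambda>_. 1))" for j
  have G: "bdd_fn (G j)" for j using g by (simp add: G_def)
  have two: "(\<Prod>j<n. Q j) = Q a * Q b" if "\<And>j. j < n \<Longrightarrow> j \<noteq> a \<Longrightarrow> j \<noteq> b \<Longrightarrow> Q j = (1::real)" for Q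
  proof -
    have "(\<Prod>j<n. Q j) = (\<Prod>j\<in>{a, b}. Q j)"
      using a b that by (intro prod.mono_neutral_right) auto
    then show ?thesis using ab by simp
  qed
  have pr: "(\<Prod>j<n. G j (x j)) = g (x a) * g (x b)" for x
    by (subst two) (auto simp: G_def)
  show ?A using integral_leibniz_sq(1)[of n G, OF G] by (simp add: pr)
  have "(\<Sum>\<tau>\<in>?S. of_int (sign \<sigma> * sign \<tau>) * (\<Prod>j<n. gm (G j) (\<sigma> j) (\<tau> j))) =
      gm g (\<sigma> a) (\<sigma> a) * gm g (\<sigma> b) (\<sigma> b) - (gm g (\<sigma> a) (\<sigma> b))\<^sup>2" if s: "\<sigma> \<in> ?S" for \<sigma>
  proof -
    have t: "?t permutes {..<n}" using a b by (intro permutes_swap_id) auto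
    have st: "\<sigma> \<circ> ?t \<in> ?S" using s t by (auto intro: permutes_compose)
    have ne: "\<sigma> \<circ> ?t \<noteq> \<sigma>"
    proof
      assume "\<sigma> \<circ> ?t = \<sigma>"
      then have "\<sigma> (?t a) = \<sigma> a" by (metis comp_apply)
      then show False using ab s permutes_inj[of \<sigma> "{..<n}"] by (auto simp: inj_eq)
    qed
    have sg: "sign (\<sigma> \<circ> ?t) = - sign \<sigma>"
      using ab s t by (subst sign_compose) (auto simp: sign_swap_id permutation_permutes intro: permutation_swap_id)
    have "(\<Sum>\<tau>\<in>?S. of_int (sign \<sigma> * sign \<tau>) * (\<Prod>j<n. gm (G j) (\<sigma> j) (\<tau> j))) =
        (\<Sum>\<tau>\<in>{\<sigma>, \<sigma> \<circ> ?t}. of_int (sign \<sigma> * sign \<tau>) * (\<Prod>j<n. gm (G j) (\<sigma> j) (\<tau> j)))"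
    proof (rule sum.mono_neutral_right)
      show "\<forall>\<tau>\<in>?S - {\<sigma>, \<sigma> \<circ> ?t}. of_int (sign \<sigma> * sign \<tau>) * (\<Prod>j<n. gm (G j) (\<sigma> j) (\<tau> j)) = 0"
      proof
        fix \<tau> assume t: "\<tau> \<in> ?S - {\<sigma>, \<sigma> \<circ> ?t}"
        have "\<exists>j<n. j \<noteq> a \<and> j \<noteq> b \<and> \<tau> j \<noteq> \<sigma> j"
        proof (rule ccontr)
          assume "\<not> ?thesis"
          then have "\<tau> = \<sigma> \<or> \<tau> = \<sigma> \<circ> ?t"
            using s t a b by (intro permutes_agree_off_two[where A = "{..<n}"]) auto
          with t show False by auto
        qed
        then obtain j where "j < n" "gm (G j) (\<sigma> j) (\<tau> j) = 0" by (auto simp: G_def gm_1)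
        then show "of_int (sign \<sigma> * sign \<tau>) * (\<Prod>j<n. gm (G j) (\<sigma> j) (\<tau> j)) = 0"
          by (auto intro!: prod_zero)
      qed
    qed (use s st in \<open>auto simp: finite_permutations\<close>)
    also have "\<dots> = (\<Prod>j<n. gm (G j) (\<sigma> j) (\<sigma> j)) - (\<Prod>j<n. gm (G j) (\<sigma> j) ((\<sigma> \<circ> ?t) j))"
      using ne sg by (simp flip: of_int_mult)
    also have "(\<Prod>j<n. gm (G j) (\<sigma> j) (\<sigma> j)) = gm g (\<sigma> a) (\<sigma> a) * gm g (\<sigma> b) (\<sigma> b)"
      by (subst two) (auto simp: G_def gm_1)
    also have "(\<Prod>j<n. gm (G j) (\<sigma> j) ((\<sigma> \<circ> ?t) j)) = gm g (\<sigma> a) (\<sigma> b) * gm g (\<sigma> b) (\<sigma> a)"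
      by (subst two) (auto simp: G_def gm_1)
    also have "gm g (\<sigma> b) (\<sigma> a) = gm g (\<sigma> a) (\<sigma> b)" by (rule gm_commute)
    finally show ?thesis by (simp add: power2_eq_square)
  qed
  then show ?B using integral_leibniz_sq(2)[of n G, OF G] by (simp add: pr)
qed

text \<open>The factor from \<open>vandermonde_sq\<close> to the squared determinant; it cancels
  between the density and its normalisation.\<close>

definition OPlead :: "nat \<Rightarrow> real" where
  "OPlead n = (\<Prod>k<n. lead_coeff (OP k))\<^sup>2"

lemma OPlead_pos: "0 < OPlead n"
  using OP_neq_0 by (auto simp: OPlead_def leading_coeff_0_iff simp del: degree_OP)

lemma leibniz_OP_sq: "(leibniz_det OP n x)\<^sup>2 = OPlead n * vandermonde_sq n x"
  unfolding OPlead_def by (rule leibniz_det_sq) simp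

text \<open>Without a test function only the diagonal pairs of permutations survive, each
  contributing one.\<close>

lemma integral_leibniz_norm:
  "integrable (Pn n) (\<lambda>x. (leibniz_det OP n x)\<^sup>2)"
  "(\<integral>x. (leibniz_det OP n x)\<^sup>2 \<partial>Pn n) = fact n"
proof -
  let ?S = "{\<sigma>. \<sigma> permutes {..<n}}"
  show "integrable (Pn n) (\<lambda>x. (leibniz_det OP n x)\<^sup>2)"
    using integral_leibniz_sq(1)[of n "\<lambda>_ _. 1"] by simp
  have "(\<Sum>\<tau>\<in>?S. of_int (sign \<sigma> * sign \<tau>) * (\<Prod>j<n. gm (\<lambda>_. 1) (\<sigma> j) (\<tau> j))) = 1" if s: "\<sigma> \<in> ?S" for \<sigma>
  proof -
    have "(\<Sum>\<tau>\<in>?S. of_int (sign \<sigma> * sign \<tau>) * (\<Prod>j<n. gm (\<lambda>_. 1) (\<sigma> j) (\<tau> j))) =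
        (\<Sum>\<tau>\<in>{\<sigma>}. of_int (sign \<sigma> * sign \<tau>) * (\<Prod>j<n. gm (\<lambda>_. 1) (\<sigma> j) (\<tau> j)))"
    proof (rule sum.mono_neutral_right)
      show "\<forall>\<tau>\<in>?S - {\<sigma>}. of_int (sign \<sigma> * sign \<tau>) * (\<Prod>j<n. gm (\<lambda>_. 1) (\<sigma> j) (\<tau> j)) = 0"
      proof
        fix \<tau> assume t: "\<tau> \<in> ?S - {\<sigma>}"
        have "\<exists>j<n. \<tau> j \<noteq> \<sigma> j"
        proof (rule ccontr)
          assume "\<not> ?thesis"
          then have "\<tau> = \<sigma>"
            using s t by (intro ext) (metis DiffD1 lessThan_iff mem_Collect_eq permutes_not_in)
          with t show False by auto
        qed
        then obtain j where "j < n" "gm (\<lambda>_. 1) (\<sigma> j) (\<tau> j) = 0" by (auto simp: gm_1)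
        then show "of_int (sign \<sigma> * sign \<tau>) * (\<Prod>j<n. gm (\<lambda>_. 1) (\<sigma> j) (\<tau> j)) = 0"
          by (auto intro!: prod_zero)
      qed
    qed (use s in \<open>auto simp: finite_permutations\<close>)
    then show ?thesis by (simp add: gm_1)
  qed
  then show "(\<integral>x. (leibniz_det OP n x)\<^sup>2 \<partial>Pn n) = fact n"
    using integral_leibniz_sq(2)[of n "\<lambda>_ _. 1"] by (simp add: card_permutations)
qed

section \<open>The ensemble as a probability measure, and moments of its linear statistics\<close>

lemma vandermonde_sq_nonneg: "0 \<le> vandermonde_sq n x"
  by (simp add: vandermonde_sq_def prod_nonneg)

lemma vandermonde_integral:
  "integrable (Pn n) (vandermonde_sq n)"
  "(\<integral>x. vandermonde_sq n x \<partial>Pn n) = fact n / OPlead n"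
proof -
  have eq: "vandermonde_sq n x = (leibniz_det OP n x)\<^sup>2 / OPlead n" for x
    using OPlead_pos[of n] by (simp add: leibniz_OP_sq)
  show "integrable (Pn n) (vandermonde_sq n)"
    unfolding eq[abs_def] by (intro integrable_divide integral_leibniz_norm)
  show "(\<integral>x. vandermonde_sq n x \<partial>Pn n) = fact n / OPlead n"
    unfolding eq by (simp add: integral_leibniz_norm)
qed

lemma vandermonde_integral_pos: "0 < (\<integral>x. vandermonde_sq n x \<partial>Pn n)"
  by (simp add: vandermonde_integral OPlead_pos)

lemma sets_OPE [measurable_cong]: "sets (OPE \<mu> n) = sets (Pn n)"
  by (simp add: OPE_def Let_def)

lemma integral_OPE:
  fixes f :: "_ \<Rightarrow> 'b::{banach, second_countable_topology}"
  assumes "f \<in> borel_measurable (Pn n)"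
  shows "integral\<^sup>L (OPE \<mu> n) f = (1 / (\<integral>x. vandermonde_sq n x \<partial>Pn n)) *\<^sub>R (\<integral>x. vandermonde_sq n x *\<^sub>R f x \<partial>Pn n)"
proof -
  let ?Z = "\<integral>x. vandermonde_sq n x \<partial>Pn n"
  have "integral\<^sup>L (OPE \<mu> n) f = (\<integral>x. (vandermonde_sq n x / ?Z) *\<^sub>R f x \<partial>Pn n)"
    unfolding OPE_def Let_def using vandermonde_integral_pos[of n]
    by (intro integral_density) (use assms in \<open>auto intro!: divide_nonneg_pos vandermonde_sq_nonneg\<close>)
  also have "\<dots> = (\<integral>x. (1 / ?Z) *\<^sub>R (vandermonde_sq n x *\<^sub>R f x) \<partial>Pn n)"
    by (simp only: scaleR_scaleR times_divide_eq_left mult_1)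
  finally show ?thesis by (simp only: integral_scaleR_right)
qed

lemma integral_OPE_leibniz:
  fixes f :: "_ \<Rightarrow> real"
  assumes "f \<in> borel_measurable (Pn n)"
  shows "integral\<^sup>L (OPE \<mu> n) f = (\<integral>x. (leibniz_det OP n x)\<^sup>2 * f x \<partial>Pn n) / fact n"
  using OPlead_pos[of n]
  by (simp add: integral_OPE[OF assms] leibniz_OP_sq vandermonde_integral mult.assoc)

lemma prob_space_OPE: "prob_space (OPE \<mu> n)"
proof
  let ?Z = "\<integral>x. vandermonde_sq n x \<partial>Pn n"
  have "emeasure (OPE \<mu> n) (space (OPE \<mu> n)) = (\<integral>\<^sup>+x. ennreal (vandermonde_sq n x / ?Z) \<partial>Pn n)"
    by (simp add: OPE_def Let_def emeasure_density cong: nn_integral_cong)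
  also have "\<dots> = ennreal (\<integral>x. vandermonde_sq n x / ?Z \<partial>Pn n)"
    using vandermonde_integral_pos[of n]
    by (intro nn_integral_eq_integral) (auto intro!: integrable_divide vandermonde_integral divide_nonneg_pos vandermonde_sq_nonneg)
  also have "\<dots> = 1" using vandermonde_integral_pos[of n] by simp
  finally show "emeasure (OPE \<mu> n) (space (OPE \<mu> n)) = 1" .
qed

lemma AE_OPE: "AE x in OPE \<mu> n. \<forall>j<n. x j \<in> {-1..1}"
  unfolding OPE_def Let_def
  by (subst AE_density) (use AE_Pn[of n] in \<open>auto elim!: eventually_mono\<close>)

lemma OPE_integrable_bounded:
  fixes f :: "(nat \<Rightarrow> real) \<Rightarrow> 'b::{banach, second_countable_topology}"
  assumes "f \<in> borel_measurable (Pn n)" "\<And>x. (\<And>j. j < n \<Longrightarrow> x j \<in> {-1..1}) \<Longrightarrow> norm (f x) \<le> C"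
  shows "integrable (OPE \<mu> n) f"
proof -
  interpret prob_space "OPE \<mu> n" by (rule prob_space_OPE)
  show ?thesis
  proof (rule integrable_const_bound[where B = C])
    show "AE x in OPE \<mu> n. norm (f x) \<le> C"
      using AE_OPE by eventually_elim (use assms(2) in auto)
  qed (use assms in simp)
qed

lemma measurable_linstat:
  fixes g :: "real \<Rightarrow> 'b::{second_countable_topology, topological_comm_monoid_add}"
  shows "g \<in> borel_measurable borel \<Longrightarrow> (\<lambda>x. \<Sum>j<n. g (x j)) \<in> borel_measurable (Pn n)"
  by (intro borel_measurable_sum) (use measurable_compose[OF measurable_coordinate] in auto)

lemma OPE_mean:
  assumes g: "bdd_fn g"
  shows "integral\<^sup>L (OPE \<mu> n) (\<lambda>x. \<Sum>j<n. g (x j)) = (\<Sum>k<n. gm g k k)"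
proof -
  have gb: "g \<in> borel_measurable borel" using g by (simp add: bdd_fn_def)
  have "integral\<^sup>L (OPE \<mu> n) (\<lambda>x. \<Sum>j<n. g (x j)) = (\<integral>x. (\<Sum>a<n. (leibniz_det OP n x)\<^sup>2 * g (x a)) \<partial>Pn n) / fact n"
    by (subst integral_OPE_leibniz[OF measurable_linstat[OF gb]]) (simp add: sum_distrib_left)
  also have "\<dots> = (\<Sum>a<n. \<Sum>\<sigma> | \<sigma> permutes {..<n}. gm g (\<sigma> a) (\<sigma> a)) / fact n"
    by (subst Bochner_Integration.integral_sum) (use integral_leibniz_sq_single[OF g] in auto)
  also have "\<dots> = (\<Sum>k<n. gm g k k)"
    by (subst sum_perms_single) simp
  finally show ?thesis .
qed

text \<open>Squaring the statistic separates a diagonal part, which is the linear statistic of the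
  squared function, from pairs of distinct coordinates, which the two-point minor handles.\<close>

lemma OPE_second_moment:
  assumes g: "bdd_fn g"
  shows "integral\<^sup>L (OPE \<mu> n) (\<lambda>x. (\<Sum>j<n. g (x j))\<^sup>2) =
    (\<Sum>k<n. gm (\<lambda>x. g x * g x) k k) + (\<Sum>k<n. gm g k k)\<^sup>2 - (\<Sum>k<n. \<Sum>l<n. (gm g k l)\<^sup>2)"
proof -
  have gb: "g \<in> borel_measurable borel" using g by (simp add: bdd_fn_def)
  have gg: "bdd_fn (\<lambda>x. g x * g x)" using g by (intro bdd_fn_mult)
  define D2 where "D2 x = (leibniz_det OP n x)\<^sup>2" for x
  define F where "F a b x = (if a = b then 0 else D2 x * (g (x a) * g (x b)))" for a b :: nat and x
  have iF: "integrable (Pn n) (F a b)" if "a < n" "b < n" for a b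
    using integral_leibniz_sq_pair(1)[OF g that] by (cases "a = b") (auto simp: F_def[abs_def] D2_def)
  have split: "D2 x * (\<Sum>j<n. g (x j))\<^sup>2 = (\<Sum>a<n. D2 x * (g (x a) * g (x a))) + (\<Sum>a<n. \<Sum>b<n. F a b x)" for x
  proof -
    have "D2 x * (\<Sum>j<n. g (x j))\<^sup>2 = (\<Sum>a<n. \<Sum>b<n. D2 x * (g (x a) * g (x b)))"
      by (subst power2_eq_square, subst sum_product) (simp only: sum_distrib_left)
    also have "\<dots> = (\<Sum>a<n. \<Sum>b<n. (if a = b then D2 x * (g (x a) * g (x a)) else 0) + F a b x)"
      by (intro sum.cong) (auto simp: F_def)
    finally show ?thesis by (simp add: sum.distrib)
  qed
  have "integral\<^sup>L (OPE \<mu> n) (\<lambda>x. (\<Sum>j<n. g (x j))\<^sup>2) = (\<integral>x. D2 x * (\<Sum>j<n. g (x j))\<^sup>2 \<partial>Pn n) / fact n"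
    unfolding D2_def by (rule integral_OPE_leibniz) (intro borel_measurable_power measurable_linstat gb)
  also have "(\<integral>x. D2 x * (\<Sum>j<n. g (x j))\<^sup>2 \<partial>Pn n) =
     (\<Sum>a<n. \<integral>x. D2 x * (g (x a) * g (x a)) \<partial>Pn n) + (\<Sum>a<n. \<Sum>b<n. \<integral>x. F a b x \<partial>Pn n)"
  proof -
    have iS: "integrable (Pn n) (\<lambda>x. D2 x * (g (x a) * g (x a)))" if "a < n" for a
      using integral_leibniz_sq_single(1)[OF gg that] by (simp add: D2_def)
    have "(\<integral>x. (\<Sum>a<n. \<Sum>b<n. F a b x) \<partial>Pn n) = (\<Sum>a<n. \<integral>x. (\<Sum>b<n. F a b x) \<partial>Pn n)"
      by (rule Bochner_Integration.integral_sum) (auto intro!: Bochner_Integration.integrable_sum iF)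
    also have "\<dots> = (\<Sum>a<n. \<Sum>b<n. \<integral>x. F a b x \<partial>Pn n)"
      by (rule sum.cong[OF refl], rule Bochner_Integration.integral_sum) (auto intro!: iF)
    finally have e2: "(\<integral>x. (\<Sum>a<n. \<Sum>b<n. F a b x) \<partial>Pn n) = (\<Sum>a<n. \<Sum>b<n. \<integral>x. F a b x \<partial>Pn n)" .
    have e1: "(\<integral>x. (\<Sum>a<n. D2 x * (g (x a) * g (x a))) \<partial>Pn n) = (\<Sum>a<n. \<integral>x. D2 x * (g (x a) * g (x a)) \<partial>Pn n)"
      by (rule Bochner_Integration.integral_sum) (auto intro!: iS)
    show ?thesis unfolding split e1[symmetric] e2[symmetric]
      by (rule Bochner_Integration.integral_add) (auto intro!: Bochner_Integration.integrable_sum iF iS)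
  qed
  also have "(\<Sum>a<n. \<integral>x. D2 x * (g (x a) * g (x a)) \<partial>Pn n) = fact n * (\<Sum>k<n. gm (\<lambda>x. g x * g x) k k)"
    unfolding sum_perms_single[symmetric] by (intro sum.cong refl) (use integral_leibniz_sq_single(2)[OF gg] in \<open>simp add: D2_def\<close>)
  also have "(\<Sum>a<n. \<Sum>b<n. \<integral>x. F a b x \<partial>Pn n) =
      fact n * (\<Sum>k<n. \<Sum>l<n. if k = l then 0 else gm g k k * gm g l l - (gm g k l)\<^sup>2)"
    unfolding sum_perms_pair[symmetric]
    by (intro sum.cong refl) (use integral_leibniz_sq_pair(2)[OF g] in \<open>auto simp: D2_def F_def[abs_def]\<close>)
  \<comment> \<open>The excluded diagonal may be restored because the minor vanishes at
    \<open>k = l\<close>.\<close>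
  also have "(\<Sum>k<n. \<Sum>l<n. if k = l then 0 else gm g k k * gm g l l - (gm g k l)\<^sup>2) =
      (\<Sum>k<n. \<Sum>l<n. gm g k k * gm g l l - (gm g k l)\<^sup>2)"
    by (intro sum.cong refl) (auto simp: power2_eq_square)
  finally have "integral\<^sup>L (OPE \<mu> n) (\<lambda>x. (\<Sum>j<n. g (x j))\<^sup>2) =
      (\<Sum>k<n. gm (\<lambda>x. g x * g x) k k) + (\<Sum>k<n. \<Sum>l<n. gm g k k * gm g l l - (gm g k l)\<^sup>2)"
    by (simp add: add_divide_distrib)
  then show ?thesis
    by (simp add: sum_subtractf sum_product power2_eq_square)
qed

lemma OPE_variance:
  fixes n :: nat
  assumes g: "bdd_fn g"
  defines "m \<equiv> integral\<^sup>L (OPE \<mu> n) (\<lambda>x. \<Sum>j<n. g (x j))"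
  shows "integral\<^sup>L (OPE \<mu> n) (\<lambda>x. ((\<Sum>j<n. g (x j)) - m)\<^sup>2) =
    (\<Sum>k<n. gm (\<lambda>x. g x * g x) k k) - (\<Sum>k<n. \<Sum>l<n. (gm g k l)\<^sup>2)"
proof -
  interpret prob_space "OPE \<mu> n" by (rule prob_space_OPE)
  have gb: "g \<in> borel_measurable borel" using g by (simp add: bdd_fn_def)
  obtain C where C: "\<And>x. x \<in> {-1..1} \<Longrightarrow> \<bar>g x\<bar> \<le> C" using g unfolding bdd_fn_def by blast
  let ?Q = "\<lambda>x. \<Sum>j<n. g (x j)"
  have b: "\<bar>?Q x\<bar> \<le> real n * C" if "\<And>j. j < n \<Longrightarrow> x j \<in> {-1..1}" for x
    using sum_norm_bound[of "{..<n}" "\<lambda>j. g (x j)" C] that C by auto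
  have i1: "integrable (OPE \<mu> n) ?Q"
    by (rule OPE_integrable_bounded[OF measurable_linstat[OF gb]]) (use b in auto)
  have i2: "integrable (OPE \<mu> n) (\<lambda>x. (?Q x)\<^sup>2)"
  proof (rule OPE_integrable_bounded)
    show "(\<lambda>x. (?Q x)\<^sup>2) \<in> borel_measurable (Pn n)" by (intro borel_measurable_power measurable_linstat gb)
    fix x :: "nat \<Rightarrow> real" assume "\<And>j. j < n \<Longrightarrow> x j \<in> {-1..1}"
    from power_mono[OF b[OF this] abs_ge_zero, where n = 2] show "norm ((?Q x)\<^sup>2) \<le> (real n * C)\<^sup>2" by simp
  qed
  have "integral\<^sup>L (OPE \<mu> n) (\<lambda>x. (?Q x - m)\<^sup>2) = integral\<^sup>L (OPE \<mu> n) (\<lambda>x. (?Q x)\<^sup>2) - m\<^sup>2"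
    using variance_eq[OF i1 i2] by (simp add: m_def)
  then show ?thesis
    using OPE_second_moment[OF g, of n] OPE_mean[OF g, of n] by (simp add: m_def)
qed

text \<open>The kernel is that of a projection, so integrating its square over one variable gives
  back its diagonal. Hence the variance is half of an integral of squared differences, in which only
  increments of \<open>g\<close> matter.\<close>

lemma OPE_variance_kernel:
  assumes g: "bdd_fn g"
  shows "2 * ((\<Sum>k<n. gm (\<lambda>x. g x * g x) k k) - (\<Sum>k<n. \<Sum>l<n. (gm g k l)\<^sup>2)) =
      (\<integral>x. (\<integral>y. (g x - g y)\<^sup>2 * (CDker n x y)\<^sup>2 \<partial>\<mu>) \<partial>\<mu>)"
    and "integrable \<mu> (\<lambda>x. \<integral>y. (g x - g y)\<^sup>2 * (CDker n x y)\<^sup>2 \<partial>\<mu>)"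
    and "integrable \<mu> (\<lambda>y. (g x - g y)\<^sup>2 * (CDker n x y)\<^sup>2)"
proof -
  define p where "p k l x = poly (OP k) x * poly (OP l) x" for k l x
  have gg: "bdd_fn (\<lambda>x. g x * g x)" using g by (intro bdd_fn_mult)
  have i0: "integrable \<mu> (p k l)" for k l
    unfolding p_def[abs_def] by (rule integrable_poly_mult)
  have i1: "integrable \<mu> (\<lambda>y. g y * p k l y)" for k l
    unfolding p_def by (rule bdd_fn_gm_integrable[OF g])
  have i2: "integrable \<mu> (\<lambda>y. (g y * g y) * p k l y)" for k l
    unfolding p_def by (rule bdd_fn_gm_integrable[OF gg])
  have v0: "(\<integral>y. p k l y \<partial>\<mu>) = (if k = l then 1 else 0)" for k l
    using gm_1[of k l] by (simp add: gm_def p_def)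
  have v1: "(\<integral>y. g y * p k l y \<partial>\<mu>) = gm g k l" for k l by (simp add: gm_def p_def)
  have v2: "(\<integral>y. (g y * g y) * p k l y \<partial>\<mu>) = gm (\<lambda>x. g x * g x) k l" for k l by (simp add: gm_def p_def)
  have ex: "(g x - g y)\<^sup>2 * (CDker n x y)\<^sup>2 = (\<Sum>k<n. \<Sum>l<n.
      (g x * g x * p k l x) * p k l y - 2 * (g x * p k l x) * (g y * p k l y) + p k l x * ((g y * g y) * p k l y))" for x y
  proof -
    have "(CDker n x y)\<^sup>2 = (\<Sum>k<n. \<Sum>l<n. p k l x * p k l y)"
      by (simp add: CDker_def power2_eq_square sum_product p_def algebra_simps)
    then have "(g x - g y)\<^sup>2 * (CDker n x y)\<^sup>2 = (\<Sum>k<n. \<Sum>l<n. (g x - g y)\<^sup>2 * (p k l x * p k l y))"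
      by (simp only: sum_distrib_left)
    also have "\<dots> = (\<Sum>k<n. \<Sum>l<n.
      (g x * g x * p k l x) * p k l y - 2 * (g x * p k l x) * (g y * p k l y) + p k l x * ((g y * g y) * p k l y))"
      by (intro sum.cong refl) (simp add: power2_eq_square algebra_simps)
    finally show ?thesis .
  qed
  show "integrable \<mu> (\<lambda>y. (g x - g y)\<^sup>2 * (CDker n x y)\<^sup>2)" for x
    unfolding ex by (intro Bochner_Integration.integrable_sum Bochner_Integration.integrable_add
        Bochner_Integration.integrable_diff integrable_mult_right i0 i1 i2)
  have inner: "(\<integral>y. (g x - g y)\<^sup>2 * (CDker n x y)\<^sup>2 \<partial>\<mu>) = (\<Sum>k<n. \<Sum>l<n.
     (if k = l then 1 else 0) * (g x * g x * p k l x) - 2 * gm g k l * (g x * p k l x) + gm (\<lambda>x. g x * g x) k l * p k l x)" for x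
  proof -
    have "(\<integral>y. (g x - g y)\<^sup>2 * (CDker n x y)\<^sup>2 \<partial>\<mu>) = (\<Sum>k<n. \<Sum>l<n.
      (g x * g x * p k l x) * (\<integral>y. p k l y \<partial>\<mu>) - 2 * (g x * p k l x) * (\<integral>y. g y * p k l y \<partial>\<mu>)
        + p k l x * (\<integral>y. (g y * g y) * p k l y \<partial>\<mu>))"
      unfolding ex
      by (simp add: Bochner_Integration.integral_sum Bochner_Integration.integral_add Bochner_Integration.integral_diff
          Bochner_Integration.integrable_sum Bochner_Integration.integrable_add
          Bochner_Integration.integrable_diff i0 i1 i2)
    then show ?thesis unfolding v0 v1 v2 by (simp add: algebra_simps)
  qed
  show "integrable \<mu> (\<lambda>x. \<integral>y. (g x - g y)\<^sup>2 * (CDker n x y)\<^sup>2 \<partial>\<mu>)"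
    unfolding inner by (intro Bochner_Integration.integrable_sum Bochner_Integration.integrable_add
        Bochner_Integration.integrable_diff integrable_mult_right i0 i1 i2)
  have "(\<integral>x. (\<integral>y. (g x - g y)\<^sup>2 * (CDker n x y)\<^sup>2 \<partial>\<mu>) \<partial>\<mu>) = (\<Sum>k<n. \<Sum>l<n.
     (if k = l then 1 else 0) * gm (\<lambda>x. g x * g x) k l - 2 * gm g k l * gm g k l
       + gm (\<lambda>x. g x * g x) k l * (if k = l then 1 else 0))"
    unfolding inner
    by (simp only: Bochner_Integration.integral_sum Bochner_Integration.integral_add Bochner_Integration.integral_diff
          integral_mult_right_zero
          Bochner_Integration.integrable_sum Bochner_Integration.integrable_add
          Bochner_Integration.integrable_diff integrable_mult_right i0 i1 i2 v0 v1 v2)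
  also have "\<dots> = (\<Sum>k<n. \<Sum>l<n. (if k = l then 2 * gm (\<lambda>x. g x * g x) k k else 0) - 2 * (gm g k l)\<^sup>2)"
    by (intro sum.cong refl) (auto simp: power2_eq_square)
  finally show "2 * ((\<Sum>k<n. gm (\<lambda>x. g x * g x) k k) - (\<Sum>k<n. \<Sum>l<n. (gm g k l)\<^sup>2)) =
      (\<integral>x. (\<integral>y. (g x - g y)\<^sup>2 * (CDker n x y)\<^sup>2 \<partial>\<mu>) \<partial>\<mu>)"
    by (simp add: sum_subtractf sum_distrib_left)
qed

text \<open>The increment of \<open>g\<close> supplies a factor \<open>\<bar>x - y\<bar>\<close>,
  and this times the kernel is by Christoffel--Darboux an antisymmetric expression in
  \<open>OP n\<close> and \<open>OP (n - 1)\<close> alone. After squaring, the two variables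
  separate.\<close>

lemma OPE_variance_bound:
  assumes n: "n > 0" and g: "bdd_fn g" and \<rho>: "bdd_fn \<rho>"
    and lip: "\<And>x y. x \<in> {-1..1} \<Longrightarrow> y \<in> {-1..1} \<Longrightarrow> \<bar>g x - g y\<bar> \<le> M * \<bar>x - y\<bar> * (\<rho> x * \<rho> y)"
  defines "m \<equiv> integral\<^sup>L (OPE \<mu> n) (\<lambda>x. \<Sum>j<n. g (x j))"
  shows "integral\<^sup>L (OPE \<mu> n) (\<lambda>x. ((\<Sum>j<n. g (x j)) - m)\<^sup>2) \<le>
     2 * M\<^sup>2 * (gm (\<lambda>x. (\<rho> x)\<^sup>2) n n * gm (\<lambda>x. (\<rho> x)\<^sup>2) (n - 1) (n - 1))"
proof -
  let ?p = "poly (OP n)" and ?q = "poly (OP (n - 1))"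
  let ?A = "gm (\<lambda>x. (\<rho> x)\<^sup>2) n n" and ?B = "gm (\<lambda>x. (\<rho> x)\<^sup>2) (n - 1) (n - 1)"
  have rr: "bdd_fn (\<lambda>x. (\<rho> x)\<^sup>2)" unfolding power2_eq_square using \<rho> by (intro bdd_fn_mult)
  have iA: "integrable \<mu> (\<lambda>y. (\<rho> y)\<^sup>2 * (?p y * ?p y))" and iB: "integrable \<mu> (\<lambda>y. (\<rho> y)\<^sup>2 * (?q y * ?q y))"
    by (intro bdd_fn_gm_integrable rr)+
  define U where "U x y = 2 * M\<^sup>2 * ((\<rho> x)\<^sup>2 * (?p x * ?p x)) * ((\<rho> y)\<^sup>2 * (?q y * ?q y))
      + 2 * M\<^sup>2 * ((\<rho> x)\<^sup>2 * (?q x * ?q x)) * ((\<rho> y)\<^sup>2 * (?p y * ?p y))" for x y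
  have pw: "(g x - g y)\<^sup>2 * (CDker n x y)\<^sup>2 \<le> U x y" if xy: "x \<in> {-1..1}" "y \<in> {-1..1}" for x y
  proof -
    let ?T = "?p x * ?q y - ?q x * ?p y"
    have "\<bar>(g x - g y) * CDker n x y\<bar> \<le> M * \<bar>x - y\<bar> * (\<rho> x * \<rho> y) * \<bar>CDker n x y\<bar>"
      unfolding abs_mult using lip[OF xy] by (intro mult_right_mono) auto
    also have "\<dots> = M * (\<rho> x * \<rho> y) * \<bar>(x - y) * CDker n x y\<bar>" by (simp add: abs_mult)
    also have "\<dots> = M * (\<rho> x * \<rho> y) * \<bar>ofd n * ?T\<bar>" unfolding Christoffel_Darboux[OF n] ..
    finally have "((g x - g y) * CDker n x y)\<^sup>2 \<le> (M * (\<rho> x * \<rho> y) * \<bar>ofd n * ?T\<bar>)\<^sup>2"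
      by (metis abs_ge_zero power2_abs power_mono)
    also have "\<dots> = (M * (\<rho> x * \<rho> y))\<^sup>2 * (?T\<^sup>2 * (ofd n)\<^sup>2)"
      by (simp add: power_mult_distrib)
    also have "\<dots> \<le> (M * (\<rho> x * \<rho> y))\<^sup>2 * (?T\<^sup>2 * 1)"
      using ofd_bound[of n] by (intro mult_left_mono) (auto simp: abs_square_le_1)
    also have "\<dots> \<le> (M * (\<rho> x * \<rho> y))\<^sup>2 * (2 * (?p x * ?q y)\<^sup>2 + 2 * (?q x * ?p y)\<^sup>2)"
    proof (intro mult_left_mono)
      have "0 \<le> (?p x * ?q y + ?q x * ?p y)\<^sup>2" by simp
      then show "?T\<^sup>2 * 1 \<le> 2 * (?p x * ?q y)\<^sup>2 + 2 * (?q x * ?p y)\<^sup>2"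
        by (simp add: power2_sum power2_diff)
    qed simp
    also have "\<dots> = U x y" by (simp add: U_def power2_eq_square algebra_simps)
    finally show ?thesis by (simp add: power_mult_distrib)
  qed
  have iU: "integrable \<mu> (U x)" for x
    unfolding U_def[abs_def] by (intro Bochner_Integration.integrable_add integrable_mult_right iA iB)
  have vU: "(\<integral>y. U x y \<partial>\<mu>) = 2 * M\<^sup>2 * ?B * ((\<rho> x)\<^sup>2 * (?p x * ?p x)) + 2 * M\<^sup>2 * ?A * ((\<rho> x)\<^sup>2 * (?q x * ?q x))" for x
    unfolding U_def gm_def
    by (simp only: Bochner_Integration.integral_add integrable_mult_right iA iB integral_mult_right_zero) (simp add: algebra_simps)
  have "(\<integral>x. (\<integral>y. (g x - g y)\<^sup>2 * (CDker n x y)\<^sup>2 \<partial>\<mu>) \<partial>\<mu>) \<le> (\<integral>x. (\<integral>y. U x y \<partial>\<mu>) \<partial>\<mu>)"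
  proof (rule integral_mono_AE)
    show "integrable \<mu> (\<lambda>x. \<integral>y. (g x - g y)\<^sup>2 * (CDker n x y)\<^sup>2 \<partial>\<mu>)"
      by (rule OPE_variance_kernel(2)[OF g])
    show "integrable \<mu> (\<lambda>x. \<integral>y. U x y \<partial>\<mu>)"
      unfolding vU by (intro Bochner_Integration.integrable_add integrable_mult_right iA iB)
    show "AE x in \<mu>. (\<integral>y. (g x - g y)\<^sup>2 * (CDker n x y)\<^sup>2 \<partial>\<mu>) \<le> (\<integral>y. U x y \<partial>\<mu>)"
      using supp_mu
    proof eventually_elim
      case (elim x)
      show ?case
      proof (rule integral_mono_AE[OF OPE_variance_kernel(3)[OF g] iU])
        show "AE y in \<mu>. (g x - g y)\<^sup>2 * (CDker n x y)\<^sup>2 \<le> U x y"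
          using supp_mu by eventually_elim (use pw elim in auto)
      qed
    qed
  qed
  also have "\<dots> = 4 * M\<^sup>2 * (?A * ?B)"
    unfolding vU
    by (simp only: Bochner_Integration.integral_add integrable_mult_right iA iB integral_mult_right_zero gm_def[symmetric])
       (simp add: algebra_simps)
  finally show ?thesis
    using OPE_variance_kernel(1)[OF g, of n] OPE_variance[OF g, of n] by (simp add: m_def)
qed

end

section \<open>Weights of Jacobi type\<close>

text \<open>The function \<open>h\<close> is positive and continuous on the whole line, so that
  integrands are globally continuous, but differentiable only inside the interval: an extension by
  constants beyond the endpoints fits. The Lipschitz bound on \<open>h'\<close> serves the term with
  \<open>Bw\<close> in the loop equation.\<close>

locale jacobi_weight =
  fixes h h' :: "real \<Rightarrow> real" and g1 g2 :: real
  assumes g1: "g1 > -1" and g2: "g2 > -1"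
    and h_pos: "\<And>x. h x > 0"
    and h_cont: "continuous_on UNIV h" and h'_cont: "continuous_on UNIV h'"
    and h_deriv: "\<And>x. x \<in> {-1<..<1} \<Longrightarrow> (h has_real_derivative h' x) (at x)"
    and h'_lip: "\<exists>L. \<forall>x\<in>{-1..1}. \<forall>y\<in>{-1..1}. \<bar>h' x - h' y\<bar> \<le> L * \<bar>x - y\<bar>"
begin

definition wt :: "real \<Rightarrow> real" where
  "wt x = indicator {-1..1} x * h x * (1 - x) powr g1 * (1 + x) powr g2"

abbreviation mu :: "real measure" where "mu \<equiv> jacobi_type_measure h g1 g2"

lemma mu_eq: "mu = density lborel (\<lambda>x. ennreal (wt x))"
  by (simp add: jacobi_type_measure_def wt_def)

lemma measurable_h [measurable]: "h \<in> borel_measurable borel"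
  and measurable_h' [measurable]: "h' \<in> borel_measurable borel"
  by (intro borel_measurable_continuous_onI h_cont h'_cont)+

lemma measurable_wt [measurable]: "wt \<in> borel_measurable borel"
  unfolding wt_def[abs_def] by measurable

lemma wt_nonneg: "0 \<le> wt x"
  using h_pos[of x] by (auto simp: wt_def indicator_def intro!: mult_nonneg_nonneg)

lemma wt_pos: "x \<in> {-1<..<1} \<Longrightarrow> 0 < wt x"
  using h_pos[of x] by (auto simp: wt_def)

lemma h_bounds: "\<exists>m M. 0 < m \<and> (\<forall>x\<in>{-1..1}. m \<le> h x \<and> h x \<le> M)"
proof -
  have c: "continuous_on {-1..1} h" using h_cont continuous_on_subset by blast
  obtain a where a: "\<forall>y\<in>{-1..1}. h a \<le> h y"
    using continuous_attains_inf[OF compact_Icc _ c] by auto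
  obtain b where b: "\<forall>y\<in>{-1..1}. h y \<le> h b"
    using continuous_attains_sup[OF compact_Icc _ c] by auto
  show ?thesis using a b h_pos[of a] by blast
qed

text \<open>The substitution \<open>(1 + x) / 2\<close> turns the weight into a Beta integrand times
  the bounded factor \<open>h\<close>; the power of two comes from rescaling the two edge
  factors.\<close>

lemma integrable_wt: "integrable lborel wt"
proof -
  obtain m M where M: "\<forall>x\<in>{-1..1}. m \<le> h x \<and> h x \<le> M" using h_bounds by blast
  let ?f = "\<lambda>t::real. indicator {0..1} t * (t powr g2 * (1 - t) powr g1)"
  have "set_integrable lborel {0..1} (\<lambda>t. t powr (g2 + 1 - 1) * (1 - t) powr (g1 + 1 - 1))"
    using g1 g2 by (intro integrable_Beta) auto
  then have "integrable lborel ?f" by (simp add: set_integrable_def)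
  then have "integrable lborel (\<lambda>x. ?f (1 / 2 + (1 / 2) * x))"
    by (subst lborel_integrable_real_affine_iff) auto
  then have I: "integrable lborel (\<lambda>x. M * 2 powr (g1 + g2) * ?f (1 / 2 + (1 / 2) * x))"
    by (rule integrable_mult_right)
  show ?thesis
  proof (rule Bochner_Integration.integrable_bound[OF I])
    show "AE x in lborel. norm (wt x) \<le> norm (M * 2 powr (g1 + g2) * ?f (1 / 2 + (1 / 2) * x))"
    proof (rule AE_I2)
      fix x :: real
      show "norm (wt x) \<le> norm (M * 2 powr (g1 + g2) * ?f (1 / 2 + (1 / 2) * x))"
      proof (cases "x \<in> {-1..1}")
        case False
        then show ?thesis by (simp add: wt_def)
      next
        case True
        have e1: "(1 + x) powr g2 = 2 powr g2 * (1 / 2 + (1 / 2) * x) powr g2"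
          using True powr_mult[of 2 "1 / 2 + (1 / 2) * x" g2] by (simp add: algebra_simps)
        have e2: "(1 - x) powr g1 = 2 powr g1 * (1 - (1 / 2 + (1 / 2) * x)) powr g1"
          using True powr_mult[of 2 "1 - (1 / 2 + (1 / 2) * x)" g1] by (simp add: algebra_simps)
        have t: "1 / 2 + (1 / 2) * x \<in> {0..1}" using True by auto
        define z where "z = (1 / 2 + (1 / 2) * x) powr g2 * (1 - (1 / 2 + (1 / 2) * x)) powr g1"
        have z: "0 \<le> z" by (simp add: z_def)
        have f: "?f (1 / 2 + (1 / 2) * x) = z" using t by (simp add: z_def)
        have "wt x = h x * (2 powr (g1 + g2) * z)"
          using True by (simp add: wt_def e1 e2 z_def powr_add algebra_simps)
        also have "\<dots> \<le> M * (2 powr (g1 + g2) * z)"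
          using M True z by (intro mult_right_mono) auto
        finally have "wt x \<le> M * (2 powr (g1 + g2) * z)" .
        moreover have "0 \<le> M" using M True h_pos[of x] by (meson less_imp_le order_trans)
        ultimately show ?thesis unfolding f using wt_nonneg[of x] z by (simp add: abs_mult mult.assoc)
      qed
    qed
  qed simp
qed

lemma integral_mu:
  fixes f :: "real \<Rightarrow> 'b::{banach, second_countable_topology}"
  assumes "f \<in> borel_measurable borel"
  shows "integral\<^sup>L mu f = (\<integral>x. wt x *\<^sub>R f x \<partial>lborel)"
  unfolding mu_eq by (rule integral_density) (use assms wt_nonneg in auto)

lemma integrable_mu:
  fixes f :: "real \<Rightarrow> 'b::{banach, second_countable_topology}"
  assumes "f \<in> borel_measurable borel"
  shows "integrable mu f \<longleftrightarrow> integrable lborel (\<lambda>x. wt x *\<^sub>R f x)"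
  unfolding mu_eq by (rule integrable_density) (use assms wt_nonneg in auto)

lemma AE_mu_zero:
  assumes [measurable]: "(f :: real \<Rightarrow> real) \<in> borel_measurable borel" and "AE x in mu. f x = 0"
  shows "AE x in lborel. x \<in> {-1<..<1} \<longrightarrow> f x = 0"
  using assms(2) unfolding mu_eq
  by (subst (asm) AE_density) (auto elim!: eventually_mono simp: wt_pos)

lemma not_AE_outside:
  assumes "a < b"
  shows "\<not> (AE x in lborel. x \<notin> {a<..<b::real})"
proof
  assume "AE x in lborel. x \<notin> {a<..<b::real}"
  then have "emeasure lborel {a<..<b} = 0"
    by (subst (asm) AE_iff_measurable[of "{a<..<b}"]) auto
  with assms show False by simp
qed

sublocale ope_measure mu
proof (rule ope_measure.intro)
  show "sets mu = sets borel" by (simp add: mu_eq)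
  show fin: "finite_measure mu"
  proof
    have "emeasure mu (space mu) = (\<integral>\<^sup>+x. ennreal (wt x) \<partial>lborel)"
      unfolding mu_eq by (subst emeasure_density) (auto intro!: nn_integral_cong)
    also have "\<dots> = ennreal (\<integral>x. wt x \<partial>lborel)"
      by (rule nn_integral_eq_integral[OF integrable_wt]) (simp add: wt_nonneg)
    finally show "emeasure mu (space mu) \<noteq> \<infinity>" by simp
  qed
  show s: "AE x in mu. x \<in> {-1..1}"
    unfolding mu_eq by (subst AE_density) (auto simp: wt_def indicator_def intro!: AE_I2 split: if_splits)
  fix p :: "real poly" assume p: "p \<noteq> 0"
  have pm [measurable]: "poly p \<in> borel_measurable borel"
    by (intro borel_measurable_continuous_onI continuous_intros)
  have "bounded (poly p ` {-1..1})"
    by (intro compact_imp_bounded compact_continuous_image continuous_intros) auto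
  then obtain C where C: "\<forall>x\<in>{-1..1}. \<bar>poly p x\<bar> \<le> C" by (auto simp: bounded_iff)
  have i: "integrable mu (\<lambda>x. (poly p x)\<^sup>2)"
  proof (rule finite_measure.integrable_const_bound[OF fin, where B = "C\<^sup>2"])
    show "AE x in mu. norm ((poly p x)\<^sup>2) \<le> C\<^sup>2"
      using s by eventually_elim (use C in \<open>metis abs_ge_zero power2_abs power_mono real_norm_def abs_power2\<close>)
    show "(\<lambda>x. (poly p x)\<^sup>2) \<in> borel_measurable mu"
      unfolding mu_eq by measurable
  qed
  \<comment> \<open>A polynomial of norm zero would vanish almost everywhere on the open interval,
    while its zero set is finite.\<close>
  have "(\<integral>x. (poly p x)\<^sup>2 \<partial>mu) \<noteq> 0"
  proof
    assume "(\<integral>x. (poly p x)\<^sup>2 \<partial>mu) = 0"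
    then have "AE x in mu. (poly p x)\<^sup>2 = 0"
      using integral_nonneg_eq_0_iff_AE[OF i] by simp
    then have "AE x in lborel. x \<in> {-1<..<1} \<longrightarrow> (poly p x)\<^sup>2 = 0"
      by (intro AE_mu_zero) measurable
    moreover have "AE x in lborel. x \<notin> {x. poly p x = 0}"
      by (intro AE_not_in finite_imp_null_set_lborel poly_roots_finite p)
    ultimately have "AE x in lborel. x \<notin> {-1<..<1::real}"
      by eventually_elim auto
    with not_AE_outside[of "-1" 1] show False by simp
  qed
  moreover have "0 \<le> (\<integral>x. (poly p x)\<^sup>2 \<partial>mu)" by simp
  ultimately show "0 < (\<integral>x. (poly p x)\<^sup>2 \<partial>mu)" by linarith
qed

lemma measure_mu_pos:
  assumes "-1 < a" "a < b" "b < 1"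
  shows "0 < measure mu {a..b}"
proof -
  have "measure mu {a..b} \<noteq> 0"
  proof
    assume "measure mu {a..b} = 0"
    then have "AE x in mu. x \<notin> {a..b}"
      by (intro AE_not_in) (auto simp: null_sets_def sets_mu emeasure_eq_measure)
    then have "AE x in mu. indicat_real {a..b} x = 0" by eventually_elim auto
    then have "AE x in lborel. x \<in> {-1<..<1} \<longrightarrow> indicat_real {a..b} x = 0"
      by (intro AE_mu_zero) measurable
    then have "AE x in lborel. x \<notin> {a<..<b}"
      by eventually_elim (use assms in \<open>auto simp: indicator_def split: if_splits\<close>)
    with not_AE_outside[OF assms(2)] show False by simp
  qed
  then show ?thesis using measure_nonneg[of mu "{a..b}"] by linarith
qed

text \<open>The logarithmic derivative of the weight times \<open>1 - x\<^sup>2\<close>, written out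
  so that it is continuous up to the endpoints.\<close>

definition Bw :: "real \<Rightarrow> real" where
  "Bw x = (g2 - g1) - (g1 + g2) * x + (1 - x\<^sup>2) * (h' x / h x)"

lemma Bw_cont: "continuous_on UNIV Bw"
  unfolding Bw_def[abs_def] using h_pos
  by (intro continuous_intros h_cont h'_cont) (metis less_irrefl)

lemma bounded_on_unit:
  fixes F :: "real \<Rightarrow> 'b::real_normed_vector"
  assumes "continuous_on UNIV F"
  shows "\<exists>C. \<forall>x\<in>{-1..1}. norm (F x) \<le> C"
proof -
  have "bounded (F ` {-1..1})"
    by (intro compact_imp_bounded compact_continuous_image continuous_on_subset[OF assms]) auto
  then show ?thesis by (auto simp: bounded_iff)
qed

text \<open>The factor \<open>1 - x\<^sup>2\<close> kills the boundary terms, whatever the exponents above \<open>-1\<close>.\<close>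

lemma integral_by_parts_weight:
  fixes \<Phi> \<Phi>' :: "real \<Rightarrow> 'b::euclidean_space"
  assumes D: "\<And>x. (\<Phi> has_vector_derivative \<Phi>' x) (at x)" and C: "continuous_on UNIV \<Phi>'"
  shows "(\<integral>x. (1 - x\<^sup>2) *\<^sub>R \<Phi>' x + (Bw x - 2 * x) *\<^sub>R \<Phi> x \<partial>mu) = 0"
proof -
  have \<Phi>c: "continuous_on UNIV \<Phi>"
    using D by (auto intro!: continuous_at_imp_continuous_on has_vector_derivative_continuous)
  define G where "G x = (1 - x\<^sup>2) *\<^sub>R \<Phi>' x + (Bw x - 2 * x) *\<^sub>R \<Phi> x" for x
  have Gc: "continuous_on UNIV G"
    unfolding G_def[abs_def] by (intro continuous_intros C \<Phi>c Bw_cont)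
  have Gm [measurable]: "G \<in> borel_measurable borel" by (intro borel_measurable_continuous_onI Gc)
  obtain K where K: "\<forall>x\<in>{-1..1}. norm (G x) \<le> K" using bounded_on_unit[OF Gc] by blast
  have iG: "integrable mu G" by (rule integrable_bounded_on[where C = K]) (use K in auto)
  define f where "f x = wt x *\<^sub>R G x" for x
  \<comment> \<open>The weight times \<open>1 - x\<^sup>2\<close> times \<open>\<Phi>\<close>, with
    the powers merged: the exponents are now positive, so \<open>F\<close> is continuous on the
    closed interval and zero at both ends.\<close>
  define F where "F x = ((1 - x) powr (g1 + 1) * (1 + x) powr (g2 + 1) * h x) *\<^sub>R \<Phi> x" for x
  have pc: "continuous_on {-1..1} (\<lambda>x::real. (1 - x) powr (g1 + 1))"
     "continuous_on {-1..1} (\<lambda>x::real. (1 + x) powr (g2 + 1))"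
    by (rule continuous_on_powr'; (intro continuous_on_const continuous_on_diff continuous_on_add continuous_on_id)?;
        use g1 g2 in auto)+
  have Fc: "continuous_on {-1..1} F"
    unfolding F_def[abs_def]
    by (intro continuous_intros pc continuous_on_subset[OF \<Phi>c] continuous_on_subset[OF h_cont]) auto
  have wtx: "wt x = h x * (1 - x) powr g1 * (1 + x) powr g2" if "x \<in> {-1<..<1}" for x
    using that by (simp add: wt_def)
  have "(LBINT x=ereal (-1)..ereal 1. f x) = 0 - 0"
  proof (rule interval_integral_FTC_integrable[where F = F])
    fix x :: real assume "ereal (-1) < ereal x" "ereal x < ereal 1"
    then have x: "x \<in> {-1<..<1}" by auto
    have p1: "(1 - x) powr (g1 + 1) = (1 - x) * (1 - x) powr g1"
      and p2: "(1 + x) powr (g2 + 1) = (1 + x) * (1 + x) powr g2"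
      using x by (auto simp: powr_add)
    have d: "((\<lambda>x. (1 - x) powr (g1 + 1) * (1 + x) powr (g2 + 1) * h x) has_real_derivative
        wt x * (Bw x - 2 * x)) (at x)"
      by (rule derivative_eq_intros refl h_deriv[OF x] | use x in simp; fail)+
        (use x h_pos[of x] in \<open>simp add: wtx p1 p2 p1[unfolded add.commute[of g1 1]] p2[unfolded add.commute[of g2 1]] Bw_def field_simps power2_eq_square\<close>)
    have "(F has_vector_derivative
        ((1 - x) powr (g1 + 1) * (1 + x) powr (g2 + 1) * h x) *\<^sub>R \<Phi>' x + (wt x * (Bw x - 2 * x)) *\<^sub>R \<Phi> x) (at x)"
      unfolding F_def[abs_def] by (rule has_vector_derivative_scaleR[OF d D])
    also have "((1 - x) powr (g1 + 1) * (1 + x) powr (g2 + 1) * h x) = wt x * (1 - x\<^sup>2)"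
      using x by (simp add: wtx p1 p2 p1[unfolded add.commute[of g1 1]] p2[unfolded add.commute[of g2 1]] power2_eq_square algebra_simps)
    finally show "(F has_vector_derivative f x) (at x)"
      by (simp add: f_def G_def scaleR_add_right)
  next
    fix x :: real assume "ereal (-1) < ereal x" "ereal x < ereal 1"
    then have x: "x \<in> {-1<..<1}" by auto
    have "continuous_on {-1<..<1} (\<lambda>x. (h x * (1 - x) powr g1 * (1 + x) powr g2) *\<^sub>R G x)"
      by (intro continuous_intros continuous_on_subset[OF Gc] continuous_on_subset[OF h_cont]) auto
    then have "continuous_on {-1<..<1} f"
      by (rule continuous_on_cong[THEN iffD1, rotated 2]) (auto simp: f_def wtx)
    then show "isCont f x" using x by (simp add: continuous_on_eq_continuous_at)
  next
    have "integrable lborel f"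
      using iG integrable_mu[of G] by (simp add: f_def[abs_def])
    then show "set_integrable lborel (einterval (ereal (-1)) (ereal 1)) f"
      unfolding set_integrable_def by (intro integrable_mult_indicator) auto
  next
    have "(F \<longlongrightarrow> F (-1)) (at_right (-1))"
      using Fc by (intro continuous_on_Icc_at_rightD[of "-1" 1]) auto
    then show "((F \<circ> real_of_ereal) \<longlongrightarrow> 0) (at_right (ereal (-1)))"
      using g2 by (simp add: ereal_tendsto_simps F_def)
    have "(F \<longlongrightarrow> F 1) (at_left 1)"
      using Fc by (intro continuous_on_Icc_at_leftD[of "-1" 1]) auto
    then show "((F \<circ> real_of_ereal) \<longlongrightarrow> 0) (at_left (ereal 1))"
      using g1 by (simp add: ereal_tendsto_simps F_def)
  qed simp
  then have "(\<integral>x. indicator {-1..1} x *\<^sub>R f x \<partial>lborel) = 0"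
    by (simp add: interval_integral_Icc set_lebesgue_integral_def)
  also have "(\<lambda>x. indicator {-1..1} x *\<^sub>R f x) = f"
    by (auto simp: f_def wt_def indicator_def)
  finally have "integral\<^sup>L mu G = 0"
    using integral_mu[OF Gm] by (simp add: f_def[abs_def])
  then show ?thesis by (simp only: G_def[abs_def])
qed

text \<open>\<open>OP n\<close> solves the Jacobi differential equation \<open>L p = - \<lambda> p\<close>, because \<open>L\<close> is symmetric
  and preserves degrees; the energy \<open>\<lambda> p\<^sup>2 + (1 - x\<^sup>2) p'\<^sup>2\<close> then varies by at most a constant factor
  on \<open>{-s..s}\<close>, so it is bounded by its mean.\<close>

lemma jacobi_bulk_bound:
  assumes h1: "\<And>x. h x = 1" "\<And>x. h' x = 0" and s: "0 < s" "s < 1"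
  shows "\<exists>C. \<forall>n. \<forall>x\<in>{-s..s}. (poly (OP n) x)\<^sup>2 \<le> C"
proof -
  \<comment> \<open>For constant \<open>h\<close> the coefficient \<open>Bw x - 2 * x\<close> is the
    polynomial \<open>b0 - b1 * x\<close>, so the weight times \<open>L p\<close> is the derivative
    of the weight times \<open>(1 - x\<^sup>2) * p'\<close>.\<close>
  define b0 where "b0 = g2 - g1"
  define b1 where "b1 = g1 + g2 + 2"
  define S :: "real poly" where "S = [:1, 0, -1:]"
  define L where "L p = S * pderiv (pderiv p) + [:b0, - b1:] * pderiv p" for p
  have S: "poly S x = 1 - x\<^sup>2" for x by (simp add: S_def power2_eq_square)
  have Bx: "Bw x = b0 - b1 * x + 2 * x" for x by (simp add: Bw_def h1 b0_def b1_def algebra_simps)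
  have degL: "degree (L p) \<le> degree p" for p
  proof -
    consider "degree p = 0" | "degree p = 1" | "degree p \<ge> 2" by linarith
    then show ?thesis
    proof cases
      case 1
      then have "pderiv p = 0" by (simp add: pderiv_eq_0_iff)
      then show ?thesis by (simp add: L_def)
    next
      case 2
      then have "pderiv (pderiv p) = 0" by (simp add: pderiv_eq_0_iff degree_pderiv)
      moreover have "degree ([:b0, - b1:] * pderiv p) \<le> 1 + 0"
        using 2 by (intro order.trans[OF degree_mult_le] add_mono) (auto simp: degree_pderiv)
      ultimately show ?thesis using 2 by (simp add: L_def)
    next
      case 3
      have "degree (S * pderiv (pderiv p)) \<le> 2 + (degree p - 2)"
        by (intro order.trans[OF degree_mult_le] add_mono) (auto simp: degree_pderiv S_def)
      moreover have "degree ([:b0, - b1:] * pderiv p) \<le> 1 + (degree p - 1)"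
        by (intro order.trans[OF degree_mult_le] add_mono) (auto simp: degree_pderiv)
      ultimately show ?thesis using 3 unfolding L_def by (intro degree_add_le) auto
    qed
  qed
  \<comment> \<open>Integration by parts applied to \<open>p * pderiv q\<close> exhibits the
    symmetry of \<open>L\<close>: what remains is a weighted inner product of the two
    derivatives.\<close>
  have ipL: "ip p (L q) = - ip (pderiv p) (S * pderiv q)" for p q
  proof -
    let ?r = "p * pderiv q"
    have "(\<integral>x. (1 - x\<^sup>2) *\<^sub>R poly (pderiv ?r) x + (Bw x - 2 * x) *\<^sub>R poly ?r x \<partial>mu) = 0"
      by (rule integral_by_parts_weight)
        (auto intro!: continuous_intros poly_DERIV simp flip: has_real_derivative_iff_has_vector_derivative simp del: poly_mult)
    also have "(\<lambda>x. (1 - x\<^sup>2) *\<^sub>R poly (pderiv ?r) x + (Bw x - 2 * x) *\<^sub>R poly ?r x) =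
       (\<lambda>x. poly (pderiv p) x * poly (S * pderiv q) x + poly p x * poly (L q) x)"
      by (rule ext) (simp add: Bx L_def S pderiv_mult algebra_simps)
    finally show ?thesis
      unfolding ip_def by (simp add: integrable_poly_mult del: poly_mult)
  qed
  have ipL_sym: "ip p (L q) = ip q (L p)" for p q
    by (metis ipL ip_mult_swap ip_commute)
  define lam where "lam n = ip (pderiv (OP n)) (S * pderiv (OP n))" for n
  have ode: "L (OP n) = smult (- lam n) (OP n)" for n
  proof -
    have z: "ip (L (OP n)) (OP j) = 0" if "j < n" for j
    proof -
      have "ip (L (OP n)) (OP j) = ip (OP n) (L (OP j))" by (metis ip_commute ipL_sym)
      also have "\<dots> = 0" using degL[of "OP j"] that by (subst ip_commute, intro ip_OP_eq_0) simp
      finally show ?thesis .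
    qed
    have "L (OP n) = (\<Sum>j\<le>n. smult (ip (L (OP n)) (OP j)) (OP j))"
      using degL[of "OP n"] by (intro OP_expansion) simp
    also have "\<dots> = (\<Sum>j\<in>{n}. smult (ip (L (OP n)) (OP j)) (OP j))"
      by (intro sum.mono_neutral_right) (use z in auto)
    also have "\<dots> = smult (- lam n) (OP n)"
      using ipL[of "OP n" "OP n"] by (simp add: lam_def ip_commute)
    finally show ?thesis .
  qed
  define m where "m = measure mu {-s..s}"
  have m: "0 < m" unfolding m_def by (rule measure_mu_pos) (use s in auto)
  \<comment> \<open>A Gronwall constant: the numerator bounds the coefficient in the derivative of
    the energy \<open>E\<close>, and \<open>1 - s\<^sup>2\<close> is the least share of the squared
    derivative that \<open>E\<close> contains on \<open>{-s..s}\<close>.\<close>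
  define k where "k = (2 + 2 * (\<bar>b0\<bar> + \<bar>b1\<bar>)) / (1 - s\<^sup>2)"
  have s2: "0 < 1 - s\<^sup>2" using s by (simp add: power_less_one_iff abs_square_less_1)
  have k0: "0 \<le> k" unfolding k_def using s2 by (intro divide_nonneg_pos) auto
  have "(poly (OP n) x)\<^sup>2 \<le> (2 * exp (2 * k) + 1) / m" if x: "x \<in> {-s..s}" for n x
  proof -
    define P where "P = poly (OP n)"
    define P1 where "P1 = poly (pderiv (OP n))"
    define P2 where "P2 = poly (pderiv (pderiv (OP n)))"
    define E where "E x = lam n * (P x)\<^sup>2 + (1 - x\<^sup>2) * (P1 x)\<^sup>2" for x
    have ode': "(1 - x\<^sup>2) * P2 x = - lam n * P x - (b0 - b1 * x) * P1 x" for x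
      using arg_cong[OF ode[of n], of "\<lambda>p. poly p x"] by (simp add: L_def S P_def P1_def P2_def algebra_simps)
    have l0: "0 \<le> lam n"
      unfolding lam_def ip_def
    proof (rule integral_nonneg_AE)
      show "AE x in mu. 0 \<le> poly (pderiv (OP n)) x * poly (S * pderiv (OP n)) x"
        using supp_mu
      proof eventually_elim
        case (elim x)
        then have "0 \<le> (1 - x\<^sup>2) * (P1 x)\<^sup>2"
          by (intro mult_nonneg_nonneg) (auto simp: abs_square_le_1 abs_le_iff)
        then show ?case by (simp add: S P1_def power2_eq_square algebra_simps)
      qed
    qed
    \<comment> \<open>By the differential equation the products of \<open>P\<close> and
      \<open>P1\<close> cancel; what remains is a multiple of the squared derivative, free of the
      eigenvalue \<open>lam n\<close>.\<close>
    have E': "(E has_real_derivative (- 2 * x - 2 * (b0 - b1 * x)) * (P1 x)\<^sup>2) (at x)" for x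
    proof -
      have d1: "(P has_real_derivative P1 x) (at x)" and d2: "(P1 has_real_derivative P2 x) (at x)"
        by (auto simp: P_def P1_def P2_def intro!: poly_DERIV)
      have "(E has_real_derivative 2 * lam n * P x * P1 x + (2 * P1 x * ((1 - x\<^sup>2) * P2 x) - 2 * x * (P1 x)\<^sup>2)) (at x)"
        unfolding E_def[abs_def] by (rule derivative_eq_intros d1 d2 refl)+ (simp add: algebra_simps power2_eq_square)
      then show ?thesis unfolding ode' by (rule DERIV_cong) (simp add: algebra_simps power2_eq_square)
    qed
    have sq1: "1 - s\<^sup>2 \<le> 1 - t\<^sup>2" if "t \<in> {-s..s}" for t
      using that s abs_le_square_iff[of t s] by (auto simp: abs_le_iff)
    have E'_bound: "\<bar>(- 2 * t - 2 * (b0 - b1 * t)) * (P1 t)\<^sup>2\<bar> \<le> k * E t" if t: "t \<in> {-s..s}" for t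
    proof -
      have t1: "\<bar>t\<bar> \<le> 1" using t s by auto
      define w where "w = b1 * t"
      have "\<bar>w\<bar> \<le> \<bar>b1\<bar> * 1" unfolding abs_mult w_def using t1 by (intro mult_left_mono) auto
      then have "w \<le> \<bar>b1\<bar>" "- w \<le> \<bar>b1\<bar>" "t \<le> 1" "- t \<le> 1" using t1 by (auto simp: abs_le_iff)
      then have "\<bar>- 2 * t - 2 * (b0 - w)\<bar> \<le> 2 + 2 * (\<bar>b0\<bar> + \<bar>b1\<bar>)"
        using abs_ge_self[of b0] abs_ge_minus_self[of b0] by (intro abs_leI) (simp_all add: algebra_simps)
      then have "\<bar>- 2 * t - 2 * (b0 - b1 * t)\<bar> \<le> 2 + 2 * (\<bar>b0\<bar> + \<bar>b1\<bar>)" by (simp only: w_def)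
      then have "\<bar>(- 2 * t - 2 * (b0 - b1 * t)) * (P1 t)\<^sup>2\<bar> \<le> (2 + 2 * (\<bar>b0\<bar> + \<bar>b1\<bar>)) * (P1 t)\<^sup>2"
        unfolding abs_mult by (simp add: mult_right_mono)
      also have "\<dots> = k * ((1 - s\<^sup>2) * (P1 t)\<^sup>2)" using s2 by (simp add: k_def)
      also have "\<dots> \<le> k * ((1 - t\<^sup>2) * (P1 t)\<^sup>2)"
        using k0 sq1[OF t] by (intro mult_left_mono mult_right_mono) auto
      also have "\<dots> \<le> k * E t" unfolding E_def using k0 l0 by (intro mult_left_mono) auto
      finally show ?thesis .
    qed
    have E0: "0 \<le> E t" if "t \<in> {-1..1}" for t
      using that l0 unfolding E_def by (intro add_nonneg_nonneg mult_nonneg_nonneg) (auto simp: abs_square_le_1 abs_le_iff)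
    \<comment> \<open>The factors \<open>exp (k * t)\<close> and \<open>exp (- k * t)\<close> make
      \<open>E\<close> increasing and decreasing, respectively; two points of the interval are at
      most 2 apart, whence \<open>exp (2 * k)\<close>.\<close>
    have comp: "E x \<le> exp (2 * k) * E y" if x: "x \<in> {-s..s}" and y: "y \<in> {-s..s}" for x y
    proof (cases "x \<le> y")
      case True
      have "E x * exp (k * x) \<le> E y * exp (k * y)"
      proof (rule DERIV_nonneg_imp_nondecreasing[OF True])
        fix t assume "x \<le> t" "t \<le> y"
        then have t: "t \<in> {-s..s}" using x y by auto
        have "((\<lambda>t. E t * exp (k * t)) has_real_derivative
            ((- 2 * t - 2 * (b0 - b1 * t)) * (P1 t)\<^sup>2 + k * E t) * exp (k * t)) (at t)"
          by (rule derivative_eq_intros E' refl)+ (simp add: algebra_simps)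
        moreover have "0 \<le> ((- 2 * t - 2 * (b0 - b1 * t)) * (P1 t)\<^sup>2 + k * E t) * exp (k * t)"
          using E'_bound[OF t] by (intro mult_nonneg_nonneg) auto
        ultimately show "\<exists>z. ((\<lambda>t. E t * exp (k * t)) has_real_derivative z) (at t) \<and> 0 \<le> z" by blast
      qed
      then have "E x \<le> E y * exp (k * y) / exp (k * x)" by (simp add: pos_le_divide_eq)
      also have "\<dots> = exp (k * (y - x)) * E y" by (simp add: exp_diff right_diff_distrib)
      also have "\<dots> \<le> exp (2 * k) * E y"
      proof (rule mult_right_mono)
        have "k * (y - x) \<le> k * 2" using k0 x y s by (intro mult_left_mono) auto
        then show "exp (k * (y - x)) \<le> exp (2 * k)" by simp
        show "0 \<le> E y" using E0 y s by auto
      qed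
      finally show ?thesis .
    next
      case False
      then have yx: "y \<le> x" by simp
      have "E x * exp (- k * x) \<le> E y * exp (- k * y)"
      proof (rule DERIV_nonpos_imp_nonincreasing[OF yx])
        fix t assume "y \<le> t" "t \<le> x"
        then have t: "t \<in> {-s..s}" using x y by auto
        have "((\<lambda>t. E t * exp (- k * t)) has_real_derivative
            ((- 2 * t - 2 * (b0 - b1 * t)) * (P1 t)\<^sup>2 - k * E t) * exp (- k * t)) (at t)"
          by (rule derivative_eq_intros E' refl)+ (simp add: algebra_simps)
        moreover have "((- 2 * t - 2 * (b0 - b1 * t)) * (P1 t)\<^sup>2 - k * E t) * exp (- k * t) \<le> 0"
          using E'_bound[OF t] by (intro mult_nonpos_nonneg) auto
        ultimately show "\<exists>z. ((\<lambda>t. E t * exp (- k * t)) has_real_derivative z) (at t) \<and> z \<le> 0" by blast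
      qed
      then have "E x \<le> E y * exp (- k * y) / exp (- k * x)" by (simp add: pos_le_divide_eq)
      also have "\<dots> = exp (- k * y - (- k * x)) * E y" by (simp only: exp_diff) simp
      also have "\<dots> \<le> exp (2 * k) * E y"
      proof (rule mult_right_mono)
        have "k * (x - y) \<le> k * 2" using k0 x y s by (intro mult_left_mono) auto
        then show "exp (- k * y - (- k * x)) \<le> exp (2 * k)" by (simp add: algebra_simps)
        show "0 \<le> E y" using E0 y s by auto
      qed
      finally show ?thesis .
    qed
    have Epoly: "E = poly (smult (lam n) (OP n * OP n) + pderiv (OP n) * (S * pderiv (OP n)))"
      by (rule ext) (simp add: E_def P_def P1_def S power2_eq_square algebra_simps)
    have iE: "integrable mu E" unfolding Epoly by (rule integrable_poly)
    have intE: "(\<integral>y. E y \<partial>mu) = 2 * lam n"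
    proof -
      have Eeq: "E y = lam n * (poly (OP n) y * poly (OP n) y) + poly (pderiv (OP n)) y * poly (S * pderiv (OP n)) y" for y
        by (simp add: E_def P_def P1_def S power2_eq_square algebra_simps)
      have "(\<integral>y. E y \<partial>mu) = lam n * ip (OP n) (OP n) + ip (pderiv (OP n)) (S * pderiv (OP n))"
        unfolding Eeq ip_def
        by (subst Bochner_Integration.integral_add)
          (auto intro!: integrable_mult_right integrable_poly_mult simp del: poly_mult)
      then show ?thesis by (simp add: ip_OP lam_def)
    qed
    \<comment> \<open>A Markov-type bound: a lower bound on \<open>{-s..s}\<close> alone passes to
      the integral at the cost of the positive mass \<open>m\<close> of this interval.\<close>
    have mass: "c * m \<le> (\<integral>y. F y \<partial>mu)"
      if "integrable mu F" "\<And>y. y \<in> {-s..s} \<Longrightarrow> c \<le> F y" "\<And>y. y \<in> {-1..1} \<Longrightarrow> 0 \<le> F y" for c F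
    proof -
      have "c * m = (\<integral>y. indicat_real {-s..s} y * c \<partial>mu)" by (simp add: m_def sets_mu)
      also have "\<dots> \<le> (\<integral>y. F y \<partial>mu)"
      proof (rule integral_mono_AE)
        show "AE y in mu. indicat_real {-s..s} y * c \<le> F y"
          using supp_mu by eventually_elim (use that in \<open>auto simp: indicator_def\<close>)
      qed (use that in \<open>auto simp: sets_mu emeasure_eq_measure\<close>)
      finally show ?thesis .
    qed
    have Em: "E x * m \<le> exp (2 * k) * (2 * lam n)" if x: "x \<in> {-s..s}" for x
    proof -
      have "(E x / exp (2 * k)) * m \<le> (\<integral>y. E y \<partial>mu)"
        by (rule mass[OF iE]) (use comp[OF x] E0 in \<open>auto simp: pos_divide_le_eq mult.commute\<close>)
      then show ?thesis by (simp add: intE field_simps)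
    qed
    show ?thesis
    proof (cases "lam n = 0")
      case False
      then have l: "0 < lam n" using l0 by simp
      have "lam n * (P x)\<^sup>2 * m \<le> E x * m"
        using m x s sq1[OF x] s2 by (intro mult_right_mono) (auto simp: E_def intro!: mult_nonneg_nonneg)
      also note Em[OF x]
      finally have "(P x)\<^sup>2 * m \<le> 2 * exp (2 * k)" using l by (simp add: field_simps)
      then show ?thesis using m by (simp add: P_def field_simps)
    next
      \<comment> \<open>With \<open>lam n = 0\<close> the energy no longer controls
        \<open>P\<close>. The derivative then vanishes on an interval, so \<open>OP n\<close> is
        constant and bounded through its norm.\<close>
      case True
      have "P1 t = 0" if t: "t \<in> {-s..s}" for t
      proof -
        have "E t * m \<le> 0" using Em[OF t] True by simp
        then have "E t \<le> 0" using m by (simp add: mult_le_0_iff)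
        then have "(1 - t\<^sup>2) * (P1 t)\<^sup>2 \<le> 0" by (simp add: E_def True)
        then show ?thesis using sq1[OF t] s2 by (simp add: mult_le_0_iff)
      qed
      then have "{-s..s} \<subseteq> {t. poly (pderiv (OP n)) t = 0}" by (auto simp: P1_def)
      moreover have "infinite {-s..s}" using s by (simp add: infinite_Icc_iff)
      ultimately have "pderiv (OP n) = 0" using poly_roots_finite finite_subset by blast
      then obtain c where c: "OP n = [:c:]" using pderiv_iszero by blast
      have "c\<^sup>2 * m \<le> (\<integral>y. poly (OP n) y * poly (OP n) y \<partial>mu)"
        by (rule mass[OF integrable_poly_mult]) (auto simp: c power2_eq_square)
      also have "\<dots> = 1" using ip_OP[of n n] by (simp add: ip_def)
      finally have "(P x)\<^sup>2 * m \<le> 1" by (simp add: P_def c)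
      also have "\<dots> \<le> 2 * exp (2 * k) + 1" by simp
      finally show ?thesis using m by (simp add: P_def field_simps)
    qed
  qed
  then show ?thesis by blast
qed

lemma h_lipschitz: "\<exists>L\<ge>0. \<forall>x\<in>{-1..1}. \<forall>y\<in>{-1..1}. \<bar>h x - h y\<bar> \<le> L * \<bar>x - y\<bar>"
proof -
  obtain L where L: "\<forall>x\<in>{-1..1}. norm (h' x) \<le> L" using bounded_on_unit[OF h'_cont] by blast
  have L0: "0 \<le> L" using L[rule_format, of 0] norm_ge_zero[of "h' 0"] by auto
  have le: "\<bar>h x - h y\<bar> \<le> L * \<bar>x - y\<bar>" if "x < y" "-1 \<le> x" "y \<le> 1" for x y
  proof -
    have df: "h differentiable (at z)" if "x < z" "z < y" for z
      using h_deriv[of z] that \<open>-1 \<le> x\<close> \<open>y \<le> 1\<close> unfolding real_differentiable_def by auto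
    have "\<exists>l z. x < z \<and> z < y \<and> (h has_real_derivative l) (at z) \<and> h y - h x = (y - x) * l"
      by (rule MVT) (use that df in \<open>auto intro!: continuous_on_subset[OF h_cont]\<close>)
    then obtain l z where z: "x < z" "z < y" "(h has_real_derivative l) (at z)" "h y - h x = (y - x) * l" by blast
    have "l = h' z" using z h_deriv[of z] that by (intro DERIV_unique[OF z(3)]) auto
    then have "\<bar>l\<bar> \<le> L" using L z that by auto
    then have "\<bar>y - x\<bar> * \<bar>l\<bar> \<le> \<bar>y - x\<bar> * L" by (intro mult_left_mono) auto
    then show ?thesis using z(4) by (metis abs_minus_commute abs_mult mult.commute)
  qed
  have "\<bar>h x - h y\<bar> \<le> L * \<bar>x - y\<bar>" if "x \<in> {-1..1}" "y \<in> {-1..1}" for x y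
    using le[of x y] le[of y x] that by (cases x y rule: linorder_cases) (auto simp: abs_minus_commute)
  with L0 show ?thesis by blast
qed

text \<open>Korous' argument: reproduce \<open>OP n\<close> by the kernel for \<open>h = 1\<close>. In \<open>h x * OP n x\<close> the part with
  \<open>h y\<close> under the integral reduces to one term by orthogonality, and in the part with \<open>h x - h y\<close> the
  Lipschitz bound cancels the denominator \<open>x - y\<close> of the Christoffel--Darboux formula.\<close>

lemma bulk_bound:
  assumes s: "0 < s" "s < 1"
  shows "\<exists>C\<ge>0. \<forall>n. \<forall>x\<in>{-s..s}. \<bar>poly (OP n) x\<bar> \<le> C"
proof -
  \<comment> \<open>The pure Jacobi weight with the same exponents, for which the differential
    equation gives the bound.\<close>
  interpret J: jacobi_weight "\<lambda>_. 1" "\<lambda>_. 0" g1 g2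
    by standard (use g1 g2 in \<open>auto intro!: derivative_eq_intros exI[of _ 0]\<close>)
  obtain C0 where C0: "\<And>n x. x \<in> {-s..s} \<Longrightarrow> (poly (J.OP n) x)\<^sup>2 \<le> C0"
    using J.jacobi_bulk_bound[OF _ _ s] by blast
  define C1 where "C1 = sqrt C0"
  have C1: "\<bar>poly (J.OP n) x\<bar> \<le> C1" if "x \<in> {-s..s}" for n x
    using real_sqrt_le_mono[OF C0[OF that, of n]] by (simp add: C1_def)
  obtain lo hi where lh: "0 < lo" "\<And>x. x \<in> {-1..1} \<Longrightarrow> lo \<le> h x" "\<And>x. x \<in> {-1..1} \<Longrightarrow> h x \<le> hi"
    using h_bounds by blast
  obtain Lh where Lh: "0 \<le> Lh" "\<And>x y. x \<in> {-1..1} \<Longrightarrow> y \<in> {-1..1} \<Longrightarrow> \<bar>h x - h y\<bar> \<le> Lh * \<bar>x - y\<bar>"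
    using h_lipschitz by blast
  have int_h: "integral\<^sup>L mu f = (\<integral>x. h x * f x \<partial>J.mu)" if [measurable]: "f \<in> borel_measurable borel" for f :: "real \<Rightarrow> real"
  proof -
    have "wt x * f x = J.wt x * (h x * f x)" for x by (simp add: wt_def J.wt_def)
    then show ?thesis
      by (simp only: integral_mu[OF that] J.integral_mu[OF borel_measurable_times[OF measurable_h that]] real_scaleR_def)
  qed
  have hb: "\<bar>h x\<bar> \<le> hi" if "x \<in> {-1..1}" for x using lh(3)[OF that] h_pos[of x] by simp
  have ihP: "integrable J.mu (\<lambda>x. h x * poly p x)" for p
    by (rule J.integrable_bounded_poly[OF measurable_h hb])
  \<comment> \<open>Half the sum of the squared norms for the Jacobi measure, 1 for \<open>Q\<close>
    and at most \<open>1 / lo\<close> for \<open>P\<close>; \<open>K\<close> is the analogue with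
    \<open>h\<close> inserted, where \<open>P\<close> has norm 1 and the square of \<open>Q\<close>
    integrates to at most \<open>hi\<close>.\<close>
  define D where "D = (1 + 1 / lo) / 2"
  define K where "K = (1 + hi) / 2"
  define P where "P n = poly (OP n)" for n
  define Q where "Q n = poly (J.OP n)" for n
  have Qm [measurable]: "Q n \<in> borel_measurable borel" and Pm [measurable]: "P n \<in> borel_measurable borel" for n
    unfolding Q_def P_def by (rule borel_measurable_poly)+
  have iQP: "integrable J.mu (\<lambda>y. Q j y * P n y)" and iQQ: "integrable J.mu (\<lambda>y. Q j y * Q l y)"
    and iPP: "integrable J.mu (\<lambda>y. P j y * P n y)" for j l n
    unfolding Q_def P_def by (rule J.integrable_poly_mult)+
  have PP: "(\<integral>y. P n y * P n y \<partial>J.mu) \<le> 1 / lo" for n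
  proof -
    have "lo * (\<integral>y. P n y * P n y \<partial>J.mu) = (\<integral>y. lo * (P n y * P n y) \<partial>J.mu)" by simp
    also have "\<dots> \<le> (\<integral>y. h y * (P n y * P n y) \<partial>J.mu)"
    proof (rule integral_mono_AE)
      show "integrable J.mu (\<lambda>y. h y * (P n y * P n y))" using ihP[of "OP n * OP n"] by (simp add: P_def)
      show "AE y in J.mu. lo * (P n y * P n y) \<le> h y * (P n y * P n y)"
        using J.supp_mu by eventually_elim (use lh in \<open>auto intro!: mult_right_mono\<close>)
    qed (intro integrable_mult_right iPP)
    also have "\<dots> = ip (OP n) (OP n)" unfolding ip_def by (subst int_h) (simp_all add: P_def)
    finally show ?thesis using lh(1) by (simp add: ip_OP field_simps)
  qed
  have QQ: "(\<integral>y. Q n y * Q n y \<partial>J.mu) = 1" for n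
    using J.ip_OP[of n n] by (simp add: J.ip_def Q_def)
  have QP: "(\<integral>y. \<bar>Q j y * P n y\<bar> \<partial>J.mu) \<le> D" for j n
  proof -
    have "(\<integral>y. \<bar>Q j y * P n y\<bar> \<partial>J.mu) \<le> (\<integral>y. (Q j y * Q j y + P n y * P n y) / 2 \<partial>J.mu)"
    proof (rule integral_mono)
      fix y show "\<bar>Q j y * P n y\<bar> \<le> (Q j y * Q j y + P n y * P n y) / 2"
        using sum_squares_bound[of "\<bar>Q j y\<bar>" "\<bar>P n y\<bar>"] by (simp add: abs_mult power2_eq_square)
    qed (intro integrable_abs integrable_divide Bochner_Integration.integrable_add iQP iQQ iPP)+
    also have "\<dots> = (1 + (\<integral>y. P n y * P n y \<partial>J.mu)) / 2" using iQQ iPP by (simp add: QQ)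
    also have "\<dots> \<le> D" unfolding D_def using PP[of n] by simp
    finally show ?thesis .
  qed
  have hQP: "\<bar>\<integral>y. h y * (Q n y * P n y) \<partial>J.mu\<bar> \<le> K" for n
  proof -
    have ih2: "integrable J.mu (\<lambda>y. h y * (Q n y * P n y))" "integrable J.mu (\<lambda>y. h y * (P n y * P n y))"
      using ihP[of "J.OP n * OP n"] ihP[of "OP n * OP n"] by (simp_all add: P_def Q_def)
    have "\<bar>\<integral>y. h y * (Q n y * P n y) \<partial>J.mu\<bar> \<le> (\<integral>y. \<bar>h y * (Q n y * P n y)\<bar> \<partial>J.mu)"
      by (rule integral_abs_bound)
    also have "\<dots> \<le> (\<integral>y. (h y * (P n y * P n y) + hi * (Q n y * Q n y)) / 2 \<partial>J.mu)"
    proof (rule integral_mono_AE)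
      show "AE y in J.mu. \<bar>h y * (Q n y * P n y)\<bar> \<le> (h y * (P n y * P n y) + hi * (Q n y * Q n y)) / 2"
        using J.supp_mu
      proof eventually_elim
        case (elim y)
        have "\<bar>h y * (Q n y * P n y)\<bar> = h y * (\<bar>Q n y\<bar> * \<bar>P n y\<bar>)" using h_pos[of y] by (simp add: abs_mult)
        also have "\<dots> \<le> h y * ((Q n y * Q n y + P n y * P n y) / 2)"
          using h_pos[of y] sum_squares_bound[of "\<bar>Q n y\<bar>" "\<bar>P n y\<bar>"]
          by (intro mult_left_mono) (auto simp: power2_eq_square)
        also have "\<dots> \<le> (h y * (P n y * P n y) + hi * (Q n y * Q n y)) / 2"
          using mult_right_mono[OF lh(3)[OF elim], of "Q n y * Q n y"] by (simp add: algebra_simps)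
        finally show ?case .
      qed
    qed (intro integrable_abs integrable_divide Bochner_Integration.integrable_add integrable_mult_right ih2 iQQ)+
    also have "\<dots> = ((\<integral>y. h y * (P n y * P n y) \<partial>J.mu) + hi) / 2" using ih2 iQQ by (simp add: QQ)
    also have "(\<integral>y. h y * (P n y * P n y) \<partial>J.mu) = ip (OP n) (OP n)"
      unfolding ip_def by (subst int_h) (simp_all add: P_def)
    finally show ?thesis by (simp add: ip_OP K_def)
  qed
  have main: "h x * \<bar>P n x\<bar> \<le> 2 * Lh * C1 * D + C1 * K" if x: "x \<in> {-s..s}" for n x
  proof -
    \<comment> \<open>\<open>Suc n\<close> terms are needed, since the kernel has to reproduce
      \<open>OP n\<close>, a polynomial of degree \<open>n\<close>.\<close>
    define ker where "ker y = J.CDker (Suc n) x y" for y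
    have x1: "x \<in> {-1..1}" using x s by auto
    have C10: "0 \<le> C1" using C1[OF x, of 0] by linarith
    have kp: "ker y = poly (\<Sum>k<Suc n. smult (Q k x) (J.OP k)) y" for y
      by (simp add: ker_def J.CDker_def Q_def poly_sum)
    have iker: "integrable J.mu (\<lambda>y. ker y * P n y)"
      unfolding kp P_def by (rule J.integrable_poly_mult)
    have ihker: "integrable J.mu (\<lambda>y. h y * (ker y * P n y))"
      using ihP[of "(\<Sum>k<Suc n. smult (Q k x) (J.OP k)) * OP n"] by (simp only: kp P_def poly_mult)
    have rep: "P n x = (\<integral>y. ker y * P n y \<partial>J.mu)"
    proof -
      have "OP n = (\<Sum>j\<le>n. smult (J.ip (OP n) (J.OP j)) (J.OP j))"
        by (rule J.OP_expansion) simp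
      then have "P n x = (\<Sum>j\<le>n. J.ip (OP n) (J.OP j) * Q j x)"
        unfolding P_def Q_def by (metis (no_types, lifting) poly_smult poly_sum sum.cong)
      also have "\<dots> = (\<Sum>k<Suc n. Q k x * (\<integral>y. Q k y * P n y \<partial>J.mu))"
        unfolding lessThan_Suc_atMost by (intro sum.cong) (auto simp: J.ip_def P_def Q_def mult.commute)
      also have "\<dots> = (\<integral>y. (\<Sum>k<Suc n. Q k x * (Q k y * P n y)) \<partial>J.mu)"
        by (subst Bochner_Integration.integral_sum) (auto intro!: integrable_mult_right iQP)
      also have "\<dots> = (\<integral>y. ker y * P n y \<partial>J.mu)"
        by (simp only: ker_def J.CDker_def Q_def sum_distrib_right mult.assoc)
      finally show ?thesis .
    qed
    have repn: "(\<integral>y. h y * (ker y * P n y) \<partial>J.mu) = Q n x * (\<integral>y. h y * (Q n y * P n y) \<partial>J.mu)"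
    proof -
      have ih: "integrable J.mu (\<lambda>y. h y * (Q k y * P n y))" for k
        using ihP[of "J.OP k * OP n"] by (simp add: P_def Q_def)
      have z: "(\<integral>y. h y * (Q k y * P n y) \<partial>J.mu) = 0" if "k < n" for k
      proof -
        have "(\<integral>y. h y * (Q k y * P n y) \<partial>J.mu) = ip (J.OP k) (OP n)"
          unfolding ip_def by (subst int_h) (simp_all add: P_def Q_def)
        also have "\<dots> = 0" using that by (intro ip_OP_eq_0) simp
        finally show ?thesis .
      qed
      have "(\<integral>y. h y * (ker y * P n y) \<partial>J.mu) = (\<integral>y. (\<Sum>k<Suc n. Q k x * (h y * (Q k y * P n y))) \<partial>J.mu)"
        by (simp only: ker_def J.CDker_def Q_def sum_distrib_right sum_distrib_left mult.assoc mult.left_commute)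
      also have "\<dots> = (\<Sum>k<Suc n. Q k x * (\<integral>y. h y * (Q k y * P n y) \<partial>J.mu))"
        by (subst Bochner_Integration.integral_sum) (auto intro!: integrable_mult_right ih)
      also have "\<dots> = Q n x * (\<integral>y. h y * (Q n y * P n y) \<partial>J.mu)"
        using z by simp
      finally show ?thesis .
    qed
    define T where "T = (\<integral>y. (h x - h y) * (ker y * P n y) \<partial>J.mu)"
    have "h x * P n x = T + Q n x * (\<integral>y. h y * (Q n y * P n y) \<partial>J.mu)"
    proof -
      have "T = h x * (\<integral>y. ker y * P n y \<partial>J.mu) - (\<integral>y. h y * (ker y * P n y) \<partial>J.mu)"
        unfolding T_def left_diff_distrib
        by (subst Bochner_Integration.integral_diff) (auto intro!: iker ihker)
      then show ?thesis using rep repn by simp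
    qed
    moreover have "\<bar>T\<bar> \<le> 2 * Lh * C1 * D"
    proof -
      have "\<bar>T\<bar> \<le> (\<integral>y. \<bar>(h x - h y) * (ker y * P n y)\<bar> \<partial>J.mu)"
        unfolding T_def by (rule integral_abs_bound)
      also have "\<dots> \<le> (\<integral>y. Lh * C1 * (\<bar>Q n y * P n y\<bar> + \<bar>Q (Suc n) y * P n y\<bar>) \<partial>J.mu)"
      proof (rule integral_mono_AE)
        have "integrable J.mu (\<lambda>y. h x * (ker y * P n y) - h y * (ker y * P n y))"
          by (intro Bochner_Integration.integrable_diff integrable_mult_right iker ihker)
        then show "integrable J.mu (\<lambda>y. \<bar>(h x - h y) * (ker y * P n y)\<bar>)"
          unfolding left_diff_distrib by (rule integrable_abs)
        show "AE y in J.mu. \<bar>(h x - h y) * (ker y * P n y)\<bar> \<le> Lh * C1 * (\<bar>Q n y * P n y\<bar> + \<bar>Q (Suc n) y * P n y\<bar>)"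
          using J.supp_mu
        proof eventually_elim
          case (elim y)
          have cd: "(x - y) * ker y = J.ofd (Suc n) * (Q (Suc n) x * Q n y - Q n x * Q (Suc n) y)"
            unfolding ker_def Q_def using J.Christoffel_Darboux[of "Suc n" x y] by simp
          have "\<bar>(h x - h y) * (ker y * P n y)\<bar> \<le> Lh * \<bar>x - y\<bar> * \<bar>ker y * P n y\<bar>"
            unfolding abs_mult[of "h x - h y"] using Lh(2)[OF x1 elim] by (intro mult_right_mono) auto
          also have "\<dots> = Lh * (\<bar>(x - y) * ker y\<bar> * \<bar>P n y\<bar>)" by (simp add: abs_mult)
          also have "\<dots> \<le> Lh * ((C1 * \<bar>Q n y\<bar> + C1 * \<bar>Q (Suc n) y\<bar>) * \<bar>P n y\<bar>)"
          proof (intro mult_left_mono mult_right_mono Lh abs_ge_zero)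
            have "\<bar>(x - y) * ker y\<bar> \<le> 1 * \<bar>Q (Suc n) x * Q n y - Q n x * Q (Suc n) y\<bar>"
              unfolding cd abs_mult using J.ofd_bound by (intro mult_right_mono) auto
            also have "\<dots> \<le> \<bar>Q (Suc n) x\<bar> * \<bar>Q n y\<bar> + \<bar>Q n x\<bar> * \<bar>Q (Suc n) y\<bar>"
              using abs_triangle_ineq4[of "Q (Suc n) x * Q n y" "Q n x * Q (Suc n) y"] by (simp add: abs_mult)
            also have "\<dots> \<le> C1 * \<bar>Q n y\<bar> + C1 * \<bar>Q (Suc n) y\<bar>"
              using C1[OF x] unfolding Q_def by (intro add_mono mult_right_mono) auto
            finally show "\<bar>(x - y) * ker y\<bar> \<le> C1 * \<bar>Q n y\<bar> + C1 * \<bar>Q (Suc n) y\<bar>" .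
          qed
          also have "\<dots> = Lh * C1 * (\<bar>Q n y * P n y\<bar> + \<bar>Q (Suc n) y * P n y\<bar>)"
            by (simp add: abs_mult algebra_simps)
          finally show ?case .
        qed
      qed (intro integrable_mult_right Bochner_Integration.integrable_add integrable_abs iQP)
      also have "\<dots> = Lh * C1 * ((\<integral>y. \<bar>Q n y * P n y\<bar> \<partial>J.mu) + (\<integral>y. \<bar>Q (Suc n) y * P n y\<bar> \<partial>J.mu))"
        using iQP by simp
      also have "\<dots> \<le> Lh * C1 * (D + D)"
        using QP Lh(1) C10 by (intro mult_left_mono add_mono) auto
      finally show ?thesis by simp
    qed
    moreover have "\<bar>Q n x * (\<integral>y. h y * (Q n y * P n y) \<partial>J.mu)\<bar> \<le> C1 * K"
      unfolding abs_mult using C1[OF x, of n] hQP[of n] C10 by (intro mult_mono) (auto simp: Q_def)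
    ultimately have "\<bar>h x * P n x\<bar> \<le> 2 * Lh * C1 * D + C1 * K" by linarith
    then show ?thesis using h_pos[of x] by (simp add: abs_mult)
  qed
  define C where "C = \<bar>2 * Lh * C1 * D + C1 * K\<bar> / lo"
  have "\<bar>poly (OP n) x\<bar> \<le> C" if x: "x \<in> {-s..s}" for n x
  proof -
    have "lo * \<bar>P n x\<bar> \<le> h x * \<bar>P n x\<bar>" using lh(2)[of x] x s by (intro mult_right_mono) auto
    also have "\<dots> \<le> \<bar>2 * Lh * C1 * D + C1 * K\<bar>" using main[OF x, of n] by linarith
    finally show ?thesis using lh(1) by (simp add: C_def P_def field_simps)
  qed
  moreover have "0 \<le> C" using lh(1) by (simp add: C_def)
  ultimately show ?thesis by blast
qed

lemma wt_bounded_inside: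
  assumes s: "0 < s" "s < 1"
  shows "\<exists>C. \<forall>x\<in>{-s..s}. wt x \<le> C"
proof -
  have "continuous_on {-s..s} (\<lambda>x. h x * (1 - x) powr g1 * (1 + x) powr g2)"
    using s by (intro continuous_intros continuous_on_subset[OF h_cont]) auto
  then have "bounded ((\<lambda>x. h x * (1 - x) powr g1 * (1 + x) powr g2) ` {-s..s})"
    by (intro compact_imp_bounded compact_continuous_image) auto
  then obtain C where C: "\<forall>y\<in>(\<lambda>x. h x * (1 - x) powr g1 * (1 + x) powr g2) ` {-s..s}. norm y \<le> C"
    unfolding bounded_iff by blast
  have "wt x \<le> C" if "x \<in> {-s..s}" for x
    using C[rule_format, OF imageI[OF that]] that s by (simp add: wt_def abs_le_iff)
  then show ?thesis by blast
qed

text \<open>Its square is a Lorentzian of height one and width \<open>1 / N\<close> around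
  \<open>x0\<close>.\<close>

definition win :: "real \<Rightarrow> real \<Rightarrow> real \<Rightarrow> real" where
  "win N x0 x = 1 / sqrt (1 + (N * (x - x0))\<^sup>2)"

lemma win_pos: "0 < win N x0 x" and win_le_1: "win N x0 x \<le> 1"
proof -
  have "0 < 1 + (N * (x - x0))\<^sup>2" by (simp add: add_pos_nonneg)
  then show "0 < win N x0 x" by (simp add: win_def)
  have "1 \<le> sqrt (1 + (N * (x - x0))\<^sup>2)" by simp
  then have "1 / sqrt (1 + (N * (x - x0))\<^sup>2) \<le> 1 / 1" by (intro frac_le) auto
  then show "win N x0 x \<le> 1" by (simp add: win_def)
qed

lemma win_sq: "(win N x0 x)\<^sup>2 = 1 / (1 + (N * (x - x0))\<^sup>2)"
proof -
  have "0 \<le> 1 + (N * (x - x0))\<^sup>2" by simp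
  then show ?thesis by (simp add: win_def power_divide)
qed

lemma measurable_win [measurable]: "win N x0 \<in> borel_measurable borel"
  unfolding win_def[abs_def] by measurable

lemma bdd_fn_win: "bdd_fn (win N x0)"
  unfolding bdd_fn_def using win_pos win_le_1
  by (intro conjI measurable_win exI[of _ 1]) (auto simp: abs_of_pos)

text \<open>Near \<open>x0\<close> the polynomial and the weight are bounded and the Lorentzian
  integrates to at most \<open>pi / N\<close>; at a fixed distance the Lorentzian is at most a
  multiple of \<open>1 / N\<^sup>2\<close>, and there the norm one of \<open>OP n\<close>
  suffices.\<close>

lemma gm_win_bound:
  assumes x0: "x0 \<in> {-1<..<1}"
  shows "\<exists>C\<ge>0. \<forall>N\<ge>1. \<forall>n. gm (\<lambda>x. (win N x0 x)\<^sup>2) n n \<le> C / N"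
proof -
  \<comment> \<open>Halfway between \<open>\<bar>x0\<bar>\<close> and 1: the interval
    \<open>{-s..s}\<close> avoids the edges and still contains a neighbourhood of \<open>x0\<close>
    of radius \<open>\<delta>\<close>.\<close>
  define s where "s = (1 + \<bar>x0\<bar>) / 2"
  have s: "0 < s" "s < 1" "\<bar>x0\<bar> < s" using x0 by (auto simp: s_def field_simps abs_if)
  define \<delta> where "\<delta> = s - \<bar>x0\<bar>"
  have d: "0 < \<delta>" using s by (simp add: \<delta>_def)
  obtain C where C: "0 \<le> C" "\<And>n x. x \<in> {-s..s} \<Longrightarrow> \<bar>poly (OP n) x\<bar> \<le> C" using bulk_bound[OF s(1,2)] by blast
  obtain V where V: "\<And>x. x \<in> {-s..s} \<Longrightarrow> wt x \<le> V" using wt_bounded_inside[OF s(1,2)] by blast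
  have V0: "0 \<le> V" using V[of 0] wt_nonneg[of 0] s by auto
  have "gm (\<lambda>x. (win N x0 x)\<^sup>2) n n \<le> (C\<^sup>2 * V * pi + 1 / \<delta>\<^sup>2) / N" if N: "N \<ge> 1" for N n
  proof -
    let ?I = "\<lambda>x. indicat_real {-s..s} x * (win N x0 x)\<^sup>2"
    have iI: "integrable mu ?I"
      by (rule integrable_bounded_on[where C = 1]) (use win_le_1 win_pos in \<open>auto simp: indicator_def abs_square_le_1 abs_of_pos\<close>)
    have int_win: "has_bochner_integral lborel (\<lambda>x. (win N x0 x)\<^sup>2 * indicator {-s..s} x)
        (arctan (N * (s - x0)) / N - arctan (N * (- s - x0)) / N)"
    proof (rule has_bochner_integral_FTC_Icc_real)
      fix x
      have p: "0 < 1 + (N * (x - x0))\<^sup>2" by (simp add: add_pos_nonneg)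
      have "((\<lambda>x. arctan (N * (x - x0)) / N) has_real_derivative (inverse (1 + (N * (x - x0))\<^sup>2) * (N * 1)) / N) (at x)"
        by (auto intro!: derivative_eq_intros)
      then show "((\<lambda>x. arctan (N * (x - x0)) / N) has_real_derivative (win N x0 x)\<^sup>2) (at x)"
        unfolding win_sq by (rule DERIV_cong) (use N in \<open>simp add: inverse_eq_divide\<close>)
      show "isCont (\<lambda>x. (win N x0 x)\<^sup>2) x"
        unfolding win_sq using p by (intro continuous_intros) auto
    qed (use s in auto)
    have I1: "(\<integral>x. ?I x \<partial>mu) \<le> V * pi / N"
    proof -
      have "(\<integral>x. ?I x \<partial>mu) = (\<integral>x. wt x * ?I x \<partial>lborel)"
        by (subst integral_mu) auto
      also have "\<dots> \<le> (\<integral>x. V * ((win N x0 x)\<^sup>2 * indicator {-s..s} x) \<partial>lborel)"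
      proof (rule integral_mono)
        show "integrable lborel (\<lambda>x. wt x * ?I x)" using iI integrable_mu[of ?I] by simp
        show "integrable lborel (\<lambda>x. V * ((win N x0 x)\<^sup>2 * indicator {-s..s} x))"
          using int_win by (intro integrable_mult_right) (simp add: has_bochner_integral_iff)
        show "wt x * ?I x \<le> V * ((win N x0 x)\<^sup>2 * indicator {-s..s} x)" for x
          using V[of x] by (auto simp: indicator_def intro!: mult_right_mono)
      qed
      also have "\<dots> = V * ((arctan (N * (s - x0)) - arctan (N * (- s - x0))) / N)"
        using int_win by (simp add: has_bochner_integral_iff diff_divide_distrib)
      also have "\<dots> \<le> V * (pi / N)"
        using V0 N arctan_bounded[of "N * (s - x0)"] arctan_bounded[of "N * (- s - x0)"]
        by (intro mult_left_mono divide_right_mono) auto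
      finally show ?thesis by simp
    qed
    have "gm (\<lambda>x. (win N x0 x)\<^sup>2) n n \<le>
       (\<integral>x. C\<^sup>2 * ?I x + 1 / (N * \<delta>)\<^sup>2 * (poly (OP n) x * poly (OP n) x) \<partial>mu)"
      unfolding gm_def
    proof (rule integral_mono_AE)
      have "bdd_fn (\<lambda>x. (win N x0 x)\<^sup>2)"
        unfolding power2_eq_square by (intro bdd_fn_mult bdd_fn_win)
      then show "integrable mu (\<lambda>x. (win N x0 x)\<^sup>2 * (poly (OP n) x * poly (OP n) x))"
        by (rule bdd_fn_gm_integrable)
      show "AE x in mu. (win N x0 x)\<^sup>2 * (poly (OP n) x * poly (OP n) x) \<le>
          C\<^sup>2 * ?I x + 1 / (N * \<delta>)\<^sup>2 * (poly (OP n) x * poly (OP n) x)"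
      proof (rule AE_I2)
        fix x
        show "(win N x0 x)\<^sup>2 * (poly (OP n) x * poly (OP n) x) \<le>
          C\<^sup>2 * ?I x + 1 / (N * \<delta>)\<^sup>2 * (poly (OP n) x * poly (OP n) x)"
        proof (cases "x \<in> {-s..s}")
          case True
          have "poly (OP n) x * poly (OP n) x \<le> C\<^sup>2"
            using power_mono[OF C(2)[OF True, of n] abs_ge_zero, where n = 2] by (simp add: power2_eq_square)
          then have "(win N x0 x)\<^sup>2 * (poly (OP n) x * poly (OP n) x) \<le> (win N x0 x)\<^sup>2 * C\<^sup>2"
            by (intro mult_left_mono) auto
          then show ?thesis using True by (intro add_increasing2) (auto simp: mult.commute)
        next
          case False
          then have "\<delta> \<le> \<bar>x - x0\<bar>" unfolding \<delta>_def by auto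
          then have "N * \<delta> \<le> \<bar>N * (x - x0)\<bar>" unfolding abs_mult using N d by (intro mult_mono) auto
          then have "(N * \<delta>)\<^sup>2 \<le> \<bar>N * (x - x0)\<bar>\<^sup>2" using N d by (intro power_mono) auto
          then have "(N * \<delta>)\<^sup>2 \<le> 1 + (N * (x - x0))\<^sup>2" by simp
          then have "(win N x0 x)\<^sup>2 \<le> 1 / (N * \<delta>)\<^sup>2"
            unfolding win_sq using N d by (intro divide_left_mono) (auto intro!: mult_pos_pos add_pos_nonneg)
          then have "(win N x0 x)\<^sup>2 * (poly (OP n) x * poly (OP n) x) \<le> 1 / (N * \<delta>)\<^sup>2 * (poly (OP n) x * poly (OP n) x)"
            by (rule mult_right_mono) simp
          then show ?thesis using False by simp
        qed
      qed
    qed (intro Bochner_Integration.integrable_add integrable_mult_right iI integrable_poly_mult)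
    also have "\<dots> = C\<^sup>2 * (\<integral>x. ?I x \<partial>mu) + 1 / (N * \<delta>)\<^sup>2 * ip (OP n) (OP n)"
      unfolding ip_def using iI integrable_poly_mult by (simp del: integral_indicator)
    also have "\<dots> \<le> C\<^sup>2 * (V * pi / N) + 1 / (N * \<delta>)\<^sup>2"
      using I1 by (intro add_mono mult_left_mono) (auto simp: ip_OP)
    also have "1 / (N * \<delta>)\<^sup>2 \<le> (1 / \<delta>\<^sup>2) / N"
    proof -
      have "N * \<delta>\<^sup>2 \<le> (N * \<delta>)\<^sup>2" using N mult_right_mono[of 1 N "N * \<delta>\<^sup>2"] by (simp add: power2_eq_square algebra_simps)
      then have "1 / (N * \<delta>)\<^sup>2 \<le> 1 / (N * \<delta>\<^sup>2)" using N d by (intro divide_left_mono) auto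
      then show ?thesis by (simp add: mult.commute)
    qed
    finally show ?thesis by (simp add: add_divide_distrib mult.assoc)
  qed
  moreover have "0 \<le> C\<^sup>2 * V * pi + 1 / \<delta>\<^sup>2" using V0 by simp
  ultimately show ?thesis by blast
qed

text \<open>The hypothesis on \<open>g\<close> is a Lipschitz bound for the chordal metric in \<open>N * (x - x0)\<close>.\<close>

lemma mesoscopic_variance:
  assumes x0: "x0 \<in> {-1<..<1}"
  shows "\<exists>C\<ge>0. \<forall>N\<ge>1. \<forall>n. \<forall>g M. bdd_fn g \<longrightarrow>
     (\<forall>x\<in>{-1..1}. \<forall>y\<in>{-1..1}. \<bar>g x - g y\<bar> \<le> M * (N * \<bar>x - y\<bar> * (win N x0 x * win N x0 y))) \<longrightarrow>
     integral\<^sup>L (OPE mu n) (\<lambda>x. ((\<Sum>j<n. g (x j)) - integral\<^sup>L (OPE mu n) (\<lambda>x. \<Sum>j<n. g (x j)))\<^sup>2) \<le> C * M\<^sup>2"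
proof -
  obtain C where C: "0 \<le> C" "\<And>N n. N \<ge> 1 \<Longrightarrow> gm (\<lambda>x. (win N x0 x)\<^sup>2) n n \<le> C / N"
    using gm_win_bound[OF x0] by blast
  have "integral\<^sup>L (OPE mu n) (\<lambda>x. ((\<Sum>j<n. g (x j)) - integral\<^sup>L (OPE mu n) (\<lambda>x. \<Sum>j<n. g (x j)))\<^sup>2) \<le> 2 * C\<^sup>2 * M\<^sup>2"
    if N: "N \<ge> 1" and g: "bdd_fn g"
      and lip: "\<forall>x\<in>{-1..1}. \<forall>y\<in>{-1..1}. \<bar>g x - g y\<bar> \<le> M * (N * \<bar>x - y\<bar> * (win N x0 x * win N x0 y))" for N n g M
  proof (cases "n = 0")
    case True
    interpret prob_space "OPE mu n" by (rule prob_space_OPE)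
    show ?thesis using True C by simp
  next
    case False
    have gm0: "0 \<le> gm (\<lambda>x. (win N x0 x)\<^sup>2) k k" for k
      unfolding gm_def by (intro Bochner_Integration.integral_nonneg) simp
    have "integral\<^sup>L (OPE mu n) (\<lambda>x. ((\<Sum>j<n. g (x j)) - integral\<^sup>L (OPE mu n) (\<lambda>x. \<Sum>j<n. g (x j)))\<^sup>2) \<le>
        2 * (M * N)\<^sup>2 * (gm (\<lambda>x. (win N x0 x)\<^sup>2) n n * gm (\<lambda>x. (win N x0 x)\<^sup>2) (n - 1) (n - 1))"
      using False lip by (intro OPE_variance_bound g bdd_fn_win) (auto simp: mult.assoc)
    \<comment> \<open>In unscaled coordinates the Lipschitz constant is \<open>M * N\<close>; the
      two window masses, each at most \<open>C / N\<close>, remove the powers of \<open>N\<close>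
      again.\<close>
    also have "\<dots> \<le> 2 * (M * N)\<^sup>2 * (C / N * (C / N))"
      using C N gm0 by (intro mult_left_mono mult_mono) auto
    also have "\<dots> = 2 * C\<^sup>2 * M\<^sup>2" using N by (simp add: power2_eq_square field_simps)
    finally show ?thesis .
  qed
  then show ?thesis by (intro exI[of _ "2 * C\<^sup>2"]) auto
qed

end

section \<open>The loop equation\<close>

text \<open>Freezing all coordinates but one leaves a polynomial with double zeros at the other
  points; the constant \<open>A\<close> depends on those points. This is the form needed for
  integrating by parts in one coordinate.\<close>

lemma vandermonde_sq_update:
  assumes "i < n"
  shows "\<exists>A. \<forall>y. vandermonde_sq n (x(i := y)) = A * (\<Prod>j\<in>{..<n} - {i}. (y - x j)\<^sup>2)"
  using assms
proof (induction n)
  case (Suc n)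
  have S: "vandermonde_sq (Suc n) w = vandermonde_sq n w * (\<Prod>a<n. (w a - w n)\<^sup>2)" for w
    by (simp add: vandermonde_sq_def)
  show ?case
  proof (cases "i = n")
    case True
    have "vandermonde_sq n (x(n := y)) = vandermonde_sq n x" for y
      unfolding vandermonde_sq_def by (intro prod.cong refl) auto
    moreover have "(\<Prod>a<n. ((x(n := y)) a - (x(n := y)) n)\<^sup>2) = (\<Prod>j<n. (y - x j)\<^sup>2)" for y
      by (intro prod.cong refl) (auto simp: power2_commute)
    moreover have "{..<Suc n} - {n} = {..<n}" by auto
    ultimately show ?thesis unfolding S True by auto
  next
    case False
    then have i: "i < n" using Suc.prems by simp
    from Suc.IH[OF i] obtain A where A: "\<And>y. vandermonde_sq n (x(i := y)) = A * (\<Prod>j\<in>{..<n} - {i}. (y - x j)\<^sup>2)" by blast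
    have "(\<Prod>a<n. ((x(i := y)) a - (x(i := y)) n)\<^sup>2) = (y - x n)\<^sup>2 * (\<Prod>a\<in>{..<n} - {i}. (x a - x n)\<^sup>2)" for y
      using i by (subst prod.remove[of _ i]) (auto intro!: prod.cong)
    moreover have "{..<Suc n} - {i} = insert n ({..<n} - {i})" using i by auto
    ultimately have "vandermonde_sq (Suc n) (x(i := y)) =
        (A * (\<Prod>a\<in>{..<n} - {i}. (x a - x n)\<^sup>2)) * (\<Prod>j\<in>{..<Suc n} - {i}. (y - x j)\<^sup>2)" for y
      unfolding S A by simp
    then show ?thesis by blast
  qed
qed simp

text \<open>One squared difference is kept and all others are bounded by 4; the kept factor tames
  the interaction \<open>2 / (x i - x j)\<close> in the loop equation.\<close>

lemma vandermonde_sq_le: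
  assumes x: "\<And>j. j < n \<Longrightarrow> x j \<in> {-1..1}" and ij: "i < n" "j < n" "i \<noteq> j"
  shows "vandermonde_sq n x \<le> (4 ^ n) ^ n * (x i - x j)\<^sup>2"
proof -
  have f: "(x a - x b)\<^sup>2 \<le> 4" if "a < n" "b < n" for a b
  proof -
    have "\<bar>x a - x b\<bar> \<le> 2" using x[OF that(1)] x[OF that(2)] by auto
    then have "\<bar>x a - x b\<bar>\<^sup>2 \<le> 2\<^sup>2" by (intro power_mono) auto
    then show ?thesis by simp
  qed
  have *: "vandermonde_sq n x \<le> (4 ^ n) ^ n * (x a - x b)\<^sup>2" if ab: "a < b" "b < n" for a b
  proof -
    have inner: "(\<Prod>c<d. (x c - x d)\<^sup>2) \<le> 4 ^ n" if "d < n" for d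
    proof -
      have "(\<Prod>c<d. (x c - x d)\<^sup>2) \<le> (\<Prod>c<d. 4)"
        using that f by (intro prod_mono) auto
      also have "\<dots> \<le> 4 ^ n" using that by (simp add: power_increasing)
      finally show ?thesis .
    qed
    have ib: "(\<Prod>c<b. (x c - x b)\<^sup>2) \<le> (x a - x b)\<^sup>2 * 4 ^ n"
    proof -
      have "(\<Prod>c<b. (x c - x b)\<^sup>2) = (x a - x b)\<^sup>2 * (\<Prod>c\<in>{..<b} - {a}. (x c - x b)\<^sup>2)"
        using ab by (subst prod.remove[of _ a]) auto
      also have "\<dots> \<le> (x a - x b)\<^sup>2 * (\<Prod>c\<in>{..<b} - {a}. 4)"
        using ab f by (intro mult_left_mono prod_mono) auto
      also have "\<dots> \<le> (x a - x b)\<^sup>2 * 4 ^ n"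
        using ab by (intro mult_left_mono) (auto intro!: power_increasing)
      finally show ?thesis .
    qed
    have "vandermonde_sq n x = (\<Prod>c<b. (x c - x b)\<^sup>2) * (\<Prod>d\<in>{..<n} - {b}. \<Prod>c<d. (x c - x d)\<^sup>2)"
      unfolding vandermonde_sq_def using ab by (subst prod.remove[of _ b]) auto
    also have "\<dots> \<le> ((x a - x b)\<^sup>2 * 4 ^ n) * (\<Prod>d\<in>{..<n} - {b}. 4 ^ n)"
      using inner by (intro mult_mono ib prod_mono) (auto intro!: prod_nonneg)
    also have "\<dots> = (4 ^ n) ^ n * (x a - x b)\<^sup>2"
      using ab by (simp add: power_eq_if[of "4 ^ n" n])
    finally show ?thesis .
  qed
  show ?thesis
    using *[of i j] *[of j i] ij by (cases i j rule: linorder_cases) (auto simp: power2_commute)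
qed

text \<open>The logarithmic derivative of a product of squares. The formula also holds at the zeros,
  where division by zero gives 0: the zeros are double, so both sides vanish there.\<close>

lemma prod_sq_derivative:
  fixes a :: "nat \<Rightarrow> real"
  assumes "finite J"
  shows "((\<lambda>y. \<Prod>j\<in>J. (y - a j)\<^sup>2) has_real_derivative (\<Prod>j\<in>J. (y - a j)\<^sup>2) * (\<Sum>j\<in>J. 2 / (y - a j))) (at y)"
  using assms
proof (induction J)
  case (insert k J)
  let ?Q = "\<lambda>y. \<Prod>j\<in>J. (y - a j)\<^sup>2"
  have "((\<lambda>y. (y - a k)\<^sup>2 * ?Q y) has_real_derivative
      2 * (y - a k) * ?Q y + (y - a k)\<^sup>2 * (?Q y * (\<Sum>j\<in>J. 2 / (y - a j)))) (at y)"
    by (rule derivative_eq_intros insert.IH refl)+ (simp add: algebra_simps)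
  also have "2 * (y - a k) * ?Q y + (y - a k)\<^sup>2 * (?Q y * (\<Sum>j\<in>J. 2 / (y - a j))) =
      (y - a k)\<^sup>2 * ?Q y * (2 / (y - a k) + (\<Sum>j\<in>J. 2 / (y - a j)))"
    by (cases "y = a k") (auto simp: field_simps power2_eq_square)
  finally show ?case using insert.hyps by (simp add: mult.assoc)
qed simp

lemma borel_measurable_iexp:
  assumes "F \<in> borel_measurable M"
  shows "(\<lambda>x. iexp (F x)) \<in> borel_measurable M"
proof -
  have "(\<lambda>u. iexp u) \<in> borel_measurable borel"
    by (intro borel_measurable_continuous_onI continuous_intros)
  from measurable_compose[OF assms this] show ?thesis .
qed

section \<open>Resolvents at complex poles\<close>

definition rz :: "complex \<Rightarrow> real \<Rightarrow> complex" where
  "rz \<zeta> u = 1 / (\<zeta> - of_real u)"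

lemma rz_denom_nonzero: "Im \<zeta> \<noteq> 0 \<Longrightarrow> \<zeta> - of_real u \<noteq> 0"
  by (auto simp: complex_eq_iff)

lemma norm_rz_le: "Im \<zeta> \<noteq> 0 \<Longrightarrow> norm (rz \<zeta> u) \<le> 1 / \<bar>Im \<zeta>\<bar>"
proof -
  assume "Im \<zeta> \<noteq> 0"
  moreover have "\<bar>Im \<zeta>\<bar> \<le> norm (\<zeta> - of_real u)" using abs_Im_le_cmod[of "\<zeta> - of_real u"] by simp
  ultimately show ?thesis by (simp add: rz_def norm_divide frac_le)
qed

lemma rz_deriv:
  assumes "Im \<zeta> \<noteq> 0"
  shows "((\<lambda>y. rz \<zeta> (N * (y - x0))) has_vector_derivative of_real N * (rz \<zeta> (N * (y - x0)))\<^sup>2) (at y)"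
proof -
  have "((\<lambda>w. 1 / (\<zeta> - of_real N * (w - of_real x0))) has_field_derivative
      of_real N * (rz \<zeta> (N * (y - x0)))\<^sup>2) (at (of_real y))"
    using rz_denom_nonzero[OF assms, of "N * (y - x0)"]
    by (auto intro!: derivative_eq_intros simp: rz_def power2_eq_square field_simps)
  from has_vector_derivative_real_field[OF this] show ?thesis by (simp add: rz_def)
qed

lemma continuous_rz:
  assumes "Im \<zeta> \<noteq> 0"
  shows "continuous_on A (rz \<zeta>)"
  unfolding rz_def[abs_def] using rz_denom_nonzero[OF assms] by (intro continuous_intros) auto

text \<open>The two-particle identity behind the closed form of the loop equation.\<close>

lemma loop_algebra:
  fixes a :: "nat \<Rightarrow> real" and N x0 :: real and \<zeta> :: complex
  assumes N: "N > 0" and \<zeta>: "Im \<zeta> \<noteq> 0" and inj: "inj_on a {..<n}"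
  defines "r \<equiv> \<lambda>i. rz \<zeta> (N * (a i - x0))" and "z \<equiv> of_real x0 + \<zeta> / of_real N"
  shows "(\<Sum>i<n. of_real (1 - (a i)\<^sup>2) * (of_real N * (r i)\<^sup>2) - of_real (2 * a i) * r i
            + of_real (1 - (a i)\<^sup>2) * r i * of_real (\<Sum>j<n. 2 / (a i - a j)))
       = of_real N * ((1 - z\<^sup>2) * (\<Sum>i<n. r i)\<^sup>2 + (of_nat n / of_real N)\<^sup>2)"
proof -
  define c where "c i = complex_of_real (a i)" for i
  define \<psi> where "\<psi> i = (1 - (c i)\<^sup>2) * r i" for i
  have N0: "complex_of_real N \<noteq> 0" using N by simp
  have D: "(z - c i) * r i = 1 / of_real N" for i
  proof -
    have "z - c i = (\<zeta> - of_real (N * (a i - x0))) / of_real N"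
      using N0 by (simp add: z_def c_def field_simps)
    then show ?thesis using rz_denom_nonzero[OF \<zeta>, of "N * (a i - x0)"] N0
      by (simp add: r_def rz_def)
  qed
  \<comment> \<open>The quadratic \<open>1 - x\<^sup>2\<close> is replaced by its value at the pole
    \<open>z\<close>; the remainder is divisible by \<open>z - c i\<close>, which cancels the
    resolvent.\<close>
  have psi: "\<psi> i = (1 - z\<^sup>2) * r i + (z + c i) / of_real N" for i
  proof -
    have "\<psi> i = (1 - z\<^sup>2) * r i + (z + c i) * ((z - c i) * r i)"
      by (simp add: \<psi>_def power2_eq_square algebra_simps)
    then show ?thesis unfolding D by simp
  qed
  \<comment> \<open>The term \<open>- 2 * c i * r i\<close>, from the derivative of the vector
    field's quadratic factor, turns \<open>z + c i\<close> into \<open>z - c i\<close>, so that the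
    diagonal terms acquire the form of the off-diagonal ones.\<close>
  have diag: "of_real N * (\<psi> i * r i) - 2 * c i * r i = of_real N * ((1 - z\<^sup>2) * (r i * r i)) + 1 / of_real N" for i
  proof -
    have "of_real N * (\<psi> i * r i) - 2 * c i * r i = of_real N * ((1 - z\<^sup>2) * (r i * r i)) + (z - c i) * r i"
      unfolding psi using N0 by (simp add: field_simps)
    then show ?thesis unfolding D by simp
  qed
  have rdiff: "r i - r j = of_real N * (c i - c j) * (r i * r j)" for i j
    using rz_denom_nonzero[OF \<zeta>, of "N * (a i - x0)"] rz_denom_nonzero[OF \<zeta>, of "N * (a j - x0)"]
    by (simp add: r_def rz_def c_def field_simps)
  have off: "2 * \<psi> i / (c i - c j) + 2 * \<psi> j / (c j - c i) =
      2 * (of_real N * ((1 - z\<^sup>2) * (r i * r j)) + 1 / of_real N)" if "c i \<noteq> c j" for i j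
  proof -
    have "2 * \<psi> j / (c j - c i) = - (2 * \<psi> j / (c i - c j))"
      by (metis minus_diff_eq minus_divide_right)
    then have "2 * \<psi> i / (c i - c j) + 2 * \<psi> j / (c j - c i) = 2 * ((\<psi> i - \<psi> j) / (c i - c j))"
      by (simp add: diff_divide_distrib right_diff_distrib)
    also have "\<psi> i - \<psi> j = (1 - z\<^sup>2) * (r i - r j) + (c i - c j) / of_real N"
      by (simp add: psi add_divide_distrib diff_divide_distrib right_diff_distrib)
    also have "\<dots> = (c i - c j) * (of_real N * ((1 - z\<^sup>2) * (r i * r j)) + 1 / of_real N)"
      unfolding rdiff by (simp add: field_simps)
    finally show ?thesis using that by simp
  qed
  define W where "W i j = of_real N * ((1 - z\<^sup>2) * (r i * r j)) + 1 / complex_of_real N" for i j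
  \<comment> \<open>At \<open>i = j\<close> the quotient is \<open>2 / 0 = 0\<close>, so summing
    over all \<open>j\<close> adds no self-interaction; the missing diagonal is supplied by
    \<open>W i i\<close>, and the double sum completes to a square.\<close>
  define g where "g i j = \<psi> i * (2 / (c i - c j))" for i j
  have gg: "g i j + g j i = (if i = j then 0 else 2 * W i j)" if "i < n" "j < n" for i j
  proof (cases "i = j")
    case False
    then have "c i \<noteq> c j" using inj that by (auto simp: inj_on_def c_def)
    from off[OF this] False show ?thesis by (simp add: g_def W_def mult.commute)
  qed (simp add: g_def)
  have "2 * (\<Sum>i<n. \<Sum>j<n. g i j) = (\<Sum>i<n. \<Sum>j<n. g i j) + (\<Sum>i<n. \<Sum>j<n. g j i)"
    by (subst (2) sum.swap) simp
  also have "\<dots> = (\<Sum>i<n. \<Sum>j<n. g i j + g j i)" by (simp add: sum.distrib)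
  also have "\<dots> = (\<Sum>i<n. \<Sum>j<n. 2 * (if i = j then 0 else W i j))"
    by (intro sum.cong refl) (simp add: gg)
  finally have G: "(\<Sum>i<n. \<Sum>j<n. g i j) = (\<Sum>i<n. \<Sum>j<n. if i = j then 0 else W i j)"
    by (simp add: sum_distrib_left[symmetric])
  have "(\<Sum>i<n. of_real (1 - (a i)\<^sup>2) * (of_real N * (r i)\<^sup>2) - of_real (2 * a i) * r i
            + of_real (1 - (a i)\<^sup>2) * r i * of_real (\<Sum>j<n. 2 / (a i - a j)))
      = (\<Sum>i<n. W i i + (\<Sum>j<n. g i j))"
  proof (rule sum.cong[OF refl])
    fix i
    have "of_real (1 - (a i)\<^sup>2) * (of_real N * (r i)\<^sup>2) - of_real (2 * a i) * r i = W i i"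
      using diag[of i] by (simp add: W_def \<psi>_def c_def power2_eq_square algebra_simps)
    moreover have "of_real (1 - (a i)\<^sup>2) * r i * of_real (\<Sum>j<n. 2 / (a i - a j)) = (\<Sum>j<n. g i j)"
      by (simp add: g_def \<psi>_def c_def sum_distrib_left)
    ultimately show "of_real (1 - (a i)\<^sup>2) * (of_real N * (r i)\<^sup>2) - of_real (2 * a i) * r i
            + of_real (1 - (a i)\<^sup>2) * r i * of_real (\<Sum>j<n. 2 / (a i - a j)) = W i i + (\<Sum>j<n. g i j)" by simp
  qed
  also have "\<dots> = (\<Sum>i<n. W i i + (\<Sum>j<n. if i = j then 0 else W i j))"
    using G by (simp add: sum.distrib)
  also have "\<dots> = (\<Sum>i<n. \<Sum>j<n. W i j)"
  proof (rule sum.cong[OF refl])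
    fix i assume "i \<in> {..<n}"
    then show "W i i + (\<Sum>j<n. if i = j then 0 else W i j) = (\<Sum>j<n. W i j)"
      by (subst (1 2) sum.remove[of "{..<n}" i]) (auto intro!: sum.cong)
  qed
  also have "\<dots> = of_real N * ((1 - z\<^sup>2) * (\<Sum>i<n. r i)\<^sup>2 + (of_nat n / of_real N)\<^sup>2)"
  proof -
    have "(\<Sum>i<n. r i)\<^sup>2 = (\<Sum>i<n. \<Sum>j<n. r i * r j)" by (simp add: power2_eq_square sum_product)
    then show ?thesis using N0
      by (simp add: W_def sum.distrib sum_distrib_left distrib_left power2_eq_square)
  qed
  finally show ?thesis .
qed

context jacobi_weight
begin

text \<open>Integration by parts in the coordinate \<open>i\<close> alone, with the others frozen.
  The integrand collects the derivatives of the resolvent, of the exponential, of the weight and of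
  the Vandermonde factor.\<close>

lemma loop_single:
  fixes f f' :: "real \<Rightarrow> real" and t N x0 :: real and \<zeta> :: complex
  assumes fd: "\<And>u. (f has_real_derivative f' u) (at u)" and f'c: "continuous_on UNIV f'"
    and \<zeta>: "Im \<zeta> \<noteq> 0" and i: "i < n"
  defines "r \<equiv> \<lambda>y. rz \<zeta> (N * (y - x0))"
    and "e \<equiv> \<lambda>x. iexp (t * (\<Sum>j<n. f (N * (x j - x0))))"
  defines "c1 \<equiv> \<lambda>y. of_real (1 - y\<^sup>2) * (of_real N * (r y)\<^sup>2 + \<i> * of_real (t * N * f' (N * (y - x0))) * r y)
              + of_real (Bw y - 2 * y) * r y"
    and "c2 \<equiv> \<lambda>y. of_real (1 - y\<^sup>2) * r y"
  shows "integrable (Pn n) (\<lambda>x. vandermonde_sq n x *\<^sub>R (e x * (c1 (x i) + c2 (x i) * of_real (\<Sum>j<n. 2 / (x i - x j)))))" (is "integrable _ ?F")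
    and "(\<integral>x. vandermonde_sq n x *\<^sub>R (e x * (c1 (x i) + c2 (x i) * of_real (\<Sum>j<n. 2 / (x i - x j)))) \<partial>Pn n) = 0"
proof -
  have fc: "continuous_on UNIV f" using fd by (meson DERIV_isCont continuous_at_imp_continuous_on)
  have rc: "continuous_on UNIV r"
    unfolding r_def by (intro continuous_on_compose2[OF continuous_rz[OF \<zeta>, of UNIV]] continuous_intros) auto
  have f'c2: "continuous_on UNIV (\<lambda>y. f' (N * (y - x0)))" and fc2: "continuous_on UNIV (\<lambda>y. f (N * (y - x0)))"
    by (intro continuous_on_compose2[OF f'c] continuous_on_compose2[OF fc] continuous_intros; simp)+
  have c1c: "continuous_on UNIV c1" and c2c: "continuous_on UNIV c2"
    unfolding c1_def c2_def by (intro continuous_intros rc f'c2 Bw_cont)+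
  have c1m [measurable]: "c1 \<in> borel_measurable borel" and c2m [measurable]: "c2 \<in> borel_measurable borel"
    and fm: "(\<lambda>y. f (N * (y - x0))) \<in> borel_measurable borel"
    by (intro borel_measurable_continuous_onI c1c c2c fc2)+
  obtain K1 where K1: "\<forall>y\<in>{-1..1}. norm (c1 y) \<le> K1" using bounded_on_unit[OF c1c] by blast
  obtain K2 where K2: "\<forall>y\<in>{-1..1}. norm (c2 y) \<le> K2" using bounded_on_unit[OF c2c] by blast
  have K10: "0 \<le> K1" and K20: "0 \<le> K2"
    using order.trans[OF norm_ge_zero K1[rule_format, of 0]] order.trans[OF norm_ge_zero K2[rule_format, of 0]] by auto
  define C where "C = ((4::real) ^ n) ^ n"
  have C0: "0 \<le> C" by (simp add: C_def)
  have em: "e \<in> borel_measurable (Pn n)"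
    unfolding e_def using measurable_linstat[OF fm, of n] by (intro borel_measurable_iexp borel_measurable_times borel_measurable_const)
  have ci: "(\<lambda>x. x j) \<in> borel_measurable (Pn n)" if "j < n" for j using that by (rule measurable_coordinate)
  have dm: "(\<lambda>x. \<Sum>j<n. 2 / (x i - x j)) \<in> borel_measurable (Pn n)"
    using i by (intro borel_measurable_sum borel_measurable_divide borel_measurable_diff ci) auto
  show I: "integrable (Pn n) ?F"
  proof (rule Pn_integrable_bounded)
    show "?F \<in> borel_measurable (Pn n)"
      using i by (intro borel_measurable_scaleR measurable_vandermonde_sq borel_measurable_times em borel_measurable_add
          measurable_compose[OF ci c1m] measurable_compose[OF ci c2m] borel_measurable_of_real dm) auto
    fix x :: "nat \<Rightarrow> real" assume x: "\<And>j. j < n \<Longrightarrow> x j \<in> {-1..1}"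
    have pos: "0 \<le> vandermonde_sq n x" by (rule vandermonde_sq_nonneg)
    \<comment> \<open>The double zero of the Vandermonde factor absorbs the simple pole; at
      coinciding points the quotient is 0 by convention.\<close>
    have V2: "vandermonde_sq n x * \<bar>2 / (x i - x j)\<bar> \<le> 4 * C" if j: "j < n" for j
    proof (cases "x i = x j")
      case True then show ?thesis using C0 by simp
    next
      case False
      then have ij: "i \<noteq> j" by auto
      have "vandermonde_sq n x * \<bar>2 / (x i - x j)\<bar> \<le> (C * (x i - x j)\<^sup>2) * \<bar>2 / (x i - x j)\<bar>"
        unfolding C_def by (intro mult_right_mono vandermonde_sq_le x i j ij) auto
      also have "\<dots> = C * (2 * \<bar>x i - x j\<bar>)"
      proof -
        have "d\<^sup>2 * \<bar>2 / d\<bar> = 2 * \<bar>d\<bar>" if "d \<noteq> 0" for d :: real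
          using that by (cases "0 < d") (auto simp: power2_eq_square)
        from this[of "x i - x j"] False show ?thesis by (simp only: mult.assoc)
      qed
      also have "\<dots> \<le> C * 4" using x[OF i] x[OF j] C0 by (intro mult_left_mono) auto
      finally show ?thesis by simp
    qed
    have V1: "vandermonde_sq n x \<le> 4 ^ n ^ 2"
    proof -
      have "vandermonde_sq n x \<le> (\<Prod>j<n. 4 ^ n)"
        unfolding vandermonde_sq_def
      proof (intro prod_mono conjI prod_nonneg)
        fix b assume b: "b \<in> {..<n}"
        have "(\<Prod>a<b. (x a - x b)\<^sup>2) \<le> (\<Prod>a<b. 4)"
        proof (intro prod_mono conjI)
          fix a assume a: "a \<in> {..<b}"
          have "\<bar>x a - x b\<bar> \<le> 2" using x[of a] x[of b] a b by auto
          then have "\<bar>x a - x b\<bar>\<^sup>2 \<le> 2\<^sup>2" by (intro power_mono) auto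
          then show "(x a - x b)\<^sup>2 \<le> 4" by simp
        qed auto
        also have "\<dots> \<le> 4 ^ n" using b by (simp add: power_increasing)
        finally show "(\<Prod>a<b. (x a - x b)\<^sup>2) \<le> 4 ^ n" .
      qed auto
      also have "\<dots> = 4 ^ n ^ 2" by (simp add: power2_eq_square power_mult)
      finally show ?thesis .
    qed
    have "norm (?F x) = vandermonde_sq n x * norm (c1 (x i) + c2 (x i) * of_real (\<Sum>j<n. 2 / (x i - x j)))"
      using pos by (simp add: norm_mult e_def del: of_real_sum of_real_mult)
    also have "\<dots> \<le> vandermonde_sq n x * (K1 + K2 * (\<Sum>j<n. \<bar>2 / (x i - x j)\<bar>))"
    proof (intro mult_left_mono pos)
      have "norm (c1 (x i) + c2 (x i) * of_real (\<Sum>j<n. 2 / (x i - x j))) \<le>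
          norm (c1 (x i)) + norm (c2 (x i)) * \<bar>\<Sum>j<n. 2 / (x i - x j)\<bar>"
        by (metis norm_mult norm_of_real norm_triangle_ineq)
      also have "\<dots> \<le> K1 + K2 * (\<Sum>j<n. \<bar>2 / (x i - x j)\<bar>)"
        using K1 K2 K20 x[OF i] by (intro add_mono mult_mono sum_abs) auto
      finally show "norm (c1 (x i) + c2 (x i) * of_real (\<Sum>j<n. 2 / (x i - x j))) \<le> K1 + K2 * (\<Sum>j<n. \<bar>2 / (x i - x j)\<bar>)" .
    qed
    also have "\<dots> = vandermonde_sq n x * K1 + K2 * (\<Sum>j<n. vandermonde_sq n x * \<bar>2 / (x i - x j)\<bar>)"
      by (simp add: sum_distrib_left algebra_simps)
    also have "\<dots> \<le> 4 ^ n ^ 2 * K1 + K2 * (\<Sum>j<n. 4 * C)"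
      by (rule add_mono[OF mult_right_mono[OF V1 K10] mult_left_mono[OF sum_mono[OF V2] K20]]) simp
    finally show "norm (?F x) \<le> 4 ^ n ^ 2 * K1 + K2 * (\<Sum>j<n. 4 * C)" .
  qed
  define I where "I = {..<n} - {i}"
  have ins: "{..<n} = insert i I" and iI: "i \<notin> I" and finI: "finite I" using i by (auto simp: I_def)
  have inner: "(\<integral>y. ?F (x(i := y)) \<partial>mu) = 0" for x
  proof -
    obtain A where A: "\<And>y. vandermonde_sq n (x(i := y)) = A * (\<Prod>j\<in>I. (y - x j)\<^sup>2)"
      using vandermonde_sq_update[OF i, of x] unfolding I_def by blast
    define p where "p y = A * (\<Prod>j\<in>I. (y - x j)\<^sup>2)" for y
    define s where "s y = (\<Sum>j\<in>I. 2 / (y - x j))" for y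
    have pd: "(p has_real_derivative p y * s y) (at y)" for y
      unfolding p_def[abs_def] s_def
      by (rule derivative_eq_intros prod_sq_derivative finI refl)+ simp
    have psc: "continuous_on UNIV (\<lambda>y. p y * s y)"
    proof -
      \<comment> \<open>The product \<open>p y * s y\<close> is formally singular at the other
        points; as the derivative of a polynomial it is continuous there.\<close>
      define q where "q = smult A (\<Prod>j\<in>I. [:- x j, 1:] ^ 2)"
      have pq: "p = poly q" by (rule ext) (simp add: p_def q_def poly_prod poly_power)
      have "p y * s y = poly (pderiv q) y" for y
        using pd[of y] unfolding pq by (intro DERIV_unique[OF _ poly_DERIV])
      then show ?thesis by (simp add: continuous_intros)
    qed
    have pc: "continuous_on UNIV p" using pd by (meson DERIV_isCont continuous_at_imp_continuous_on)
    define c where "c = (\<Sum>j\<in>I. f (N * (x j - x0)))"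
    define E where "E y = iexp (t * (f (N * (y - x0)) + c))" for y
    have eE: "e (x(i := y)) = E y" for y
    proof -
      have "(\<Sum>j<n. f (N * ((x(i := y)) j - x0))) = f (N * (y - x0)) + c"
        unfolding ins c_def using iI finI by (auto intro!: sum.cong)
      then show ?thesis by (simp only: e_def E_def)
    qed
    have Ed: "(E has_vector_derivative (\<i> * of_real (t * N * f' (N * (y - x0)))) * E y) (at y)" for y
    proof -
      have "((\<lambda>y. t * (f (N * (y - x0)) + c)) has_real_derivative t * N * f' (N * (y - x0))) (at y)"
        by (rule derivative_eq_intros DERIV_chain2[OF fd] refl)+ simp
      then have "((\<lambda>y. complex_of_real (t * (f (N * (y - x0)) + c))) has_vector_derivative of_real (t * N * f' (N * (y - x0)))) (at y)"
        by (rule has_vector_derivative_of_real)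
      then have "((\<lambda>y. \<i> * complex_of_real (t * (f (N * (y - x0)) + c))) has_vector_derivative \<i> * of_real (t * N * f' (N * (y - x0)))) (at y)"
        by (rule has_vector_derivative_mult_right)
      from field_vector_diff_chain_at[OF this DERIV_exp] show ?thesis
        by (simp add: o_def E_def[abs_def])
    qed
    have Ec: "continuous_on UNIV E"
      unfolding E_def[abs_def] by (intro continuous_intros fc2)
    define \<Phi> where "\<Phi> y = of_real (p y) * (r y * E y)" for y
    define \<Phi>' where "\<Phi>' y = of_real (p y) * (r y * ((\<i> * of_real (t * N * f' (N * (y - x0)))) * E y) + of_real N * (r y)\<^sup>2 * E y)
        + of_real (p y * s y) * (r y * E y)" for y
    have "(\<Phi> has_vector_derivative \<Phi>' y) (at y)" for y
    proof -
      have "((\<lambda>y. complex_of_real (p y)) has_vector_derivative of_real (p y * s y)) (at y)"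
        by (rule has_vector_derivative_of_real[OF pd])
      moreover have "((\<lambda>y. r y * E y) has_vector_derivative
          (r y * ((\<i> * of_real (t * N * f' (N * (y - x0)))) * E y) + of_real N * (r y)\<^sup>2 * E y)) (at y)"
        by (rule has_vector_derivative_mult[OF _ Ed]) (unfold r_def, rule rz_deriv[OF \<zeta>])
      ultimately show ?thesis
        unfolding \<Phi>_def[abs_def] \<Phi>'_def by (rule has_vector_derivative_mult)
    qed
    moreover have "continuous_on UNIV \<Phi>'"
      unfolding \<Phi>'_def[abs_def] by (intro continuous_intros pc psc rc Ec f'c2)
    ultimately have "(\<integral>y. (1 - y\<^sup>2) *\<^sub>R \<Phi>' y + (Bw y - 2 * y) *\<^sub>R \<Phi> y \<partial>mu) = 0"
      by (rule integral_by_parts_weight)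
    also have "(\<lambda>y. (1 - y\<^sup>2) *\<^sub>R \<Phi>' y + (Bw y - 2 * y) *\<^sub>R \<Phi> y) = (\<lambda>y. ?F (x(i := y)))"
    proof (rule ext)
      fix y
      have ss: "(\<Sum>j<n. 2 / ((x(i := y)) i - (x(i := y)) j)) = s y"
        unfolding ins s_def using iI finI by (auto intro!: sum.cong)
      have "?F (x(i := y)) = of_real (p y) * (E y * (c1 y + c2 y * of_real (s y)))"
        unfolding ss A eE p_def by (simp add: scaleR_conv_of_real)
      also have "\<dots> = (1 - y\<^sup>2) *\<^sub>R \<Phi>' y + (Bw y - 2 * y) *\<^sub>R \<Phi> y"
        unfolding scaleR_conv_of_real \<Phi>_def \<Phi>'_def c1_def c2_def
        by (simp add: algebra_simps power2_eq_square del: of_real_diff of_real_power)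
      finally show "(1 - y\<^sup>2) *\<^sub>R \<Phi>' y + (Bw y - 2 * y) *\<^sub>R \<Phi> y = ?F (x(i := y))" ..
    qed
    finally show ?thesis .
  qed
  have "integral\<^sup>L (Pn n) ?F = (\<integral>x. (\<integral>y. ?F (x(i := y)) \<partial>mu) \<partial>PiM I (\<lambda>_. mu))"
    using I unfolding ins by (rule PSF.product_integral_insert[OF finI iI])
  then show "integral\<^sup>L (Pn n) ?F = 0" unfolding inner by simp
qed

text \<open>Summing the one-coordinate identities and dividing by \<open>N\<close> closes the
  interaction into the square of the resolvent sum; only \<open>Bw\<close> and the test function
  leave further linear statistics.\<close>

lemma loop_equation:
  fixes f f' :: "real \<Rightarrow> real" and t N x0 :: real and \<zeta> :: complex and n :: nat
  assumes fd: "\<And>u. (f has_real_derivative f' u) (at u)" and f'c: "continuous_on UNIV f'"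
    and \<zeta>: "Im \<zeta> \<noteq> 0" and N: "N > 0"
  defines "r \<equiv> \<lambda>y. rz \<zeta> (N * (y - x0))"
    and "e \<equiv> \<lambda>x. iexp (t * (\<Sum>j<n. f (N * (x j - x0))))"
    and "z \<equiv> of_real x0 + \<zeta> / of_real N"
  shows "(\<integral>x. e x * ((1 - z\<^sup>2) * (\<Sum>i<n. r (x i))\<^sup>2 + (of_nat n / of_real N)\<^sup>2
            + (\<Sum>i<n. of_real (Bw (x i)) * r (x i)) / of_real N
            + \<i> * of_real t * (\<Sum>i<n. of_real (1 - (x i)\<^sup>2) * (r (x i) * of_real (f' (N * (x i - x0)))))) \<partial>OPE mu n) = 0"
    (is "(\<integral>x. ?L x \<partial>OPE mu n) = 0")
proof -
  define c1 where "c1 y = of_real (1 - y\<^sup>2) * (of_real N * (r y)\<^sup>2 + \<i> * of_real (t * N * f' (N * (y - x0))) * r y)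
              + of_real (Bw y - 2 * y) * r y" for y
  define c2 where "c2 y = of_real (1 - y\<^sup>2) * r y" for y
  define F where "F i x = vandermonde_sq n x *\<^sub>R (e x * (c1 (x i) + c2 (x i) * of_real (\<Sum>j<n. 2 / (x i - x j))))" for i x
  have iF: "integrable (Pn n) (F i)" and F0: "(\<integral>x. F i x \<partial>Pn n) = 0" if "i < n" for i
    using loop_single[OF fd f'c \<zeta> that, of t N x0] unfolding F_def[abs_def] c1_def c2_def r_def e_def by blast+
  have N0: "complex_of_real N \<noteq> 0" using N by simp
  have pt: "vandermonde_sq n x *\<^sub>R ?L x = (1 / N) *\<^sub>R (\<Sum>i<n. F i x)" for x
  proof (cases "inj_on x {..<n}")
    \<comment> \<open>The algebraic identity needs distinct points; where two coincide the
      Vandermonde factor annihilates both sides.\<close>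
    case False
    then obtain a b where ab: "a < n" "b < n" "a \<noteq> b" "x a = x b" by (auto simp: inj_on_def)
    define a' where "a' = min a b"
    define b' where "b' = max a b"
    have "a' < b'" "b' < n" "x a' = x b'" using ab by (auto simp: a'_def b'_def min_def max_def)
    then have "vandermonde_sq n x = 0"
      unfolding vandermonde_sq_def by (intro prod_zero bexI[of _ b'] bexI[of _ a']) auto
    then show ?thesis by (simp add: F_def)
  next
    case True
    define S where "S i = of_real (1 - (x i)\<^sup>2) * (of_real N * (r (x i))\<^sup>2) - of_real (2 * x i) * r (x i)
            + of_real (1 - (x i)\<^sup>2) * r (x i) * of_real (\<Sum>j<n. 2 / (x i - x j))" for i
    define H where "H i = of_real (Bw (x i)) * r (x i)" for i
    define T where "T i = of_real (1 - (x i)\<^sup>2) * (r (x i) * of_real (f' (N * (x i - x0))))" for i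
    have c: "c1 (x i) + c2 (x i) * of_real (\<Sum>j<n. 2 / (x i - x j)) = S i + H i + \<i> * of_real (t * N) * T i" for i
      by (simp add: c1_def c2_def S_def H_def T_def algebra_simps del: of_real_sum of_real_power)
    have "(\<Sum>i<n. F i x) = vandermonde_sq n x *\<^sub>R (e x * (\<Sum>i<n. S i + H i + \<i> * of_real (t * N) * T i))"
      unfolding F_def c by (simp only: scaleR_sum_right sum_distrib_left)
    also have "(\<Sum>i<n. S i + H i + \<i> * of_real (t * N) * T i) = (\<Sum>i<n. S i) + (\<Sum>i<n. H i) + \<i> * of_real (t * N) * (\<Sum>i<n. T i)"
      by (simp add: sum.distrib sum_distrib_left)
    also have "(\<Sum>i<n. S i) = of_real N * ((1 - z\<^sup>2) * (\<Sum>i<n. r (x i))\<^sup>2 + (of_nat n / of_real N)\<^sup>2)"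
      unfolding S_def r_def z_def by (rule loop_algebra[OF N \<zeta> True])
    finally have "(1 / N) *\<^sub>R (\<Sum>i<n. F i x) = vandermonde_sq n x *\<^sub>R (e x * ((1 / of_real N) *
        (of_real N * ((1 - z\<^sup>2) * (\<Sum>i<n. r (x i))\<^sup>2 + (of_nat n / of_real N)\<^sup>2) + (\<Sum>i<n. H i) + \<i> * of_real (t * N) * (\<Sum>i<n. T i))))"
      by (simp add: scaleR_conv_of_real)
    also have "(1 / of_real N) *
        (of_real N * ((1 - z\<^sup>2) * (\<Sum>i<n. r (x i))\<^sup>2 + (of_nat n / of_real N)\<^sup>2) + (\<Sum>i<n. H i) + \<i> * of_real (t * N) * (\<Sum>i<n. T i))
       = (1 - z\<^sup>2) * (\<Sum>i<n. r (x i))\<^sup>2 + (of_nat n / of_real N)\<^sup>2 + (\<Sum>i<n. H i) / of_real N + \<i> * of_real t * (\<Sum>i<n. T i)"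
      using N0 by (simp add: distrib_left)
    finally show ?thesis by (simp add: H_def T_def)
  qed
  have rc: "continuous_on UNIV r"
    unfolding r_def by (intro continuous_on_compose2[OF continuous_rz[OF \<zeta>, of UNIV]] continuous_intros) auto
  have fc: "continuous_on UNIV f" using fd by (meson DERIV_isCont continuous_at_imp_continuous_on)
  have f'c2: "continuous_on UNIV (\<lambda>y. f' (N * (y - x0)))" and fc2: "continuous_on UNIV (\<lambda>y. f (N * (y - x0)))"
    by (intro continuous_on_compose2[OF f'c] continuous_on_compose2[OF fc] continuous_intros; simp)+
  have m: "?L \<in> borel_measurable (Pn n)"
  proof -
    have "(\<lambda>x. \<Sum>i<n. r (x i)) \<in> borel_measurable (Pn n)"
      "(\<lambda>x. \<Sum>i<n. of_real (Bw (x i)) * r (x i)) \<in> borel_measurable (Pn n)"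
      "(\<lambda>x. \<Sum>i<n. of_real (1 - (x i)\<^sup>2) * (r (x i) * of_real (f' (N * (x i - x0))))) \<in> borel_measurable (Pn n)"
      "(\<lambda>x. \<Sum>i<n. f (N * (x i - x0))) \<in> borel_measurable (Pn n)"
      by (rule measurable_linstat, rule borel_measurable_continuous_onI, intro continuous_intros rc f'c2 fc2 Bw_cont)+
    then show ?thesis unfolding e_def
      by (intro borel_measurable_times borel_measurable_iexp borel_measurable_add borel_measurable_power
          borel_measurable_divide borel_measurable_of_real borel_measurable_const)
  qed
  have "(\<integral>x. vandermonde_sq n x *\<^sub>R ?L x \<partial>Pn n) = (1 / N) *\<^sub>R (\<Sum>i<n. \<integral>x. F i x \<partial>Pn n)"
    unfolding pt by (subst Bochner_Integration.integral_sum[symmetric]) (use iF in auto)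
  also have "\<dots> = 0" using F0 by simp
  finally show ?thesis by (subst integral_OPE[OF m]) simp
qed

text \<open>Boundedness on the cube makes functions integrable under \<open>OPE mu n\<close>, and
  the class is closed under the operations used below, so integrability becomes a matter of
  introduction rules.\<close>

definition nice :: "nat \<Rightarrow> ((nat \<Rightarrow> real) \<Rightarrow> 'b::{banach, second_countable_topology}) \<Rightarrow> bool" where
  "nice n F \<longleftrightarrow> F \<in> borel_measurable (Pn n) \<and> (\<exists>K. \<forall>x. (\<forall>j<n. x j \<in> {-1..1}) \<longrightarrow> norm (F x) \<le> K)"

lemma nice_integrable: "nice n F \<Longrightarrow> integrable (OPE mu n) F"
  unfolding nice_def using OPE_integrable_bounded by blast

lemma nice_const: "nice n (\<lambda>_. c)"
  by (auto simp: nice_def)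

lemma nice_add:
  assumes "nice n F" "nice n G" shows "nice n (\<lambda>x. F x + G x)"
proof -
  obtain K L where "\<forall>x. (\<forall>j<n. x j \<in> {-1..1}) \<longrightarrow> norm (F x) \<le> K" "\<forall>x. (\<forall>j<n. x j \<in> {-1..1}) \<longrightarrow> norm (G x) \<le> L"
    using assms unfolding nice_def by blast
  then have "\<forall>x. (\<forall>j<n. x j \<in> {-1..1}) \<longrightarrow> norm (F x + G x) \<le> K + L"
    by (meson add_mono norm_triangle_le)
  then show ?thesis using assms unfolding nice_def by (blast intro: borel_measurable_add)
qed

lemma nice_uminus: "nice n F \<Longrightarrow> nice n (\<lambda>x. - F x)"
  unfolding nice_def by (auto intro: borel_measurable_uminus)

lemma nice_diff: "nice n F \<Longrightarrow> nice n G \<Longrightarrow> nice n (\<lambda>x. F x - G x)"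
  using nice_add[of n F "\<lambda>x. - G x"] nice_uminus[of n G] by simp

lemma nice_mult:
  fixes F G :: "(nat \<Rightarrow> real) \<Rightarrow> 'b::{banach, second_countable_topology, real_normed_algebra}"
  assumes "nice n F" "nice n G" shows "nice n (\<lambda>x. F x * G x)"
proof -
  obtain K L where "\<forall>x. (\<forall>j<n. x j \<in> {-1..1}) \<longrightarrow> norm (F x) \<le> K" "\<forall>x. (\<forall>j<n. x j \<in> {-1..1}) \<longrightarrow> norm (G x) \<le> L"
    using assms unfolding nice_def by blast
  then have "\<forall>x. (\<forall>j<n. x j \<in> {-1..1}) \<longrightarrow> norm (F x * G x) \<le> K * L"
    by (meson mult_mono norm_ge_zero norm_mult_ineq order_trans)
  then show ?thesis using assms unfolding nice_def by (blast intro: borel_measurable_times)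
qed

lemma nice_norm: "nice n F \<Longrightarrow> nice n (\<lambda>x. norm (F x))"
  unfolding nice_def by (auto intro: borel_measurable_norm)

lemma nice_of_real:
  fixes F :: "(nat \<Rightarrow> real) \<Rightarrow> real"
  shows "nice n F \<Longrightarrow> nice n (\<lambda>x. complex_of_real (F x))"
  unfolding nice_def by (auto intro: borel_measurable_of_real)

lemma nice_Re: "nice n F \<Longrightarrow> nice n (\<lambda>x. Re (F x))"
  unfolding nice_def by (auto intro: borel_measurable_Re order.trans[OF abs_Re_le_cmod])

lemma nice_Im: "nice n F \<Longrightarrow> nice n (\<lambda>x. Im (F x))"
  unfolding nice_def by (auto intro: borel_measurable_Im order.trans[OF abs_Im_le_cmod])

lemma nice_iexp:
  fixes F :: "(nat \<Rightarrow> real) \<Rightarrow> real"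
  assumes "nice n F" shows "nice n (\<lambda>x. iexp (F x))"
  unfolding nice_def
proof
  show "(\<lambda>x. iexp (F x)) \<in> borel_measurable (Pn n)"
    using assms unfolding nice_def by (intro borel_measurable_iexp) auto
  show "\<exists>K. \<forall>x. (\<forall>j<n. x j \<in> {- 1..1}) \<longrightarrow> norm (iexp (F x)) \<le> K"
    by (intro exI[of _ 1]) simp
qed

lemma nice_linstat:
  fixes g :: "real \<Rightarrow> 'b::{banach, second_countable_topology}"
  assumes "continuous_on UNIV g"
  shows "nice n (\<lambda>x. \<Sum>j<n. g (x j))"
proof -
  obtain K where K: "\<forall>x\<in>{-1..1}. norm (g x) \<le> K" using bounded_on_unit[OF assms] by blast
  have "norm (\<Sum>j<n. g (x j)) \<le> of_nat n * K" if "\<forall>j<n. x j \<in> {-1..1}" for x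
    using sum_norm_bound[of "{..<n}" "\<lambda>j. g (x j)" K] K that by auto
  then show ?thesis unfolding nice_def
    by (intro conjI measurable_linstat borel_measurable_continuous_onI assms) blast
qed

lemmas nice_intros = nice_const nice_add nice_diff nice_mult nice_norm nice_of_real nice_Re nice_Im nice_iexp

lemma bdd_fn_continuous: "continuous_on UNIV g \<Longrightarrow> bdd_fn g"
  using bounded_on_unit[of g] unfolding bdd_fn_def by (auto intro: borel_measurable_continuous_onI)

text \<open>Real and imaginary parts inherit the Lipschitz bound and their variances add up, which
  doubles the constant.\<close>

lemma variance_complex:
  assumes x0: "x0 \<in> {-1<..<1}"
  shows "\<exists>C\<ge>0. \<forall>N\<ge>1. \<forall>n. \<forall>(g :: real \<Rightarrow> complex) M. continuous_on UNIV g \<longrightarrow>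
     (\<forall>x\<in>{-1..1}. \<forall>y\<in>{-1..1}. norm (g x - g y) \<le> M * (N * \<bar>x - y\<bar> * (win N x0 x * win N x0 y))) \<longrightarrow>
     integral\<^sup>L (OPE mu n) (\<lambda>x. (norm ((\<Sum>j<n. g (x j)) - integral\<^sup>L (OPE mu n) (\<lambda>x. \<Sum>j<n. g (x j))))\<^sup>2) \<le> C * M\<^sup>2"
proof -
  obtain C where C: "0 \<le> C" and V: "\<And>N n g M. N \<ge> 1 \<Longrightarrow> bdd_fn g \<Longrightarrow>
     (\<forall>x\<in>{-1..1}. \<forall>y\<in>{-1..1}. \<bar>g x - g y\<bar> \<le> M * (N * \<bar>x - y\<bar> * (win N x0 x * win N x0 y))) \<Longrightarrow>
     integral\<^sup>L (OPE mu n) (\<lambda>x. ((\<Sum>j<n. g (x j)) - integral\<^sup>L (OPE mu n) (\<lambda>x. \<Sum>j<n. g (x j)))\<^sup>2) \<le> C * M\<^sup>2"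
    using mesoscopic_variance[OF x0] by blast
  have "integral\<^sup>L (OPE mu n) (\<lambda>x. (norm ((\<Sum>j<n. g (x j)) - integral\<^sup>L (OPE mu n) (\<lambda>x. \<Sum>j<n. g (x j))))\<^sup>2) \<le> 2 * C * M\<^sup>2"
    if N: "N \<ge> 1" and g: "continuous_on UNIV g"
      and lip: "\<forall>x\<in>{-1..1}. \<forall>y\<in>{-1..1}. norm (g x - g y) \<le> M * (N * \<bar>x - y\<bar> * (win N x0 x * win N x0 y))"
    for N n and g :: "real \<Rightarrow> complex" and M
  proof -
    let ?S = "\<lambda>x. \<Sum>j<n. g (x j)"
    let ?m = "integral\<^sup>L (OPE mu n) ?S"
    have nS: "nice n ?S" by (rule nice_linstat[OF g])
    have gR: "continuous_on UNIV (\<lambda>x. Re (g x))" and gI: "continuous_on UNIV (\<lambda>x. Im (g x))"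
      by (intro continuous_intros g)+
    have R: "integral\<^sup>L (OPE mu n) (\<lambda>x. ((\<Sum>j<n. Re (g (x j))) - integral\<^sup>L (OPE mu n) (\<lambda>x. \<Sum>j<n. Re (g (x j))))\<^sup>2) \<le> C * M\<^sup>2"
    proof (rule V[OF N bdd_fn_continuous[OF gR]], intro ballI)
      fix x y :: real assume "x \<in> {-1..1}" "y \<in> {-1..1}"
      then show "\<bar>Re (g x) - Re (g y)\<bar> \<le> M * (N * \<bar>x - y\<bar> * (win N x0 x * win N x0 y))"
        using lip abs_Re_le_cmod[of "g x - g y"] by force
    qed
    have I: "integral\<^sup>L (OPE mu n) (\<lambda>x. ((\<Sum>j<n. Im (g (x j))) - integral\<^sup>L (OPE mu n) (\<lambda>x. \<Sum>j<n. Im (g (x j))))\<^sup>2) \<le> C * M\<^sup>2"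
    proof (rule V[OF N bdd_fn_continuous[OF gI]], intro ballI)
      fix x y :: real assume "x \<in> {-1..1}" "y \<in> {-1..1}"
      then show "\<bar>Im (g x) - Im (g y)\<bar> \<le> M * (N * \<bar>x - y\<bar> * (win N x0 x * win N x0 y))"
        using lip abs_Im_le_cmod[of "g x - g y"] by force
    qed
    have mR: "integral\<^sup>L (OPE mu n) (\<lambda>x. \<Sum>j<n. Re (g (x j))) = Re ?m"
      and mI: "integral\<^sup>L (OPE mu n) (\<lambda>x. \<Sum>j<n. Im (g (x j))) = Im ?m"
      using integral_Re[OF nice_integrable[OF nS]] integral_Im[OF nice_integrable[OF nS]] by (simp_all add: Re_sum Im_sum)
    have "(\<lambda>x. (norm (?S x - ?m))\<^sup>2) = (\<lambda>x. ((\<Sum>j<n. Re (g (x j))) - Re ?m)\<^sup>2 + ((\<Sum>j<n. Im (g (x j))) - Im ?m)\<^sup>2)"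
      by (rule ext) (simp add: cmod_power2 Re_sum Im_sum)
    then have "integral\<^sup>L (OPE mu n) (\<lambda>x. (norm (?S x - ?m))\<^sup>2) =
       integral\<^sup>L (OPE mu n) (\<lambda>x. ((\<Sum>j<n. Re (g (x j))) - Re ?m)\<^sup>2) + integral\<^sup>L (OPE mu n) (\<lambda>x. ((\<Sum>j<n. Im (g (x j))) - Im ?m)\<^sup>2)"
      by (simp only:) (intro Bochner_Integration.integral_add nice_integrable; unfold power2_eq_square; intro nice_intros nice_linstat gR gI)
    then show ?thesis using R I unfolding mR mI by linarith
  qed
  then show ?thesis using C by (intro exI[of _ "2 * C"]) auto
qed

end

section \<open>The mesoscopic scale\<close>

definition cw :: "real \<Rightarrow> real" where "cw u = 1 / sqrt (1 + u\<^sup>2)"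

lemma cw_pos: "0 < cw u"
  by (simp add: cw_def add_pos_nonneg)

text \<open>The chordal distance is \<open>\<bar>sin (arctan u - arctan v)\<bar>\<close>, so these
  are the functions that are Lipschitz on the line closed up by one point at infinity; resolvents
  are of this kind.\<close>

definition chordal :: "(real \<Rightarrow> 'a::real_normed_vector) \<Rightarrow> real \<Rightarrow> bool" where
  "chordal \<phi> M \<longleftrightarrow> (\<forall>u v. norm (\<phi> u - \<phi> v) \<le> M * (\<bar>u - v\<bar> * (cw u * cw v)))"

lemma chordal_nonneg: "chordal \<phi> M \<Longrightarrow> 0 \<le> M"
proof -
  assume "chordal \<phi> M"
  then have "norm (\<phi> 0 - \<phi> 1) \<le> M * (\<bar>0 - 1\<bar> * (cw 0 * cw 1))" unfolding chordal_def by blast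
  from order.trans[OF norm_ge_zero this] have "0 \<le> M * (cw 0 * cw 1)" by simp
  then show ?thesis using cw_pos[of 0] cw_pos[of 1] by (metis mult_pos_pos not_le zero_le_mult_iff)
qed

lemma rz_diff: "Im \<zeta> \<noteq> 0 \<Longrightarrow> rz \<zeta> u - rz \<zeta> v = of_real (u - v) * (rz \<zeta> u * rz \<zeta> v)"
  using rz_denom_nonzero[of \<zeta> u] rz_denom_nonzero[of \<zeta> v]
  by (simp add: rz_def field_simps)

lemma rz_diff_pole: "Im \<zeta> \<noteq> 0 \<Longrightarrow> Im \<xi> \<noteq> 0 \<Longrightarrow> rz \<zeta> u - rz \<xi> u = (\<xi> - \<zeta>) * (rz \<zeta> u * rz \<xi> u)"
  using rz_denom_nonzero[of \<zeta> u] rz_denom_nonzero[of \<xi> u]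
  by (simp add: rz_def field_simps)

text \<open>Both 1 and \<open>u\<^sup>2\<close> are bounded by multiples of the squared distance
  from \<open>u\<close> to the pole. The constant is explicit because it must be uniform for poles
  moving along a horizontal segment.\<close>

lemma rz_decay_explicit:
  assumes "Im \<zeta> \<noteq> 0"
  shows "norm (rz \<zeta> u) \<le> sqrt ((1 + 2 * (norm \<zeta>)\<^sup>2) / (Im \<zeta>)\<^sup>2 + 2) * cw u"
proof -
  define K where "K = (1 + 2 * (norm \<zeta>)\<^sup>2) / (Im \<zeta>)\<^sup>2 + 2"
  have "norm (rz \<zeta> u) \<le> sqrt K * cw u"
  proof -
    let ?d = "norm (\<zeta> - of_real u)"
    have d: "0 < ?d" using rz_denom_nonzero[OF assms, of u] by simp
    have "\<bar>Im \<zeta>\<bar> \<le> ?d" using abs_Im_le_cmod[of "\<zeta> - of_real u"] by simp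
    then have im: "(Im \<zeta>)\<^sup>2 \<le> ?d\<^sup>2" by (metis abs_ge_zero power2_abs power_mono)
    have "\<bar>u\<bar> \<le> norm \<zeta> + ?d" using norm_triangle_ineq2[of "of_real u" \<zeta>] by (simp add: norm_minus_commute)
    then have "\<bar>u\<bar>\<^sup>2 \<le> (norm \<zeta> + ?d)\<^sup>2" by (intro power_mono) auto
    also have "\<dots> \<le> 2 * (norm \<zeta>)\<^sup>2 + 2 * ?d\<^sup>2"
      using sum_squares_bound[of "norm \<zeta>" ?d] by (simp add: power2_sum)
    finally have "1 + u\<^sup>2 \<le> (1 + 2 * (norm \<zeta>)\<^sup>2) * 1 + 2 * ?d\<^sup>2" by simp
    also have "\<dots> \<le> (1 + 2 * (norm \<zeta>)\<^sup>2) * (?d\<^sup>2 / (Im \<zeta>)\<^sup>2) + 2 * ?d\<^sup>2"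
      using im assms by (intro add_mono mult_left_mono) (auto simp: le_divide_eq_1)
    also have "\<dots> = K * ?d\<^sup>2" by (simp add: K_def algebra_simps)
    finally have "sqrt (1 + u\<^sup>2) \<le> sqrt (K * ?d\<^sup>2)" by simp
    also have "\<dots> = sqrt K * ?d" by (simp add: real_sqrt_mult)
    finally have "sqrt (1 + u\<^sup>2) \<le> sqrt K * ?d" .
    moreover have "0 < sqrt (1 + u\<^sup>2)" by (simp add: add_pos_nonneg)
    ultimately show ?thesis using d by (simp add: rz_def cw_def norm_divide field_simps)
  qed
  then show ?thesis by (simp only: K_def)
qed

lemma rz_decay:
  assumes "Im \<zeta> \<noteq> 0"
  shows "\<exists>D\<ge>0. \<forall>u. norm (rz \<zeta> u) \<le> D * cw u"
  using rz_decay_explicit[OF assms]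
  by (intro exI[of _ "sqrt ((1 + 2 * (norm \<zeta>)\<^sup>2) / (Im \<zeta>)\<^sup>2 + 2)"]) simp

text \<open>The resolvent identity writes the increment as \<open>u - v\<close> times two
  resolvents, each decaying like \<open>cw\<close>.\<close>

lemma chordal_rz:
  assumes "Im \<zeta> \<noteq> 0"
  shows "\<exists>M. chordal (rz \<zeta>) M"
proof -
  obtain D where D: "D \<ge> 0" "\<And>u. norm (rz \<zeta> u) \<le> D * cw u" using rz_decay[OF assms] by blast
  have "norm (rz \<zeta> u - rz \<zeta> v) \<le> D * D * (\<bar>u - v\<bar> * (cw u * cw v))" for u v
  proof -
    have "norm (rz \<zeta> u - rz \<zeta> v) = \<bar>u - v\<bar> * (norm (rz \<zeta> u) * norm (rz \<zeta> v))"
      unfolding rz_diff[OF assms] by (simp add: norm_mult del: of_real_diff)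
    also have "\<dots> \<le> \<bar>u - v\<bar> * ((D * cw u) * (D * cw v))"
      using D cw_pos[THEN less_imp_le] by (intro mult_left_mono mult_mono mult_nonneg_nonneg) auto
    finally show ?thesis by (simp add: mult_ac)
  qed
  then show ?thesis unfolding chordal_def by blast
qed

lemma chordal_add: "chordal f M \<Longrightarrow> chordal g L \<Longrightarrow> chordal (\<lambda>u. f u + g u) (M + L)"
  unfolding chordal_def
proof (intro allI)
  fix u v assume a: "\<forall>u v. norm (f u - f v) \<le> M * (\<bar>u - v\<bar> * (cw u * cw v))" "\<forall>u v. norm (g u - g v) \<le> L * (\<bar>u - v\<bar> * (cw u * cw v))"
  have "norm (f u + g u - (f v + g v)) \<le> norm (f u - f v) + norm (g u - g v)"
    by (metis add_diff_add norm_triangle_ineq)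
  also have "\<dots> \<le> M * (\<bar>u - v\<bar> * (cw u * cw v)) + L * (\<bar>u - v\<bar> * (cw u * cw v))" using a by (intro add_mono) auto
  finally show "norm (f u + g u - (f v + g v)) \<le> (M + L) * (\<bar>u - v\<bar> * (cw u * cw v))" by (simp add: distrib_right)
qed

lemma chordal_const: "chordal (\<lambda>_. c) 0"
  by (simp add: chordal_def)

lemma chordal_mult:
  fixes f g :: "real \<Rightarrow> 'a::real_normed_algebra"
  assumes f: "chordal f M" and g: "chordal g L" and fb: "\<And>u. norm (f u) \<le> K" and gb: "\<And>u. norm (g u) \<le> J"
  shows "chordal (\<lambda>u. f u * g u) (M * J + K * L)"
  unfolding chordal_def
proof (intro allI)
  fix u v
  let ?w = "\<bar>u - v\<bar> * (cw u * cw v)"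
  have w: "0 \<le> ?w" using cw_pos[of u] cw_pos[of v] by simp
  have K: "0 \<le> K" and J: "0 \<le> J" using fb[of 0] gb[of 0] norm_ge_zero order_trans by blast+
  have "norm (f u * g u - f v * g v) = norm ((f u - f v) * g u + f v * (g u - g v))" by (simp add: algebra_simps)
  also have "\<dots> \<le> norm (f u - f v) * norm (g u) + norm (f v) * norm (g u - g v)"
    by (intro order.trans[OF norm_triangle_ineq] add_mono norm_mult_ineq)
  also have "\<dots> \<le> (M * ?w) * J + K * (L * ?w)"
    using f g fb gb K J w chordal_nonneg[OF f] chordal_nonneg[OF g] unfolding chordal_def
    by (intro add_mono mult_mono) auto
  finally show "norm (f u * g u - f v * g v) \<le> (M * J + K * L) * ?w" by (simp add: algebra_simps)
qed

lemma chordal_cmult: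
  fixes f :: "real \<Rightarrow> 'a::real_normed_algebra"
  assumes "chordal f M" shows "chordal (\<lambda>u. c * f u) (norm c * M)"
  unfolding chordal_def
proof (intro allI)
  fix u v
  have "norm (c * f u - c * f v) \<le> norm c * norm (f u - f v)"
    by (simp add: norm_mult_ineq right_diff_distrib[symmetric])
  also have "\<dots> \<le> norm c * (M * (\<bar>u - v\<bar> * (cw u * cw v)))"
    using assms unfolding chordal_def by (intro mult_left_mono) auto
  finally show "norm (c * f u - c * f v) \<le> norm c * M * (\<bar>u - v\<bar> * (cw u * cw v))" by simp
qed

lemma real_powr_at_top:
  assumes "0 < a"
  shows "filterlim (\<lambda>n. real n powr a) at_top sequentially"
proof -
  have "filterlim (\<lambda>n. exp (a * ln (real n))) at_top sequentially"
    by (intro filterlim_compose[OF exp_at_top] filterlim_tendsto_pos_mult_at_top[OF tendsto_const assms]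
        filterlim_compose[OF ln_at_top filterlim_real_sequentially])
  then show ?thesis
    by (rule filterlim_mono_eventually[OF _ order_refl order_refl])
      (auto simp: eventually_at_top_linorder powr_def intro!: exI[of _ 1])
qed

locale meso = jacobi_weight +
  fixes x0 \<alpha> :: real
  assumes x0: "x0 \<in> {-1<..<1}" and \<alpha>0: "0 < \<alpha>" and \<alpha>1: "\<alpha> < 1"
begin

definition Nn :: "nat \<Rightarrow> real" where "Nn n = real n powr \<alpha>"
text \<open>The order of the number of points seen in the window. The mean resolvent is normalised
  by it, and its growth makes the fluctuations negligible against the mean.\<close>

definition qn :: "nat \<Rightarrow> real" where "qn n = real n / Nn n"

abbreviation EE :: "nat \<Rightarrow> ((nat \<Rightarrow> real) \<Rightarrow> 'b::{banach, second_countable_topology}) \<Rightarrow> 'b" where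
  "EE n F \<equiv> integral\<^sup>L (OPE mu n) F"

lemma Nn_ge_1: "n \<ge> 1 \<Longrightarrow> 1 \<le> Nn n"
  using \<alpha>0 by (simp add: Nn_def ge_one_powr_ge_zero)

lemma qn_eq: "n \<ge> 1 \<Longrightarrow> qn n = real n powr (1 - \<alpha>)"
  by (simp add: qn_def Nn_def powr_diff)

lemma qn_ge_1: "n \<ge> 1 \<Longrightarrow> 1 \<le> qn n"
  using \<alpha>1 by (simp add: qn_eq ge_one_powr_ge_zero)

lemma Nn_at_top: "filterlim Nn at_top sequentially"
  unfolding Nn_def[abs_def] using \<alpha>0 by (rule real_powr_at_top)

lemma qn_at_top: "filterlim qn at_top sequentially"
proof -
  have "filterlim (\<lambda>n. real n powr (1 - \<alpha>)) at_top sequentially"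
    using \<alpha>1 by (intro real_powr_at_top) simp
  then show ?thesis
    by (rule filterlim_mono_eventually[OF _ order_refl order_refl])
      (use qn_eq in \<open>auto simp: eventually_at_top_linorder intro!: exI[of _ 1]\<close>)
qed

lemma inverse_Nn_tendsto: "(\<lambda>n. 1 / Nn n) \<longlonglongrightarrow> 0"
  using tendsto_inverse_0_at_top[OF Nn_at_top] by (simp add: inverse_eq_divide)

lemma inverse_qn_tendsto: "(\<lambda>n. 1 / qn n) \<longlonglongrightarrow> 0"
  using tendsto_inverse_0_at_top[OF qn_at_top] by (simp add: inverse_eq_divide)

lemma win_eq: "win N x0 x = cw (N * (x - x0))"
  by (simp add: win_def cw_def)

text \<open>On the support the scaled position is at most \<open>2 * N\<close> in size, so the
  window never falls below \<open>1 / (3 * N)\<close>. This lets a Lipschitz bound on the original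
  scale pay for a missing window factor.\<close>

lemma one_le_win: "N \<ge> 1 \<Longrightarrow> x \<in> {-1..1} \<Longrightarrow> 1 \<le> 3 * N * win N x0 x"
proof -
  assume N: "N \<ge> 1" and x: "x \<in> {-1..1}"
  have "\<bar>x - x0\<bar> \<le> 2" using x x0 by auto
  then have "\<bar>N * (x - x0)\<bar> \<le> N * 2" unfolding abs_mult using N by (intro mult_mono) auto
  then have "\<bar>N * (x - x0)\<bar>\<^sup>2 \<le> (N * 2)\<^sup>2" by (intro power_mono) auto
  then have "(N * (x - x0))\<^sup>2 \<le> (N * 2)\<^sup>2" by (simp only: power2_abs)
  then have "1 + (N * (x - x0))\<^sup>2 \<le> N\<^sup>2 + (N * 2)\<^sup>2" using one_le_power[OF N, of 2] by linarith
  also have "\<dots> \<le> (3 * N)\<^sup>2" by (simp add: power_mult_distrib)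
  finally have "1 + (N * (x - x0))\<^sup>2 \<le> (3 * N)\<^sup>2" .
  then have "sqrt (1 + (N * (x - x0))\<^sup>2) \<le> 3 * N" by (intro real_le_lsqrt) (use N in auto)
  moreover have "0 < sqrt (1 + (N * (x - x0))\<^sup>2)" by (simp add: add_pos_nonneg)
  ultimately show ?thesis by (simp add: win_def)
qed

text \<open>A choice of the constant in \<open>variance_complex\<close>, fixed once so that it
  depends neither on \<open>n\<close> nor on the statistic.\<close>

definition VC :: real where
  "VC = (SOME C. C \<ge> 0 \<and> (\<forall>N\<ge>1. \<forall>n. \<forall>(g :: real \<Rightarrow> complex) M. continuous_on UNIV g \<longrightarrow>
     (\<forall>x\<in>{-1..1}. \<forall>y\<in>{-1..1}. norm (g x - g y) \<le> M * (N * \<bar>x - y\<bar> * (win N x0 x * win N x0 y))) \<longrightarrow>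
     integral\<^sup>L (OPE mu n) (\<lambda>x. (norm ((\<Sum>j<n. g (x j)) - integral\<^sup>L (OPE mu n) (\<lambda>x. \<Sum>j<n. g (x j))))\<^sup>2) \<le> C * M\<^sup>2))"

lemma VC: "0 \<le> VC"
  "N \<ge> 1 \<Longrightarrow> continuous_on UNIV g \<Longrightarrow>
   (\<And>x y. x \<in> {-1..1} \<Longrightarrow> y \<in> {-1..1} \<Longrightarrow> norm (g x - g y) \<le> M * (N * \<bar>x - y\<bar> * (win N x0 x * win N x0 y))) \<Longrightarrow>
   EE n (\<lambda>x. (norm ((\<Sum>j<n. g (x j)) - EE n (\<lambda>x. \<Sum>j<n. g (x j))))\<^sup>2) \<le> VC * M\<^sup>2"
  for g :: "real \<Rightarrow> complex"
  using someI_ex[OF variance_complex[OF x0]] unfolding VC_def[symmetric] by blast+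

lemma nice_norm_power:
  fixes F :: "(nat \<Rightarrow> real) \<Rightarrow> complex"
  assumes "nice n F" shows "nice n (\<lambda>x. (norm (F x))\<^sup>2)"
  unfolding power2_eq_square by (intro nice_intros assms)

lemma EE_diff: "nice n F \<Longrightarrow> nice n G \<Longrightarrow> EE n (\<lambda>x. F x - G x) = EE n F - EE n G"
  by (intro Bochner_Integration.integral_diff nice_integrable)

lemma EE_add: "nice n F \<Longrightarrow> nice n G \<Longrightarrow> EE n (\<lambda>x. F x + G x) = EE n F + EE n G"
  by (intro Bochner_Integration.integral_add nice_integrable)

lemma measure_OPE_space [simp]: "measure (OPE mu n) (space (OPE mu n)) = 1"
  using prob_space.prob_space[OF prob_space_OPE] .

lemma EE_const: "EE n (\<lambda>_. c) = c"
proof -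
  interpret prob_space "OPE mu n" by (rule prob_space_OPE)
  show ?thesis by (simp add: prob_space)
qed

lemma EE_mono:
  fixes F G :: "(nat \<Rightarrow> real) \<Rightarrow> real"
  assumes "nice n F" "nice n G" "\<And>x. (\<And>j. j < n \<Longrightarrow> x j \<in> {-1..1}) \<Longrightarrow> F x \<le> G x"
  shows "EE n F \<le> EE n G"
proof (rule integral_mono_AE[OF nice_integrable[OF assms(1)] nice_integrable[OF assms(2)]])
  show "AE x in OPE mu n. F x \<le> G x" using AE_OPE by eventually_elim (use assms(3) in auto)
qed

lemma EE_norm_le:
  fixes F :: "(nat \<Rightarrow> real) \<Rightarrow> 'b::{banach, second_countable_topology}"
  shows "norm (EE n F) \<le> EE n (\<lambda>x. norm (F x))"
  by (rule integral_norm_bound)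

lemma EE_norm_bound:
  fixes F :: "(nat \<Rightarrow> real) \<Rightarrow> 'b::{banach, second_countable_topology}"
  assumes "nice n F" "\<And>x. (\<And>j. j < n \<Longrightarrow> x j \<in> {-1..1}) \<Longrightarrow> norm (F x) \<le> K"
  shows "norm (EE n F) \<le> K"
proof -
  have "norm (EE n F) \<le> EE n (\<lambda>x. norm (F x))" by (rule EE_norm_le)
  also have "\<dots> \<le> EE n (\<lambda>_. K)" by (rule EE_mono) (use assms in \<open>auto intro: nice_intros\<close>)
  finally show ?thesis unfolding EE_const .
qed

text \<open>Nonnegativity of the variance of the modulus gives the comparison of first and second
  moments.\<close>

lemma EE_abs_le_sqrt:
  fixes F :: "(nat \<Rightarrow> real) \<Rightarrow> complex"
  assumes "nice n F" "EE n (\<lambda>x. (norm (F x))\<^sup>2) \<le> K\<^sup>2" "0 \<le> K"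
  shows "EE n (\<lambda>x. norm (F x)) \<le> K"
proof -
  interpret prob_space "OPE mu n" by (rule prob_space_OPE)
  have "0 \<le> EE n (\<lambda>x. (norm (F x) - expectation (\<lambda>x. norm (F x)))\<^sup>2)" by (intro Bochner_Integration.integral_nonneg) simp
  also have "\<dots> = EE n (\<lambda>x. (norm (F x))\<^sup>2) - (EE n (\<lambda>x. norm (F x)))\<^sup>2"
    by (intro variance_eq nice_integrable nice_norm_power nice_intros assms)
  finally have "(EE n (\<lambda>x. norm (F x)))\<^sup>2 \<le> K\<^sup>2" using assms(2) by linarith
  then show ?thesis using assms(3) by (rule power2_le_imp_le)
qed

definition LS :: "nat \<Rightarrow> (real \<Rightarrow> 'b::real_normed_vector) \<Rightarrow> (nat \<Rightarrow> real) \<Rightarrow> 'b" where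
  "LS n g x = (\<Sum>j<n. g (x j))"

lemma nice_LS:
  fixes g :: "real \<Rightarrow> 'b::{banach, second_countable_topology}"
  shows "continuous_on UNIV g \<Longrightarrow> nice n (LS n g)"
  unfolding LS_def[abs_def] by (rule nice_linstat)

lemma LS_variance:
  fixes g :: "real \<Rightarrow> complex"
  assumes "n \<ge> 1" "continuous_on UNIV g"
   "\<And>x y. x \<in> {-1..1} \<Longrightarrow> y \<in> {-1..1} \<Longrightarrow> norm (g x - g y) \<le> M * (Nn n * \<bar>x - y\<bar> * (win (Nn n) x0 x * win (Nn n) x0 y))"
  shows "EE n (\<lambda>x. (norm (LS n g x - EE n (LS n g)))\<^sup>2) \<le> VC * M\<^sup>2"
  unfolding LS_def[abs_def] by (rule VC(2)[OF Nn_ge_1]) (use assms in auto)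

lemma LS_abs_dev:
  fixes g :: "real \<Rightarrow> complex"
  assumes "n \<ge> 1" "continuous_on UNIV g" "0 \<le> M"
   "\<And>x y. x \<in> {-1..1} \<Longrightarrow> y \<in> {-1..1} \<Longrightarrow> norm (g x - g y) \<le> M * (Nn n * \<bar>x - y\<bar> * (win (Nn n) x0 x * win (Nn n) x0 y))"
  shows "EE n (\<lambda>x. norm (LS n g x - EE n (LS n g))) \<le> sqrt VC * M"
proof (rule EE_abs_le_sqrt)
  show "nice n (\<lambda>x. LS n g x - EE n (LS n g))" by (intro nice_intros nice_LS assms)
  show "EE n (\<lambda>x. (norm (LS n g x - EE n (LS n g)))\<^sup>2) \<le> (sqrt VC * M)\<^sup>2"
    using LS_variance[OF assms(1,2,4)] VC(1) by (simp add: power_mult_distrib)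
qed (use assms VC(1) in auto)

abbreviation sc :: "nat \<Rightarrow> real \<Rightarrow> real" where "sc n x \<equiv> Nn n * (x - x0)"

lemma chordal_scaled:
  assumes "chordal \<phi> M" "n \<ge> 1"
  shows "norm (\<phi> (sc n x) - \<phi> (sc n y)) \<le> M * (Nn n * \<bar>x - y\<bar> * (win (Nn n) x0 x * win (Nn n) x0 y))"
proof -
  have "sc n x - sc n y = Nn n * (x - y)" by (simp add: algebra_simps)
  then have "\<bar>sc n x - sc n y\<bar> = Nn n * \<bar>x - y\<bar>" using Nn_ge_1[OF assms(2)] by (simp add: abs_mult)
  then show ?thesis using assms(1)[unfolded chordal_def, rule_format, of "sc n x" "sc n y"] by (simp add: win_eq mult_ac)
qed

text \<open>When the increment falls on the macroscopic factor \<open>a\<close>, the decay of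
  \<open>\<phi>\<close> gives one window and \<open>one_le_win\<close> the other at the price of
  \<open>3 * N\<close>; hence the summand \<open>3 * L * D\<close>.\<close>

lemma lip_times_chordal:
  fixes a :: "real \<Rightarrow> real" and \<phi> :: "real \<Rightarrow> complex"
  assumes n: "n \<ge> 1" and \<phi>: "chordal \<phi> M" and dec: "\<And>u. norm (\<phi> u) \<le> D * cw u"
    and lip: "\<And>x y. x \<in> {-1..1} \<Longrightarrow> y \<in> {-1..1} \<Longrightarrow> \<bar>a x - a y\<bar> \<le> L * \<bar>x - y\<bar>"
    and bd: "\<And>x. x \<in> {-1..1} \<Longrightarrow> \<bar>a x\<bar> \<le> K"
    and nn: "0 \<le> D" "0 \<le> L" and x: "x \<in> {-1..1}" and y: "y \<in> {-1..1}"
  shows "norm (of_real (a x) * \<phi> (sc n x) - of_real (a y) * \<phi> (sc n y)) \<le>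
     (3 * L * D + K * M) * (Nn n * \<bar>x - y\<bar> * (win (Nn n) x0 x * win (Nn n) x0 y))"
proof -
  let ?w = "win (Nn n) x0"
  have N: "1 \<le> Nn n" by (rule Nn_ge_1[OF n])
  have "of_real (a x) * \<phi> (sc n x) - of_real (a y) * \<phi> (sc n y) =
      of_real (a x - a y) * \<phi> (sc n x) + of_real (a y) * (\<phi> (sc n x) - \<phi> (sc n y))"
    by (simp add: algebra_simps)
  then have "norm (of_real (a x) * \<phi> (sc n x) - of_real (a y) * \<phi> (sc n y)) \<le>
      \<bar>a x - a y\<bar> * norm (\<phi> (sc n x)) + \<bar>a y\<bar> * norm (\<phi> (sc n x) - \<phi> (sc n y))"
    by (metis norm_mult norm_of_real norm_triangle_ineq)
  also have "\<dots> \<le> (L * \<bar>x - y\<bar>) * (D * ?w x) + K * (M * (Nn n * \<bar>x - y\<bar> * (?w x * ?w y)))"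
    using lip[OF x y] dec[of "sc n x"] bd[OF y] chordal_scaled[OF \<phi> n, of x y] nn
    by (intro add_mono mult_mono) (auto simp: win_eq)
  also have "(L * \<bar>x - y\<bar>) * (D * ?w x) \<le> (L * \<bar>x - y\<bar>) * (D * ?w x) * (3 * Nn n * ?w y)"
    using mult_left_mono[OF one_le_win[OF N y], of "(L * \<bar>x - y\<bar>) * (D * ?w x)"] nn win_pos[of "Nn n" x0 x] by simp
  finally show ?thesis by (simp add: algebra_simps)
qed

text \<open>The quotient of \<open>h'\<close> by \<open>h\<close> is Lipschitz because both
  functions are and \<open>h\<close> stays above a positive constant; the remaining terms are
  polynomial.\<close>

lemma Bw_bounds:
  "\<exists>K L. 0 \<le> L \<and> (\<forall>x\<in>{-1..1}. \<bar>Bw x\<bar> \<le> K) \<and> (\<forall>x\<in>{-1..1}. \<forall>y\<in>{-1..1}. \<bar>Bw x - Bw y\<bar> \<le> L * \<bar>x - y\<bar>)"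
proof -
  obtain K where K: "\<forall>x\<in>{-1..1}. norm (Bw x) \<le> K" using bounded_on_unit[OF Bw_cont] by blast
  obtain H1 where H1: "\<forall>x\<in>{-1..1}. norm (h' x) \<le> H1" using bounded_on_unit[OF h'_cont] by blast
  obtain lo hi where lh: "0 < lo" "\<And>x. x \<in> {-1..1} \<Longrightarrow> lo \<le> h x" "\<And>x. x \<in> {-1..1} \<Longrightarrow> h x \<le> hi"
    using h_bounds by blast
  obtain L0 where L0: "0 \<le> L0" "\<And>x y. x \<in> {-1..1} \<Longrightarrow> y \<in> {-1..1} \<Longrightarrow> \<bar>h x - h y\<bar> \<le> L0 * \<bar>x - y\<bar>"
    using h_lipschitz by blast
  obtain L1 where L1: "\<And>x y. x \<in> {-1..1} \<Longrightarrow> y \<in> {-1..1} \<Longrightarrow> \<bar>h' x - h' y\<bar> \<le> L1 * \<bar>x - y\<bar>"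
    using h'_lip by blast
  have H10: "0 \<le> H1" using order.trans[OF norm_ge_zero H1[rule_format, of 0]] by simp
  have L10: "0 \<le> L1" using L1[of 0 1] by simp
  define L2 where "L2 = L1 / lo + H1 * L0 / lo\<^sup>2"
  have L20: "0 \<le> L2" using L10 H10 L0 lh(1) by (simp add: L2_def)
  have q: "\<bar>h' x / h x - h' y / h y\<bar> \<le> L2 * \<bar>x - y\<bar>" if x: "x \<in> {-1..1}" and y: "y \<in> {-1..1}" for x y
  proof -
    have hx: "0 < h x" "lo \<le> h x" and hy: "0 < h y" "lo \<le> h y" using lh(2) x y h_pos by auto
    have "h' x / h x - h' y / h y = (h' x - h' y) / h x + h' y * (h y - h x) / (h x * h y)"
      using hx hy by (simp add: field_simps)
    then have "\<bar>h' x / h x - h' y / h y\<bar> \<le> \<bar>h' x - h' y\<bar> / h x + \<bar>h' y\<bar> * \<bar>h x - h y\<bar> / (h x * h y)"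
      using hx hy abs_triangle_ineq[of "(h' x - h' y) / h x" "h' y * (h y - h x) / (h x * h y)"]
      by (simp add: abs_mult abs_minus_commute[of "h y"])
    also have "\<dots> \<le> (L1 * \<bar>x - y\<bar>) / lo + H1 * (L0 * \<bar>x - y\<bar>) / (lo * lo)"
      using hx hy L1[OF x y] L0(2)[OF x y] H1 y lh(1) H10 L10 L0(1)
      by (intro add_mono frac_le mult_mono) auto
    also have "\<dots> = L2 * \<bar>x - y\<bar>" by (simp add: L2_def power2_eq_square algebra_simps)
    finally show ?thesis .
  qed
  define Q where "Q = H1 / lo"
  have Q: "\<bar>h' x / h x\<bar> \<le> Q" if "x \<in> {-1..1}" for x
  proof -
    have "\<bar>h' x\<bar> / h x \<le> H1 / lo" using H1 that lh h_pos[of x] by (intro frac_le) auto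
    then show ?thesis using h_pos[of x] by (simp add: Q_def)
  qed
  have "\<bar>Bw x - Bw y\<bar> \<le> (\<bar>g1 + g2\<bar> + L2 + 2 * Q) * \<bar>x - y\<bar>" if x: "x \<in> {-1..1}" and y: "y \<in> {-1..1}" for x y
  proof -
    have e: "Bw x - Bw y = - (g1 + g2) * (x - y) + (1 - x\<^sup>2) * (h' x / h x - h' y / h y) - (x + y) * (x - y) * (h' y / h y)"
    proof -
      have "(g2 - g1) - (g1 + g2) * x + (1 - x\<^sup>2) * X - ((g2 - g1) - (g1 + g2) * y + (1 - y\<^sup>2) * Y) =
          - (g1 + g2) * (x - y) + (1 - x\<^sup>2) * (X - Y) - (x + y) * (x - y) * Y" for X Y
        by (simp add: power2_eq_square algebra_simps)
      then show ?thesis unfolding Bw_def .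
    qed
    have "\<bar>Bw x - Bw y\<bar> \<le> \<bar>g1 + g2\<bar> * \<bar>x - y\<bar> + \<bar>1 - x\<^sup>2\<bar> * \<bar>h' x / h x - h' y / h y\<bar> + \<bar>x + y\<bar> * \<bar>x - y\<bar> * \<bar>h' y / h y\<bar>"
      unfolding e by (intro order.trans[OF abs_triangle_ineq4] add_mono order.trans[OF abs_triangle_ineq]) (auto simp: abs_mult simp flip: abs_minus_cancel[of "g1 + g2"])
    also have "\<dots> \<le> \<bar>g1 + g2\<bar> * \<bar>x - y\<bar> + 1 * (L2 * \<bar>x - y\<bar>) + 2 * \<bar>x - y\<bar> * Q"
    proof (intro add_mono mult_mono order_refl q x y Q)
      show "\<bar>1 - x\<^sup>2\<bar> \<le> 1" using x abs_square_le_1[of x] by (auto simp: abs_le_iff)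
      show "\<bar>x + y\<bar> \<le> 2" using x y by auto
    qed (use L20 in auto)
    finally show ?thesis by (simp add: algebra_simps)
  qed
  moreover have "0 \<le> \<bar>g1 + g2\<bar> + L2 + 2 * Q" using L20 H10 lh(1) by (simp add: Q_def)
  ultimately show ?thesis using K by (intro exI[of _ K] exI[of _ "\<bar>g1 + g2\<bar> + L2 + 2 * Q"]) auto
qed

end

section \<open>Asymptotics of the mean resolvent\<close>

text \<open>Approximation uniform in \<open>n\<close>: the null sequence may depend on \<delta>, the
  constant \<open>K\<close> may not.\<close>

lemma tendsto_zero_approx:
  fixes a :: "nat \<Rightarrow> complex"
  assumes "0 \<le> K" and "\<And>\<delta>. 0 < \<delta> \<Longrightarrow> \<delta> \<le> 1 \<Longrightarrow> \<exists>b :: nat \<Rightarrow> complex. b \<longlonglongrightarrow> 0 \<and> (\<forall>n\<ge>1. norm (a n) \<le> norm (b n) + K * \<delta>)"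
  shows "a \<longlonglongrightarrow> 0"
proof (rule LIMSEQ_I)
  fix e :: real assume e: "0 < e"
  define \<delta> where "\<delta> = min 1 (e / (2 * (K + 1)))"
  have d: "0 < \<delta>" "\<delta> \<le> 1" using e assms(1) by (auto simp: \<delta>_def)
  have "K * \<delta> \<le> (K + 1) * (e / (2 * (K + 1)))" using assms(1) d by (intro mult_mono) (auto simp: \<delta>_def)
  also have "\<dots> = e / 2"
  proof -
    define L where "L = K + 1"
    have "L \<noteq> 0" using assms(1) by (simp add: L_def)
    then show ?thesis unfolding L_def[symmetric] by simp
  qed
  finally have kd: "K * \<delta> \<le> e / 2" .
  from assms(2)[OF d] obtain b :: "nat \<Rightarrow> complex"
    where bb: "b \<longlonglongrightarrow> 0 \<and> (\<forall>n\<ge>1. norm (a n) \<le> norm (b n) + K * \<delta>)" by (elim exE)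
  then have b: "b \<longlonglongrightarrow> 0" "\<And>n. n \<ge> 1 \<Longrightarrow> norm (a n) \<le> norm (b n) + K * \<delta>" by simp_all
  obtain n0 where n0: "\<And>n. n \<ge> n0 \<Longrightarrow> norm (b n - 0) < e / 2" using LIMSEQ_D[OF b(1), of "e / 2"] e by auto
  show "\<exists>no. \<forall>n\<ge>no. norm (a n - 0) < e"
  proof (intro exI allI impI)
    fix n assume "n \<ge> max 1 n0"
    then have "norm (a n) \<le> norm (b n) + K * \<delta>" "norm (b n) < e / 2" using b(2)[of n] n0[of n] by auto
    then show "norm (a n - 0) < e" using kd by simp
  qed
qed

lemma Im_rz: "Im (rz \<zeta> u) = - Im \<zeta> * (norm (rz \<zeta> u))\<^sup>2"
proof -
  have "Im (rz \<zeta> u) = - Im \<zeta> / (norm (\<zeta> - of_real u))\<^sup>2"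
    by (simp add: rz_def Im_divide cmod_power2)
  then show ?thesis by (simp add: rz_def norm_divide power_divide)
qed

context meso
begin

lemma cont_rz: "Im \<zeta> \<noteq> 0 \<Longrightarrow> continuous_on UNIV (\<lambda>x. rz \<zeta> (sc n x))"
  by (intro continuous_on_compose2[OF continuous_rz[of \<zeta> UNIV]] continuous_intros) auto

definition RR :: "nat \<Rightarrow> complex \<Rightarrow> (nat \<Rightarrow> real) \<Rightarrow> complex" where
  "RR n \<zeta> = LS n (\<lambda>x. rz \<zeta> (sc n x))"

definition HH :: "nat \<Rightarrow> complex \<Rightarrow> (nat \<Rightarrow> real) \<Rightarrow> complex" where
  "HH n \<zeta> = LS n (\<lambda>x. of_real (Bw x) * rz \<zeta> (sc n x))"

definition AA :: "nat \<Rightarrow> complex \<Rightarrow> complex" where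
  "AA n \<zeta> = 1 - (of_real x0 + \<zeta> / of_real (Nn n))\<^sup>2"

definition mR :: "nat \<Rightarrow> complex \<Rightarrow> complex" where
  "mR n \<zeta> = EE n (RR n \<zeta>) / of_real (qn n)"

text \<open>The Stieltjes transform, as a principal value at infinity, of a constant density with
  the value \<open>1 / (pi * sqrt (1 - x0\<^sup>2))\<close> of the arcsine law at \<open>x0\<close>;
  of the pole only its half-plane matters.\<close>

definition mlim :: "complex \<Rightarrow> complex" where
  "mlim \<zeta> = - \<i> * of_real (sgn (Im \<zeta>) / sqrt (1 - x0\<^sup>2))"

lemma nice_RR: "Im \<zeta> \<noteq> 0 \<Longrightarrow> nice n (RR n \<zeta>)"
  unfolding RR_def by (intro nice_LS cont_rz)

lemma nice_HH: "Im \<zeta> \<noteq> 0 \<Longrightarrow> nice n (HH n \<zeta>)"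
  unfolding HH_def by (intro nice_LS continuous_intros cont_rz Bw_cont)

lemma RR_dev:
  assumes "Im \<zeta> \<noteq> 0"
  shows "\<exists>C\<ge>0. \<forall>n\<ge>1. EE n (\<lambda>x. (norm (RR n \<zeta> x - EE n (RR n \<zeta>)))\<^sup>2) \<le> C"
proof -
  obtain M where M: "chordal (rz \<zeta>) M" using chordal_rz[OF assms] by blast
  have "EE n (\<lambda>x. (norm (RR n \<zeta> x - EE n (RR n \<zeta>)))\<^sup>2) \<le> VC * M\<^sup>2" if n: "n \<ge> 1" for n
    unfolding RR_def using chordal_scaled[OF M n] by (intro LS_variance n cont_rz assms) auto
  then show ?thesis using VC(1) by (intro exI[of _ "VC * M\<^sup>2"]) auto
qed

lemma HH_dev:
  assumes "Im \<zeta> \<noteq> 0"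
  shows "\<exists>C\<ge>0. \<forall>n\<ge>1. EE n (\<lambda>x. norm (HH n \<zeta> x - EE n (HH n \<zeta>))) \<le> C"
proof -
  obtain M where M: "chordal (rz \<zeta>) M" using chordal_rz[OF assms] by blast
  obtain D where D: "D \<ge> 0" "\<And>u. norm (rz \<zeta> u) \<le> D * cw u" using rz_decay[OF assms] by blast
  obtain K L where KL: "0 \<le> L" "\<And>x. x \<in> {-1..1} \<Longrightarrow> \<bar>Bw x\<bar> \<le> K"
    "\<And>x y. x \<in> {-1..1} \<Longrightarrow> y \<in> {-1..1} \<Longrightarrow> \<bar>Bw x - Bw y\<bar> \<le> L * \<bar>x - y\<bar>" using Bw_bounds by blast
  have K0: "0 \<le> K" using KL(2)[of 0] by simp
  have C0: "0 \<le> 3 * L * D + K * M" using KL(1) D(1) K0 chordal_nonneg[OF M] by simp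
  have "EE n (\<lambda>x. norm (HH n \<zeta> x - EE n (HH n \<zeta>))) \<le> sqrt VC * (3 * L * D + K * M)" if n: "n \<ge> 1" for n
    unfolding HH_def
  proof (rule LS_abs_dev[OF n _ C0])
    show "continuous_on UNIV (\<lambda>x. complex_of_real (Bw x) * rz \<zeta> (sc n x))"
      by (intro continuous_intros cont_rz Bw_cont assms)
  qed (rule lip_times_chordal[OF n M D(2) KL(3,2) D(1) KL(1)])
  then show ?thesis using VC(1) C0 by (intro exI[of _ "sqrt VC * (3 * L * D + K * M)"]) auto
qed

text \<open>The crude bound of order \<open>n\<close> suffices: in the normalised loop equation it
  is divided by \<open>Nn n * (qn n)\<^sup>2\<close>, which leaves \<open>1 / qn n\<close>.\<close>

lemma HH_mean:
  assumes "Im \<zeta> \<noteq> 0"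
  shows "\<exists>C\<ge>0. \<forall>n. norm (EE n (HH n \<zeta>)) \<le> C * real n"
proof -
  obtain K L where KL: "\<And>x. x \<in> {-1..1} \<Longrightarrow> \<bar>Bw x\<bar> \<le> K" using Bw_bounds by blast
  have K0: "0 \<le> K" using KL[of 0] by simp
  have "norm (EE n (HH n \<zeta>)) \<le> (K * (1 / \<bar>Im \<zeta>\<bar>)) * real n" for n
  proof (rule EE_norm_bound[OF nice_HH[OF assms]])
    fix x :: "nat \<Rightarrow> real" assume x: "\<And>j. j < n \<Longrightarrow> x j \<in> {-1..1}"
    have "norm (\<Sum>j<n. of_real (Bw (x j)) * rz \<zeta> (sc n (x j))) \<le> of_nat (card {..<n}) * (K * (1 / \<bar>Im \<zeta>\<bar>))"
    proof (rule sum_norm_bound)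
      fix j assume "j \<in> {..<n}"
      then show "norm (of_real (Bw (x j)) * rz \<zeta> (sc n (x j))) \<le> K * (1 / \<bar>Im \<zeta>\<bar>)"
        unfolding norm_mult norm_of_real using x[of j] KL K0 norm_rz_le[OF assms] by (intro mult_mono) auto
    qed
    then show "norm (HH n \<zeta> x) \<le> (K * (1 / \<bar>Im \<zeta>\<bar>)) * real n"
      by (simp add: HH_def LS_def mult.commute)
  qed
  then show ?thesis using K0 by (intro exI[of _ "K * (1 / \<bar>Im \<zeta>\<bar>)"]) auto
qed

lemma AA_nonzero: "Im \<zeta> \<noteq> 0 \<Longrightarrow> n \<ge> 1 \<Longrightarrow> AA n \<zeta> \<noteq> 0"
proof
  assume a: "Im \<zeta> \<noteq> 0" "n \<ge> 1" "AA n \<zeta> = 0"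
  then have "(of_real x0 + \<zeta> / of_real (Nn n))\<^sup>2 = (1::complex)" by (simp add: AA_def)
  then have "of_real x0 + \<zeta> / of_real (Nn n) = (1::complex) \<or> of_real x0 + \<zeta> / of_real (Nn n) = (-1::complex)"
    by (simp add: power2_eq_1_iff)
  then have "Im (of_real x0 + \<zeta> / of_real (Nn n)) = 0"
    by (metis one_complex.sel(2) uminus_complex.sel(2) neg_equal_0_iff_equal)
  then have "Im \<zeta> / Nn n = 0" by (simp add: Im_divide_of_real)
  with a Nn_ge_1[OF a(2)] show False by simp
qed

lemma x0_sq: "0 < 1 - x0\<^sup>2"
  using x0 by (simp add: abs_square_less_1 abs_less_iff)

lemma AA_tendsto: "(\<lambda>n. AA n \<zeta>) \<longlonglongrightarrow> of_real (1 - x0\<^sup>2)"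
proof -
  have l: "(\<lambda>n. complex_of_real (1 / Nn n)) \<longlonglongrightarrow> of_real 0" by (intro tendsto_of_real inverse_Nn_tendsto)
  have "(\<lambda>n. 1 - (of_real x0 + \<zeta> * of_real (1 / Nn n))\<^sup>2) \<longlonglongrightarrow> 1 - (of_real x0 + \<zeta> * of_real 0)\<^sup>2"
    by (intro tendsto_diff tendsto_const tendsto_power tendsto_add tendsto_mult l)
  then show ?thesis by (simp add: AA_def)
qed

lemma loop_meso:
  assumes fd: "\<And>u. (f has_real_derivative f' u) (at u)" and f'c: "continuous_on UNIV f'"
    and \<zeta>: "Im \<zeta> \<noteq> 0" and n: "n \<ge> 1"
  shows "EE n (\<lambda>x. iexp (t * LS n (\<lambda>y. f (sc n y)) x) * (AA n \<zeta> * (RR n \<zeta> x)\<^sup>2 + (of_real (qn n))\<^sup>2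
      + HH n \<zeta> x / of_real (Nn n) + \<i> * of_real t * LS n (\<lambda>y. of_real (1 - y\<^sup>2) * (rz \<zeta> (sc n y) * of_real (f' (sc n y)))) x)) = 0"
  using loop_equation[OF fd f'c \<zeta>, of "Nn n" n t x0] Nn_ge_1[OF n]
  by (simp add: LS_def RR_def HH_def AA_def qn_def)

lemma loop_zero:
  assumes \<zeta>: "Im \<zeta> \<noteq> 0" and n: "n \<ge> 1"
  shows "AA n \<zeta> * EE n (\<lambda>x. (RR n \<zeta> x)\<^sup>2) + (of_real (qn n))\<^sup>2 + EE n (HH n \<zeta>) / of_real (Nn n) = 0"
proof -
  have "EE n (\<lambda>x. AA n \<zeta> * (RR n \<zeta> x)\<^sup>2 + (of_real (qn n))\<^sup>2 + HH n \<zeta> x / of_real (Nn n)) = 0"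
    using loop_meso[of "\<lambda>_. 0" "\<lambda>_. 0" \<zeta> n 0] \<zeta> n by simp
  moreover have n1: "nice n (\<lambda>x. AA n \<zeta> * (RR n \<zeta> x)\<^sup>2)"
    unfolding power2_eq_square by (intro nice_intros nice_RR \<zeta>)
  moreover have n2: "nice n (\<lambda>x. HH n \<zeta> x / of_real (Nn n))"
    unfolding divide_inverse by (intro nice_intros nice_HH \<zeta>)
  ultimately show ?thesis
    by (simp add: EE_add nice_add nice_const)
qed

lemma EE_centered_sq:
  fixes F :: "(nat \<Rightarrow> real) \<Rightarrow> complex"
  assumes "nice n F"
  shows "EE n (\<lambda>x. (F x - EE n F)\<^sup>2) = EE n (\<lambda>x. (F x)\<^sup>2) - (EE n F)\<^sup>2"
proof -
  have "(\<lambda>x. (F x - EE n F)\<^sup>2) = (\<lambda>x. F x * F x - (2 * EE n F) * F x + EE n F * EE n F)"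
    by (rule ext) (simp add: power2_eq_square algebra_simps)
  then have "EE n (\<lambda>x. (F x - EE n F)\<^sup>2) = EE n (\<lambda>x. F x * F x) - EE n (\<lambda>x. (2 * EE n F) * F x) + EE n (\<lambda>x. EE n F * EE n F)"
    by (simp add: EE_add EE_diff nice_intros assms)
  then show ?thesis by (simp add: power2_eq_square)
qed

text \<open>In the loop equation at \<open>t = 0\<close> divided by \<open>(qn n)\<^sup>2\<close>,
  the variance of the resolvent sum and the term with \<open>Bw\<close> disappear in the limit,
  leaving \<open>(1 - x0\<^sup>2) * m\<^sup>2 + 1 = 0\<close> for the limit
  \<open>m\<close>.\<close>

lemma mR_sq_tendsto:
  assumes \<zeta>: "Im \<zeta> \<noteq> 0"
  shows "(\<lambda>n. (mR n \<zeta>)\<^sup>2) \<longlonglongrightarrow> - 1 / of_real (1 - x0\<^sup>2)"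
proof -
  obtain C where C: "0 \<le> C" "\<And>n. n \<ge> 1 \<Longrightarrow> EE n (\<lambda>x. (norm (RR n \<zeta> x - EE n (RR n \<zeta>)))\<^sup>2) \<le> C"
    using RR_dev[OF \<zeta>] by blast
  obtain D where D: "0 \<le> D" "\<And>n. norm (EE n (HH n \<zeta>)) \<le> D * real n" using HH_mean[OF \<zeta>] by blast
  define a where "a n = EE n (HH n \<zeta>) / of_real (Nn n) / (of_real (qn n))\<^sup>2" for n
  define v where "v n = EE n (\<lambda>x. (RR n \<zeta> x - EE n (RR n \<zeta>))\<^sup>2) / (of_real (qn n))\<^sup>2" for n
  have a0: "a \<longlonglongrightarrow> 0"
  proof (rule Lim_null_comparison)
    show "(\<lambda>n. D * (1 / qn n)) \<longlonglongrightarrow> 0" using tendsto_mult_right_zero[OF inverse_qn_tendsto] by simp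
    show "\<forall>\<^sub>F n in sequentially. norm (a n) \<le> D * (1 / qn n)"
      unfolding eventually_at_top_linorder
    proof (intro exI allI impI)
      fix n :: nat assume n: "n \<ge> 1"
      have N: "1 \<le> Nn n" and q: "1 \<le> qn n" using Nn_ge_1[OF n] qn_ge_1[OF n] by auto
      have "norm (a n) = norm (EE n (HH n \<zeta>)) / Nn n / (qn n)\<^sup>2"
        unfolding a_def norm_divide norm_power norm_of_real using N q by simp
      also have "\<dots> \<le> D * real n / Nn n / (qn n)\<^sup>2"
        using N q D by (intro divide_right_mono) auto
      also have "\<dots> = D * (1 / qn n)"
        using N q by (simp add: qn_def power2_eq_square)
      finally show "norm (a n) \<le> D * (1 / qn n)" .
    qed
  qed
  have v0: "v \<longlonglongrightarrow> 0"
  proof (rule Lim_null_comparison)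
    show "(\<lambda>n. C * (1 / qn n)) \<longlonglongrightarrow> 0" using tendsto_mult_right_zero[OF inverse_qn_tendsto] by simp
    show "\<forall>\<^sub>F n in sequentially. norm (v n) \<le> C * (1 / qn n)"
      unfolding eventually_at_top_linorder
    proof (intro exI allI impI)
      fix n :: nat assume n: "n \<ge> 1"
      have q: "1 \<le> qn n" using qn_ge_1[OF n] by auto
      have "norm (EE n (\<lambda>x. (RR n \<zeta> x - EE n (RR n \<zeta>))\<^sup>2)) \<le> EE n (\<lambda>x. norm ((RR n \<zeta> x - EE n (RR n \<zeta>))\<^sup>2))"
        by (rule EE_norm_le)
      also have "\<dots> \<le> C" using C(2)[OF n] by (simp add: norm_power)
      finally have "norm (v n) \<le> C / (qn n)\<^sup>2"
        using q by (simp add: v_def norm_divide norm_power divide_right_mono)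
      also have "\<dots> \<le> C / qn n"
      proof (rule divide_left_mono)
        show "qn n \<le> (qn n)\<^sup>2" using q by (simp add: power2_eq_square)
      qed (use q C in auto)
      finally show "norm (v n) \<le> C * (1 / qn n)" by simp
    qed
  qed
  have ev: "\<forall>\<^sub>F n in sequentially. - (1 + a n) / AA n \<zeta> - v n = (mR n \<zeta>)\<^sup>2"
    unfolding eventually_at_top_linorder
  proof (intro exI allI impI)
    fix n :: nat assume n: "n \<ge> 1"
    have q: "complex_of_real (qn n) \<noteq> 0" using qn_ge_1[OF n] by simp
    have A: "AA n \<zeta> \<noteq> 0" by (rule AA_nonzero[OF \<zeta> n])
    define q2 where "q2 = (complex_of_real (qn n))\<^sup>2"
    have q2: "q2 \<noteq> 0" using q by (simp add: q2_def)
    have "EE n (\<lambda>x. (RR n \<zeta> x)\<^sup>2) = v n * q2 + (EE n (RR n \<zeta>))\<^sup>2"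
      using EE_centered_sq[OF nice_RR[OF \<zeta>]] q2 by (simp add: v_def q2_def)
    moreover have "EE n (HH n \<zeta>) / of_real (Nn n) = a n * q2" using q2 by (simp add: a_def q2_def)
    ultimately have "AA n \<zeta> * (v n * q2 + (EE n (RR n \<zeta>))\<^sup>2) + q2 + a n * q2 = 0"
      using loop_zero[OF \<zeta> n] by (simp add: q2_def)
    moreover have "(EE n (RR n \<zeta>))\<^sup>2 = (mR n \<zeta>)\<^sup>2 * q2" using q by (simp add: mR_def q2_def power_divide)
    ultimately have "q2 * (AA n \<zeta> * (v n + (mR n \<zeta>)\<^sup>2) + 1 + a n) = 0" by (simp add: algebra_simps)
    then have "AA n \<zeta> * (v n + (mR n \<zeta>)\<^sup>2) + 1 + a n = 0" using q2 by (simp only: mult_eq_0_iff) simp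
    then have "AA n \<zeta> * (v n + (mR n \<zeta>)\<^sup>2) = - (1 + a n)" by (simp only: eq_neg_iff_add_eq_0 add.assoc)
    then have "v n + (mR n \<zeta>)\<^sup>2 = - (1 + a n) / AA n \<zeta>" using A by (simp add: field_simps)
    then show "- (1 + a n) / AA n \<zeta> - v n = (mR n \<zeta>)\<^sup>2" by (simp add: algebra_simps)
  qed
  have "(\<lambda>n. - (1 + a n) / AA n \<zeta> - v n) \<longlonglongrightarrow> - (1 + 0) / of_real (1 - x0\<^sup>2) - 0"
    using x0_sq by (intro tendsto_intros a0 v0 AA_tendsto) (simp del: of_real_diff)
  then show ?thesis using Lim_transform_eventually[OF _ ev] by simp
qed

text \<open>The imaginary part of a resolvent is \<open>- Im \<zeta>\<close> times its squared
  modulus. The identity serves twice: it fixes the branch of the square root, and it bounds the mean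
  of the squared moduli.\<close>

lemma mR_sign:
  assumes \<zeta>: "Im \<zeta> \<noteq> 0" and n: "n \<ge> 1"
  shows "EE n (LS n (\<lambda>x. (norm (rz \<zeta> (sc n x)))\<^sup>2)) / qn n = - Im (mR n \<zeta>) / Im \<zeta>"
proof -
  have q: "0 < qn n" using qn_ge_1[OF n] by simp
  have "Im (EE n (RR n \<zeta>)) = EE n (\<lambda>x. Im (RR n \<zeta> x))"
    using integral_Im[OF nice_integrable[OF nice_RR[OF \<zeta>]]] by simp
  also have "(\<lambda>x. Im (RR n \<zeta> x)) = (\<lambda>x. - Im \<zeta> * LS n (\<lambda>x. (norm (rz \<zeta> (sc n x)))\<^sup>2) x)"
    by (rule ext) (simp add: RR_def LS_def Im_rz sum_distrib_left sum_negf)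
  finally have "Im (EE n (RR n \<zeta>)) = - Im \<zeta> * EE n (LS n (\<lambda>x. (norm (rz \<zeta> (sc n x)))\<^sup>2))"
    by simp
  then show ?thesis using \<zeta> q by (simp add: mR_def Im_divide_of_real field_simps)
qed

lemma mR_sign': "Im \<zeta> \<noteq> 0 \<Longrightarrow> n \<ge> 1 \<Longrightarrow> Im (mR n \<zeta>) * sgn (Im \<zeta>) \<le> 0"
proof -
  assume \<zeta>: "Im \<zeta> \<noteq> 0" and n: "n \<ge> 1"
  have "0 \<le> EE n (LS n (\<lambda>x. (norm (rz \<zeta> (sc n x)))\<^sup>2)) / qn n"
    unfolding LS_def using qn_ge_1[OF n] by (intro divide_nonneg_nonneg Bochner_Integration.integral_nonneg sum_nonneg) auto
  then have "0 \<le> - Im (mR n \<zeta>) / Im \<zeta>" unfolding mR_sign[OF \<zeta> n] .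
  then show ?thesis using \<zeta> by (cases "Im \<zeta>" "0::real" rule: linorder_cases) (auto simp: zero_le_divide_iff divide_le_0_iff)
qed

text \<open>The imaginary parts of \<open>mR n \<zeta>\<close> and of the limit are never of
  opposite sign, so the sum of the two stays at distance \<open>s\<close> from zero and can be
  divided out of the difference of squares.\<close>

lemma mR_tendsto:
  assumes \<zeta>: "Im \<zeta> \<noteq> 0"
  shows "(\<lambda>n. mR n \<zeta>) \<longlonglongrightarrow> mlim \<zeta>"
proof -
  define s where "s = 1 / sqrt (1 - x0\<^sup>2)"
  define w where "w = mlim \<zeta>"
  have s: "0 < s" using x0_sq by (simp add: s_def)
  have w: "w = - \<i> * of_real (sgn (Im \<zeta>) * s)" by (simp add: w_def mlim_def s_def)
  have sg: "(sgn (Im \<zeta>))\<^sup>2 = 1" using \<zeta> by (simp add: sgn_real_def)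
  have w2: "w\<^sup>2 = - 1 / of_real (1 - x0\<^sup>2)"
  proof -
    have "w\<^sup>2 = - of_real ((sgn (Im \<zeta>) * s)\<^sup>2)" unfolding w by (simp add: power_mult_distrib)
    also have "(sgn (Im \<zeta>) * s)\<^sup>2 = 1 / (1 - x0\<^sup>2)" using x0_sq by (simp add: power_mult_distrib sg s_def power_divide)
    finally show ?thesis by simp
  qed
  have "(\<lambda>n. (mR n \<zeta>)\<^sup>2 - w\<^sup>2) \<longlonglongrightarrow> 0"
    using mR_sq_tendsto[OF \<zeta>] unfolding w2 by (rule LIM_zero)
  then have l: "(\<lambda>n. norm ((mR n \<zeta>)\<^sup>2 - w\<^sup>2) / s) \<longlonglongrightarrow> 0"
    using tendsto_divide[OF tendsto_norm_zero tendsto_const[of s]] s by force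
  have "(\<lambda>n. mR n \<zeta> - w) \<longlonglongrightarrow> 0"
  proof (rule Lim_null_comparison[OF _ l])
    show "\<forall>\<^sub>F n in sequentially. norm (mR n \<zeta> - w) \<le> norm ((mR n \<zeta>)\<^sup>2 - w\<^sup>2) / s"
      unfolding eventually_at_top_linorder
    proof (intro exI allI impI)
      fix n :: nat assume n: "n \<ge> 1"
      have "s \<le> \<bar>Im (mR n \<zeta> + w)\<bar>"
      proof -
        have i: "Im (mR n \<zeta> + w) = Im (mR n \<zeta>) - sgn (Im \<zeta>) * s" by (simp add: w)
        show ?thesis unfolding i using mR_sign'[OF \<zeta> n] \<zeta> s by (cases "Im \<zeta> > 0") auto
      qed
      also have "\<dots> \<le> norm (mR n \<zeta> + w)" by (rule abs_Im_le_cmod)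
      finally have "norm (mR n \<zeta> - w) * s \<le> norm (mR n \<zeta> - w) * norm (mR n \<zeta> + w)" by (intro mult_left_mono) auto
      also have "\<dots> = norm ((mR n \<zeta>)\<^sup>2 - w\<^sup>2)" by (simp add: norm_mult[symmetric] power2_eq_square algebra_simps)
      finally show "norm (mR n \<zeta> - w) \<le> norm ((mR n \<zeta>)\<^sup>2 - w\<^sup>2) / s" using s by (simp add: pos_le_divide_eq)
    qed
  qed
  then show ?thesis unfolding w_def by (rule LIM_zero_cancel)
qed

lemma sq_mass_bound:
  assumes \<zeta>: "Im \<zeta> \<noteq> 0"
  shows "\<exists>K\<ge>0. \<forall>n\<ge>1. EE n (LS n (\<lambda>x. (norm (rz \<zeta> (sc n x)))\<^sup>2)) / qn n \<le> K"
proof -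
  have "Bseq (\<lambda>n. mR n \<zeta>)" using mR_tendsto[OF \<zeta>] convergentI convergent_imp_Bseq by blast
  then obtain B where B: "0 < B" "\<And>n. norm (mR n \<zeta>) \<le> B" by (auto simp: Bseq_def)
  have "EE n (LS n (\<lambda>x. (norm (rz \<zeta> (sc n x)))\<^sup>2)) / qn n \<le> B / \<bar>Im \<zeta>\<bar>" if n: "n \<ge> 1" for n
  proof -
    have "- Im (mR n \<zeta>) / Im \<zeta> \<le> \<bar>- Im (mR n \<zeta>) / Im \<zeta>\<bar>" by (rule abs_ge_self)
    also have "\<dots> = \<bar>Im (mR n \<zeta>)\<bar> / \<bar>Im \<zeta>\<bar>" by (simp add: abs_divide)
    also have "\<dots> \<le> B / \<bar>Im \<zeta>\<bar>" using B(2)[of n] abs_Im_le_cmod[of "mR n \<zeta>"] by (intro divide_right_mono) auto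
    finally show ?thesis unfolding mR_sign[OF \<zeta> n] .
  qed
  then show ?thesis using B(1) by (intro exI[of _ "B / \<bar>Im \<zeta>\<bar>"]) auto
qed

lemma EE_LS_compare:
  fixes g :: "real \<Rightarrow> complex" and k :: "real \<Rightarrow> real"
  assumes "continuous_on UNIV g" "continuous_on UNIV k" "\<And>x. x \<in> {-1..1} \<Longrightarrow> norm (g x) \<le> k x"
  shows "norm (EE n (LS n g)) \<le> EE n (LS n k)"
proof -
  have "norm (EE n (LS n g)) \<le> EE n (\<lambda>x. norm (LS n g x))" by (rule EE_norm_le)
  also have "\<dots> \<le> EE n (LS n k)"
  proof (rule EE_mono)
    show "nice n (\<lambda>x. norm (LS n g x))" "nice n (LS n k)" by (intro nice_intros nice_LS assms)+
    fix x :: "nat \<Rightarrow> real" assume x: "\<And>j. j < n \<Longrightarrow> x j \<in> {-1..1}"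
    have "norm (LS n g x) \<le> (\<Sum>j<n. norm (g (x j)))" unfolding LS_def by (rule norm_sum)
    also have "\<dots> \<le> LS n k x" unfolding LS_def using assms(3) x by (intro sum_mono) auto
    finally show "norm (LS n g x) \<le> LS n k x" .
  qed
  finally show ?thesis .
qed

lemma LS_diff: "LS n (\<lambda>x. g x - k x) = (\<lambda>x. LS n g x - LS n k x)"
  by (rule ext) (simp add: LS_def sum_subtractf)

lemma LS_cmult:
  fixes c :: "'a::real_normed_algebra"
  shows "LS n (\<lambda>x. c * g x) = (\<lambda>x. c * LS n g x)"
  by (rule ext) (simp add: LS_def sum_distrib_left)

lemma EE_LS_diff:
  fixes g k :: "real \<Rightarrow> complex"
  shows "continuous_on UNIV g \<Longrightarrow> continuous_on UNIV k \<Longrightarrow> EE n (LS n (\<lambda>x. g x - k x)) = EE n (LS n g) - EE n (LS n k)"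
  unfolding LS_diff by (intro EE_diff nice_LS)

lemma EE_LS_cmult:
  fixes c :: complex
  shows "EE n (LS n (\<lambda>x. c * g x)) = c * EE n (LS n g)"
  unfolding LS_cmult by simp

lemma scaled_compare:
  fixes g :: "real \<Rightarrow> complex" and k :: "real \<Rightarrow> real"
  assumes n: "n \<ge> 1" and g: "continuous_on UNIV g" and k: "continuous_on UNIV k" and c: "0 \<le> c"
    and le: "\<And>x. x \<in> {-1..1} \<Longrightarrow> norm (g x) \<le> c * k x" and K: "EE n (LS n k) / qn n \<le> K"
  shows "norm (EE n (LS n g) / of_real (qn n)) \<le> K * c"
proof -
  have q: "0 < qn n" using qn_ge_1[OF n] by simp
  have "norm (EE n (LS n g)) \<le> EE n (LS n (\<lambda>x. c * k x))"
    by (intro EE_LS_compare g continuous_intros k le)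
  also have "\<dots> = c * EE n (LS n k)" unfolding LS_cmult by simp
  finally have "norm (EE n (LS n g) / of_real (qn n)) \<le> c * (EE n (LS n k) / qn n)"
    using q by (simp add: norm_divide divide_right_mono)
  also have "\<dots> \<le> c * K" by (rule mult_left_mono[OF K c])
  finally show ?thesis by (simp add: mult.commute)
qed

section \<open>Means of products of resolvents\<close>

definition L2 :: "nat \<Rightarrow> complex \<Rightarrow> complex \<Rightarrow> complex" where
  "L2 n \<zeta> \<xi> = EE n (LS n (\<lambda>x. rz \<zeta> (sc n x) * rz \<xi> (sc n x))) / of_real (qn n)"

text \<open>The derivative of a resolvent combination consists of squared resolvents, which is why a
  product with one square occurs in the mean of the test-function term.\<close>

definition L3 :: "nat \<Rightarrow> complex \<Rightarrow> complex \<Rightarrow> complex" where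
  "L3 n \<zeta> \<xi> = EE n (LS n (\<lambda>x. rz \<zeta> (sc n x) * (rz \<xi> (sc n x))\<^sup>2)) / of_real (qn n)"

text \<open>Partial fractions reduce a product of two resolvents to a difference of single
  ones.\<close>

lemma L2_eq:
  assumes "Im \<zeta> \<noteq> 0" "Im \<xi> \<noteq> 0" "\<zeta> \<noteq> \<xi>"
  shows "L2 n \<zeta> \<xi> = (mR n \<xi> - mR n \<zeta>) / (\<zeta> - \<xi>)"
proof -
  have "EE n (LS n (\<lambda>x. rz \<zeta> (sc n x) - rz \<xi> (sc n x))) = (\<xi> - \<zeta>) * EE n (LS n (\<lambda>x. rz \<zeta> (sc n x) * rz \<xi> (sc n x)))"
    unfolding rz_diff_pole[OF assms(1,2)] by (rule EE_LS_cmult)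
  then have "EE n (RR n \<zeta>) - EE n (RR n \<xi>) = (\<xi> - \<zeta>) * EE n (LS n (\<lambda>x. rz \<zeta> (sc n x) * rz \<xi> (sc n x)))"
    unfolding RR_def by (subst (asm) EE_LS_diff) (use cont_rz assms in auto)
  then have "mR n \<zeta> - mR n \<xi> = (\<xi> - \<zeta>) * L2 n \<zeta> \<xi>"
    by (simp add: mR_def L2_def diff_divide_distrib[symmetric])
  then show ?thesis using assms(3) by (simp add: field_simps)
qed

text \<open>The pole moves away from the real axis by \<delta>, so it stays in its half-plane,
  \<open>mlim\<close> is unchanged, and resolvent bounds in terms of \<open>Im \<zeta>\<close>
  persist.\<close>

definition shift :: "complex \<Rightarrow> real \<Rightarrow> complex" where
  "shift \<zeta> \<delta> = \<zeta> + \<i> * of_real (\<delta> * sgn (Im \<zeta>))"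

lemma shift_props:
  assumes "Im \<zeta> \<noteq> 0" "0 < \<delta>"
  shows "Im (shift \<zeta> \<delta>) \<noteq> 0" "sgn (Im (shift \<zeta> \<delta>)) = sgn (Im \<zeta>)" "shift \<zeta> \<delta> \<noteq> \<zeta>"
    "norm (shift \<zeta> \<delta> - \<zeta>) = \<delta>" "norm (rz (shift \<zeta> \<delta>) u) \<le> 1 / \<bar>Im \<zeta>\<bar>" "mlim (shift \<zeta> \<delta>) = mlim \<zeta>"
proof -
  have i: "Im (shift \<zeta> \<delta>) = Im \<zeta> + \<delta> * sgn (Im \<zeta>)" by (simp add: shift_def)
  show a: "Im (shift \<zeta> \<delta>) \<noteq> 0" and b: "sgn (Im (shift \<zeta> \<delta>)) = sgn (Im \<zeta>)" and "shift \<zeta> \<delta> \<noteq> \<zeta>"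
    using assms by (auto simp: i sgn_real_def shift_def)
  show "norm (shift \<zeta> \<delta> - \<zeta>) = \<delta>" using assms by (simp add: shift_def norm_mult sgn_real_def)
  have "\<bar>Im \<zeta>\<bar> \<le> \<bar>Im (shift \<zeta> \<delta>)\<bar>" using assms by (auto simp: i sgn_real_def)
  then have "1 / \<bar>Im (shift \<zeta> \<delta>)\<bar> \<le> 1 / \<bar>Im \<zeta>\<bar>" using assms by (intro frac_le) auto
  then show "norm (rz (shift \<zeta> \<delta>) u) \<le> 1 / \<bar>Im \<zeta>\<bar>" using norm_rz_le[OF a, of u] by linarith
  show "mlim (shift \<zeta> \<delta>) = mlim \<zeta>" by (simp add: mlim_def b)
qed

text \<open>For coinciding poles the difference quotient in \<open>L2_eq\<close> is void (\<open>0 / 0 = 0\<close>); one pole is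
  therefore shifted by \<open>\<delta>\<close> and the error estimated uniformly in \<open>n\<close>.\<close>

lemma L2_tendsto:
  assumes \<zeta>: "Im \<zeta> \<noteq> 0" and \<xi>: "Im \<xi> \<noteq> 0"
  shows "(\<lambda>n. L2 n \<zeta> \<xi>) \<longlonglongrightarrow> (mlim \<xi> - mlim \<zeta>) / (\<zeta> - \<xi>)"
proof (cases "\<zeta> = \<xi>")
  case False
  then show ?thesis unfolding L2_eq[OF assms False]
    by (intro tendsto_intros mR_tendsto assms) auto
next
  case True
  obtain K where K: "0 \<le> K" "\<And>n. n \<ge> 1 \<Longrightarrow> EE n (LS n (\<lambda>x. (norm (rz \<zeta> (sc n x)))\<^sup>2)) / qn n \<le> K"
    using sq_mass_bound[OF \<zeta>] by blast
  have "(\<lambda>n. L2 n \<zeta> \<zeta>) \<longlonglongrightarrow> 0"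
  proof (rule tendsto_zero_approx)
    show "0 \<le> K / \<bar>Im \<zeta>\<bar>" using K by simp
    fix \<delta> :: real assume d: "0 < \<delta>" "\<delta> \<le> 1"
    define \<eta> where "\<eta> = shift \<zeta> \<delta>"
    note sp = shift_props[OF \<zeta> d(1), folded \<eta>_def]
    have "(\<lambda>n. L2 n \<zeta> \<eta>) \<longlonglongrightarrow> (mlim \<eta> - mlim \<zeta>) / (\<zeta> - \<eta>)"
      unfolding L2_eq[OF \<zeta> sp(1) sp(3)[symmetric]] using sp(3) by (intro tendsto_intros mR_tendsto \<zeta> sp(1)) auto
    then have l: "(\<lambda>n. L2 n \<zeta> \<eta>) \<longlonglongrightarrow> 0" by (simp add: sp(6))
    have "norm (L2 n \<zeta> \<zeta>) \<le> norm (L2 n \<zeta> \<eta>) + K / \<bar>Im \<zeta>\<bar> * \<delta>" if n: "n \<ge> 1" for n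
    proof -
      have q: "0 < qn n" using qn_ge_1[OF n] by simp
      let ?r = "\<lambda>x. rz \<zeta> (sc n x)" and ?s = "\<lambda>x. rz \<eta> (sc n x)"
      have "norm (EE n (LS n (\<lambda>x. ?r x * ?r x - ?r x * ?s x)) / of_real (qn n)) \<le> K * (\<delta> / \<bar>Im \<zeta>\<bar>)"
      proof (rule scaled_compare[OF n _ _ _ _ K(2)[OF n]])
        fix x
        have "norm (?r x * ?r x - ?r x * ?s x) = norm (?r x) * norm (?r x - ?s x)"
          by (simp add: norm_mult[symmetric] right_diff_distrib)
        also have "\<dots> = norm (?r x) * (\<delta> * (norm (?r x) * norm (?s x)))"
          unfolding rz_diff_pole[OF \<zeta> sp(1)] by (simp add: norm_mult sp(4))
        also have "\<dots> \<le> norm (?r x) * (\<delta> * (norm (?r x) * (1 / \<bar>Im \<zeta>\<bar>)))"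
          using sp(5) d by (intro mult_left_mono) auto
        finally show "norm (?r x * ?r x - ?r x * ?s x) \<le> (\<delta> / \<bar>Im \<zeta>\<bar>) * (norm (?r x))\<^sup>2"
          by (simp add: power2_eq_square mult_ac)
      next
        show "0 \<le> \<delta> / \<bar>Im \<zeta>\<bar>" using d by simp
      qed (intro continuous_intros cont_rz \<zeta> sp(1))+
      moreover have "EE n (LS n (\<lambda>x. ?r x * ?r x - ?r x * ?s x)) = EE n (LS n (\<lambda>x. ?r x * ?r x)) - EE n (LS n (\<lambda>x. ?r x * ?s x))"
        by (intro EE_LS_diff continuous_intros cont_rz \<zeta> sp(1))
      ultimately have "norm (L2 n \<zeta> \<zeta> - L2 n \<zeta> \<eta>) \<le> K / \<bar>Im \<zeta>\<bar> * \<delta>"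
        by (simp only: L2_def diff_divide_distrib times_divide_eq_left times_divide_eq_right)
      then show ?thesis using norm_triangle_sub[of "L2 n \<zeta> \<zeta>" "L2 n \<zeta> \<eta>"] by simp
    qed
    with l show "\<exists>b :: nat \<Rightarrow> complex. b \<longlonglongrightarrow> 0 \<and> (\<forall>n\<ge>1. norm (L2 n \<zeta> \<zeta>) \<le> norm (b n) + K / \<bar>Im \<zeta>\<bar> * \<delta>)"
      by (intro exI[of _ "\<lambda>n. L2 n \<zeta> \<eta>"] conjI) auto
  qed
  then show ?thesis using True by simp
qed

lemma L3_eq:
  assumes "Im \<zeta> \<noteq> 0" "Im \<xi> \<noteq> 0" "\<zeta> \<noteq> \<xi>"
  shows "L3 n \<zeta> \<xi> = (L2 n \<xi> \<xi> - L2 n \<zeta> \<xi>) / (\<zeta> - \<xi>)"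
proof -
  let ?r = "\<lambda>x. rz \<zeta> (sc n x)" and ?s = "\<lambda>x. rz \<xi> (sc n x)"
  have "?s x * ?s x - ?r x * ?s x = (\<zeta> - \<xi>) * (?r x * (?s x)\<^sup>2)" for x
  proof -
    have "?s x * ?s x - ?r x * ?s x = - ((?r x - ?s x) * ?s x)" by (simp add: algebra_simps)
    also have "\<dots> = (\<zeta> - \<xi>) * (?r x * (?s x)\<^sup>2)"
      unfolding rz_diff_pole[OF assms(1,2)] by (simp add: power2_eq_square algebra_simps)
    finally show ?thesis .
  qed
  then have "EE n (LS n (\<lambda>x. ?s x * ?s x - ?r x * ?s x)) = (\<zeta> - \<xi>) * EE n (LS n (\<lambda>x. ?r x * (?s x)\<^sup>2))"
    by (simp only: EE_LS_cmult)
  moreover have "EE n (LS n (\<lambda>x. ?s x * ?s x - ?r x * ?s x)) = EE n (LS n (\<lambda>x. ?s x * ?s x)) - EE n (LS n (\<lambda>x. ?r x * ?s x))"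
    by (intro EE_LS_diff continuous_intros cont_rz assms)
  ultimately have "L2 n \<xi> \<xi> - L2 n \<zeta> \<xi> = (\<zeta> - \<xi>) * L3 n \<zeta> \<xi>"
    by (simp add: L2_def L3_def diff_divide_distrib[symmetric])
  then show ?thesis using assms(3) by (simp add: field_simps)
qed

text \<open>For equal poles the stated limit reads \<open>0 / 0 = 0\<close>. This is the right
  value, as the third power of a resolvent has integral zero; it is obtained by shifting the pole of
  one factor.\<close>

lemma L3_tendsto:
  assumes \<zeta>: "Im \<zeta> \<noteq> 0" and \<xi>: "Im \<xi> \<noteq> 0"
  shows "(\<lambda>n. L3 n \<zeta> \<xi>) \<longlonglongrightarrow> (mlim \<zeta> - mlim \<xi>) / (\<zeta> - \<xi>)\<^sup>2"
proof (cases "\<zeta> = \<xi>")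
  case False
  \<comment> \<open>The quotient with denominator \<open>\<xi> - \<xi>\<close> is 0, which is the
    limit that \<open>L2_tendsto\<close> asserts for equal poles.\<close>
  have "(\<lambda>n. L3 n \<zeta> \<xi>) \<longlonglongrightarrow> ((mlim \<xi> - mlim \<xi>) / (\<xi> - \<xi>) - (mlim \<xi> - mlim \<zeta>) / (\<zeta> - \<xi>)) / (\<zeta> - \<xi>)"
    unfolding L3_eq[OF assms False] using False by (intro tendsto_divide tendsto_diff L2_tendsto tendsto_const assms) auto
  also have "((mlim \<xi> - mlim \<xi>) / (\<xi> - \<xi>) - (mlim \<xi> - mlim \<zeta>) / (\<zeta> - \<xi>)) / (\<zeta> - \<xi>) = (mlim \<zeta> - mlim \<xi>) / (\<zeta> - \<xi>)\<^sup>2"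
    using False by (simp add: power2_eq_square diff_divide_distrib)
  finally show ?thesis .
next
  case True
  obtain K where K: "0 \<le> K" "\<And>n. n \<ge> 1 \<Longrightarrow> EE n (LS n (\<lambda>x. (norm (rz \<zeta> (sc n x)))\<^sup>2)) / qn n \<le> K"
    using sq_mass_bound[OF \<zeta>] by blast
  define J where "J = 1 / \<bar>Im \<zeta>\<bar>"
  have J: "0 \<le> J" "\<And>u. norm (rz \<zeta> u) \<le> J" using norm_rz_le[OF \<zeta>] by (auto simp: J_def)
  have "(\<lambda>n. L3 n \<zeta> \<zeta>) \<longlonglongrightarrow> 0"
  proof (rule tendsto_zero_approx)
    show "0 \<le> K * (J * J)" using K J by simp
    fix \<delta> :: real assume d: "0 < \<delta>" "\<delta> \<le> 1"
    define \<eta> where "\<eta> = shift \<zeta> \<delta>"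
    note sp = shift_props[OF \<zeta> d(1), folded \<eta>_def J_def]
    have "(\<lambda>n. L3 n \<eta> \<zeta>) \<longlonglongrightarrow> ((mlim \<zeta> - mlim \<zeta>) / (\<zeta> - \<zeta>) - (mlim \<zeta> - mlim \<eta>) / (\<eta> - \<zeta>)) / (\<eta> - \<zeta>)"
      unfolding L3_eq[OF sp(1) \<zeta> sp(3)] using sp(3) by (intro tendsto_divide tendsto_diff L2_tendsto tendsto_const \<zeta> sp(1)) auto
    then have l: "(\<lambda>n. L3 n \<eta> \<zeta>) \<longlonglongrightarrow> 0" by (simp add: sp(6))
    have "norm (L3 n \<zeta> \<zeta>) \<le> norm (L3 n \<eta> \<zeta>) + K * (J * J) * \<delta>" if n: "n \<ge> 1" for n
    proof -
      have q: "0 < qn n" using qn_ge_1[OF n] by simp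
      let ?r = "\<lambda>x. rz \<zeta> (sc n x)" and ?s = "\<lambda>x. rz \<eta> (sc n x)"
      have "norm (EE n (LS n (\<lambda>x. ?r x * (?r x)\<^sup>2 - ?s x * (?r x)\<^sup>2)) / of_real (qn n)) \<le> K * (\<delta> * (J * J))"
      proof (rule scaled_compare[OF n _ _ _ _ K(2)[OF n]])
        fix x
        have "norm (?r x * (?r x)\<^sup>2 - ?s x * (?r x)\<^sup>2) = norm (?r x - ?s x) * (norm (?r x))\<^sup>2"
          by (simp add: norm_mult[symmetric] norm_power[symmetric] left_diff_distrib)
        also have "\<dots> = (\<delta> * (norm (?r x) * norm (?s x))) * (norm (?r x))\<^sup>2"
          unfolding rz_diff_pole[OF \<zeta> sp(1)] by (simp add: norm_mult sp(4))
        also have "\<dots> \<le> (\<delta> * (J * J)) * (norm (?r x))\<^sup>2"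
          using sp(5) d J by (intro mult_right_mono mult_left_mono mult_mono) auto
        finally show "norm (?r x * (?r x)\<^sup>2 - ?s x * (?r x)\<^sup>2) \<le> (\<delta> * (J * J)) * (norm (?r x))\<^sup>2" .
      next
        show "0 \<le> \<delta> * (J * J)" using d J by simp
      qed (intro continuous_intros cont_rz \<zeta> sp(1))+
      moreover have "EE n (LS n (\<lambda>x. ?r x * (?r x)\<^sup>2 - ?s x * (?r x)\<^sup>2)) = EE n (LS n (\<lambda>x. ?r x * (?r x)\<^sup>2)) - EE n (LS n (\<lambda>x. ?s x * (?r x)\<^sup>2))"
        by (intro EE_LS_diff continuous_intros cont_rz \<zeta> sp(1))
      ultimately have "norm (L3 n \<zeta> \<zeta> - L3 n \<eta> \<zeta>) \<le> K * (\<delta> * (J * J))"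
        by (simp only: L3_def diff_divide_distrib)
      then have "norm (L3 n \<zeta> \<zeta> - L3 n \<eta> \<zeta>) \<le> K * (J * J) * \<delta>" by (simp add: mult_ac)
      then show ?thesis using norm_triangle_sub[of "L3 n \<zeta> \<zeta>" "L3 n \<eta> \<zeta>"] by simp
    qed
    with l show "\<exists>b :: nat \<Rightarrow> complex. b \<longlonglongrightarrow> 0 \<and> (\<forall>n\<ge>1. norm (L3 n \<zeta> \<zeta>) \<le> norm (b n) + K * (J * J) * \<delta>)"
      by (intro exI[of _ "\<lambda>n. L3 n \<eta> \<zeta>"] conjI) auto
  qed
  then show ?thesis using True by simp
qed

end

section \<open>The characteristic function of resolvent combinations\<close>

lemma chordal_sum:
  assumes "finite I" "\<And>k. k \<in> I \<Longrightarrow> \<exists>M. chordal (F k) M"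
  shows "\<exists>M. chordal (\<lambda>u. \<Sum>k\<in>I. F k u) M"
  using assms
proof (induction I)
  case empty
  show ?case using chordal_const[of 0] by auto
next
  case (insert k I)
  then obtain M L where "chordal (F k) M" "chordal (\<lambda>u. \<Sum>k\<in>I. F k u) L" by blast
  from chordal_add[OF this] show ?case using insert.hyps by auto
qed

lemma chordal_rz_sq:
  assumes "Im \<zeta> \<noteq> 0"
  shows "\<exists>M. chordal (\<lambda>u. (rz \<zeta> u)\<^sup>2) M"
proof -
  obtain M where M: "chordal (rz \<zeta>) M" using chordal_rz[OF assms] by blast
  from chordal_mult[OF M M norm_rz_le[OF assms] norm_rz_le[OF assms]]
  show ?thesis unfolding power2_eq_square by blast
qed

lemma cw_eq_rz: "cw u = norm (rz \<i> u)"
proof -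
  have "norm (\<i> - of_real u) = sqrt (1 + u\<^sup>2)" by (simp add: cmod_def add.commute)
  then show ?thesis by (simp add: cw_def rz_def norm_divide)
qed

text \<open>The integrating factor \<open>exp (s2 * t\<^sup>2 / 2)\<close> turns the perturbed
  equation into a bound on a derivative; between 0 and \<open>t\<close> the factor is largest at
  \<open>t\<close>, so it cancels when dividing again.\<close>

lemma gaussian_ode:
  fixes \<phi> D :: "real \<Rightarrow> complex"
  assumes d: "\<And>t. (\<phi> has_vector_derivative D t) (at t)" and b: "\<And>t. norm (D t + of_real (s2 * t) * \<phi> t) \<le> (1 + \<bar>t\<bar>) * \<epsilon>"
    and \<phi>0: "\<phi> 0 = 1" and s2: "0 \<le> s2"
  shows "norm (\<phi> t - of_real (exp (- s2 * t\<^sup>2 / 2))) \<le> \<bar>t\<bar> * (1 + \<bar>t\<bar>) * \<epsilon>"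
proof -
  define w where "w t = exp (s2 * t\<^sup>2 / 2)" for t
  have e0: "0 \<le> \<epsilon>" using order.trans[OF norm_ge_zero b[of 0]] by simp
  define \<psi> where "\<psi> t = \<phi> t * of_real (w t)" for t
  have wd: "(w has_real_derivative w t * (s2 * t)) (at t)" for t
    unfolding w_def[abs_def] by (auto intro!: derivative_eq_intros)
  have "(\<psi> has_vector_derivative (\<phi> t * of_real (w t * (s2 * t)) + D t * of_real (w t))) (at t)" for t
    unfolding \<psi>_def[abs_def] by (rule has_vector_derivative_mult[OF d has_vector_derivative_of_real[OF wd]])
  then have \<psi>d: "(\<psi> has_vector_derivative (D t + of_real (s2 * t) * \<phi> t) * of_real (w t)) (at t)" for t
    by (rule has_vector_derivative_eq_rhs) (simp add: algebra_simps)
  define S where "S = {-\<bar>t\<bar>..\<bar>t\<bar>}"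
  have "norm (\<psi> t - \<psi> 0) \<le> ((1 + \<bar>t\<bar>) * \<epsilon> * w t) * norm (t - 0)"
  proof (rule differentiable_bound[of S \<psi> "\<lambda>u h. h *\<^sub>R ((D u + of_real (s2 * u) * \<phi> u) * of_real (w u))"])
    show "convex S" by (simp add: S_def)
    fix u assume u: "u \<in> S"
    show "(\<psi> has_derivative (\<lambda>h. h *\<^sub>R ((D u + of_real (s2 * u) * \<phi> u) * of_real (w u)))) (at u within S)"
      using \<psi>d[of u] by (auto simp: has_vector_derivative_def intro: has_derivative_at_withinI)
    have ut: "\<bar>u\<bar> \<le> \<bar>t\<bar>" using u by (auto simp: S_def)
    then have "u\<^sup>2 \<le> t\<^sup>2" by (simp add: abs_le_square_iff)
    then have wu: "w u \<le> w t" using s2 by (auto simp: w_def intro!: divide_right_mono mult_left_mono)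
    show "onorm (\<lambda>h. h *\<^sub>R ((D u + of_real (s2 * u) * \<phi> u) * of_real (w u))) \<le> (1 + \<bar>t\<bar>) * \<epsilon> * w t"
    proof (rule onorm_bound)
      show "0 \<le> (1 + \<bar>t\<bar>) * \<epsilon> * w t" using e0 by (simp add: w_def)
      fix h :: real
      have "norm ((D u + of_real (s2 * u) * \<phi> u) * of_real (w u)) \<le> ((1 + \<bar>t\<bar>) * \<epsilon>) * w t"
        unfolding norm_mult
      proof (rule mult_mono)
        have "(1 + \<bar>u\<bar>) * \<epsilon> \<le> (1 + \<bar>t\<bar>) * \<epsilon>" using ut e0 by (intro mult_right_mono) auto
        with b[of u] show "norm (D u + of_real (s2 * u) * \<phi> u) \<le> (1 + \<bar>t\<bar>) * \<epsilon>" by linarith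
        show "norm (complex_of_real (w u)) \<le> w t" using wu by (simp add: w_def)
      qed (use e0 in auto)
      then have "\<bar>h\<bar> * norm ((D u + of_real (s2 * u) * \<phi> u) * of_real (w u)) \<le> \<bar>h\<bar> * (((1 + \<bar>t\<bar>) * \<epsilon>) * w t)"
        by (intro mult_left_mono) auto
      then show "norm (h *\<^sub>R ((D u + of_real (s2 * u) * \<phi> u) * of_real (w u))) \<le> (1 + \<bar>t\<bar>) * \<epsilon> * w t * norm h"
        unfolding norm_scaleR by (simp only: real_norm_def mult.commute)
    qed
  qed (auto simp: S_def)
  then have n: "norm (\<psi> t - 1) \<le> ((1 + \<bar>t\<bar>) * \<epsilon> * w t) * \<bar>t\<bar>" by (simp add: \<psi>_def \<phi>0 w_def)
  have "exp (- s2 * t\<^sup>2 / 2) = 1 / w t" by (simp add: w_def exp_minus inverse_eq_divide)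
  then have "\<phi> t - of_real (exp (- s2 * t\<^sup>2 / 2)) = (\<psi> t - 1) / of_real (w t)"
    by (simp add: \<psi>_def w_def diff_divide_distrib)
  then have "norm (\<phi> t - of_real (exp (- s2 * t\<^sup>2 / 2))) = norm (\<psi> t - 1) / w t"
    by (simp add: norm_divide w_def)
  also have "\<dots> \<le> (((1 + \<bar>t\<bar>) * \<epsilon> * w t) * \<bar>t\<bar>) / w t" by (intro divide_right_mono n) (simp add: w_def)
  also have "\<dots> = \<bar>t\<bar> * (1 + \<bar>t\<bar>) * \<epsilon>" by (simp add: w_def)
  finally show ?thesis .
qed

text \<open>Minus the limiting covariance of two resolvent statistics. Poles in the same half-plane
  contribute nothing, also when they coincide.\<close>

definition opp :: "complex \<Rightarrow> complex \<Rightarrow> complex" where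
  "opp \<zeta> \<xi> = (if sgn (Im \<zeta>) = sgn (Im \<xi>) then 0 else 1 / (\<zeta> - \<xi>)\<^sup>2)"

text \<open>Coefficients and poles are complex, but the combination is real-valued, so that
  \<open>iexp (t * X)\<close> has modulus one.\<close>

locale resolvent_combo =
  fixes I :: "nat set" and c pole :: "nat \<Rightarrow> complex" and f :: "real \<Rightarrow> real"
  assumes finI: "finite I" and pole: "\<And>k. k \<in> I \<Longrightarrow> Im (pole k) \<noteq> 0"
    and f_eq: "\<And>u. complex_of_real (f u) = (\<Sum>k\<in>I. c k * rz (pole k) u)"
begin

definition f' :: "real \<Rightarrow> real" where "f' u = Re (\<Sum>k\<in>I. c k * (rz (pole k) u)\<^sup>2)"

lemma complex_deriv: "((\<lambda>u. complex_of_real (f u)) has_vector_derivative (\<Sum>k\<in>I. c k * (rz (pole k) u)\<^sup>2)) (at u)"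
  unfolding f_eq
  by (intro has_vector_derivative_sum has_vector_derivative_mult_right)
    (use rz_deriv[OF pole, of _ 1 0] in simp)

lemma f_deriv: "(f has_real_derivative f' u) (at u)"
proof -
  have "((\<lambda>u. Re (complex_of_real (f u))) has_vector_derivative f' u) (at u)"
    unfolding f'_def by (rule bounded_linear.has_vector_derivative[OF bounded_linear_Re complex_deriv])
  then show ?thesis by (simp add: has_real_derivative_iff_has_vector_derivative)
qed

text \<open>The sum is real because it is the derivative of a real-valued function.\<close>

lemma f'_eq: "complex_of_real (f' u) = (\<Sum>k\<in>I. c k * (rz (pole k) u)\<^sup>2)"
  by (rule vector_derivative_unique_at[OF has_vector_derivative_of_real[OF f_deriv] complex_deriv])

lemma f_cont: "continuous_on A f"
  using f_deriv by (meson DERIV_isCont continuous_at_imp_continuous_on)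

lemma f'_cont: "continuous_on A f'"
proof -
  have "continuous_on A (\<lambda>u. Re (\<Sum>k\<in>I. c k * (rz (pole k) u)\<^sup>2))"
    by (intro continuous_intros continuous_rz pole)
  then show ?thesis by (simp add: f'_def[abs_def])
qed

text \<open>Each squared resolvent decays like \<open>(cw u)\<^sup>2\<close>; the bound is expressed
  by the resolvent at \<open>\<i>\<close> so that \<open>sq_mass_bound\<close> applies to
  it.\<close>

lemma f'_decay: "\<exists>K\<ge>0. \<forall>u. \<bar>f' u\<bar> \<le> K * (norm (rz \<i> u))\<^sup>2"
proof -
  have "\<forall>k\<in>I. \<exists>D. D \<ge> 0 \<and> (\<forall>u. norm (rz (pole k) u) \<le> D * cw u)" using rz_decay pole by blast
  then obtain D where D: "\<And>k. k \<in> I \<Longrightarrow> D k \<ge> 0" "\<And>k u. k \<in> I \<Longrightarrow> norm (rz (pole k) u) \<le> D k * cw u"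
    by metis
  define K where "K = (\<Sum>k\<in>I. norm (c k) * (D k)\<^sup>2)"
  have "\<bar>f' u\<bar> \<le> K * (norm (rz \<i> u))\<^sup>2" for u
  proof -
    have "\<bar>f' u\<bar> = norm (complex_of_real (f' u))" by simp
    also have "\<dots> \<le> (\<Sum>k\<in>I. norm (c k * (rz (pole k) u)\<^sup>2))" unfolding f'_eq by (rule norm_sum)
    also have "\<dots> \<le> (\<Sum>k\<in>I. norm (c k) * (D k * cw u)\<^sup>2)"
      unfolding norm_mult norm_power using D by (intro sum_mono mult_left_mono power_mono) auto
    also have "\<dots> = K * (norm (rz \<i> u))\<^sup>2"
      by (simp add: K_def sum_distrib_right power_mult_distrib cw_eq_rz mult.assoc)
    finally show ?thesis .
  qed
  moreover have "0 \<le> K" unfolding K_def by (intro sum_nonneg) simp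
  ultimately show ?thesis by blast
qed

lemma f'_bounded: "\<exists>K\<ge>0. \<forall>u. \<bar>f' u\<bar> \<le> K"
proof -
  obtain K where K: "K \<ge> 0" "\<And>u. \<bar>f' u\<bar> \<le> K * (norm (rz \<i> u))\<^sup>2" using f'_decay by blast
  have "\<bar>f' u\<bar> \<le> K" for u
  proof -
    have "(norm (rz \<i> u))\<^sup>2 \<le> 1\<^sup>2" using norm_rz_le[of \<i> u] by (intro power_mono) auto
    then have "K * (norm (rz \<i> u))\<^sup>2 \<le> K * 1" using K(1) by (intro mult_left_mono) auto
    then show ?thesis using K(2)[of u] by simp
  qed
  with K(1) show ?thesis by blast
qed

lemma f'_chordal: "\<exists>M. chordal (\<lambda>u. complex_of_real (f' u)) M"
  unfolding f'_eq using chordal_cmult chordal_rz_sq pole by (intro chordal_sum finI) blast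

lemma f_chordal: "\<exists>M. chordal f M"
proof -
  have "\<exists>M. chordal (\<lambda>u. complex_of_real (f u)) M"
    unfolding f_eq using chordal_cmult chordal_rz pole by (intro chordal_sum finI) blast
  then show ?thesis unfolding chordal_def by (simp add: norm_of_real flip: of_real_diff)
qed

end

locale meso_combo = meso + resolvent_combo
begin

definition TT :: "nat \<Rightarrow> complex \<Rightarrow> (nat \<Rightarrow> real) \<Rightarrow> complex" where
  "TT n \<zeta> = LS n (\<lambda>y. of_real (1 - y\<^sup>2) * (rz \<zeta> (sc n y) * of_real (f' (sc n y))))"

lemma cont_f: "continuous_on UNIV (\<lambda>y. f (sc n y))" and cont_f': "continuous_on UNIV (\<lambda>y. f' (sc n y))"
  by (intro continuous_on_compose2[OF f_cont[of UNIV]] continuous_on_compose2[OF f'_cont[of UNIV]] continuous_intros; simp)+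

lemma nice_TT: "Im \<zeta> \<noteq> 0 \<Longrightarrow> nice n (TT n \<zeta>)"
  unfolding TT_def by (intro nice_LS continuous_intros cont_rz cont_f')

lemma TT_dev:
  assumes "Im \<zeta> \<noteq> 0"
  shows "\<exists>C\<ge>0. \<forall>n\<ge>1. EE n (\<lambda>x. norm (TT n \<zeta> x - EE n (TT n \<zeta>))) \<le> C"
proof -
  obtain M1 where M1: "chordal (rz \<zeta>) M1" using chordal_rz[OF assms] by blast
  obtain M2 where M2: "chordal (\<lambda>u. complex_of_real (f' u)) M2" using f'_chordal by blast
  obtain K where K: "K \<ge> 0" "\<And>u. \<bar>f' u\<bar> \<le> K" using f'_bounded by blast
  obtain D where D: "D \<ge> 0" "\<And>u. norm (rz \<zeta> u) \<le> D * cw u" using rz_decay[OF assms] by blast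
  define \<phi> where "\<phi> u = rz \<zeta> u * complex_of_real (f' u)" for u
  obtain M where M: "chordal \<phi> M"
    using chordal_mult[OF M1 M2 norm_rz_le[OF assms], of K] K(2) by (auto simp: \<phi>_def[abs_def])
  have dec: "norm (\<phi> u) \<le> (D * K) * cw u" for u
  proof -
    have "norm (\<phi> u) = norm (rz \<zeta> u) * \<bar>f' u\<bar>" by (simp add: \<phi>_def norm_mult)
    also have "\<dots> \<le> (D * cw u) * K" using D K cw_pos[of u] by (intro mult_mono) auto
    finally show ?thesis by (simp add: mult_ac)
  qed
  have C0: "0 \<le> 3 * 2 * (D * K) + 1 * M" using D K chordal_nonneg[OF M] by simp
  have "EE n (\<lambda>x. norm (TT n \<zeta> x - EE n (TT n \<zeta>))) \<le> sqrt VC * (3 * 2 * (D * K) + 1 * M)" if n: "n \<ge> 1" for n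
    unfolding TT_def
  proof (rule LS_abs_dev[OF n _ C0])
    show "continuous_on UNIV (\<lambda>y. complex_of_real (1 - y\<^sup>2) * (rz \<zeta> (sc n y) * complex_of_real (f' (sc n y))))"
      by (intro continuous_intros cont_rz cont_f' assms)
    fix x y :: real assume xy: "x \<in> {-1..1}" "y \<in> {-1..1}"
    show "norm (complex_of_real (1 - x\<^sup>2) * (rz \<zeta> (sc n x) * complex_of_real (f' (sc n x))) -
        complex_of_real (1 - y\<^sup>2) * (rz \<zeta> (sc n y) * complex_of_real (f' (sc n y)))) \<le>
        (3 * 2 * (D * K) + 1 * M) * (Nn n * \<bar>x - y\<bar> * (win (Nn n) x0 x * win (Nn n) x0 y))"
    proof (rule lip_times_chordal[OF n M dec, of "\<lambda>x. 1 - x\<^sup>2", unfolded \<phi>_def])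
      fix x y :: real assume x: "x \<in> {-1..1}" "y \<in> {-1..1}"
      have "\<bar>x + y\<bar> * \<bar>x - y\<bar> \<le> 2 * \<bar>x - y\<bar>" using x by (intro mult_right_mono) auto
      moreover have "(1 - x\<^sup>2) - (1 - y\<^sup>2) = - ((x + y) * (x - y))" by (simp add: power2_eq_square algebra_simps)
      ultimately show "\<bar>(1 - x\<^sup>2) - (1 - y\<^sup>2)\<bar> \<le> 2 * \<bar>x - y\<bar>" by (simp add: abs_mult)
    next
      fix x :: real assume "x \<in> {-1..1}"
      then show "\<bar>1 - x\<^sup>2\<bar> \<le> 1" using abs_square_le_1[of x] by (auto simp: abs_le_iff)
    qed (use D K xy in auto)
  qed
  then show ?thesis using VC(1) C0 by (intro exI[of _ "sqrt VC * (3 * 2 * (D * K) + 1 * M)"]) auto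
qed

text \<open>Replacing \<open>1 - y\<^sup>2\<close> by its value at \<open>x0\<close> costs a factor
  \<open>\<bar>u\<bar> / N\<close> in the scaled position \<open>u\<close>, whose growth is absorbed
  by the decay of the resolvent; the rest is a combination of \<open>L3\<close>.\<close>

lemma TT_mean:
  assumes \<zeta>: "Im \<zeta> \<noteq> 0"
  shows "(\<lambda>n. EE n (TT n \<zeta>) / of_real (qn n)) \<longlonglongrightarrow>
     of_real (1 - x0\<^sup>2) * (\<Sum>k\<in>I. c k * ((mlim \<zeta> - mlim (pole k)) / (\<zeta> - pole k)\<^sup>2))"
proof -
  obtain D where D: "D \<ge> 0" "\<And>u. norm (rz \<zeta> u) \<le> D * cw u" using rz_decay[OF \<zeta>] by blast
  obtain K where K: "K \<ge> 0" "\<And>u. \<bar>f' u\<bar> \<le> K * (norm (rz \<i> u))\<^sup>2" using f'_decay by blast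
  have i: "Im \<i> \<noteq> 0" by simp
  obtain B where B: "0 \<le> B" "\<And>n. n \<ge> 1 \<Longrightarrow> EE n (LS n (\<lambda>x. (norm (rz \<i> (sc n x)))\<^sup>2)) / qn n \<le> B"
    using sq_mass_bound[OF i] by blast
  define \<phi> where "\<phi> n y = rz \<zeta> (sc n y) * complex_of_real (f' (sc n y))" for n y
  have c\<phi>: "continuous_on UNIV (\<phi> n)" for n unfolding \<phi>_def[abs_def] by (intro continuous_intros cont_rz cont_f' \<zeta>)
  define err where "err n = EE n (LS n (\<lambda>y. of_real (x0\<^sup>2 - y\<^sup>2) * \<phi> n y)) / of_real (qn n)" for n
  have err0: "err \<longlonglongrightarrow> 0"
  proof (rule Lim_null_comparison)
    have "(\<lambda>n. B * (2 * D * K) * (1 / Nn n)) \<longlonglongrightarrow> B * (2 * D * K) * 0" by (intro tendsto_mult tendsto_const inverse_Nn_tendsto)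
    then show "(\<lambda>n. B * (2 * D * K) * (1 / Nn n)) \<longlonglongrightarrow> 0" by simp
    show "\<forall>\<^sub>F n in sequentially. norm (err n) \<le> B * (2 * D * K) * (1 / Nn n)"
      unfolding eventually_at_top_linorder
    proof (intro exI allI impI)
      fix n :: nat assume n: "n \<ge> 1"
      have N: "0 < Nn n" using Nn_ge_1[OF n] by simp
      have "norm (err n) \<le> B * (2 * D * K / Nn n)"
        unfolding err_def
      proof (rule scaled_compare[OF n _ _ _ _ B(2)[OF n]])
        show "0 \<le> 2 * D * K / Nn n" using D K N by simp
        show "continuous_on UNIV (\<lambda>y. of_real (x0\<^sup>2 - y\<^sup>2) * \<phi> n y)" by (intro continuous_intros c\<phi>)
        show "continuous_on UNIV (\<lambda>x. (norm (rz \<i> (sc n x)))\<^sup>2)" by (intro continuous_intros cont_rz i)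
        fix y :: real assume y: "y \<in> {-1..1}"
        let ?u = "sc n y"
        have ucw: "\<bar>?u\<bar> * cw ?u \<le> 1"
        proof -
          have "\<bar>?u\<bar> \<le> sqrt (1 + ?u\<^sup>2)" by (rule real_le_rsqrt) simp
          moreover have "0 < sqrt (1 + ?u\<^sup>2)" by (simp add: add_pos_nonneg)
          ultimately show ?thesis unfolding cw_def by (simp add: divide_le_eq)
        qed
        have yx: "\<bar>x0\<^sup>2 - y\<^sup>2\<bar> \<le> 2 * (\<bar>?u\<bar> / Nn n)"
        proof -
          have "x0\<^sup>2 - y\<^sup>2 = - ((y + x0) * (y - x0))" by (simp add: power2_eq_square algebra_simps)
          then have "\<bar>x0\<^sup>2 - y\<^sup>2\<bar> = \<bar>y + x0\<bar> * \<bar>y - x0\<bar>" by (simp add: abs_mult)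
          also have "\<dots> \<le> 2 * \<bar>y - x0\<bar>" using y x0 by (intro mult_right_mono) auto
          also have "\<bar>y - x0\<bar> = \<bar>?u\<bar> / Nn n" using N by (simp add: abs_mult)
          finally show ?thesis .
        qed
        have "norm (of_real (x0\<^sup>2 - y\<^sup>2) * \<phi> n y) = \<bar>x0\<^sup>2 - y\<^sup>2\<bar> * (norm (rz \<zeta> ?u) * \<bar>f' ?u\<bar>)"
          by (simp only: \<phi>_def norm_mult norm_of_real)
        also have "\<dots> \<le> (2 * (\<bar>?u\<bar> / Nn n)) * ((D * cw ?u) * (K * (norm (rz \<i> ?u))\<^sup>2))"
          using D(1) cw_pos[of ?u] N by (intro mult_mono yx D(2) K(2)) auto
        also have "\<dots> = (2 * D * K / Nn n) * (norm (rz \<i> ?u))\<^sup>2 * (\<bar>?u\<bar> * cw ?u)" by simp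
        also have "\<dots> \<le> (2 * D * K / Nn n) * (norm (rz \<i> ?u))\<^sup>2 * 1"
          using D K N by (intro mult_left_mono ucw) auto
        finally show "norm (of_real (x0\<^sup>2 - y\<^sup>2) * \<phi> n y) \<le> (2 * D * K / Nn n) * (norm (rz \<i> ?u))\<^sup>2" by simp
      qed
      then show "norm (err n) \<le> B * (2 * D * K) * (1 / Nn n)" by simp
    qed
  qed
  have eq: "EE n (TT n \<zeta>) / of_real (qn n) = of_real (1 - x0\<^sup>2) * (\<Sum>k\<in>I. c k * L3 n \<zeta> (pole k)) + err n" for n
  proof -
    have "TT n \<zeta> = (\<lambda>x. of_real (1 - x0\<^sup>2) * LS n (\<phi> n) x + LS n (\<lambda>y. of_real (x0\<^sup>2 - y\<^sup>2) * \<phi> n y) x)"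
      by (rule ext) (simp add: TT_def LS_def \<phi>_def sum_distrib_left sum.distrib[symmetric] algebra_simps)
    then have e1: "EE n (TT n \<zeta>) = of_real (1 - x0\<^sup>2) * EE n (LS n (\<phi> n)) + EE n (LS n (\<lambda>y. of_real (x0\<^sup>2 - y\<^sup>2) * \<phi> n y))"
      by (simp only:) (subst EE_add, auto intro!: nice_intros nice_LS c\<phi> continuous_intros simp del: of_real_diff)
    define \<theta> where "\<theta> k y = rz \<zeta> (sc n y) * (rz (pole k) (sc n y))\<^sup>2" for k y
    have c\<theta>: "continuous_on UNIV (\<theta> k)" if "k \<in> I" for k
      unfolding \<theta>_def[abs_def] by (intro continuous_intros cont_rz \<zeta> pole that)
    have "LS n (\<phi> n) = (\<lambda>x. \<Sum>k\<in>I. c k * LS n (\<theta> k) x)"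
    proof (rule ext)
      fix x
      have "LS n (\<phi> n) x = (\<Sum>j<n. \<Sum>k\<in>I. c k * \<theta> k (x j))"
        by (simp add: LS_def \<phi>_def f'_eq \<theta>_def sum_distrib_left algebra_simps)
      also have "\<dots> = (\<Sum>k\<in>I. \<Sum>j<n. c k * \<theta> k (x j))" by (rule sum.swap)
      finally show "LS n (\<phi> n) x = (\<Sum>k\<in>I. c k * LS n (\<theta> k) x)" by (simp add: LS_def sum_distrib_left)
    qed
    then have "EE n (LS n (\<phi> n)) = (\<Sum>k\<in>I. EE n (\<lambda>x. c k * LS n (\<theta> k) x))"
      by (simp only:) (rule Bochner_Integration.integral_sum, intro integrable_mult_right nice_integrable nice_LS c\<theta>)
    then have e2: "EE n (LS n (\<phi> n)) / of_real (qn n) = (\<Sum>k\<in>I. c k * L3 n \<zeta> (pole k))"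
      by (simp add: sum_divide_distrib L3_def \<theta>_def[abs_def])
    show ?thesis unfolding e1 add_divide_distrib err_def[symmetric] e2[symmetric] by simp
  qed
  have "(\<lambda>n. of_real (1 - x0\<^sup>2) * (\<Sum>k\<in>I. c k * L3 n \<zeta> (pole k)) + err n) \<longlonglongrightarrow>
     of_real (1 - x0\<^sup>2) * (\<Sum>k\<in>I. c k * ((mlim \<zeta> - mlim (pole k)) / (\<zeta> - pole k)\<^sup>2)) + 0"
    by (intro tendsto_add tendsto_mult tendsto_const tendsto_sum err0 L3_tendsto \<zeta> pole)
  then show ?thesis unfolding eq by simp
qed

section \<open>The linearised loop equation\<close>

definition XX :: "nat \<Rightarrow> (nat \<Rightarrow> real) \<Rightarrow> real" where
  "XX n = LS n (\<lambda>y. f (sc n y))"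

definition ee :: "nat \<Rightarrow> real \<Rightarrow> (nat \<Rightarrow> real) \<Rightarrow> complex" where
  "ee n t x = iexp (t * (XX n x - EE n (XX n)))"

definition \<phi>n :: "nat \<Rightarrow> real \<Rightarrow> complex" where
  "\<phi>n n t = EE n (ee n t)"

text \<open>The response coefficient: to leading order, the expectation of the centred resolvent sum
  times the exponential is \<open>- \<i> * t * vn n \<zeta>\<close> times the characteristic
  function.\<close>

definition vn :: "nat \<Rightarrow> complex \<Rightarrow> complex" where
  "vn n \<zeta> = EE n (TT n \<zeta>) / (2 * AA n \<zeta> * EE n (RR n \<zeta>))"

lemma nice_XX: "nice n (XX n)"
  unfolding XX_def by (intro nice_LS cont_f)

lemma nice_ee: "nice n (ee n t)"
  unfolding ee_def[abs_def] by (intro nice_intros nice_XX)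

lemma norm_ee: "norm (ee n t x) = 1"
  by (simp add: ee_def)

lemma EE_ee_le:
  assumes "nice n F"
  shows "norm (EE n (\<lambda>x. ee n t x * F x)) \<le> EE n (\<lambda>x. norm (F x))"
  using EE_norm_le[of n "\<lambda>x. ee n t x * F x"] by (simp add: norm_mult norm_ee)

lemma EE_cmult:
  fixes a :: complex
  shows "EE n (\<lambda>x. a * F x) = a * EE n F"
  by simp

lemma mlim_nonzero: "Im \<zeta> \<noteq> 0 \<Longrightarrow> mlim \<zeta> \<noteq> 0"
  using x0_sq by (simp add: mlim_def sgn_zero_iff)

text \<open>The loop equation at \<open>t\<close> is combined with the one at \<open>t = 0\<close>,
  and the square of \<open>R\<close> expanded around its mean \<open>r\<close>. The deterministic
  terms of order \<open>(qn n)\<^sup>2\<close> cancel, and the fluctuation appears with the large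
  coefficient \<open>2 * AA n \<zeta> * r\<close>.\<close>

lemma key_identity:
  assumes \<zeta>: "Im \<zeta> \<noteq> 0" and n: "n \<ge> 1"
  defines "r \<equiv> EE n (RR n \<zeta>)" and "W \<equiv> EE n (\<lambda>x. (RR n \<zeta> x - EE n (RR n \<zeta>))\<^sup>2)"
  shows "2 * AA n \<zeta> * r * EE n (\<lambda>x. ee n t x * (RR n \<zeta> x - r)) + AA n \<zeta> * EE n (\<lambda>x. ee n t x * ((RR n \<zeta> x - r)\<^sup>2 - W))
     + EE n (\<lambda>x. ee n t x * (HH n \<zeta> x - EE n (HH n \<zeta>))) / of_real (Nn n)
     + \<i> * of_real t * EE n (\<lambda>x. ee n t x * (TT n \<zeta> x - EE n (TT n \<zeta>)))
     + \<i> * of_real t * EE n (TT n \<zeta>) * \<phi>n n t = 0"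
proof -
  define A where "A = AA n \<zeta>"
  define N where "N = complex_of_real (Nn n)"
  define q where "q = complex_of_real (qn n)"
  define hb where "hb = EE n (HH n \<zeta>)"
  define tb where "tb = EE n (TT n \<zeta>)"
  \<comment> \<open>A constant phase that centres the statistic in the exponent.\<close>
  define k where "k = iexp (- t * EE n (XX n))"
  let ?R = "RR n \<zeta>" and ?H = "HH n \<zeta>" and ?T = "TT n \<zeta>" and ?e = "ee n t"
  have nR: "nice n ?R" and nH: "nice n ?H" and nT: "nice n ?T" by (intro nice_RR nice_HH nice_TT \<zeta>)+
  \<comment> \<open>The equation at \<open>t = 0\<close>, with the second moment of \<open>R\<close>
    split into variance and squared mean: exactly the nonfluctuating terms that have to
    disappear.\<close>
  have z: "A * (W + r\<^sup>2) + q\<^sup>2 + hb / N = 0"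
    using loop_zero[OF \<zeta> n] EE_centered_sq[OF nR] by (simp add: A_def W_def r_def q_def hb_def N_def)
  have ek: "?e x = k * iexp (t * XX n x)" for x
    by (simp add: ee_def k_def exp_add[symmetric] algebra_simps)
  define P where "P x = A * (?R x)\<^sup>2 + q\<^sup>2 + ?H x / N + \<i> * of_real t * ?T x" for x
  define S1 where "S1 x = (2 * A * r) * (?e x * (?R x - r))" for x
  define S2 where "S2 x = A * (?e x * ((?R x - r)\<^sup>2 - W))" for x
  define S3 where "S3 x = (1 / N) * (?e x * (?H x - hb))" for x
  define S4 where "S4 x = (\<i> * of_real t) * (?e x * (?T x - tb))" for x
  define S5 where "S5 x = (\<i> * of_real t * tb) * ?e x" for x
  have "EE n (\<lambda>x. iexp (t * XX n x) * P x) = 0"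
    using loop_meso[OF f_deriv f'_cont \<zeta> n, of t] by (simp add: P_def A_def q_def N_def XX_def TT_def)
  then have z0: "EE n (\<lambda>x. k * (iexp (t * XX n x) * P x)) = 0"
    by (simp only: EE_cmult mult_zero_right)
  have pt: "k * (iexp (t * XX n x) * P x) = S1 x + S2 x + S3 x + S4 x + S5 x" for x
  proof -
    have "P x = 2 * A * r * (?R x - r) + A * ((?R x - r)\<^sup>2 - W) + (1 / N) * (?H x - hb) + \<i> * of_real t * (?T x - tb) + \<i> * of_real t * tb
       + (A * (W + r\<^sup>2) + q\<^sup>2 + hb / N)"
      by (simp add: P_def power2_eq_square diff_divide_distrib algebra_simps)
    then have Px: "P x = 2 * A * r * (?R x - r) + A * ((?R x - r)\<^sup>2 - W) + (1 / N) * (?H x - hb) + \<i> * of_real t * (?T x - tb) + \<i> * of_real t * tb"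
      by (simp only: z add_0_right)
    have "k * (iexp (t * XX n x) * P x) = ?e x * P x" by (simp only: ek mult.assoc)
    also have "\<dots> = S1 x + S2 x + S3 x + S4 x + S5 x"
      unfolding Px S1_def S2_def S3_def S4_def S5_def by (simp add: algebra_simps)
    finally show ?thesis .
  qed
  have sq: "nice n (\<lambda>x. (?R x - r)\<^sup>2)" unfolding power2_eq_square by (intro nice_intros nR)
  have n1: "nice n S1" "nice n S2" "nice n S3" "nice n S4" "nice n S5"
    unfolding S1_def[abs_def] S2_def[abs_def] S3_def[abs_def] S4_def[abs_def] S5_def[abs_def]
    by (intro nice_mult nice_diff nice_const nice_ee nR nH nT sq)+
  have "EE n S1 + EE n S2 + EE n S3 + EE n S4 + EE n S5 = 0"
    using z0 unfolding pt by (simp only: EE_add nice_add n1)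
  then show ?thesis
    by (simp add: S1_def[abs_def] S2_def[abs_def] S3_def[abs_def] S4_def[abs_def] S5_def[abs_def]
        A_def N_def hb_def tb_def \<phi>n_def)
qed

text \<open>Division by \<open>2 * AA n \<zeta> * r\<close>, whose modulus is at least a multiple of
  \<open>qn n\<close>, makes the remainder small: the exponential has modulus one, so all other
  terms are bounded by variances and absolute deviations.\<close>

lemma key_estimate:
  assumes \<zeta>: "Im \<zeta> \<noteq> 0"
  shows "\<exists>K\<ge>0. \<exists>n0\<ge>1. \<forall>n\<ge>n0. \<forall>t. norm (EE n (\<lambda>x. ee n t x * (RR n \<zeta> x - EE n (RR n \<zeta>))) + \<i> * of_real t * \<phi>n n t * vn n \<zeta>)
     \<le> K * (1 + \<bar>t\<bar>) / qn n"
proof -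
  obtain C1 where C1: "0 \<le> C1" "\<And>n. n \<ge> 1 \<Longrightarrow> EE n (\<lambda>x. (norm (RR n \<zeta> x - EE n (RR n \<zeta>)))\<^sup>2) \<le> C1"
    using RR_dev[OF \<zeta>] by blast
  obtain C2 where C2: "0 \<le> C2" "\<And>n. n \<ge> 1 \<Longrightarrow> EE n (\<lambda>x. norm (HH n \<zeta> x - EE n (HH n \<zeta>))) \<le> C2"
    using HH_dev[OF \<zeta>] by blast
  obtain C3 where C3: "0 \<le> C3" "\<And>n. n \<ge> 1 \<Longrightarrow> EE n (\<lambda>x. norm (TT n \<zeta> x - EE n (TT n \<zeta>))) \<le> C3"
    using TT_dev[OF \<zeta>] by blast
  have "Bseq (\<lambda>n. AA n \<zeta>)" using AA_tendsto[of \<zeta>] convergentI convergent_imp_Bseq by blast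
  then obtain B where B: "0 < B" "\<And>n. norm (AA n \<zeta>) \<le> B" by (auto simp: Bseq_def)
  \<comment> \<open>The limit of the modulus of that coefficient over \<open>qn n\<close>; it is
    nonzero because \<open>x0\<close> lies inside the interval, and half of it is a lower bound for
    all large \<open>n\<close>.\<close>
  define l where "l = norm (2 * complex_of_real (1 - x0\<^sup>2) * mlim \<zeta>)"
  have l: "0 < l" unfolding l_def using x0_sq mlim_nonzero[OF \<zeta>] by (simp del: of_real_diff)
  have "(\<lambda>n. norm (2 * AA n \<zeta> * mR n \<zeta>)) \<longlonglongrightarrow> l"
    unfolding l_def by (intro tendsto_norm tendsto_mult tendsto_const AA_tendsto mR_tendsto \<zeta>)
  then have "\<forall>\<^sub>F n in sequentially. l / 2 < norm (2 * AA n \<zeta> * mR n \<zeta>)"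
    using l by (intro order_tendstoD(1)) auto
  then obtain n1 where n1: "\<And>n. n \<ge> n1 \<Longrightarrow> l / 2 < norm (2 * AA n \<zeta> * mR n \<zeta>)"
    by (auto simp: eventually_at_top_linorder)
  define K where "K = (B * (2 * C1) + C2 + C3) / (l / 2)"
  have K: "0 \<le> K" using B C1 C2 C3 l by (simp add: K_def)
  have "norm (EE n (\<lambda>x. ee n t x * (RR n \<zeta> x - EE n (RR n \<zeta>))) + \<i> * of_real t * \<phi>n n t * vn n \<zeta>) \<le> K * (1 + \<bar>t\<bar>) / qn n"
    if n: "n \<ge> max 1 n1" for n t
  proof -
    have n': "n \<ge> 1" using n by simp
    have q: "0 < qn n" and N: "1 \<le> Nn n" using qn_ge_1[OF n'] Nn_ge_1[OF n'] by auto
    define r where "r = EE n (RR n \<zeta>)"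
    define W where "W = EE n (\<lambda>x. (RR n \<zeta> x - EE n (RR n \<zeta>))\<^sup>2)"
    define d where "d = 2 * AA n \<zeta> * r"
    define E0 where "E0 = EE n (\<lambda>x. ee n t x * (RR n \<zeta> x - r))"
    define E1 where "E1 = EE n (\<lambda>x. ee n t x * ((RR n \<zeta> x - r)\<^sup>2 - W))"
    define E2 where "E2 = EE n (\<lambda>x. ee n t x * (HH n \<zeta> x - EE n (HH n \<zeta>)))"
    define E3 where "E3 = EE n (\<lambda>x. ee n t x * (TT n \<zeta> x - EE n (TT n \<zeta>)))"
    have nR: "nice n (RR n \<zeta>)" and nH: "nice n (HH n \<zeta>)" and nT: "nice n (TT n \<zeta>)" by (intro nice_RR nice_HH nice_TT \<zeta>)+
    have sq: "nice n (\<lambda>x. (RR n \<zeta> x - r)\<^sup>2)" unfolding power2_eq_square by (intro nice_intros nR)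
    have id: "d * E0 + AA n \<zeta> * E1 + E2 / of_real (Nn n) + \<i> * of_real t * E3 + \<i> * of_real t * EE n (TT n \<zeta>) * \<phi>n n t = 0"
      unfolding d_def E0_def E1_def E2_def E3_def W_def r_def by (rule key_identity[OF \<zeta> n'])
    have dq: "d = (2 * AA n \<zeta> * mR n \<zeta>) * of_real (qn n)" using q by (simp add: d_def mR_def r_def)
    have dn: "l / 2 * qn n \<le> norm d"
    proof -
      have "norm d = norm (2 * AA n \<zeta> * mR n \<zeta>) * qn n" unfolding dq norm_mult[of "2 * AA n \<zeta> * mR n \<zeta>"] using q by simp
      then show ?thesis using n1[of n] n q by (simp add: mult_right_mono)
    qed
    have lq: "0 < l / 2 * qn n" using l q by simp
    have d0: "d \<noteq> 0" using dn lq by auto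
    have vn: "vn n \<zeta> = EE n (TT n \<zeta>) / d" by (simp add: vn_def d_def r_def)
    have "EE n (\<lambda>x. norm ((RR n \<zeta> x - r)\<^sup>2)) \<le> C1" using C1(2)[OF n'] by (simp add: norm_power r_def)
    have W1: "norm W \<le> C1"
      using order.trans[OF EE_norm_le[of n "\<lambda>x. (RR n \<zeta> x - r)\<^sup>2"] \<open>EE n (\<lambda>x. norm ((RR n \<zeta> x - r)\<^sup>2)) \<le> C1\<close>] by (simp add: W_def r_def)
    have e1: "norm E1 \<le> 2 * C1"
    proof -
      have "norm E1 \<le> EE n (\<lambda>x. norm ((RR n \<zeta> x - r)\<^sup>2 - W))"
        unfolding E1_def by (intro EE_ee_le nice_intros sq)
      also have "\<dots> \<le> EE n (\<lambda>x. norm ((RR n \<zeta> x - r)\<^sup>2) + norm W)"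
        by (intro EE_mono nice_intros sq norm_triangle_ineq4)
      also have "\<dots> = EE n (\<lambda>x. norm ((RR n \<zeta> x - r)\<^sup>2)) + norm W"
        by (subst EE_add) (auto intro!: nice_intros sq simp: EE_const)
      finally show ?thesis using W1 \<open>EE n (\<lambda>x. norm ((RR n \<zeta> x - r)\<^sup>2)) \<le> C1\<close> by linarith
    qed
    have e2: "norm E2 \<le> C2" unfolding E2_def
      by (rule order.trans[OF EE_ee_le C2(2)[OF n']]) (intro nice_intros nH)
    have e3: "norm E3 \<le> C3" unfolding E3_def
      by (rule order.trans[OF EE_ee_le C3(2)[OF n']]) (intro nice_intros nT)
    define Z where "Z = AA n \<zeta> * E1 + E2 / of_real (Nn n) + \<i> * of_real t * E3"
    have "d * (E0 + \<i> * of_real t * \<phi>n n t * vn n \<zeta>) = d * E0 + \<i> * of_real t * EE n (TT n \<zeta>) * \<phi>n n t"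
      using d0 by (simp add: vn algebra_simps)
    also have "\<dots> = (d * E0 + AA n \<zeta> * E1 + E2 / of_real (Nn n) + \<i> * of_real t * E3 + \<i> * of_real t * EE n (TT n \<zeta>) * \<phi>n n t) - Z"
      by (simp add: Z_def)
    also have "\<dots> = - Z" unfolding id by simp
    finally have "norm d * norm (E0 + \<i> * of_real t * \<phi>n n t * vn n \<zeta>) = norm Z" by (metis norm_minus_cancel norm_mult)
    then have nd: "norm (E0 + \<i> * of_real t * \<phi>n n t * vn n \<zeta>) = norm Z / norm d" using d0 by (simp add: field_simps)
    have "norm Z \<le> norm (AA n \<zeta>) * norm E1 + norm E2 / Nn n + \<bar>t\<bar> * norm E3"
      unfolding Z_def using N
      by (intro order.trans[OF norm_triangle_ineq] add_mono) (auto simp: norm_mult norm_divide)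
    also have "\<dots> \<le> B * (2 * C1) + C2 / 1 + \<bar>t\<bar> * C3"
      using B e1 e2 e3 C1 C2 C3 N by (intro add_mono mult_mono frac_le) auto
    also have "\<dots> \<le> (B * (2 * C1) + C2 + C3) * (1 + \<bar>t\<bar>)"
    proof -
      have "0 \<le> B * (2 * C1) * \<bar>t\<bar>" "0 \<le> C2 * \<bar>t\<bar>" using B C1 C2 by auto
      then show ?thesis using C3(1) by (simp add: algebra_simps)
    qed
    finally have Zb: "norm Z \<le> (B * (2 * C1) + C2 + C3) * (1 + \<bar>t\<bar>)" .
    have "norm Z / norm d \<le> ((B * (2 * C1) + C2 + C3) * (1 + \<bar>t\<bar>)) / (l / 2 * qn n)"
      using Zb dn lq by (intro frac_le) (auto intro: order.trans[OF norm_ge_zero])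
    also have "\<dots> = K * (1 + \<bar>t\<bar>) / qn n" by (simp add: K_def)
    finally show ?thesis unfolding nd[symmetric] E0_def r_def .
  qed
  then show ?thesis using K by (intro exI[of _ K] conjI exI[of _ "max 1 n1"]) auto
qed

text \<open>The value \<open>mlim (pole k)\<close> is \<open>mlim \<zeta>\<close> or its negative,
  so the quotient by \<open>2 * mlim \<zeta>\<close> is 0 or 1. The factor
  \<open>1 - x0\<^sup>2\<close> cancels, which is why the limiting variance does not depend on
  \<open>x0\<close>.\<close>

lemma vn_tendsto:
  assumes \<zeta>: "Im \<zeta> \<noteq> 0"
  shows "(\<lambda>n. vn n \<zeta>) \<longlonglongrightarrow> (\<Sum>k\<in>I. c k * opp \<zeta> (pole k))"
proof -
  define b where "b = complex_of_real (1 - x0\<^sup>2)"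
  have b: "b \<noteq> 0" using x0_sq by (simp add: b_def del: of_real_diff)
  have m: "mlim \<zeta> \<noteq> 0" by (rule mlim_nonzero[OF \<zeta>])
  have "(\<lambda>n. (EE n (TT n \<zeta>) / of_real (qn n)) / (2 * AA n \<zeta> * mR n \<zeta>)) \<longlonglongrightarrow>
      (b * (\<Sum>k\<in>I. c k * ((mlim \<zeta> - mlim (pole k)) / (\<zeta> - pole k)\<^sup>2))) / (2 * b * mlim \<zeta>)"
    unfolding b_def using b m
    by (intro tendsto_divide tendsto_mult tendsto_const TT_mean AA_tendsto mR_tendsto \<zeta>) (simp add: b_def del: of_real_diff)
  moreover have "\<forall>\<^sub>F n in sequentially. (EE n (TT n \<zeta>) / of_real (qn n)) / (2 * AA n \<zeta> * mR n \<zeta>) = vn n \<zeta>"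
    unfolding eventually_at_top_linorder
  proof (intro exI allI impI)
    fix n :: nat assume n: "n \<ge> 1"
    then have "complex_of_real (qn n) \<noteq> 0" using qn_ge_1[OF n] by simp
    then show "(EE n (TT n \<zeta>) / of_real (qn n)) / (2 * AA n \<zeta> * mR n \<zeta>) = vn n \<zeta>"
      by (simp add: vn_def mR_def)
  qed
  ultimately have "(\<lambda>n. vn n \<zeta>) \<longlonglongrightarrow> (b * (\<Sum>k\<in>I. c k * ((mlim \<zeta> - mlim (pole k)) / (\<zeta> - pole k)\<^sup>2))) / (2 * b * mlim \<zeta>)"
    by (rule Lim_transform_eventually)
  also have "(b * (\<Sum>k\<in>I. c k * ((mlim \<zeta> - mlim (pole k)) / (\<zeta> - pole k)\<^sup>2))) / (2 * b * mlim \<zeta>) =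
      (\<Sum>k\<in>I. c k * ((mlim \<zeta> - mlim (pole k)) / (\<zeta> - pole k)\<^sup>2)) / (2 * mlim \<zeta>)" using b by simp
  also have "\<dots> = (\<Sum>k\<in>I. c k * opp \<zeta> (pole k))"
    unfolding sum_divide_distrib
  proof (rule sum.cong[OF refl])
    fix k assume k: "k \<in> I"
    show "c k * ((mlim \<zeta> - mlim (pole k)) / (\<zeta> - pole k)\<^sup>2) / (2 * mlim \<zeta>) = c k * opp \<zeta> (pole k)"
    proof (cases "sgn (Im \<zeta>) = sgn (Im (pole k))")
      case True
      then show ?thesis by (simp add: opp_def mlim_def)
    next
      case False
      then have "sgn (Im (pole k)) = - sgn (Im \<zeta>)" using \<zeta> pole[OF k] by (auto simp: sgn_real_def split: if_splits)
      then have "mlim (pole k) = - mlim \<zeta>" by (simp add: mlim_def)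
      then show ?thesis using m False by (simp add: opp_def)
    qed
  qed
  finally show ?thesis .
qed

lemma XX_RR: "complex_of_real (XX n x) = (\<Sum>k\<in>I. c k * RR n (pole k) x)"
proof -
  have "complex_of_real (XX n x) = (\<Sum>j<n. \<Sum>k\<in>I. c k * rz (pole k) (sc n (x j)))"
    by (simp add: XX_def LS_def f_eq)
  also have "\<dots> = (\<Sum>k\<in>I. \<Sum>j<n. c k * rz (pole k) (sc n (x j)))" by (rule sum.swap)
  finally show ?thesis by (simp add: RR_def LS_def sum_distrib_left)
qed

text \<open>Differentiation under the expectation by the second-order Taylor bound for
  \<open>iexp\<close>, with the variance of the statistic as remainder constant.\<close>

lemma \<phi>n_deriv: "(\<phi>n n has_vector_derivative \<i> * EE n (\<lambda>x. ee n t x * of_real (XX n x - EE n (XX n)))) (at t)"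
proof -
  define Y where "Y x = XX n x - EE n (XX n)" for x
  have nY: "nice n Y" unfolding Y_def[abs_def] by (intro nice_intros nice_XX)
  have nY2: "nice n (\<lambda>x. (Y x)\<^sup>2)" unfolding power2_eq_square by (intro nice_intros nY)
  define D where "D = \<i> * EE n (\<lambda>x. ee n t x * of_real (Y x))"
  define Q where "Q = EE n (\<lambda>x. (Y x)\<^sup>2)"
  have Q0: "0 \<le> Q" unfolding Q_def by (intro Bochner_Integration.integral_nonneg) simp
  have bound: "norm (\<phi>n n (t + s) - \<phi>n n t - of_real s * D) \<le> s\<^sup>2 * Q" for s
  proof -
    have n1: "nice n (\<lambda>x. ee n t x * complex_of_real (Y x))" by (intro nice_intros nice_ee nY)
    have eq: "\<phi>n n (t + s) - \<phi>n n t - of_real s * D =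
        EE n (\<lambda>x. (ee n (t + s) x - ee n t x) - (of_real s * \<i>) * (ee n t x * of_real (Y x)))"
    proof -
      have n2: "nice n (\<lambda>x. ee n (t + s) x - ee n t x)" by (intro nice_diff nice_ee)
      have n3: "nice n (\<lambda>x. (of_real s * \<i>) * (ee n t x * complex_of_real (Y x)))" by (intro nice_mult nice_const nice_ee nice_of_real nY)
      show ?thesis
        unfolding EE_diff[OF n2 n3] EE_diff[OF nice_ee nice_ee] EE_cmult by (simp add: \<phi>n_def D_def)
    qed
    have "norm (\<phi>n n (t + s) - \<phi>n n t - of_real s * D) \<le> EE n (\<lambda>x. norm ((ee n (t + s) x - ee n t x) - (of_real s * \<i>) * (ee n t x * of_real (Y x))))"
      unfolding eq by (rule EE_norm_le)
    also have "\<dots> \<le> EE n (\<lambda>x. s\<^sup>2 * (Y x)\<^sup>2)"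
    proof (rule EE_mono)
      show "nice n (\<lambda>x. norm ((ee n (t + s) x - ee n t x) - (of_real s * \<i>) * (ee n t x * of_real (Y x))))"
        by (intro nice_intros nice_ee nY)
      show "nice n (\<lambda>x. s\<^sup>2 * (Y x)\<^sup>2)" by (intro nice_mult nice_const nY2)
      fix x
      have e1: "ee n (t + s) x = ee n t x * iexp (s * Y x)" by (simp add: ee_def Y_def exp_add[symmetric] algebra_simps)
      have "(ee n (t + s) x - ee n t x) - (of_real s * \<i>) * (ee n t x * of_real (Y x)) =
          ee n t x * (iexp (s * Y x) - (\<Sum>k\<le>1. (\<i> * of_real (s * Y x)) ^ k / fact k))"
        unfolding e1 by (simp add: algebra_simps)
      then have "norm ((ee n (t + s) x - ee n t x) - (of_real s * \<i>) * (ee n t x * of_real (Y x))) =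
          norm (iexp (s * Y x) - (\<Sum>k\<le>1. (\<i> * of_real (s * Y x)) ^ k / fact k))"
        by (simp only: norm_mult norm_ee mult_1)
      also have "\<dots> \<le> \<bar>s * Y x\<bar> ^ Suc 1 / fact (Suc 1)" by (rule iexp_approx1)
      also have "\<dots> \<le> s\<^sup>2 * (Y x)\<^sup>2"
      proof -
        have "\<bar>a\<bar> ^ Suc 1 / fact (Suc 1) \<le> a\<^sup>2" for a :: real by (simp add: power2_eq_square)
        from this[of "s * Y x"] show ?thesis by (simp only: power_mult_distrib)
      qed
      finally show "norm ((ee n (t + s) x - ee n t x) - (of_real s * \<i>) * (ee n t x * of_real (Y x))) \<le> s\<^sup>2 * (Y x)\<^sup>2" .
    qed
    also have "\<dots> = s\<^sup>2 * Q" by (simp add: Q_def)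
    finally show ?thesis .
  qed
  have "((\<lambda>y. norm (\<phi>n n y - \<phi>n n t - (y - t) *\<^sub>R D) / norm (y - t)) \<longlongrightarrow> 0) (at t)"
  proof (rule Lim_null_comparison)
    show "((\<lambda>y. \<bar>y - t\<bar> * Q) \<longlongrightarrow> 0) (at t)"
      by (rule tendsto_eq_intros refl)+ simp
    show "\<forall>\<^sub>F y in at t. norm (norm (\<phi>n n y - \<phi>n n t - (y - t) *\<^sub>R D) / norm (y - t)) \<le> \<bar>y - t\<bar> * Q"
      unfolding eventually_at_filter
    proof (intro always_eventually allI impI)
      fix y assume "y \<noteq> t"
      then have p: "0 < \<bar>y - t\<bar>" by simp
      have "norm (\<phi>n n y - \<phi>n n t - (y - t) *\<^sub>R D) \<le> \<bar>y - t\<bar> * Q * \<bar>y - t\<bar>"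
        using bound[of "y - t"] by (simp add: scaleR_conv_of_real power2_eq_square abs_if algebra_simps)
      then show "norm (norm (\<phi>n n y - \<phi>n n t - (y - t) *\<^sub>R D) / norm (y - t)) \<le> \<bar>y - t\<bar> * Q"
        using p by (simp add: pos_divide_le_eq)
    qed
  qed
  then show ?thesis
    unfolding has_vector_derivative_def has_derivative_iff_norm D_def[symmetric] Y_def[symmetric]
    by (intro conjI bounded_linear_scaleR_left)
qed

text \<open>Weighting \<open>key_estimate\<close> by the coefficients and summing over the poles
  produces the derivative of the characteristic function, which therefore solves the Gaussian
  equation up to an error at most \<open>1 + \<bar>t\<bar>\<close> times a null sequence.\<close>

theorem combo_char_tendsto:
  assumes s2: "0 \<le> s2" and kap: "(\<Sum>l\<in>I. \<Sum>k\<in>I. c l * c k * opp (pole l) (pole k)) = - complex_of_real s2"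
  shows "(\<lambda>n. \<phi>n n t) \<longlonglongrightarrow> of_real (exp (- s2 * t\<^sup>2 / 2))"
proof -
  define Q where "Q l K m \<longleftrightarrow> 0 \<le> K \<and> (\<forall>n\<ge>m. \<forall>t. norm (EE n (\<lambda>x. ee n t x * (RR n (pole l) x - EE n (RR n (pole l)))) + \<i> * of_real t * \<phi>n n t * vn n (pole l))
     \<le> K * (1 + \<bar>t\<bar>) / qn n)" for l K and m :: nat
  have "\<forall>l\<in>I. \<exists>K m. Q l K m"
  proof
    fix l assume "l \<in> I"
    from key_estimate[OF pole[OF this]] show "\<exists>K m. Q l K m" unfolding Q_def by auto
  qed
  then obtain K n0 where KQ: "\<And>l. l \<in> I \<Longrightarrow> Q l (K l) (n0 l)" by metis
  then have Kn: "0 \<le> K l" "n \<ge> n0 l \<Longrightarrow>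
     norm (EE n (\<lambda>x. ee n t x * (RR n (pole l) x - EE n (RR n (pole l)))) + \<i> * of_real t * \<phi>n n t * vn n (pole l)) \<le> K l * (1 + \<bar>t\<bar>) / qn n"
    if "l \<in> I" for l n t
    using that unfolding Q_def by auto
  define M where "M = (\<Sum>l\<in>I. norm (c l) * K l)"
  define \<kappa> where "\<kappa> n = (\<Sum>l\<in>I. c l * vn n (pole l))" for n
  define \<epsilon> where "\<epsilon> n = M * (1 / qn n) + norm (\<kappa> n + of_real s2)" for n
  have "\<kappa> \<longlonglongrightarrow> (\<Sum>l\<in>I. c l * (\<Sum>k\<in>I. c k * opp (pole l) (pole k)))"
    unfolding \<kappa>_def by (intro tendsto_sum tendsto_mult tendsto_const vn_tendsto pole)
  also have "(\<Sum>l\<in>I. c l * (\<Sum>k\<in>I. c k * opp (pole l) (pole k))) = - of_real s2"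
    unfolding kap[symmetric] by (simp add: sum_distrib_left mult.assoc)
  finally have "(\<lambda>n. norm (\<kappa> n + of_real s2)) \<longlonglongrightarrow> norm (- complex_of_real s2 + of_real s2)"
    by (intro tendsto_norm tendsto_add tendsto_const)
  then have "\<epsilon> \<longlonglongrightarrow> M * 0 + norm (- complex_of_real s2 + of_real s2)"
    unfolding \<epsilon>_def by (intro tendsto_add tendsto_mult tendsto_const inverse_qn_tendsto)
  then have \<epsilon>0: "\<epsilon> \<longlonglongrightarrow> 0" by simp
  \<comment> \<open>A common threshold for the finitely many poles. For empty \<open>I\<close> the
    maximum is unspecified but harmless, since it is compared only with \<open>n0 l\<close> for
    \<open>l \<in> I\<close>.\<close>
  define n1 where "n1 = max 1 (Max (n0 ` I))"
  have bound: "norm (\<phi>n n t - of_real (exp (- s2 * t\<^sup>2 / 2))) \<le> \<bar>t\<bar> * (1 + \<bar>t\<bar>) * \<epsilon> n" if n: "n \<ge> n1" for n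
  proof (rule gaussian_ode[OF \<phi>n_deriv _ _ s2])
    have n': "n \<ge> 1" using n by (simp add: n1_def)
    have q: "0 < qn n" using qn_ge_1[OF n'] by simp
    show "\<phi>n n 0 = 1" by (simp add: \<phi>n_def ee_def[abs_def])
    fix t
    define E where "E l = EE n (\<lambda>x. ee n t x * (RR n (pole l) x - EE n (RR n (pole l))))" for l
    have nl: "n \<ge> n0 l" if "l \<in> I" for l
    proof -
      have "n0 l \<le> Max (n0 ` I)" by (intro Max_ge finite_imageI finI imageI that)
      with n show ?thesis by (simp add: n1_def)
    qed
    have "complex_of_real (EE n (XX n)) = EE n (\<lambda>x. complex_of_real (XX n x))"
      by simp
    also have "\<dots> = (\<Sum>k\<in>I. c k * EE n (RR n (pole k)))"
      unfolding XX_RR by (subst Bochner_Integration.integral_sum) (auto intro!: nice_integrable nice_mult nice_const nice_RR pole)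
    finally have mean: "complex_of_real (EE n (XX n)) = (\<Sum>k\<in>I. c k * EE n (RR n (pole k)))" .
    have "EE n (\<lambda>x. ee n t x * of_real (XX n x - EE n (XX n))) =
        EE n (\<lambda>x. \<Sum>k\<in>I. c k * (ee n t x * (RR n (pole k) x - EE n (RR n (pole k)))))"
      unfolding of_real_diff XX_RR mean by (simp add: sum_subtractf[symmetric] sum_distrib_left algebra_simps)
    also have "\<dots> = (\<Sum>k\<in>I. c k * E k)"
      unfolding E_def
      by (subst Bochner_Integration.integral_sum) (auto intro!: integrable_mult_right nice_integrable nice_intros nice_ee nice_RR pole)
    finally have X: "EE n (\<lambda>x. ee n t x * of_real (XX n x - EE n (XX n))) = (\<Sum>k\<in>I. c k * E k)" .
    have \<phi>1: "norm (\<phi>n n t) \<le> 1" unfolding \<phi>n_def by (rule EE_norm_bound[OF nice_ee]) (simp add: norm_ee)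
    define U where "U = (\<Sum>k\<in>I. c k * (E k + \<i> * of_real t * \<phi>n n t * vn n (pole k)))"
    have U: "norm U \<le> M * (1 + \<bar>t\<bar>) / qn n"
    proof -
      have "norm U \<le> (\<Sum>k\<in>I. norm (c k * (E k + \<i> * of_real t * \<phi>n n t * vn n (pole k))))" unfolding U_def by (rule norm_sum)
      also have "\<dots> \<le> (\<Sum>k\<in>I. norm (c k) * (K k * (1 + \<bar>t\<bar>) / qn n))"
        unfolding norm_mult[of "c _"] E_def using Kn(2)[OF _ nl] by (intro sum_mono mult_left_mono) auto
      also have "\<dots> = M * (1 + \<bar>t\<bar>) / qn n" by (simp add: M_def sum_distrib_right sum_divide_distrib mult.assoc)
      finally show ?thesis .
    qed
    have "U = (\<Sum>k\<in>I. c k * E k) + \<i> * of_real t * \<phi>n n t * \<kappa> n"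
      by (simp add: U_def \<kappa>_def distrib_left sum.distrib sum_distrib_left mult_ac)
    then have "\<i> * (\<Sum>k\<in>I. c k * E k) + of_real (s2 * t) * \<phi>n n t = \<i> * U + of_real t * \<phi>n n t * (\<kappa> n + of_real s2)"
      by (simp add: algebra_simps)
    then have "norm (\<i> * EE n (\<lambda>x. ee n t x * of_real (XX n x - EE n (XX n))) + of_real (s2 * t) * \<phi>n n t) =
       norm (\<i> * U + of_real t * \<phi>n n t * (\<kappa> n + of_real s2))" unfolding X by simp
    also have "\<dots> \<le> norm U + \<bar>t\<bar> * norm (\<phi>n n t) * norm (\<kappa> n + of_real s2)"
      by (rule order.trans[OF norm_triangle_ineq]) (simp add: norm_mult)
    also have "\<dots> \<le> M * (1 + \<bar>t\<bar>) / qn n + (1 + \<bar>t\<bar>) * 1 * norm (\<kappa> n + of_real s2)"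
      using U \<phi>1 by (intro add_mono mult_right_mono mult_mono) auto
    also have "\<dots> = (1 + \<bar>t\<bar>) * \<epsilon> n" by (simp add: \<epsilon>_def algebra_simps)
    finally show "norm (\<i> * EE n (\<lambda>x. ee n t x * of_real (XX n x - EE n (XX n))) + of_real (s2 * t) * \<phi>n n t) \<le> (1 + \<bar>t\<bar>) * \<epsilon> n" .
  qed
  have "(\<lambda>n. \<phi>n n t - of_real (exp (- s2 * t\<^sup>2 / 2))) \<longlonglongrightarrow> 0"
  proof (rule Lim_null_comparison)
    show "\<forall>\<^sub>F n in sequentially. norm (\<phi>n n t - of_real (exp (- s2 * t\<^sup>2 / 2))) \<le> \<bar>t\<bar> * (1 + \<bar>t\<bar>) * \<epsilon> n"
      using bound by (auto simp: eventually_at_top_linorder)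
    show "(\<lambda>n. \<bar>t\<bar> * (1 + \<bar>t\<bar>) * \<epsilon> n) \<longlonglongrightarrow> 0"
      using tendsto_mult_right_zero[OF \<epsilon>0] by simp
  qed
  then show ?thesis by (rule LIM_zero_cancel)
qed

end

section \<open>The limiting variance of resolvent combinations\<close>

lemma integrable_cw_sq: "integrable lborel (\<lambda>u. (cw u)\<^sup>2)" and integral_cw_sq: "(\<integral>u. (cw u)\<^sup>2 \<partial>lborel) = pi"
proof -
  have e: "(cw u)\<^sup>2 = inverse (1 + u\<^sup>2)" for u
  proof -
    have "0 \<le> 1 + u\<^sup>2" by simp
    then show ?thesis by (simp add: cw_def power_divide inverse_eq_divide)
  qed
  show "integrable lborel (\<lambda>u. (cw u)\<^sup>2)"
    using integrable_inverse_1_plus_square by (simp add: e set_integrable_def)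
  show "(\<integral>u. (cw u)\<^sup>2 \<partial>lborel) = pi"
    using LBINT_inverse_1_plus_square by (simp add: e interval_lebesgue_integral_def set_lebesgue_integral_def)
qed

lemma measurable_rz: "Im \<zeta> \<noteq> 0 \<Longrightarrow> rz \<zeta> \<in> borel_measurable borel"
  by (intro borel_measurable_continuous_onI continuous_rz)

lemma integrable_rz_mult:
  assumes "Im \<zeta> \<noteq> 0" "Im \<xi> \<noteq> 0"
  shows "integrable lborel (\<lambda>u. rz \<zeta> u * rz \<xi> u)"
proof -
  obtain D where D: "D \<ge> 0" "\<And>u. norm (rz \<zeta> u) \<le> D * cw u" using rz_decay[OF assms(1)] by blast
  obtain E where E: "E \<ge> 0" "\<And>u. norm (rz \<xi> u) \<le> E * cw u" using rz_decay[OF assms(2)] by blast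
  show ?thesis
  proof (rule Bochner_Integration.integrable_bound[OF integrable_mult_right[OF integrable_cw_sq, of "D * E"]])
    show "(\<lambda>u. rz \<zeta> u * rz \<xi> u) \<in> borel_measurable lborel"
      using measurable_rz[OF assms(1)] measurable_rz[OF assms(2)] by simp
    show "AE u in lborel. norm (rz \<zeta> u * rz \<xi> u) \<le> norm (D * E * (cw u)\<^sup>2)"
    proof (rule AE_I2)
      fix u
      have "norm (rz \<zeta> u * rz \<xi> u) \<le> (D * cw u) * (E * cw u)"
        unfolding norm_mult using D E cw_pos[of u] by (intro mult_mono) auto
      also have "\<dots> = norm (D * E * (cw u)\<^sup>2)" using D E by (simp add: power2_eq_square abs_mult)
      finally show "norm (rz \<zeta> u * rz \<xi> u) \<le> norm (D * E * (cw u)\<^sup>2)" .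
    qed
  qed
qed

text \<open>The logarithm of \<open>\<zeta> - u\<close>, up to a constant, in real terms so that no branch cut interferes.\<close>

definition Fz :: "complex \<Rightarrow> real \<Rightarrow> complex" where
  "Fz \<zeta> u = of_real (ln ((u - Re \<zeta>)\<^sup>2 + (Im \<zeta>)\<^sup>2) / 2) + \<i> * of_real (arctan ((u - Re \<zeta>) / Im \<zeta>))"

lemma Fz_deriv:
  assumes "Im \<zeta> \<noteq> 0"
  shows "(Fz \<zeta> has_vector_derivative - rz \<zeta> u) (at u)"
proof -
  let ?a = "Re \<zeta>" and ?b = "Im \<zeta>"
  have p: "0 < (u - ?a)\<^sup>2 + ?b\<^sup>2" using assms by (simp add: add_nonneg_pos)
  have d1: "((\<lambda>u. ln ((u - ?a)\<^sup>2 + ?b\<^sup>2) / 2) has_real_derivative (u - ?a) / ((u - ?a)\<^sup>2 + ?b\<^sup>2)) (at u)"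
  proof -
    have i: "((\<lambda>u. (u - ?a)\<^sup>2 + ?b\<^sup>2) has_real_derivative 2 * (u - ?a)) (at u)"
      by (auto intro!: derivative_eq_intros)
    have "((\<lambda>u. ln ((u - ?a)\<^sup>2 + ?b\<^sup>2) / 2) has_real_derivative (1 / ((u - ?a)\<^sup>2 + ?b\<^sup>2) * (2 * (u - ?a))) / 2) (at u)"
      by (intro DERIV_cdivide DERIV_chain2[OF DERIV_ln_divide[OF p] i])
    moreover have "1 / q * (2 * d) / 2 = d / q" for q d :: real by simp
    ultimately show ?thesis by (simp only:)
  qed
  have "((\<lambda>u. arctan ((u - ?a) / ?b)) has_real_derivative inverse (1 + ((u - ?a) / ?b)\<^sup>2) * (1 / ?b)) (at u)"
    using assms by (auto intro!: derivative_eq_intros)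
  also have "inverse (1 + ((u - ?a) / ?b)\<^sup>2) * (1 / ?b) = ?b / ((u - ?a)\<^sup>2 + ?b\<^sup>2)"
  proof -
    have "1 + ((u - ?a) / ?b)\<^sup>2 = ((u - ?a)\<^sup>2 + ?b\<^sup>2) / ?b\<^sup>2" using assms by (simp add: power_divide add_divide_distrib)
    then show ?thesis using assms by (simp add: power2_eq_square)
  qed
  finally have d2: "((\<lambda>u. arctan ((u - ?a) / ?b)) has_real_derivative ?b / ((u - ?a)\<^sup>2 + ?b\<^sup>2)) (at u)" .
  have "(Fz \<zeta> has_vector_derivative of_real ((u - ?a) / ((u - ?a)\<^sup>2 + ?b\<^sup>2)) + \<i> * of_real (?b / ((u - ?a)\<^sup>2 + ?b\<^sup>2))) (at u)"
    unfolding Fz_def[abs_def]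
    by (intro has_vector_derivative_add has_vector_derivative_of_real has_vector_derivative_mult_right d1 d2)
  also have "of_real ((u - ?a) / ((u - ?a)\<^sup>2 + ?b\<^sup>2)) + \<i> * of_real (?b / ((u - ?a)\<^sup>2 + ?b\<^sup>2)) = - rz \<zeta> u"
  proof -
    define x where "x = u - ?a"
    define y where "y = ?b"
    define Q where "Q = x\<^sup>2 + y\<^sup>2"
    have Q: "Q \<noteq> 0" using p unfolding Q_def x_def y_def by linarith
    have d: "\<zeta> - of_real u = - (of_real x - \<i> * of_real y)" by (simp add: complex_eq_iff x_def y_def)
    have "(of_real (x / Q) + \<i> * of_real (y / Q)) * (of_real x - \<i> * of_real y) = of_real ((x * x + y * y) / Q)"
      by (simp add: complex_eq_iff add_divide_distrib)
    also have "(x * x + y * y) / Q = 1" using Q by (simp add: Q_def power2_eq_square)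
    finally have one: "(of_real (x / Q) + \<i> * of_real (y / Q)) * (of_real x - \<i> * of_real y) = 1" by simp
    then have "of_real x - \<i> * of_real y \<noteq> 0" by (metis mult_zero_right zero_neq_one)
    with one have "of_real (x / Q) + \<i> * of_real (y / Q) = 1 / (of_real x - \<i> * of_real y)" by (simp only: eq_divide_eq) simp
    also have "\<dots> = - rz \<zeta> u" unfolding rz_def d by (simp only: divide_minus_right minus_minus)
    finally show ?thesis by (simp only: Q_def x_def y_def)
  qed
  finally show ?thesis .
qed

lemma quadratic_ratio_tendsto: "((\<lambda>u::real. ((u - p)\<^sup>2 + q) / ((u - r)\<^sup>2 + s)) \<longlongrightarrow> 1) at_infinity"
proof -
  have l: "((\<lambda>u::real. ((1 - p * inverse u)\<^sup>2 + q * (inverse u)\<^sup>2) / ((1 - r * inverse u)\<^sup>2 + s * (inverse u)\<^sup>2)) \<longlongrightarrow>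
      ((1 - p * 0)\<^sup>2 + q * 0\<^sup>2) / ((1 - r * 0)\<^sup>2 + s * 0\<^sup>2)) at_infinity"
    by (intro tendsto_intros tendsto_inverse_0) simp
  have ev: "\<forall>\<^sub>F u::real in at_infinity. ((1 - p * inverse u)\<^sup>2 + q * (inverse u)\<^sup>2) / ((1 - r * inverse u)\<^sup>2 + s * (inverse u)\<^sup>2)
      = ((u - p)\<^sup>2 + q) / ((u - r)\<^sup>2 + s)"
    unfolding eventually_at_infinity
  proof (intro exI[of _ 1] allI impI)
    fix u :: real assume "1 \<le> norm u"
    then have u: "u \<noteq> 0" by auto
    have e: "(1 - p * inverse u)\<^sup>2 + q * (inverse u)\<^sup>2 = ((u - p)\<^sup>2 + q) * (inverse u)\<^sup>2" for p q
    proof -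
      have "1 - p * inverse u = (u - p) * inverse u" using u by (simp add: left_diff_distrib)
      then show ?thesis by (simp add: power_mult_distrib distrib_right)
    qed
    show "((1 - p * inverse u)\<^sup>2 + q * (inverse u)\<^sup>2) / ((1 - r * inverse u)\<^sup>2 + s * (inverse u)\<^sup>2) = ((u - p)\<^sup>2 + q) / ((u - r)\<^sup>2 + s)"
      unfolding e using u by simp
  qed
  from Lim_transform_eventually[OF l ev] show ?thesis by simp
qed

text \<open>The logarithms of the moduli cancel in the difference at infinity; the arctangents tend
  to \<open>pi / 2\<close> up to signs that record the half-planes.\<close>

lemma Fz_diff_tendsto:
  assumes z: "Im \<zeta> \<noteq> 0" and x: "Im \<xi> \<noteq> 0"
  shows "((\<lambda>u. Fz \<xi> u - Fz \<zeta> u) \<longlongrightarrow> \<i> * of_real (pi / 2 * (sgn (Im \<xi>) - sgn (Im \<zeta>)))) at_top"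
    and "((\<lambda>u. Fz \<xi> u - Fz \<zeta> u) \<longlongrightarrow> - \<i> * of_real (pi / 2 * (sgn (Im \<xi>) - sgn (Im \<zeta>)))) at_bot"
proof -
  define L where "L u = ln ((u - Re \<xi>)\<^sup>2 + (Im \<xi>)\<^sup>2) / 2 - ln ((u - Re \<zeta>)\<^sup>2 + (Im \<zeta>)\<^sup>2) / 2" for u
  have L: "(L \<longlongrightarrow> 0) at_infinity"
  proof -
    have "((\<lambda>u. ln (((u - Re \<xi>)\<^sup>2 + (Im \<xi>)\<^sup>2) / ((u - Re \<zeta>)\<^sup>2 + (Im \<zeta>)\<^sup>2)) / 2) \<longlongrightarrow> ln 1 / 2) at_infinity"
      by (intro tendsto_intros quadratic_ratio_tendsto) auto
    moreover have "ln (((u - Re \<xi>)\<^sup>2 + (Im \<xi>)\<^sup>2) / ((u - Re \<zeta>)\<^sup>2 + (Im \<zeta>)\<^sup>2)) / 2 = L u" for u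
    proof -
      have "0 < (u - Re \<xi>)\<^sup>2 + (Im \<xi>)\<^sup>2" "0 < (u - Re \<zeta>)\<^sup>2 + (Im \<zeta>)\<^sup>2" using z x by (auto intro: add_nonneg_pos)
      then show ?thesis using z x by (simp add: L_def ln_div diff_divide_distrib)
    qed
    ultimately show ?thesis by simp
  qed
  have at: "((\<lambda>u. arctan ((u - a) / b)) \<longlongrightarrow> pi / 2 * sgn b) at_top \<and> ((\<lambda>u. arctan ((u - a) / b)) \<longlongrightarrow> - (pi / 2 * sgn b)) at_bot"
    if "b \<noteq> 0" for a b :: real
  proof -
    have t: "filterlim (\<lambda>u. - a + u) at_top at_top" "filterlim (\<lambda>u. - a + u) at_bot at_bot"
    proof -
      show "filterlim (\<lambda>u. - a + u) at_top at_top"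
        by (rule filterlim_tendsto_add_at_top[OF tendsto_const filterlim_ident])
      show "filterlim (\<lambda>u. - a + u) at_bot at_bot"
        unfolding filterlim_at_bot
      proof
        fix Z show "\<forall>\<^sub>F u in at_bot. - a + u \<le> Z"
          using eventually_le_at_bot[of "Z + a"] by eventually_elim simp
      qed
    qed
    show ?thesis
    proof (cases "b > 0")
      case True
      have fl: "filterlim (\<lambda>u. inverse b * (- a + u)) at_top at_top" "filterlim (\<lambda>u. inverse b * (- a + u)) at_bot at_bot"
        by (rule filterlim_tendsto_pos_mult_at_top[OF tendsto_const _ t(1)], use True in simp,
            rule filterlim_tendsto_pos_mult_at_bot[OF tendsto_const _ t(2)], use True in simp)
      have h: "((\<lambda>u. arctan (inverse b * (- a + u))) \<longlongrightarrow> pi / 2) at_top" "((\<lambda>u. arctan (inverse b * (- a + u))) \<longlongrightarrow> - (pi / 2)) at_bot"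
        by (rule filterlim_compose[OF tendsto_arctan_at_top fl(1)], rule filterlim_compose[OF tendsto_arctan_at_bot fl(2)])
      have e: "inverse b * (- a + u) = (u - a) / b" for u by (simp add: divide_inverse)
      from h[unfolded e] show ?thesis using True by simp
    next
      case False
      with that have nb: "0 < - b" by simp
      have fl: "filterlim (\<lambda>u. inverse (- b) * (- a + u)) at_top at_top" "filterlim (\<lambda>u. inverse (- b) * (- a + u)) at_bot at_bot"
        by (rule filterlim_tendsto_pos_mult_at_top[OF tendsto_const _ t(1)], use nb in simp,
            rule filterlim_tendsto_pos_mult_at_bot[OF tendsto_const _ t(2)], use nb in simp)
      have h: "((\<lambda>u. arctan (inverse (- b) * (- a + u))) \<longlongrightarrow> pi / 2) at_top" "((\<lambda>u. arctan (inverse (- b) * (- a + u))) \<longlongrightarrow> - (pi / 2)) at_bot"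
        by (rule filterlim_compose[OF tendsto_arctan_at_top fl(1)], rule filterlim_compose[OF tendsto_arctan_at_bot fl(2)])
      have e: "arctan (inverse (- b) * (- a + u)) = - arctan ((u - a) / b)" for u
      proof -
        have "inverse (- b) * (- a + u) = - ((u - a) / b)" by (simp add: divide_inverse)
        then show ?thesis by (simp only: arctan_minus)
      qed
      from tendsto_minus[OF h(1)[unfolded e]] tendsto_minus[OF h(2)[unfolded e]] show ?thesis using nb by simp
    qed
  qed
  have F: "Fz \<xi> u - Fz \<zeta> u = of_real (L u) + \<i> * of_real (arctan ((u - Re \<xi>) / Im \<xi>) - arctan ((u - Re \<zeta>) / Im \<zeta>))" for u
    by (simp add: Fz_def L_def algebra_simps)
  have "((\<lambda>u. of_real (L u) + \<i> * of_real (arctan ((u - Re \<xi>) / Im \<xi>) - arctan ((u - Re \<zeta>) / Im \<zeta>))) \<longlongrightarrow>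
      of_real 0 + \<i> * complex_of_real (pi / 2 * sgn (Im \<xi>) - pi / 2 * sgn (Im \<zeta>))) at_top"
    by (intro tendsto_add tendsto_of_real tendsto_mult tendsto_const tendsto_diff tendsto_mono[OF at_top_le_at_infinity L]
        at[OF x, THEN conjunct1] at[OF z, THEN conjunct1])
  then show "((\<lambda>u. Fz \<xi> u - Fz \<zeta> u) \<longlongrightarrow> \<i> * of_real (pi / 2 * (sgn (Im \<xi>) - sgn (Im \<zeta>)))) at_top"
    unfolding F by (simp add: right_diff_distrib)
  have "((\<lambda>u. of_real (L u) + \<i> * of_real (arctan ((u - Re \<xi>) / Im \<xi>) - arctan ((u - Re \<zeta>) / Im \<zeta>))) \<longlongrightarrow>
      of_real 0 + \<i> * complex_of_real (- (pi / 2 * sgn (Im \<xi>)) - - (pi / 2 * sgn (Im \<zeta>)))) at_bot"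
    by (intro tendsto_add tendsto_of_real tendsto_mult tendsto_const tendsto_diff tendsto_mono[OF at_bot_le_at_infinity L]
        at[OF x, THEN conjunct2] at[OF z, THEN conjunct2])
  then show "((\<lambda>u. Fz \<xi> u - Fz \<zeta> u) \<longlongrightarrow> - \<i> * of_real (pi / 2 * (sgn (Im \<xi>) - sgn (Im \<zeta>)))) at_bot"
    unfolding F by (simp add: right_diff_distrib algebra_simps)
qed

lemma integral_line_FTC:
  fixes f F :: "real \<Rightarrow> complex"
  assumes "\<And>x. (F has_vector_derivative f x) (at x)" "continuous_on UNIV f" "integrable lborel f"
    "(F \<longlongrightarrow> A) at_bot" "(F \<longlongrightarrow> B) at_top"
  shows "(\<integral>x. f x \<partial>lborel) = B - A"
proof -
  have "(LBINT x=-\<infinity>..\<infinity>. f x) = B - A"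
    by (rule interval_integral_FTC_integrable[where F = F])
      (use assms in \<open>auto simp: ereal_tendsto_simps set_integrable_def continuous_on_eq_continuous_at\<close>)
  then show ?thesis by (simp add: interval_lebesgue_integral_def set_lebesgue_integral_def)
qed

text \<open>For distinct poles the integral is \<open>\<i> * pi * (sgn (Im \<xi>) - sgn (Im
  \<zeta>)) / (\<xi> - \<zeta>)\<close>, the residue value, read off from an antiderivative built
  with \<open>Fz\<close>; for equal poles the resolvent itself is an antiderivative.\<close>

lemma integral_rz_mult_sq:
  assumes z: "Im \<zeta> \<noteq> 0" and x: "Im \<xi> \<noteq> 0"
  shows "(\<integral>u. rz \<zeta> u * rz \<xi> u \<partial>lborel)\<^sup>2 = - (4 * of_real (pi\<^sup>2)) * opp \<zeta> \<xi>"
proof (cases "\<zeta> = \<xi>")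
  case True
  have lim: "(rz \<zeta> \<longlongrightarrow> 0) at_infinity"
  proof -
    obtain D where D: "D \<ge> 0" "\<And>u. norm (rz \<zeta> u) \<le> D * cw u" using rz_decay[OF z] by blast
    show ?thesis
    proof (rule Lim_null_comparison)
      have "((\<lambda>u::real. D * norm (inverse u)) \<longlongrightarrow> D * norm (0::real)) at_infinity"
        by (intro tendsto_mult tendsto_const tendsto_norm tendsto_inverse_0)
      then show "((\<lambda>u::real. D * norm (inverse u)) \<longlongrightarrow> 0) at_infinity" by simp
      show "\<forall>\<^sub>F u in at_infinity. norm (rz \<zeta> u) \<le> D * norm (inverse u)"
        unfolding eventually_at_infinity
      proof (intro exI[of _ 1] allI impI)
        fix u :: real assume u: "1 \<le> norm u"
        have "\<bar>u\<bar> \<le> sqrt (1 + u\<^sup>2)" by (rule real_le_rsqrt) simp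
        then have "cw u \<le> norm (inverse u)"
          unfolding cw_def using u by (simp add: inverse_eq_divide abs_divide frac_le)
        then show "norm (rz \<zeta> u) \<le> D * norm (inverse u)" using D mult_left_mono order_trans by blast
      qed
    qed
  qed
  have "(\<integral>u. rz \<zeta> u * rz \<zeta> u \<partial>lborel) = 0 - 0"
  proof (rule integral_line_FTC[where F = "rz \<zeta>"])
    show "(rz \<zeta> has_vector_derivative rz \<zeta> u * rz \<zeta> u) (at u)" for u
      using rz_deriv[OF z, of 1 0 u] by (simp add: power2_eq_square)
    show "continuous_on UNIV (\<lambda>u. rz \<zeta> u * rz \<zeta> u)" by (intro continuous_intros continuous_rz z)
    show "(rz \<zeta> \<longlongrightarrow> 0) at_bot" "(rz \<zeta> \<longlongrightarrow> 0) at_top"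
      by (rule tendsto_mono[OF at_bot_le_at_infinity lim], rule tendsto_mono[OF at_top_le_at_infinity lim])
  qed (rule integrable_rz_mult[OF z z])
  then show ?thesis using True by (simp add: opp_def)
next
  case False
  define d where "d = \<xi> - \<zeta>"
  have d: "d \<noteq> 0" using False by (simp add: d_def)
  define s where "s = sgn (Im \<xi>) - sgn (Im \<zeta>)"
  define G where "G u = (Fz \<xi> u - Fz \<zeta> u) / d" for u
  have "(\<integral>u. rz \<zeta> u * rz \<xi> u \<partial>lborel) = (\<i> * of_real (pi / 2 * s)) / d - (- \<i> * of_real (pi / 2 * s)) / d"
  proof (rule integral_line_FTC[where F = G])
    fix u
    have "((\<lambda>u. (1 / d) * (Fz \<xi> u - Fz \<zeta> u)) has_vector_derivative (1 / d) * (- rz \<xi> u - - rz \<zeta> u)) (at u)"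
      by (intro has_vector_derivative_mult_right has_vector_derivative_diff Fz_deriv z x)
    also have "- rz \<xi> u - - rz \<zeta> u = d * (rz \<zeta> u * rz \<xi> u)"
      using rz_diff_pole[OF z x, of u] by (simp add: d_def)
    finally show "(G has_vector_derivative rz \<zeta> u * rz \<xi> u) (at u)" using d by (simp add: G_def[abs_def])
  next
    show "(G \<longlongrightarrow> (- \<i> * of_real (pi / 2 * s)) / d) at_bot"
      unfolding G_def s_def by (intro tendsto_divide tendsto_const Fz_diff_tendsto z x d)
    show "(G \<longlongrightarrow> (\<i> * of_real (pi / 2 * s)) / d) at_top"
      unfolding G_def s_def by (intro tendsto_divide tendsto_const Fz_diff_tendsto z x d)
    show "continuous_on UNIV (\<lambda>u. rz \<zeta> u * rz \<xi> u)" by (intro continuous_intros continuous_rz z x)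
  qed (rule integrable_rz_mult[OF z x])
  also have "\<dots> = \<i> * of_real (pi * s) / d" by (simp add: add_divide_distrib[symmetric])
  finally have "(\<integral>u. rz \<zeta> u * rz \<xi> u \<partial>lborel)\<^sup>2 = - (of_real (pi\<^sup>2 * s\<^sup>2)) / d\<^sup>2"
    by (simp add: power_divide power_mult_distrib)
  also have "\<dots> = - (4 * of_real (pi\<^sup>2)) * opp \<zeta> \<xi>"
  proof (cases "sgn (Im \<zeta>) = sgn (Im \<xi>)")
    case True
    then show ?thesis by (simp add: s_def opp_def)
  next
    case False
    then have "s\<^sup>2 = 4" using z x by (auto simp: s_def sgn_real_def power2_eq_square split: if_splits)
    then show ?thesis using False by (simp add: opp_def d_def power2_commute[of \<xi>] mult.commute)
  qed
  finally show ?thesis .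
qed

lemma AE_lborel_pair_neq: "AE p in lborel \<Otimes>\<^sub>M lborel. fst p \<noteq> (snd p :: real)"
proof -
  have m: "{p \<in> space (lborel \<Otimes>\<^sub>M lborel). fst p \<noteq> (snd p :: real)} \<in> sets (lborel \<Otimes>\<^sub>M lborel)"
    by measurable
  have "AE y in lborel. x \<noteq> y" for x :: real
    using AE_lborel_singleton[of x] by eventually_elim auto
  then have "AE x in lborel. AE y in lborel. x \<noteq> (y::real)" by simp
  then show ?thesis
    by (intro lborel_pair.AE_pair_measure[OF m]) simp
qed

lemma integral_pair_mult:
  fixes f g :: "real \<Rightarrow> 'a::{real_normed_field, banach, second_countable_topology}"
  assumes f: "integrable lborel f" and g: "integrable lborel g"
  shows "integrable (lborel \<Otimes>\<^sub>M lborel) (\<lambda>p. f (fst p) * g (snd p))"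
    and "(\<integral>p. f (fst p) * g (snd p) \<partial>(lborel \<Otimes>\<^sub>M lborel)) = (\<integral>x. f x \<partial>lborel) * (\<integral>y. g y \<partial>lborel)"
proof -
  have [measurable]: "f \<in> borel_measurable borel" "g \<in> borel_measurable borel" using f g by auto
  show i: "integrable (lborel \<Otimes>\<^sub>M lborel) (\<lambda>p. f (fst p) * g (snd p))"
  proof (rule lborel_pair.Fubini_integrable)
    show "AE x in lborel. integrable lborel (\<lambda>y. f (fst (x, y)) * g (snd (x, y)))"
      using g by (auto intro!: AE_I2)
    show "integrable lborel (\<lambda>x. \<integral>y. norm (f (fst (x, y)) * g (snd (x, y))) \<partial>lborel)"
      using f by (simp add: norm_mult)
  qed measurable
  show "(\<integral>p. f (fst p) * g (snd p) \<partial>(lborel \<Otimes>\<^sub>M lborel)) = (\<integral>x. f x \<partial>lborel) * (\<integral>y. g y \<partial>lborel)"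
    using lborel_pair.integral_fst'[OF i] by simp
qed

text \<open>The difference quotient of a resolvent is the product of its values at the two points,
  so the squared quotient of \<open>f\<close> is a double sum of functions of \<open>x\<close> times
  the same functions of \<open>y\<close>, and the double integral becomes a sum of squared single
  integrals. The diagonal, where the quotient is \<open>0 / 0\<close>, is a null set.\<close>

lemma (in resolvent_combo) sigma_sq_combo:
  "(\<Sum>l\<in>I. \<Sum>k\<in>I. c l * c k * opp (pole l) (pole k)) = - complex_of_real (sigma_sq f)"
proof -
  let ?P = "lborel \<Otimes>\<^sub>M lborel :: (real \<times> real) measure"
  let ?r = "\<lambda>k. rz (pole k)"
  have i: "integrable lborel (\<lambda>u. ?r l u * ?r k u)" if "l \<in> I" "k \<in> I" for l k
    by (rule integrable_rz_mult[OF pole[OF that(1)] pole[OF that(2)]])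
  define S where "S p = (\<Sum>l\<in>I. \<Sum>k\<in>I. c l * c k * ((?r l (fst p) * ?r k (fst p)) * (?r l (snd p) * ?r k (snd p))))" for p :: "real \<times> real"
  have ip: "integrable ?P (\<lambda>p. (?r l (fst p) * ?r k (fst p)) * (?r l (snd p) * ?r k (snd p)))"
    and vp: "(\<integral>p. (?r l (fst p) * ?r k (fst p)) * (?r l (snd p) * ?r k (snd p)) \<partial>?P) = (\<integral>u. ?r l u * ?r k u \<partial>lborel)\<^sup>2"
    if "l \<in> I" "k \<in> I" for l k
    using integral_pair_mult[OF i[OF that] i[OF that]] by (auto simp: power2_eq_square)
  have iS: "integrable ?P S"
    unfolding S_def[abs_def] by (intro Bochner_Integration.integrable_sum integrable_mult_right ip)
  have vS: "(\<integral>p. S p \<partial>?P) = (\<Sum>l\<in>I. \<Sum>k\<in>I. c l * c k * (\<integral>u. ?r l u * ?r k u \<partial>lborel)\<^sup>2)"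
  proof -
    have "(\<integral>p. S p \<partial>?P) = (\<Sum>l\<in>I. \<integral>p. (\<Sum>k\<in>I. c l * c k * ((?r l (fst p) * ?r k (fst p)) * (?r l (snd p) * ?r k (snd p)))) \<partial>?P)"
      unfolding S_def by (rule Bochner_Integration.integral_sum) (intro Bochner_Integration.integrable_sum integrable_mult_right ip)
    also have "\<dots> = (\<Sum>l\<in>I. \<Sum>k\<in>I. \<integral>p. c l * c k * ((?r l (fst p) * ?r k (fst p)) * (?r l (snd p) * ?r k (snd p))) \<partial>?P)"
      by (rule sum.cong[OF refl], rule Bochner_Integration.integral_sum) (intro integrable_mult_right ip)
    also have "\<dots> = (\<Sum>l\<in>I. \<Sum>k\<in>I. c l * c k * (\<integral>u. ?r l u * ?r k u \<partial>lborel)\<^sup>2)"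
      by (intro sum.cong refl) (simp only: integral_mult_right_zero vp)
    finally show ?thesis .
  qed
  have fm [measurable]: "f \<in> borel_measurable borel" by (intro borel_measurable_continuous_onI f_cont)
  have "complex_of_real (\<integral>p. (case p of (x, y) \<Rightarrow> ((f x - f y) / (x - y))\<^sup>2) \<partial>?P) =
      (\<integral>p. complex_of_real (case p of (x, y) \<Rightarrow> ((f x - f y) / (x - y))\<^sup>2) \<partial>?P)"
    by simp
  also have "\<dots> = (\<integral>p. S p \<partial>?P)"
  proof (rule integral_cong_AE)
    show "(\<lambda>p. complex_of_real (case p of (x, y) \<Rightarrow> ((f x - f y) / (x - y))\<^sup>2)) \<in> borel_measurable ?P" by measurable
    show "S \<in> borel_measurable ?P" using iS by auto
    show "AE p in ?P. complex_of_real (case p of (x, y) \<Rightarrow> ((f x - f y) / (x - y))\<^sup>2) = S p"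
      using AE_lborel_pair_neq
    proof eventually_elim
      case (elim p)
      obtain x y where p: "p = (x, y)" by (cases p)
      with elim have xy: "complex_of_real (x - y) \<noteq> 0" by simp
      have "complex_of_real (f x - f y) = (\<Sum>k\<in>I. c k * (?r k x - ?r k y))"
        by (simp add: f_eq sum_subtractf right_diff_distrib)
      also have "\<dots> = of_real (x - y) * (\<Sum>k\<in>I. c k * (?r k x * ?r k y))"
        unfolding sum_distrib_left by (intro sum.cong refl) (simp add: rz_diff[OF pole] del: of_real_diff)
      finally have "complex_of_real ((f x - f y) / (x - y)) = (\<Sum>k\<in>I. c k * (?r k x * ?r k y))"
        using xy by (simp add: of_real_divide del: of_real_diff)
      then have "complex_of_real (((f x - f y) / (x - y))\<^sup>2) = (\<Sum>k\<in>I. c k * (?r k x * ?r k y))\<^sup>2"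
        by (simp only: of_real_power)
      also have "\<dots> = S p"
        unfolding S_def p power2_eq_square sum_product by (intro sum.cong refl) (simp add: mult_ac)
      finally show ?case by (simp only: p prod.case)
    qed
  qed
  also have "\<dots> = (\<Sum>l\<in>I. \<Sum>k\<in>I. c l * c k * (- (4 * of_real (pi\<^sup>2)) * opp (pole l) (pole k)))"
    unfolding vS by (intro sum.cong refl) (simp only: integral_rz_mult_sq[OF pole pole])
  also have "\<dots> = - (4 * of_real (pi\<^sup>2)) * (\<Sum>l\<in>I. \<Sum>k\<in>I. c l * c k * opp (pole l) (pole k))"
    by (simp only: sum_distrib_left mult.left_commute)
  finally have "complex_of_real (sigma_sq f) = 1 / (4 * of_real (pi\<^sup>2)) * (- (4 * of_real (pi\<^sup>2)) * (\<Sum>l\<in>I. \<Sum>k\<in>I. c l * c k * opp (pole l) (pole k)))"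
    by (simp add: sigma_sq_def)
  then show ?thesis by simp
qed

section \<open>Approximation by Poisson integrals\<close>

lemma mult_cos_le_sin:
  assumes "0 \<le> y" "y \<le> pi"
  shows "y * cos y \<le> sin y"
proof -
  have "sin 0 - 0 * cos 0 \<le> sin y - y * cos y"
  proof (rule DERIV_nonneg_imp_nondecreasing[OF assms(1)])
    fix t assume t: "0 \<le> t" "t \<le> y"
    have "((\<lambda>t. sin t - t * cos t) has_real_derivative t * sin t) (at t)"
      by (auto intro!: derivative_eq_intros)
    moreover have "0 \<le> t * sin t" using t assms by (intro mult_nonneg_nonneg sin_ge_zero) auto
    ultimately show "\<exists>z. ((\<lambda>t. sin t - t * cos t) has_real_derivative z) (at t) \<and> 0 \<le> z" by blast
  qed
  then show ?thesis by simp
qed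

text \<open>With \<open>y = x / 2\<close>, the value \<open>2 * sin y * cos y\<close> is at least
  \<open>2 * y * (cos y)\<^sup>2\<close>, and the squared cosine is at least \<open>1 / 2\<close> up
  to \<open>pi / 4\<close>.\<close>

lemma half_le_sin:
  assumes "0 \<le> x" "x \<le> pi / 2"
  shows "x / 2 \<le> sin x"
proof -
  define y where "y = x / 2"
  have y: "0 \<le> y" "y \<le> pi / 4" using assms by (auto simp: y_def)
  have c: "sqrt 2 / 2 \<le> cos y" using cos_monotone_0_pi_le[OF y(1) y(2)] pi_gt_zero by (simp add: cos_45)
  then have "(sqrt 2 / 2)\<^sup>2 \<le> (cos y)\<^sup>2" by (intro power_mono) auto
  then have c2: "1 / 2 \<le> (cos y)\<^sup>2" by (simp add: power_divide)
  have c0: "0 \<le> cos y" using c by (rule order.trans[rotated]) simp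
  have "x / 2 \<le> 2 * y * (1 / 2)" by (simp add: y_def)
  also have "\<dots> \<le> 2 * y * (cos y)\<^sup>2" using c2 y by (intro mult_left_mono) auto
  also have "\<dots> = 2 * (y * cos y) * cos y" by (simp add: power2_eq_square)
  also have "\<dots> \<le> 2 * sin y * cos y"
    using mult_cos_le_sin[of y] y pi_gt_zero c0 by (intro mult_right_mono mult_left_mono) auto
  also have "\<dots> = sin x" using sin_double[of y] by (simp add: y_def)
  finally show ?thesis .
qed

lemma sin_arctan_diff: "sin (arctan v - arctan u) = (v - u) * (cw u * cw v)"
  by (simp add: sin_diff sin_arctan cos_arctan cw_def diff_divide_distrib mult.commute)

text \<open>With \<delta> the difference of the arctangents, integrating the derivative directly
  bounds the increment by \<open>\<epsilon> * \<delta>\<close>, and going round through infinity,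
  where both limits are 0, by \<open>\<epsilon> * (pi - \<delta>)\<close>. The smaller of the two is
  at most \<open>2 * \<epsilon> * sin \<delta>\<close>, the chordal distance times
  \<open>2 * \<epsilon>\<close>.\<close>

lemma chordal_of_derivative:
  fixes D D' :: "real \<Rightarrow> real"
  assumes d: "\<And>u. (D has_real_derivative D' u) (at u)" and b: "\<And>u. \<bar>D' u\<bar> \<le> \<epsilon> * (cw u)\<^sup>2"
    and top: "(D \<longlongrightarrow> 0) at_top" and bot: "(D \<longlongrightarrow> 0) at_bot"
  shows "chordal D (2 * \<epsilon>)"
proof -
  have e0: "0 \<le> \<epsilon>"
  proof -
    have "0 \<le> \<epsilon> * (cw 0)\<^sup>2" using b[of 0] abs_ge_zero order_trans by blast
    then show ?thesis by (simp add: cw_def)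
  qed
  have cwi: "(cw t)\<^sup>2 = inverse (1 + t\<^sup>2)" for t
  proof -
    have "0 \<le> 1 + t\<^sup>2" by simp
    then show ?thesis by (simp add: cw_def power_divide inverse_eq_divide)
  qed
  have mono: "\<bar>D v - D u\<bar> \<le> \<epsilon> * (arctan v - arctan u)" if uv: "u \<le> v" for u v
  proof (rule abs_leI)
    have "\<epsilon> * arctan u - D u \<le> \<epsilon> * arctan v - D v"
    proof (rule DERIV_nonneg_imp_nondecreasing[OF uv])
      fix t
      have "((\<lambda>t. \<epsilon> * arctan t - D t) has_real_derivative \<epsilon> * (cw t)\<^sup>2 - D' t) (at t)"
        unfolding cwi by (intro DERIV_diff DERIV_cmult DERIV_arctan d)
      moreover have "0 \<le> \<epsilon> * (cw t)\<^sup>2 - D' t" using b[of t] by (simp add: abs_le_iff)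
      ultimately show "\<exists>z. ((\<lambda>t. \<epsilon> * arctan t - D t) has_real_derivative z) (at t) \<and> 0 \<le> z" by blast
    qed
    then show "D v - D u \<le> \<epsilon> * (arctan v - arctan u)" by (simp add: right_diff_distrib)
    have "\<epsilon> * arctan u + D u \<le> \<epsilon> * arctan v + D v"
    proof (rule DERIV_nonneg_imp_nondecreasing[OF uv])
      fix t
      have "((\<lambda>t. \<epsilon> * arctan t + D t) has_real_derivative \<epsilon> * (cw t)\<^sup>2 + D' t) (at t)"
        unfolding cwi by (intro DERIV_add DERIV_cmult DERIV_arctan d)
      moreover have "0 \<le> \<epsilon> * (cw t)\<^sup>2 + D' t" using b[of t] by (simp add: abs_le_iff)
      ultimately show "\<exists>z. ((\<lambda>t. \<epsilon> * arctan t + D t) has_real_derivative z) (at t) \<and> 0 \<le> z" by blast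
    qed
    then show "- (D v - D u) \<le> \<epsilon> * (arctan v - arctan u)" by (simp add: right_diff_distrib)
  qed
  have up: "\<bar>D u\<bar> \<le> \<epsilon> * (pi / 2 - arctan u)" for u
  proof (rule tendsto_upperbound)
    show "((\<lambda>w. \<bar>D w - D u\<bar>) \<longlongrightarrow> \<bar>D u\<bar>) at_top"
      using tendsto_rabs[OF tendsto_diff[OF top tendsto_const[of "D u"]]] by simp
    show "\<forall>\<^sub>F w in at_top. \<bar>D w - D u\<bar> \<le> \<epsilon> * (pi / 2 - arctan u)"
      using eventually_ge_at_top[of u]
    proof eventually_elim
      case (elim w)
      have "\<epsilon> * (arctan w - arctan u) \<le> \<epsilon> * (pi / 2 - arctan u)"
        using e0 arctan_bounded[of w] by (intro mult_left_mono) auto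
      with mono[OF elim] show ?case by linarith
    qed
  qed simp
  have dn: "\<bar>D u\<bar> \<le> \<epsilon> * (arctan u + pi / 2)" for u
  proof (rule tendsto_upperbound)
    show "((\<lambda>w. \<bar>D u - D w\<bar>) \<longlongrightarrow> \<bar>D u\<bar>) at_bot"
      using tendsto_rabs[OF tendsto_diff[OF tendsto_const[of "D u"] bot]] by simp
    show "\<forall>\<^sub>F w in at_bot. \<bar>D u - D w\<bar> \<le> \<epsilon> * (arctan u + pi / 2)"
      using eventually_le_at_bot[of u]
    proof eventually_elim
      case (elim w)
      have "\<epsilon> * (arctan u - arctan w) \<le> \<epsilon> * (arctan u + pi / 2)"
        using e0 arctan_bounded[of w] by (intro mult_left_mono) auto
      with mono[OF elim] show ?case by linarith
    qed
  qed simp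
  have main: "\<bar>D v - D u\<bar> \<le> 2 * \<epsilon> * ((v - u) * (cw u * cw v))" if uv: "u \<le> v" for u v
  proof -
    define \<delta> where "\<delta> = arctan v - arctan u"
    have sd: "sin \<delta> = (v - u) * (cw u * cw v)" unfolding \<delta>_def by (rule sin_arctan_diff)
    have d0: "0 \<le> \<delta>" using uv by (simp add: \<delta>_def arctan_le_iff)
    have dpi: "\<delta> \<le> pi" using arctan_bounded[of u] arctan_bounded[of v] by (simp add: \<delta>_def)
    have 1: "\<bar>D v - D u\<bar> \<le> \<epsilon> * \<delta>" using mono[OF uv] by (simp add: \<delta>_def)
    have "\<bar>D v - D u\<bar> \<le> \<bar>D v\<bar> + \<bar>D u\<bar>" by (rule abs_triangle_ineq4)
    also have "\<dots> \<le> \<epsilon> * (pi / 2 - arctan v) + \<epsilon> * (arctan u + pi / 2)" by (intro add_mono up dn)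
    also have "\<dots> = \<epsilon> * (pi - \<delta>)" by (simp add: \<delta>_def algebra_simps)
    finally have 2: "\<bar>D v - D u\<bar> \<le> \<epsilon> * (pi - \<delta>)" .
    have "\<bar>D v - D u\<bar> \<le> \<epsilon> * (2 * sin \<delta>)"
    proof (cases "\<delta> \<le> pi / 2")
      case True
      have "\<epsilon> * \<delta> \<le> \<epsilon> * (2 * sin \<delta>)" using half_le_sin[OF d0 True] e0 by (intro mult_left_mono) auto
      with 1 show ?thesis by linarith
    next
      case False
      have "(pi - \<delta>) / 2 \<le> sin (pi - \<delta>)" using False dpi by (intro half_le_sin) auto
      then have "\<epsilon> * (pi - \<delta>) \<le> \<epsilon> * (2 * sin \<delta>)" using e0 by (intro mult_left_mono) auto
      with 2 show ?thesis by linarith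
    qed
    then show ?thesis by (simp add: sd mult_ac)
  qed
  show ?thesis unfolding chordal_def
  proof (intro allI)
    fix u v
    show "norm (D u - D v) \<le> 2 * \<epsilon> * (\<bar>u - v\<bar> * (cw u * cw v))"
    proof (cases "u \<le> v")
      case True
      then have "\<bar>u - v\<bar> = v - u" by simp
      with main[OF True] show ?thesis by (simp add: abs_minus_commute[of "D u"])
    next
      case False
      then have vu: "v \<le> u" by simp
      then have "\<bar>u - v\<bar> = u - v" by simp
      with main[OF vu] show ?thesis by (simp add: mult.commute[of "cw u" "cw v"])
    qed
  qed
qed

text \<open>The integrand enters the error only through its Lipschitz constant, so a constant of the
  form \<open>L * (cw u)\<^sup>2\<close> carries its decay in a parameter \<open>u\<close> over to
  the error.\<close>

lemma riemann_sum_error: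
  fixes G :: "real \<Rightarrow> real"
  assumes G: "continuous_on {a..b} G" and ab: "a \<le> b" and m: "m > 0"
    and lip: "\<And>v w. v \<in> {a..b} \<Longrightarrow> w \<in> {a..b} \<Longrightarrow> \<bar>G v - G w\<bar> \<le> L * \<bar>v - w\<bar>" and L: "0 \<le> L"
  defines "\<delta> \<equiv> (b - a) / real m"
  shows "\<bar>integral {a..b} G - (\<Sum>k<m. \<delta> * G (a + real k * \<delta>))\<bar> \<le> L * (b - a) * \<delta>"
proof -
  have d0: "0 \<le> \<delta>" using ab by (simp add: \<delta>_def)
  have dm: "real m * \<delta> = b - a" using m by (simp add: \<delta>_def)
  have le: "a + real j * \<delta> \<le> b" if "j \<le> m" for j
  proof -
    have "real j * \<delta> \<le> real m * \<delta>" using that d0 by (intro mult_right_mono) auto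
    then show ?thesis using dm by simp
  qed
  have "\<bar>integral {a..a + real j * \<delta>} G - (\<Sum>k<j. \<delta> * G (a + real k * \<delta>))\<bar> \<le> L * \<delta> * (real j * \<delta>)" if "j \<le> m" for j
    using that
  proof (induction j)
    case (Suc j)
    let ?c = "a + real j * \<delta>" and ?e = "a + real (Suc j) * \<delta>"
    have ce: "?c \<le> ?e" "?e \<le> b" "a \<le> ?c" using le[OF Suc.prems] d0 by (auto simp: algebra_simps)
    have cont: "continuous_on {?c..?e} G" "continuous_on {a..?e} G"
      using ce by (auto intro!: continuous_on_subset[OF G])
    have i: "integral {a..?c} G + integral {?c..?e} G = integral {a..?e} G"
      by (rule Henstock_Kurzweil_Integration.integral_combine) (use ce cont integrable_continuous_interval in auto)
    have "integral {?c..?e} G - \<delta> * G ?c = integral {?c..?e} (\<lambda>v. G v - G ?c)"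
      using ce cont(1) d0 by (subst Henstock_Kurzweil_Integration.integral_diff) (auto intro!: integrable_continuous_interval simp: algebra_simps)
    also have "norm \<dots> \<le> (L * \<delta>) * (?e - ?c)"
    proof (rule integral_bound[OF ce(1)])
      show "continuous_on {?c..?e} (\<lambda>v. G v - G ?c)" by (intro continuous_intros cont)
      fix v assume v: "v \<in> {?c..?e}"
      have "\<bar>G v - G ?c\<bar> \<le> L * \<bar>v - ?c\<bar>" using v ce by (intro lip) auto
      also have "\<dots> \<le> L * \<delta>" using v L by (intro mult_left_mono) (auto simp: algebra_simps)
      finally show "norm (G v - G ?c) \<le> L * \<delta>" by simp
    qed
    finally have s: "\<bar>integral {?c..?e} G - \<delta> * G ?c\<bar> \<le> (L * \<delta>) * \<delta>" by (simp add: algebra_simps)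
    have IH: "\<bar>integral {a..?c} G - (\<Sum>k<j. \<delta> * G (a + real k * \<delta>))\<bar> \<le> L * \<delta> * (real j * \<delta>)" using Suc by simp
    have "integral {a..?e} G - (\<Sum>k<Suc j. \<delta> * G (a + real k * \<delta>)) =
        (integral {a..?c} G - (\<Sum>k<j. \<delta> * G (a + real k * \<delta>))) + (integral {?c..?e} G - \<delta> * G ?c)"
      using i by simp
    then have "\<bar>integral {a..?e} G - (\<Sum>k<Suc j. \<delta> * G (a + real k * \<delta>))\<bar> \<le> L * \<delta> * (real j * \<delta>) + (L * \<delta>) * \<delta>"
      using IH s by linarith
    then show ?case by (simp add: algebra_simps)
  qed simp
  from this[of m] show ?thesis using dm by (simp add: mult_ac)
qed

text \<open>The Poisson kernel of the half-plane without its factor \<open>1 / pi\<close>.\<close>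

definition pois :: "real \<Rightarrow> real \<Rightarrow> real \<Rightarrow> real" where
  "pois \<eta> v u = - Im (rz (Complex v \<eta>) u)"

definition pois' :: "real \<Rightarrow> real \<Rightarrow> real \<Rightarrow> real" where
  "pois' \<eta> v u = - Im ((rz (Complex v \<eta>) u)\<^sup>2)"

lemma pois_eq: "pois \<eta> v u = \<eta> / ((v - u)\<^sup>2 + \<eta>\<^sup>2)"
  by (simp add: pois_def rz_def Im_divide)

lemma pois_deriv_u:
  assumes "\<eta> \<noteq> 0"
  shows "(pois \<eta> v has_real_derivative pois' \<eta> v u) (at u)"
proof -
  have "((\<lambda>u. Im (rz (Complex v \<eta>) u)) has_vector_derivative Im ((rz (Complex v \<eta>) u)\<^sup>2)) (at u)"
    using rz_deriv[of "Complex v \<eta>" 1 0 u] assms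
    by (intro bounded_linear.has_vector_derivative[OF bounded_linear_Im]) simp
  then have "((\<lambda>u. Im (rz (Complex v \<eta>) u)) has_real_derivative Im ((rz (Complex v \<eta>) u)\<^sup>2)) (at u)"
    by (simp add: has_real_derivative_iff_has_vector_derivative)
  from DERIV_minus[OF this] show ?thesis by (simp add: pois_def[abs_def] pois'_def)
qed

lemma rz_translate: "rz (Complex v \<eta>) u = rz (Complex 0 \<eta>) (u - v)"
proof -
  have "Complex v \<eta> - of_real u = Complex 0 \<eta> - of_real (u - v)" by (simp add: complex_eq_iff)
  then show ?thesis by (simp add: rz_def)
qed

lemma pois_deriv_v:
  assumes "\<eta> \<noteq> 0"
  shows "((\<lambda>v. pois \<eta> v u) has_real_derivative - pois' \<eta> v u) (at v)"
proof -
  have t: "pois \<eta> v u = pois \<eta> 0 (u - v)" "pois' \<eta> v u = pois' \<eta> 0 (u - v)" for v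
    unfolding pois_def pois'_def by (simp_all only: rz_translate[of v \<eta> u])
  have "((\<lambda>v. pois \<eta> 0 (u - v)) has_real_derivative pois' \<eta> 0 (u - v) * (- 1)) (at v)"
    by (rule DERIV_chain2[OF pois_deriv_u[OF assms]]) (auto intro!: derivative_eq_intros)
  then show ?thesis unfolding t by simp
qed

lemma pois_pos: "0 < \<eta> \<Longrightarrow> 0 < pois \<eta> v u"
  unfolding pois_eq by (intro divide_pos_pos add_nonneg_pos) auto

lemma pois_cont: "\<eta> \<noteq> 0 \<Longrightarrow> continuous_on A (\<lambda>v. pois \<eta> v u)"
  using pois_deriv_v by (meson DERIV_isCont continuous_at_imp_continuous_on)

lemma pois'_cont: "\<eta> \<noteq> 0 \<Longrightarrow> continuous_on A (\<lambda>v. pois' \<eta> v u)"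
proof -
  assume \<eta>: "\<eta> \<noteq> 0"
  have "continuous_on A (\<lambda>v. - Im ((rz (Complex 0 \<eta>) (u - v))\<^sup>2))"
    using \<eta> by (intro continuous_intros continuous_on_compose2[OF continuous_rz[of "Complex 0 \<eta>" UNIV]]) auto
  then show ?thesis unfolding pois'_def by (simp only: rz_translate[of _ \<eta> u])
qed

lemma abs_pois_le:
  assumes "0 < \<eta>" "\<bar>v\<bar> \<le> R"
  defines "D \<equiv> sqrt ((1 + 2 * (R\<^sup>2 + \<eta>\<^sup>2)) / \<eta>\<^sup>2 + 2)"
  shows "norm (rz (Complex v \<eta>) u) \<le> D * cw u"
proof -
  have i: "Im (Complex v \<eta>) \<noteq> 0" using assms by simp
  have "v\<^sup>2 \<le> R\<^sup>2" using assms(2) by (metis abs_ge_zero power2_abs power_mono)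
  then have "(norm (Complex v \<eta>))\<^sup>2 \<le> R\<^sup>2 + \<eta>\<^sup>2" by (simp add: cmod_power2)
  then have "sqrt ((1 + 2 * (norm (Complex v \<eta>))\<^sup>2) / \<eta>\<^sup>2 + 2) \<le> D"
    unfolding D_def by (intro real_sqrt_le_mono add_right_mono divide_right_mono add_left_mono mult_left_mono) auto
  then have "sqrt ((1 + 2 * (norm (Complex v \<eta>))\<^sup>2) / \<eta>\<^sup>2 + 2) * cw u \<le> D * cw u"
    using cw_pos[of u] by (intro mult_right_mono) auto
  with rz_decay_explicit[OF i, of u] show ?thesis by simp
qed

text \<open>Since \<open>pi / 2 - arctan (1 / \<eta>)\<close> is \<open>arctan \<eta>\<close>, it is
  at most \<eta>. This controls the mass that the Poisson kernel puts beyond distance one.\<close>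

lemma one_minus_arctan_bound:
  assumes "0 < \<eta>" "1 \<le> x"
  shows "pi / 2 - arctan (x / \<eta>) \<le> \<eta>"
proof -
  have "arctan (1 / \<eta>) \<le> arctan (x / \<eta>)" using assms by (simp add: arctan_le_iff divide_right_mono)
  moreover have "arctan (1 / \<eta>) = pi / 2 - arctan \<eta>"
    using arctan_inverse[of \<eta>] assms by (simp add: inverse_eq_divide)
  moreover have "arctan \<eta> \<le> \<eta>" using arctan_le_self[of \<eta>] assms by simp
  ultimately show ?thesis by linarith
qed

text \<open>The weight \<open>(cw u)\<^sup>2\<close> is what \<open>chordal_of_derivative\<close> needs.\<close>

lemma poisson_approx:
  fixes \<phi> :: "real \<Rightarrow> real"
  assumes \<phi>: "continuous_on UNIV \<phi>" and supp: "\<And>u. \<bar>u\<bar> > R0 \<Longrightarrow> \<phi> u = 0" and R0: "0 \<le> R0" and \<epsilon>: "0 < \<epsilon>"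
  defines "R \<equiv> R0 + 1"
  shows "\<exists>\<eta>>0. \<forall>u. \<bar>integral {-R..R} (\<lambda>v. \<phi> v * pois \<eta> v u) / pi - \<phi> u\<bar> \<le> \<epsilon> * (cw u)\<^sup>2"
proof -
  have R: "1 \<le> R" using R0 by (simp add: R_def)
  define K where "K = {-(R + 1)..R + 1}"
  have cK: "continuous_on K \<phi>" using \<phi> continuous_on_subset by blast
  have "bounded (\<phi> ` K)" unfolding K_def by (intro compact_imp_bounded compact_continuous_image cK[unfolded K_def]) auto
  then obtain M0 where M0: "\<forall>y\<in>\<phi> ` K. norm y \<le> M0" unfolding bounded_iff by blast
  define M where "M = \<bar>M0\<bar>"
  have M: "0 \<le> M" by (simp add: M_def)
  have Mb: "\<bar>\<phi> u\<bar> \<le> M" for u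
  proof (cases "u \<in> K")
    case True
    then show ?thesis using M0 by (force simp: M_def)
  next
    case False
    then have "\<phi> u = 0" by (intro supp) (auto simp: K_def R_def)
    then show ?thesis using M by simp
  qed
  \<comment> \<open>On \<open>\<bar>u\<bar> \<le> 2 * R\<close> the weight is at least
    \<open>1 / (1 + 4 * R\<^sup>2)\<close>, so an unweighted error of \<open>2 * e\<close> is good
    enough there.\<close>
  define e where "e = \<epsilon> / (4 * (1 + 4 * R\<^sup>2))"
  have pR: "0 < 1 + 4 * R\<^sup>2" by (simp add: add_pos_nonneg)
  have e: "0 < e" using \<epsilon> pR by (simp add: e_def)
  have "uniformly_continuous_on K \<phi>" using cK by (intro compact_uniformly_continuous) (auto simp: K_def)
  then obtain d0 where d0: "0 < d0" "\<And>u v. u \<in> K \<Longrightarrow> v \<in> K \<Longrightarrow> dist u v < d0 \<Longrightarrow> dist (\<phi> u) (\<phi> v) < e"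
    using e unfolding uniformly_continuous_on_def by metis
  define d where "d = min d0 1"
  have d: "0 < d" "d \<le> 1" "d \<le> d0" using d0 by (auto simp: d_def)
  \<comment> \<open>Uniform continuity for near points and the trivial bound \<open>2 * M\<close>
    for far ones, merged into a quadratic modulus because the kernel times the squared distance is
    at most \<eta>.\<close>
  have mod: "\<bar>\<phi> v - \<phi> u\<bar> \<le> e + 2 * M / d\<^sup>2 * (v - u)\<^sup>2" if v: "v \<in> {-R..R}" for u v
  proof (cases "\<bar>v - u\<bar> < d")
    case True
    then have "u \<in> K" "v \<in> K" using v d by (auto simp: K_def)
    then have "\<bar>\<phi> v - \<phi> u\<bar> < e" using d0(2)[of v u] True d by (simp add: dist_real_def)
    moreover have "0 \<le> 2 * M / d\<^sup>2 * (v - u)\<^sup>2" using M by simp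
    ultimately show ?thesis by linarith
  next
    case False
    then have "d\<^sup>2 \<le> \<bar>v - u\<bar>\<^sup>2" using d by (intro power_mono) auto
    then have "d\<^sup>2 \<le> (v - u)\<^sup>2" by simp
    then have "2 * M * 1 \<le> 2 * M * ((v - u)\<^sup>2 / d\<^sup>2)" using M d by (intro mult_left_mono) auto
    moreover have "\<bar>\<phi> v - \<phi> u\<bar> \<le> 2 * M" using abs_triangle_ineq4[of "\<phi> v" "\<phi> u"] Mb[of u] Mb[of v] by linarith
    ultimately have "\<bar>\<phi> v - \<phi> u\<bar> \<le> 2 * M / d\<^sup>2 * (v - u)\<^sup>2" by simp
    then show ?thesis using e by linarith
  qed
  \<comment> \<open>The sum of all coefficients of \<eta> in the errors below, so that
    \<open>\<eta> = e / C\<close> makes them at most \<open>e\<close> together; the final 1 keeps it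
    positive.\<close>
  define C where "C = 4 * M * R / d\<^sup>2 + 2 * M + 16 * R * M + 1"
  have C1: "1 \<le> C" using M R by (simp add: C_def)
  define \<eta> where "\<eta> = e / C"
  have \<eta>: "0 < \<eta>" using e C1 by (simp add: \<eta>_def)
  have "C * \<eta> = e" using C1 by (simp add: \<eta>_def)
  then have Ce: "4 * M * R / d\<^sup>2 * \<eta> + 2 * M * \<eta> + 16 * R * M * \<eta> + \<eta> = e" by (simp add: C_def algebra_simps)
  have nn: "0 \<le> 4 * M * R / d\<^sup>2 * \<eta>" "0 \<le> 2 * M * \<eta>" "0 \<le> 16 * R * M * \<eta>" using M R \<eta> by auto
  have pc: "continuous_on A (\<lambda>v. pois \<eta> v u)" for A u using \<eta> by (intro pois_cont) simp
  have \<phi>c: "continuous_on A \<phi>" for A using \<phi> continuous_on_subset by blast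
  define T where "T u = integral {-R..R} (\<lambda>v. \<phi> v * pois \<eta> v u)" for u
  define A where "A u = integral {-R..R} (\<lambda>v. pois \<eta> v u)" for u
  have pois_int: "((\<lambda>v. pois \<eta> v u) has_integral (arctan ((R - u) / \<eta>) - arctan ((- R - u) / \<eta>))) {-R..R}" for u
  proof (rule fundamental_theorem_of_calculus)
    show "- R \<le> R" using R by simp
    fix v
    have "((\<lambda>v. arctan ((v - u) / \<eta>)) has_real_derivative inverse (1 + ((v - u) / \<eta>)\<^sup>2) * (1 / \<eta>)) (at v)"
      using \<eta> by (auto intro!: derivative_eq_intros)
    also have "inverse (1 + ((v - u) / \<eta>)\<^sup>2) * (1 / \<eta>) = pois \<eta> v u"
    proof -
      have "1 + ((v - u) / \<eta>)\<^sup>2 = ((v - u)\<^sup>2 + \<eta>\<^sup>2) / \<eta>\<^sup>2" using \<eta> by (simp add: power_divide add_divide_distrib)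
      then show ?thesis using \<eta> by (simp add: pois_eq power2_eq_square)
    qed
    finally show "((\<lambda>v. arctan ((v - u) / \<eta>)) has_vector_derivative pois \<eta> v u) (at v within {-R..R})"
      by (simp add: has_real_derivative_iff_has_vector_derivative has_vector_derivative_at_within)
  qed
  have A_eq: "A u = arctan ((R - u) / \<eta>) + arctan ((R + u) / \<eta>)" for u
  proof -
    have "(- R - u) / \<eta> = - ((R + u) / \<eta>)" by (simp add: minus_divide_left)
    then have "arctan ((- R - u) / \<eta>) = - arctan ((R + u) / \<eta>)" by (simp only: arctan_minus)
    then show ?thesis using integral_unique[OF pois_int[of u]] by (simp add: A_def)
  qed
  have A_le: "A u \<le> pi" for u
    using arctan_bounded[of "(R - u) / \<eta>"] arctan_bounded[of "(R + u) / \<eta>"] by (simp add: A_eq)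
  \<comment> \<open>Where \<open>\<phi>\<close> may be nonzero both ends of \<open>{-R..R}\<close>
    are at distance at least one, because \<open>R = R0 + 1\<close>; the mass cut off there is at
    most \<open>2 * \<eta>\<close>.\<close>
  have Aphi: "\<bar>\<phi> u * (A u - pi)\<bar> \<le> 2 * M * \<eta>" for u
  proof (cases "\<bar>u\<bar> > R0")
    case True
    then show ?thesis using supp[of u] nn by simp
  next
    case False
    then have "pi / 2 - arctan ((R - u) / \<eta>) \<le> \<eta>" "pi / 2 - arctan ((R + u) / \<eta>) \<le> \<eta>"
      using \<eta> by (auto intro!: one_minus_arctan_bound simp: R_def)
    then have "\<bar>A u - pi\<bar> \<le> 2 * \<eta>" using A_le[of u] by (simp add: A_eq)
    then have "\<bar>\<phi> u\<bar> * \<bar>A u - pi\<bar> \<le> M * (2 * \<eta>)" using Mb M by (intro mult_mono) auto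
    then show ?thesis by (simp add: abs_mult)
  qed
  have unif: "\<bar>T u - pi * \<phi> u\<bar> \<le> e * pi + 4 * M * R / d\<^sup>2 * \<eta> + 2 * M * \<eta>" for u
  proof -
    have "T u - \<phi> u * A u = integral {-R..R} (\<lambda>v. \<phi> v * pois \<eta> v u - \<phi> u * pois \<eta> v u)"
      unfolding T_def A_def
      by (subst Henstock_Kurzweil_Integration.integral_diff) (auto intro!: integrable_continuous_interval continuous_intros \<phi>c pc)
    also have "norm \<dots> \<le> integral {-R..R} (\<lambda>v. e * pois \<eta> v u + 2 * M / d\<^sup>2 * \<eta>)"
    proof (rule Henstock_Kurzweil_Integration.integral_norm_bound_integral)
      show "(\<lambda>v. \<phi> v * pois \<eta> v u - \<phi> u * pois \<eta> v u) integrable_on {-R..R}"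
        "(\<lambda>v. e * pois \<eta> v u + 2 * M / d\<^sup>2 * \<eta>) integrable_on {-R..R}"
        by (intro integrable_continuous_interval continuous_intros \<phi>c pc)+
      fix v assume v: "v \<in> {-R..R}"
      have pp: "0 < pois \<eta> v u" by (rule pois_pos[OF \<eta>])
      have sq: "(v - u)\<^sup>2 * pois \<eta> v u \<le> \<eta>"
      proof -
        have q: "0 < (v - u)\<^sup>2 + \<eta>\<^sup>2" using \<eta> by (intro add_nonneg_pos) auto
        have "(v - u)\<^sup>2 * \<eta> \<le> \<eta> * ((v - u)\<^sup>2 + \<eta>\<^sup>2)" using \<eta> by (simp add: algebra_simps)
        then show ?thesis using q by (simp add: pois_eq divide_le_eq)
      qed
      have "norm (\<phi> v * pois \<eta> v u - \<phi> u * pois \<eta> v u) = \<bar>\<phi> v - \<phi> u\<bar> * pois \<eta> v u"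
        using pp by (simp add: left_diff_distrib[symmetric] abs_mult)
      also have "\<dots> \<le> (e + 2 * M / d\<^sup>2 * (v - u)\<^sup>2) * pois \<eta> v u" using pp by (intro mult_right_mono mod[OF v]) auto
      also have "\<dots> = e * pois \<eta> v u + 2 * M / d\<^sup>2 * ((v - u)\<^sup>2 * pois \<eta> v u)" by (simp add: algebra_simps)
      also have "\<dots> \<le> e * pois \<eta> v u + 2 * M / d\<^sup>2 * \<eta>" using sq M by (intro add_left_mono mult_left_mono) auto
      finally show "norm (\<phi> v * pois \<eta> v u - \<phi> u * pois \<eta> v u) \<le> e * pois \<eta> v u + 2 * M / d\<^sup>2 * \<eta>" .
    qed
    also have "\<dots> = e * A u + (2 * M / d\<^sup>2 * \<eta>) * (2 * R)"
      unfolding A_def using R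
      by (subst Henstock_Kurzweil_Integration.integral_add) (auto intro!: integrable_continuous_interval continuous_intros pc)
    also have "\<dots> \<le> e * pi + 4 * M * R / d\<^sup>2 * \<eta>"
    proof (rule add_mono)
      show "e * A u \<le> e * pi" using A_le[of u] e by (intro mult_left_mono) auto
      show "2 * M / d\<^sup>2 * \<eta> * (2 * R) \<le> 4 * M * R / d\<^sup>2 * \<eta>" by (simp add: mult_ac)
    qed
    finally have "\<bar>T u - \<phi> u * A u\<bar> \<le> e * pi + 4 * M * R / d\<^sup>2 * \<eta>" by simp
    moreover have "T u - pi * \<phi> u = (T u - \<phi> u * A u) + \<phi> u * (A u - pi)" by (simp add: algebra_simps)
    ultimately show ?thesis using Aphi[of u] by linarith
  qed
  have "\<bar>T u / pi - \<phi> u\<bar> \<le> \<epsilon> * (cw u)\<^sup>2" for u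
  proof (cases "\<bar>u\<bar> \<le> 2 * R")
    case True
    have "\<bar>T u / pi - \<phi> u\<bar> = \<bar>T u - pi * \<phi> u\<bar> / pi"
    proof -
      have "T u / pi - \<phi> u = (T u - pi * \<phi> u) / pi" by (simp add: diff_divide_distrib)
      then show ?thesis by (simp add: abs_divide)
    qed
    also have "\<dots> \<le> (e * pi + e * pi) / pi"
    proof (intro divide_right_mono)
      have "e \<le> e * pi" using e pi_gt3 by simp
      then show "\<bar>T u - pi * \<phi> u\<bar> \<le> e * pi + e * pi" using unif[of u] Ce nn \<eta> by linarith
    qed simp
    also have "\<dots> = 2 * e" by simp
    also have "\<dots> \<le> \<epsilon> / (1 + 4 * R\<^sup>2)" using \<epsilon> pR by (simp add: e_def field_simps)
    also have "\<dots> \<le> \<epsilon> / (1 + u\<^sup>2)"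
    proof (rule divide_left_mono)
      have "\<bar>u\<bar>\<^sup>2 \<le> (2 * R)\<^sup>2" using True by (intro power_mono) auto
      then show "1 + u\<^sup>2 \<le> 1 + 4 * R\<^sup>2" by (simp add: power_mult_distrib)
      show "0 < (1 + 4 * R\<^sup>2) * (1 + u\<^sup>2)" using pR by (intro mult_pos_pos add_pos_nonneg) auto
    qed (use \<epsilon> in simp)
    also have "\<dots> = \<epsilon> * (cw u)\<^sup>2"
    proof -
      have "0 \<le> 1 + u\<^sup>2" by simp
      then show ?thesis by (simp add: cw_def power_divide)
    qed
    finally show ?thesis .
  next
    \<comment> \<open>Far out \<open>\<phi>\<close> vanishes, and \<open>\<bar>v - u\<bar>\<close>
      is at least \<open>\<bar>u\<bar> / 2\<close>, so the kernel is at most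
      \<open>4 * \<eta> / u\<^sup>2\<close> and supplies the decay.\<close>
    case False
    then have u: "2 * R < \<bar>u\<bar>" by simp
    have u0: "\<phi> u = 0" using u R by (intro supp) (auto simp: R_def)
    have u1: "1 \<le> \<bar>u\<bar>" using u R by simp
    then have u2: "1 \<le> u\<^sup>2" using power_mono[of 1 "\<bar>u\<bar>" 2] by simp
    have "norm (T u) \<le> (M * (4 * \<eta> / u\<^sup>2)) * (R - - R)"
      unfolding T_def
    proof (rule integral_bound)
      show "- R \<le> R" using R by simp
      show "continuous_on {-R..R} (\<lambda>v. \<phi> v * pois \<eta> v u)" by (intro continuous_intros \<phi>c pc)
      fix v assume v: "v \<in> {-R..R}"
      have "\<bar>v\<bar> \<le> R" using v by auto
      then have "\<bar>u\<bar> / 2 \<le> \<bar>v - u\<bar>" using u by linarith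
      then have "(\<bar>u\<bar> / 2)\<^sup>2 \<le> \<bar>v - u\<bar>\<^sup>2" by (intro power_mono) auto
      then have "u\<^sup>2 / 4 \<le> (v - u)\<^sup>2 + \<eta>\<^sup>2" using zero_le_power2[of \<eta>] by (simp add: power_divide add_increasing2)
      then have "\<eta> / ((v - u)\<^sup>2 + \<eta>\<^sup>2) \<le> \<eta> / (u\<^sup>2 / 4)"
        using \<eta> u2 by (intro divide_left_mono) (auto intro!: mult_pos_pos add_nonneg_pos)
      then have "pois \<eta> v u \<le> 4 * \<eta> / u\<^sup>2" by (simp add: pois_eq mult.commute)
      then show "norm (\<phi> v * pois \<eta> v u) \<le> M * (4 * \<eta> / u\<^sup>2)"
        using Mb[of v] pois_pos[OF \<eta>, of v u] M unfolding real_norm_def abs_mult by (intro mult_mono) auto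
    qed
    also have "\<dots> = 8 * R * M * \<eta> * (1 / u\<^sup>2)" by simp
    also have "\<dots> \<le> 8 * R * M * \<eta> * (2 * (cw u)\<^sup>2)"
    proof (rule mult_left_mono)
      have "0 \<le> 1 + u\<^sup>2" by simp
      then have cc: "(cw u)\<^sup>2 = 1 / (1 + u\<^sup>2)" by (simp add: cw_def power_divide)
      have "1 * (1 + u\<^sup>2) \<le> 2 * u\<^sup>2" using u2 by simp
      then show "1 / u\<^sup>2 \<le> 2 * (cw u)\<^sup>2" unfolding cc using u2 by (simp add: divide_le_eq le_divide_eq add_pos_nonneg)
    qed (use M R \<eta> in simp)
    also have "\<dots> = (16 * R * M * \<eta>) * (cw u)\<^sup>2" by simp
    also have "\<dots> \<le> \<epsilon> * (cw u)\<^sup>2"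
    proof (rule mult_right_mono)
      have "e \<le> \<epsilon>"
      proof -
        have "1 * 1 \<le> 4 * (1 + 4 * R\<^sup>2)" by (intro mult_mono) auto
        then have "\<epsilon> / (4 * (1 + 4 * R\<^sup>2)) \<le> \<epsilon> / 1" using \<epsilon> pR by (intro divide_left_mono) auto
        then show ?thesis by (simp add: e_def)
      qed
      then show "16 * R * M * \<eta> \<le> \<epsilon>" using Ce nn \<eta> by linarith
    qed simp
    finally have "\<bar>T u\<bar> \<le> \<epsilon> * (cw u)\<^sup>2" by simp
    moreover have "\<bar>T u / pi\<bar> \<le> \<bar>T u\<bar> / 1" unfolding abs_divide using pi_gt3 by (intro frac_le) auto
    ultimately show ?thesis by (simp add: u0)
  qed
  then show ?thesis using \<eta> unfolding T_def by blast
qed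

lemma sum_pairs: "(\<Sum>k<2 * m. F k) = (\<Sum>k<m. F (2 * k) + F (2 * k + 1))" for F :: "nat \<Rightarrow> 'a::comm_monoid_add"
  by (induction m) (auto simp: add.assoc)

lemma rz_cnj: "rz (cnj \<zeta>) u = cnj (rz \<zeta> u)"
  by (simp add: rz_def)

text \<open>A Poisson kernel is the difference of the resolvents at two conjugate poles over
  \<open>2 * \<i>\<close>; the even index of each pair carries the pole in the lower
  half-plane.\<close>

lemma resolvent_combo_pois:
  assumes "0 < \<eta>"
  shows "resolvent_combo {..<2 * m}
     (\<lambda>k. (if even k then 1 else - 1) * of_real (a (k div 2)) / (2 * \<i>))
     (\<lambda>k. Complex (v (k div 2)) (if even k then - \<eta> else \<eta>))
     (\<lambda>u. \<Sum>k<m. a k * pois \<eta> (v k) u)"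
proof
  fix u
  have p: "complex_of_real (pois \<eta> w u) = (rz (Complex w (- \<eta>)) u - rz (Complex w \<eta>) u) / (2 * \<i>)" for w
  proof -
    have "Complex w (- \<eta>) = cnj (Complex w \<eta>)" by (simp add: complex_eq_iff)
    then have "rz (Complex w (- \<eta>)) u - rz (Complex w \<eta>) u = cnj (rz (Complex w \<eta>) u) - rz (Complex w \<eta>) u"
      by (simp add: rz_cnj)
    then show ?thesis by (simp add: pois_def complex_eq_iff Re_divide Im_divide)
  qed
  show "complex_of_real (\<Sum>k<m. a k * pois \<eta> (v k) u) =
      (\<Sum>k<2 * m. (if even k then 1 else - 1) * of_real (a (k div 2)) / (2 * \<i>) *
        rz (Complex (v (k div 2)) (if even k then - \<eta> else \<eta>)) u)"
    unfolding sum_pairs of_real_sum of_real_mult p by (intro sum.cong refl) (simp add: field_simps)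
qed (use assms in auto)

lemma pois_tendsto_0: "((\<lambda>u. pois \<eta> v u) \<longlongrightarrow> 0) at_infinity" if "0 < \<eta>"
proof -
  have i: "Im (Complex v \<eta>) \<noteq> 0" using that by simp
  obtain D where D: "D \<ge> 0" "\<And>u. norm (rz (Complex v \<eta>) u) \<le> D * cw u" using rz_decay[OF i] by blast
  show ?thesis
  proof (rule Lim_null_comparison)
    have "((\<lambda>u::real. D * norm (inverse u)) \<longlongrightarrow> D * norm (0::real)) at_infinity"
      by (intro tendsto_mult tendsto_const tendsto_norm tendsto_inverse_0)
    then show "((\<lambda>u::real. D * norm (inverse u)) \<longlongrightarrow> 0) at_infinity" by simp
    show "\<forall>\<^sub>F u in at_infinity. norm (pois \<eta> v u) \<le> D * norm (inverse u)"
      unfolding eventually_at_infinity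
    proof (intro exI[of _ 1] allI impI)
      fix u :: real assume u: "1 \<le> norm u"
      have "\<bar>u\<bar> \<le> sqrt (1 + u\<^sup>2)" by (rule real_le_rsqrt) simp
      then have "cw u \<le> norm (inverse u)"
        unfolding cw_def using u by (simp add: inverse_eq_divide abs_divide frac_le)
      then have "D * cw u \<le> D * norm (inverse u)" using D by (intro mult_left_mono) auto
      moreover have "norm (pois \<eta> v u) \<le> norm (rz (Complex v \<eta>) u)" unfolding pois_def using abs_Im_le_cmod by simp
      ultimately show "norm (pois \<eta> v u) \<le> D * norm (inverse u)" using D(2)[of u] by linarith
    qed
  qed
qed

text \<open>The approximation is made for derivatives, where the error can be weighted by
  \<open>(cw u)\<^sup>2\<close>. Integration by parts moves the derivative from \<open>f\<close> to
  the kernel: the integrand is then Lipschitz in \<open>v\<close> although \<open>fd\<close> is only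
  continuous, and the Riemann sum over \<open>pi\<close> is the derivative of the combination
  \<open>g\<close>.\<close>

theorem resolvent_approx:
  fixes f fd :: "real \<Rightarrow> real"
  assumes f: "\<And>u. (f has_real_derivative fd u) (at u)" and fd: "continuous_on UNIV fd"
    and supp: "\<And>u. \<bar>u\<bar> > R0 \<Longrightarrow> f u = 0" and R0: "0 \<le> R0" and \<epsilon>: "0 < \<epsilon>"
  shows "\<exists>I c pole g. resolvent_combo I c pole g \<and> chordal (\<lambda>u. f u - g u) \<epsilon>"
proof -
  have fd0: "fd u = 0" if "\<bar>u\<bar> > R0" for u
  proof -
    have "((\<lambda>_. 0) has_real_derivative fd u) (at u)"
    proof (rule DERIV_cong_ev[THEN iffD1, OF refl _ refl f[of u]])
      have "open {u::real. R0 < \<bar>u\<bar>}" by (intro open_Collect_less continuous_intros)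
      then have "\<forall>\<^sub>F x in nhds u. x \<in> {u. R0 < \<bar>u\<bar>}" by (intro eventually_nhds_in_open) (use that in auto)
      then show "\<forall>\<^sub>F x in nhds u. f x = 0" by eventually_elim (use supp in auto)
    qed
    then show ?thesis using DERIV_unique[OF _ DERIV_const] by blast
  qed
  define R where "R = R0 + 1"
  have R: "1 \<le> R" using R0 by (simp add: R_def)
  have e4: "0 < \<epsilon> / 4" using \<epsilon> by simp
  obtain \<eta> where \<eta>: "0 < \<eta>" and T: "\<And>u. \<bar>integral {-R..R} (\<lambda>v. fd v * pois \<eta> v u) / pi - fd u\<bar> \<le> \<epsilon> / 4 * (cw u)\<^sup>2"
    using poisson_approx[OF fd fd0 R0 e4] unfolding R_def by blast
  have fc: "continuous_on A f" for A using f by (meson DERIV_isCont continuous_at_imp_continuous_on)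
  have fdc: "continuous_on A fd" for A using fd continuous_on_subset by blast
  have fR: "f R = 0" "f (- R) = 0" using R0 by (auto intro!: supp simp: R_def)
  have ibp: "integral {-R..R} (\<lambda>v. fd v * pois \<eta> v u) = integral {-R..R} (\<lambda>v. f v * pois' \<eta> v u)" for u
  proof -
    have "((\<lambda>v. fd v * pois \<eta> v u + f v * - pois' \<eta> v u) has_integral f R * pois \<eta> R u - f (- R) * pois \<eta> (- R) u) {-R..R}"
    proof (rule fundamental_theorem_of_calculus)
      show "- R \<le> R" using R by simp
      fix v
      have "((\<lambda>v. f v * pois \<eta> v u) has_real_derivative f v * - pois' \<eta> v u + fd v * pois \<eta> v u) (at v)"
        using DERIV_mult'[OF f[of v] pois_deriv_v[of \<eta> u v]] \<eta> by simp
      then show "((\<lambda>v. f v * pois \<eta> v u) has_vector_derivative fd v * pois \<eta> v u + f v * - pois' \<eta> v u) (at v within {-R..R})"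
        by (simp add: has_real_derivative_iff_has_vector_derivative has_vector_derivative_at_within add.commute)
    qed
    then have "integral {-R..R} (\<lambda>v. fd v * pois \<eta> v u + f v * - pois' \<eta> v u) = 0"
      using fR by (simp add: integral_unique)
    moreover have "integral {-R..R} (\<lambda>v. fd v * pois \<eta> v u + f v * - pois' \<eta> v u) =
        integral {-R..R} (\<lambda>v. fd v * pois \<eta> v u) + integral {-R..R} (\<lambda>v. f v * - pois' \<eta> v u)"
      using \<eta> by (intro Henstock_Kurzweil_Integration.integral_add integrable_continuous_interval continuous_intros fdc fc pois_cont pois'_cont) auto
    ultimately show ?thesis by simp
  qed
  define D where "D = sqrt ((1 + 2 * (R\<^sup>2 + \<eta>\<^sup>2)) / \<eta>\<^sup>2 + 2)"
  have D0: "0 \<le> D" by (simp add: D_def)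
  have rD: "norm (rz (Complex v \<eta>) u) \<le> D * cw u" if "v \<in> {-R..R}" for u v
    unfolding D_def using that by (intro abs_pois_le \<eta>) auto
  have "bounded (f ` {-R..R})" "bounded (fd ` {-R..R})"
    by (intro compact_imp_bounded compact_continuous_image fc fdc; simp)+
  then obtain B0 B1 where B0: "\<forall>y\<in>f ` {-R..R}. norm y \<le> B0" and B1: "\<forall>y\<in>fd ` {-R..R}. norm y \<le> B1"
    unfolding bounded_iff by blast
  have B00: "0 \<le> B0" and B10: "0 \<le> B1"
    using order.trans[OF norm_ge_zero B0[rule_format, of "f 0"]] order.trans[OF norm_ge_zero B1[rule_format, of "fd 0"]] R by auto
  have flip: "\<bar>f v - f w\<bar> \<le> B1 * \<bar>v - w\<bar>" if "v \<in> {-R..R}" "w \<in> {-R..R}" for v w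
    using field_differentiable_bound[of "{-R..R}" f fd B1 v w] that B1 f
    by (auto intro: has_field_derivative_at_within)
  \<comment> \<open>The product rule for increments in \<open>v\<close>: \<open>B1\<close> and
    \<open>B0\<close> bound \<open>fd\<close> and \<open>f\<close>, while \<open>D * cw u\<close>
    and \<open>1 / \<eta>\<close> are two bounds for the resolvent, of which the first carries the
    decay.\<close>
  define L where "L = B1 * D\<^sup>2 + B0 * (D\<^sup>2 * (2 / \<eta>))"
  have L0: "0 \<le> L" using B00 B10 \<eta> by (simp add: L_def)
  have Glip: "\<bar>f v * pois' \<eta> v u - f w * pois' \<eta> w u\<bar> \<le> L * (cw u)\<^sup>2 * \<bar>v - w\<bar>" if v: "v \<in> {-R..R}" and w: "w \<in> {-R..R}" for u v w
  proof -
    let ?r = "rz (Complex v \<eta>) u" and ?s = "rz (Complex w \<eta>) u"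
    have r: "norm ?r \<le> D * cw u" "norm ?s \<le> D * cw u" using rD v w by auto
    have r1: "norm ?r \<le> 1 / \<eta>" "norm ?s \<le> 1 / \<eta>"
      using norm_rz_le[of "Complex v \<eta>" u] norm_rz_le[of "Complex w \<eta>" u] \<eta> by auto
    have pb: "\<bar>pois' \<eta> v u\<bar> \<le> (D * cw u)\<^sup>2"
    proof -
      have "\<bar>pois' \<eta> v u\<bar> \<le> norm (?r\<^sup>2)" unfolding pois'_def using abs_Im_le_cmod[of "?r\<^sup>2"] by simp
      also have "\<dots> \<le> (D * cw u)\<^sup>2" unfolding norm_power by (intro power_mono r) auto
      finally show ?thesis .
    qed
    have pd: "\<bar>pois' \<eta> v u - pois' \<eta> w u\<bar> \<le> \<bar>v - w\<bar> * ((D * cw u)\<^sup>2 * (2 / \<eta>))"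
    proof -
      have "?r - ?s = (Complex w \<eta> - Complex v \<eta>) * (?r * ?s)" using \<eta> by (intro rz_diff_pole) auto
      moreover have "Complex w \<eta> - Complex v \<eta> = of_real (w - v)" by (simp add: complex_eq_iff)
      ultimately have rs: "norm (?r - ?s) = \<bar>v - w\<bar> * (norm ?r * norm ?s)"
        by (simp add: norm_mult abs_minus_commute del: of_real_diff)
      have "pois' \<eta> v u - pois' \<eta> w u = - Im (?r\<^sup>2 - ?s\<^sup>2)" by (simp add: pois'_def)
      then have "\<bar>pois' \<eta> v u - pois' \<eta> w u\<bar> \<le> norm (?r\<^sup>2 - ?s\<^sup>2)" using abs_Im_le_cmod[of "?r\<^sup>2 - ?s\<^sup>2"] by simp
      also have "?r\<^sup>2 - ?s\<^sup>2 = (?r - ?s) * (?r + ?s)" by (simp add: power2_eq_square algebra_simps)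
      also have "norm \<dots> \<le> \<bar>v - w\<bar> * (norm ?r * norm ?s) * (norm ?r + norm ?s)"
        unfolding norm_mult rs by (intro mult_left_mono norm_triangle_ineq) auto
      also have "\<dots> \<le> \<bar>v - w\<bar> * ((D * cw u) * (D * cw u)) * (1 / \<eta> + 1 / \<eta>)"
        using r r1 D0 cw_pos[of u] \<eta> by (intro mult_mono add_mono mult_nonneg_nonneg) auto
      finally show ?thesis by (simp add: power2_eq_square mult.assoc)
    qed
    have "f v * pois' \<eta> v u - f w * pois' \<eta> w u = (f v - f w) * pois' \<eta> v u + f w * (pois' \<eta> v u - pois' \<eta> w u)"
      by (simp add: algebra_simps)
    then have "\<bar>f v * pois' \<eta> v u - f w * pois' \<eta> w u\<bar> \<le> \<bar>f v - f w\<bar> * \<bar>pois' \<eta> v u\<bar> + \<bar>f w\<bar> * \<bar>pois' \<eta> v u - pois' \<eta> w u\<bar>"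
      by (metis abs_mult abs_triangle_ineq)
    also have "\<dots> \<le> (B1 * \<bar>v - w\<bar>) * (D * cw u)\<^sup>2 + B0 * (\<bar>v - w\<bar> * ((D * cw u)\<^sup>2 * (2 / \<eta>)))"
      using flip[OF v w] pb pd B0 w B00 B10 by (intro add_mono mult_mono) auto
    also have "\<dots> = L * (cw u)\<^sup>2 * \<bar>v - w\<bar>" by (simp add: L_def power_mult_distrib algebra_simps)
    finally show ?thesis .
  qed
  obtain m0 :: nat where m0: "L * (2 * R) * (2 * R) / (\<epsilon> / 4) < real m0" using reals_Archimedean2 by blast
  define m where "m = Suc m0"
  have m: "m > 0" by (simp add: m_def)
  have mb: "L * (2 * R) * (2 * R / real m) \<le> \<epsilon> / 4"
  proof -
    have "L * (2 * R) * (2 * R) / (\<epsilon> / 4) < real m" using m0 by (simp add: m_def)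
    then have "L * (2 * R) * (2 * R) < real m * (\<epsilon> / 4)" using e4 by (simp only: pos_divide_less_eq)
    then have "L * (2 * R) * (2 * R) / real m \<le> \<epsilon> / 4" using m by (simp only: pos_divide_le_eq of_nat_0_less_iff) (simp add: mult.commute)
    then show ?thesis by simp
  qed
  define \<delta> where "\<delta> = 2 * R / real m"
  define pt where "pt k = - R + real k * \<delta>" for k
  \<comment> \<open>Mesh width times sampled value, with the factor \<open>1 / pi\<close> that
    normalises the Poisson kernel.\<close>
  define a where "a k = \<delta> * f (pt k) / pi" for k
  define g where "g u = (\<Sum>k<m. a k * pois \<eta> (pt k) u)" for u
  define gd where "gd u = (\<Sum>k<m. a k * pois' \<eta> (pt k) u)" for u
  have gderiv: "(g has_real_derivative gd u) (at u)" for u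
    unfolding g_def[abs_def] gd_def using \<eta> by (intro DERIV_sum DERIV_cmult pois_deriv_u) simp
  have rs: "\<bar>integral {-R..R} (\<lambda>v. f v * pois' \<eta> v u) - (\<Sum>k<m. \<delta> * (f (pt k) * pois' \<eta> (pt k) u))\<bar> \<le> \<epsilon> / 4 * (cw u)\<^sup>2" for u
  proof -
    have "\<bar>integral {-R..R} (\<lambda>v. f v * pois' \<eta> v u) - (\<Sum>k<m. (R - - R) / real m * (f (- R + real k * ((R - - R) / real m)) * pois' \<eta> (- R + real k * ((R - - R) / real m)) u))\<bar>
      \<le> (L * (cw u)\<^sup>2) * (R - - R) * ((R - - R) / real m)"
      using \<eta> R L0 by (intro riemann_sum_error[OF _ _ m Glip] continuous_intros fc pois'_cont) auto
    also have "\<dots> = (L * (2 * R) * (2 * R / real m)) * (cw u)\<^sup>2" by simp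
    also have "\<dots> \<le> \<epsilon> / 4 * (cw u)\<^sup>2" by (intro mult_right_mono mb) simp
    finally show ?thesis by (simp add: \<delta>_def pt_def)
  qed
  have bound: "\<bar>fd u - gd u\<bar> \<le> \<epsilon> / 2 * (cw u)\<^sup>2" for u
  proof -
    let ?S = "\<Sum>k<m. \<delta> * (f (pt k) * pois' \<eta> (pt k) u)" and ?J = "integral {-R..R} (\<lambda>v. fd v * pois \<eta> v u)"
    have gS: "gd u = ?S / pi" by (simp add: gd_def a_def sum_divide_distrib mult.assoc)
    have "\<bar>?J - ?S\<bar> \<le> \<epsilon> / 4 * (cw u)\<^sup>2" unfolding ibp by (rule rs)
    moreover have "\<bar>?J / pi - ?S / pi\<bar> \<le> \<bar>?J - ?S\<bar> / 1"
      unfolding diff_divide_distrib[symmetric] abs_divide using pi_gt3 by (intro frac_le) auto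
    ultimately have "\<bar>?J / pi - gd u\<bar> \<le> \<epsilon> / 4 * (cw u)\<^sup>2" by (simp add: gS)
    moreover have "\<epsilon> / 4 * (cw u)\<^sup>2 + \<epsilon> / 4 * (cw u)\<^sup>2 = \<epsilon> / 2 * (cw u)\<^sup>2" by simp
    ultimately show ?thesis using T[of u] by linarith
  qed
  have glim: "(g \<longlongrightarrow> 0) at_infinity"
  proof -
    have "(g \<longlongrightarrow> (\<Sum>k<m. a k * 0)) at_infinity"
      unfolding g_def[abs_def] by (intro tendsto_sum tendsto_mult tendsto_const pois_tendsto_0 \<eta>)
    then show ?thesis by simp
  qed
  have flim: "(f \<longlongrightarrow> 0) at_infinity"
  proof (rule tendsto_eventually)
    show "\<forall>\<^sub>F u in at_infinity. f u = 0"
      unfolding eventually_at_infinity using supp R0 by (intro exI[of _ "R0 + 1"]) auto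
  qed
  have lim: "((\<lambda>u. f u - g u) \<longlongrightarrow> 0) at_infinity" using tendsto_diff[OF flim glim] by simp
  have "chordal (\<lambda>u. f u - g u) (2 * (\<epsilon> / 2))"
  proof (rule chordal_of_derivative[where D' = "\<lambda>u. fd u - gd u"])
    show "((\<lambda>u. f u - g u) has_real_derivative fd u - gd u) (at u)" for u by (rule DERIV_diff[OF f gderiv])
    show "((\<lambda>u. f u - g u) \<longlongrightarrow> 0) at_top" "((\<lambda>u. f u - g u) \<longlongrightarrow> 0) at_bot"
      by (rule tendsto_mono[OF at_top_le_at_infinity lim], rule tendsto_mono[OF at_bot_le_at_infinity lim])
  qed (rule bound)
  moreover have "resolvent_combo {..<2 * m}
     (\<lambda>k. (if even k then 1 else - 1) * of_real (a (k div 2)) / (2 * \<i>))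
     (\<lambda>k. Complex (pt (k div 2)) (if even k then - \<eta> else \<eta>)) g"
    unfolding g_def[abs_def] by (rule resolvent_combo_pois[OF \<eta>])
  ultimately show ?thesis by auto
qed

section \<open>The central limit theorem\<close>

lemma char_normal_measure:
  assumes "0 \<le> s2"
  shows "char (normal_measure s2) t = of_real (exp (- s2 * t\<^sup>2 / 2))"
proof (cases "s2 = 0")
  case True
  then show ?thesis by (simp add: normal_measure_def char_def integral_return)
next
  case False
  define s where "s = sqrt s2"
  have s: "0 < s" using False assms by (simp add: s_def)
  have s2: "s\<^sup>2 = s2" using assms by (simp add: s_def)
  have d: "normal_density 0 s x = std_normal_density (x / s) / s" for x
    using s by (simp add: normal_density_def real_sqrt_mult power_divide field_simps)
  have "char (normal_measure s2) t = (\<integral>x. normal_density 0 s x *\<^sub>R iexp (t * x) \<partial>lborel)"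
    unfolding char_def normal_measure_def using False
    by (simp add: s_def[symmetric]) (subst integral_density; simp)
  also have "\<dots> = \<bar>s\<bar> *\<^sub>R (\<integral>x. normal_density 0 s (0 + s * x) *\<^sub>R iexp (t * (0 + s * x)) \<partial>lborel)"
    using s by (intro lborel_integral_real_affine) simp
  also have "\<dots> = (\<integral>x. std_normal_density x *\<^sub>R iexp (t * s * x) \<partial>lborel)"
    using s unfolding d by (simp add: mult.assoc flip: integral_scaleR_right)
  also have "\<dots> = char std_normal_distribution (t * s)"
    unfolding char_def by (subst integral_density; simp)
  also have "\<dots> = of_real (exp (- s2 * t\<^sup>2 / 2))"
    by (simp add: char_std_normal_distribution power_mult_distrib s2 mult.commute)
  finally show ?thesis .
qed

lemma real_distribution_normal_measure:
  assumes "0 \<le> s2" shows "real_distribution (normal_measure s2)"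
proof (cases "s2 = 0")
  case True
  then show ?thesis
    by (auto simp: normal_measure_def real_distribution_def real_distribution_axioms_def intro!: prob_space_return)
next
  case False
  then have "prob_space (density lborel (normal_density 0 (sqrt s2)))"
    using assms by (intro prob_space_normal_density) simp
  with False show ?thesis
    by (simp add: normal_measure_def real_distribution_def real_distribution_axioms_def)
qed

lemma sigma_sq_nonneg: "0 \<le> sigma_sq f"
  unfolding sigma_sq_def by (intro mult_nonneg_nonneg Bochner_Integration.integral_nonneg) auto

lemma chordal_quotient:
  fixes f :: "real \<Rightarrow> real"
  assumes "chordal f M"
  shows "\<bar>(f x - f y) / (x - y)\<bar> \<le> M * (cw x * cw y)"
proof (cases "x = y")
  case True
  then show ?thesis using chordal_nonneg[OF assms] cw_pos[of x] cw_pos[of y] by simp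
next
  case False
  have "\<bar>f x - f y\<bar> \<le> M * (cw x * cw y) * \<bar>x - y\<bar>"
    using assms[unfolded chordal_def, rule_format, of x y] by (simp add: mult_ac)
  then show ?thesis using False by (simp add: abs_divide pos_divide_le_eq)
qed

lemma integrable_sigma_sq:
  fixes f :: "real \<Rightarrow> real"
  assumes "chordal f M" and [measurable]: "f \<in> borel_measurable borel"
  shows "integrable (lborel \<Otimes>\<^sub>M lborel) (\<lambda>p. ((f (fst p) - f (snd p)) / (fst p - snd p))\<^sup>2)"
proof (rule Bochner_Integration.integrable_bound)
  show "integrable (lborel \<Otimes>\<^sub>M lborel) (\<lambda>p. M\<^sup>2 * ((cw (fst p))\<^sup>2 * (cw (snd p))\<^sup>2))"
    by (intro integrable_mult_right integral_pair_mult integrable_cw_sq)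
  show "(\<lambda>p. ((f (fst p) - f (snd p)) / (fst p - snd p))\<^sup>2) \<in> borel_measurable (lborel \<Otimes>\<^sub>M lborel)"
    by measurable
  show "AE p in lborel \<Otimes>\<^sub>M lborel. norm (((f (fst p) - f (snd p)) / (fst p - snd p))\<^sup>2) \<le> norm (M\<^sup>2 * ((cw (fst p))\<^sup>2 * (cw (snd p))\<^sup>2))"
  proof (rule AE_I2)
    fix p :: "real \<times> real"
    have "\<bar>(f (fst p) - f (snd p)) / (fst p - snd p)\<bar>\<^sup>2 \<le> (M * (cw (fst p) * cw (snd p)))\<^sup>2"
      by (intro power_mono chordal_quotient assms) simp
    then show "norm (((f (fst p) - f (snd p)) / (fst p - snd p))\<^sup>2) \<le> norm (M\<^sup>2 * ((cw (fst p))\<^sup>2 * (cw (snd p))\<^sup>2))"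
      unfolding power2_abs by (simp add: power_mult_distrib)
  qed
qed

text \<open>The difference of the squared quotients factors into a part governed by \<open>e\<close>
  and one governed by \<open>2 * M + e\<close>. The double integral of the two Lorentzians is
  \<open>pi\<^sup>2\<close>, which the prefactor of \<open>sigma_sq\<close> turns into
  \<open>1 / 4\<close>.\<close>

lemma sigma_sq_close:
  fixes f g :: "real \<Rightarrow> real"
  assumes f: "chordal f M" and fg: "chordal (\<lambda>u. f u - g u) e"
    and [measurable]: "f \<in> borel_measurable borel" "g \<in> borel_measurable borel"
  shows "\<bar>sigma_sq f - sigma_sq g\<bar> \<le> e * (2 * M + e) / 4"
proof -
  let ?P = "lborel \<Otimes>\<^sub>M lborel :: (real \<times> real) measure"
  let ?q = "\<lambda>f p. (f (fst p) - f (snd p)) / (fst p - snd p :: real)"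
  let ?w = "\<lambda>p. (cw (fst p))\<^sup>2 * (cw (snd p))\<^sup>2"
  have M: "0 \<le> M" and e: "0 \<le> e" using chordal_nonneg f fg by auto
  have g: "chordal g (M + e)"
  proof -
    have "chordal (\<lambda>u. - (f u - g u)) e" unfolding chordal_def
    proof (intro allI)
      fix u v
      have "norm (- (f u - g u) - - (f v - g v)) = norm ((f u - g u) - (f v - g v))" by simp
      then show "norm (- (f u - g u) - - (f v - g v)) \<le> e * (\<bar>u - v\<bar> * (cw u * cw v))"
        using fg unfolding chordal_def by metis
    qed
    from chordal_add[OF f this] show ?thesis by simp
  qed
  have i: "integrable ?P (\<lambda>p. (?q f p)\<^sup>2)" "integrable ?P (\<lambda>p. (?q g p)\<^sup>2)"
    using integrable_sigma_sq f g by auto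
  have iw: "integrable ?P ?w" and vw: "(\<integral>p. ?w p \<partial>?P) = pi\<^sup>2"
    using integral_pair_mult[OF integrable_cw_sq integrable_cw_sq] unfolding integral_cw_sq by (auto simp: power2_eq_square)
  have pt: "\<bar>(?q f p)\<^sup>2 - (?q g p)\<^sup>2\<bar> \<le> e * (2 * M + e) * ?w p" for p
  proof -
    let ?c = "cw (fst p) * cw (snd p)"
    have qd: "?q f p - ?q g p = ?q (\<lambda>u. f u - g u) p" by (simp add: diff_divide_distrib)
    have "\<bar>?q f p - ?q g p\<bar> \<le> e * ?c" unfolding qd by (rule chordal_quotient[OF fg])
    moreover have "\<bar>?q f p + ?q g p\<bar> \<le> M * ?c + (M + e) * ?c"
      by (rule order.trans[OF abs_triangle_ineq add_mono[OF chordal_quotient[OF f] chordal_quotient[OF g]]])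
    ultimately have "\<bar>?q f p - ?q g p\<bar> * \<bar>?q f p + ?q g p\<bar> \<le> (e * ?c) * (M * ?c + (M + e) * ?c)"
      using e cw_pos[of "fst p"] cw_pos[of "snd p"] by (intro mult_mono) auto
    also have "\<dots> = e * (2 * M + e) * ?w p" by (simp add: power2_eq_square algebra_simps)
    also have "\<bar>?q f p - ?q g p\<bar> * \<bar>?q f p + ?q g p\<bar> = \<bar>(?q f p)\<^sup>2 - (?q g p)\<^sup>2\<bar>"
      unfolding abs_mult[symmetric] by (rule arg_cong[where f = abs]) (simp add: power2_eq_square algebra_simps)
    finally show ?thesis .
  qed
  have "\<bar>(\<integral>p. (?q f p)\<^sup>2 \<partial>?P) - (\<integral>p. (?q g p)\<^sup>2 \<partial>?P)\<bar> = norm (\<integral>p. (?q f p)\<^sup>2 - (?q g p)\<^sup>2 \<partial>?P)"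
    using i by simp
  also have "\<dots> \<le> (\<integral>p. e * (2 * M + e) * ?w p \<partial>?P)"
    using i iw pt by (intro Bochner_Integration.integral_norm_bound_integral) auto
  also have "\<dots> = e * (2 * M + e) * pi\<^sup>2" using vw by simp
  finally have *: "\<bar>(\<integral>p. (?q f p)\<^sup>2 \<partial>?P) - (\<integral>p. (?q g p)\<^sup>2 \<partial>?P)\<bar> \<le> e * (2 * M + e) * pi\<^sup>2" .
  have sg: "sigma_sq k = (\<integral>p. (?q k p)\<^sup>2 \<partial>?P) / (4 * pi\<^sup>2)" for k :: "real \<Rightarrow> real"
    by (simp add: sigma_sq_def case_prod_unfold)
  have "\<bar>sigma_sq f - sigma_sq g\<bar> = \<bar>(\<integral>p. (?q f p)\<^sup>2 \<partial>?P) - (\<integral>p. (?q g p)\<^sup>2 \<partial>?P)\<bar> / (4 * pi\<^sup>2)"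
    unfolding sg diff_divide_distrib[symmetric] abs_divide by simp
  also have "\<dots> \<le> e * (2 * M + e) * pi\<^sup>2 / (4 * pi\<^sup>2)" by (intro divide_right_mono *) simp
  also have "\<dots> = e * (2 * M + e) / 4" by simp
  finally show ?thesis .
qed

lemma norm_iexp_diff_le: "norm (iexp a - iexp b) \<le> \<bar>a - b\<bar>"
proof -
  have "iexp a - iexp b = iexp b * (iexp (a - b) - 1)"
    by (simp add: right_diff_distrib exp_add[symmetric])
  then have "norm (iexp a - iexp b) = norm (iexp (a - b) - 1)" by (simp only: norm_mult norm_exp_i_times mult_1)
  also have "\<dots> \<le> \<bar>a - b\<bar>" using iexp_approx1[of "a - b" 0] by simp
  finally show ?thesis .
qed

lemma exp_minus_diff_le:
  fixes a b :: real
  assumes "0 \<le> a" "0 \<le> b"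
  shows "\<bar>exp (- a) - exp (- b)\<bar> \<le> \<bar>a - b\<bar>"
proof -
  have *: "exp (- a) - exp (- b) \<le> b - a" if "0 \<le> a" "a \<le> b" for a b :: real
  proof -
    have "exp (- a) - exp (- b) = exp (- a) * (1 - exp (- (b - a)))" by (simp add: right_diff_distrib exp_add[symmetric])
    also have "\<dots> \<le> 1 * (b - a)"
    proof (rule mult_mono)
      show "1 - exp (- (b - a)) \<le> b - a" using exp_ge_add_one_self[of "- (b - a)"] by linarith
    qed (use that in auto)
    finally show ?thesis by simp
  qed
  show ?thesis
  proof (cases "a \<le> b")
    case True
    then show ?thesis using *[of a b] assms by simp
  next
    case False
    then show ?thesis using *[of b a] assms by simp
  qed
qed

context meso_combo
begin

lemma combo_char_limit:
  "(\<lambda>n. EE n (\<lambda>x. iexp (t * (LS n (\<lambda>y. f (sc n y)) x - EE n (LS n (\<lambda>y. f (sc n y))))))) \<longlonglongrightarrow>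
     of_real (exp (- sigma_sq f * t\<^sup>2 / 2))"
  using combo_char_tendsto[OF sigma_sq_nonneg sigma_sq_combo, of t]
  unfolding \<phi>n_def ee_def[abs_def] XX_def .

end

context meso
begin

text \<open>The variance bound for \<open>f - g\<close>. Its independence of \<open>n\<close> is
  what permits exchanging the limit in \<open>n\<close> with the approximation.\<close>

lemma LS_diff_abs_dev:
  fixes f g :: "real \<Rightarrow> real"
  assumes n: "n \<ge> 1" and f: "continuous_on UNIV f" and g: "continuous_on UNIV g" and e: "chordal (\<lambda>u. f u - g u) e"
  defines "F \<equiv> LS n (\<lambda>y. f (sc n y))" and "G \<equiv> LS n (\<lambda>y. g (sc n y))"
  shows "EE n (\<lambda>x. \<bar>(F x - EE n F) - (G x - EE n G)\<bar>) \<le> sqrt VC * e"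
proof -
  let ?d = "\<lambda>y. complex_of_real (f (sc n y) - g (sc n y))"
  have fs: "continuous_on UNIV (\<lambda>y. f (sc n y))" and gs: "continuous_on UNIV (\<lambda>y. g (sc n y))"
    by (intro continuous_on_compose2[OF f] continuous_on_compose2[OF g] continuous_intros; simp)+
  have nF: "nice n F" "nice n G" unfolding F_def G_def by (intro nice_LS fs gs)+
  have LSd: "LS n ?d x = of_real (F x - G x)" for x by (simp add: LS_def F_def G_def sum_subtractf)
  have Ed: "EE n (LS n ?d) = of_real (EE n F - EE n G)"
  proof -
    have "EE n (LS n ?d) = EE n (\<lambda>x. complex_of_real (F x - G x))" unfolding LSd[abs_def] ..
    also have "\<dots> = of_real (EE n (\<lambda>x. F x - G x))" by (rule integral_complex_of_real)
    also have "\<dots> = of_real (EE n F - EE n G)" using EE_diff[OF nF] by simp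
    finally show ?thesis .
  qed
  have "EE n (\<lambda>x. norm (LS n ?d x - EE n (LS n ?d))) \<le> sqrt VC * e"
  proof (rule LS_abs_dev[OF n])
    show "continuous_on UNIV ?d" by (intro continuous_intros fs gs)
    show "0 \<le> e" by (rule chordal_nonneg[OF e])
    fix x y :: real
    have "?d x - ?d y = complex_of_real ((f (sc n x) - g (sc n x)) - (f (sc n y) - g (sc n y)))" by simp
    then show "norm (?d x - ?d y) \<le> e * (Nn n * \<bar>x - y\<bar> * (win (Nn n) x0 x * win (Nn n) x0 y))"
      using chordal_scaled[OF e n, of x y] by (simp only: norm_of_real real_norm_def)
  qed
  moreover have "norm (LS n ?d x - EE n (LS n ?d)) = \<bar>(F x - EE n F) - (G x - EE n G)\<bar>" for x
    unfolding LSd Ed of_real_diff[symmetric] norm_of_real by (simp add: algebra_simps)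
  ultimately show ?thesis by simp
qed

lemma char_diff_le:
  fixes f g :: "real \<Rightarrow> real"
  assumes n: "n \<ge> 1" and f: "continuous_on UNIV f" and g: "continuous_on UNIV g" and e: "chordal (\<lambda>u. f u - g u) e"
  defines "F \<equiv> LS n (\<lambda>y. f (sc n y))" and "G \<equiv> LS n (\<lambda>y. g (sc n y))"
  shows "norm (EE n (\<lambda>x. iexp (t * (F x - EE n F))) - EE n (\<lambda>x. iexp (t * (G x - EE n G)))) \<le> \<bar>t\<bar> * (sqrt VC * e)"
proof -
  let ?u = "\<lambda>x. F x - EE n F" and ?v = "\<lambda>x. G x - EE n G"
  have "continuous_on UNIV (\<lambda>y. f (sc n y))" "continuous_on UNIV (\<lambda>y. g (sc n y))"
    by (intro continuous_on_compose2[OF f] continuous_on_compose2[OF g] continuous_intros; simp)+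
  then have "nice n F" "nice n G" unfolding F_def G_def by (auto intro: nice_LS)
  then have nu: "nice n ?u" "nice n ?v" by (auto intro: nice_intros)
  have ni: "nice n (\<lambda>x. iexp (t * ?u x))" "nice n (\<lambda>x. iexp (t * ?v x))" by (intro nice_intros nu)+
  have nd: "nice n (\<lambda>x. \<bar>t\<bar> * norm (?u x - ?v x))" by (intro nice_intros nu)
  have "norm (EE n (\<lambda>x. iexp (t * ?u x) - iexp (t * ?v x))) \<le> EE n (\<lambda>x. norm (iexp (t * ?u x) - iexp (t * ?v x)))"
    by (rule EE_norm_le)
  moreover have "EE n (\<lambda>x. norm (iexp (t * ?u x) - iexp (t * ?v x))) \<le> EE n (\<lambda>x. \<bar>t\<bar> * norm (?u x - ?v x))"
  proof (rule EE_mono[OF _ nd])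
    show "nice n (\<lambda>x. norm (iexp (t * ?u x) - iexp (t * ?v x)))" by (intro nice_norm nice_diff ni)
    fix x
    have "\<bar>t * ?u x - t * ?v x\<bar> = \<bar>t\<bar> * norm (?u x - ?v x)" by (simp add: right_diff_distrib[symmetric] abs_mult)
    then show "norm (iexp (t * ?u x) - iexp (t * ?v x)) \<le> \<bar>t\<bar> * norm (?u x - ?v x)"
      using norm_iexp_diff_le[of "t * ?u x" "t * ?v x"] by simp
  qed
  moreover have "EE n (\<lambda>x. \<bar>t\<bar> * norm (?u x - ?v x)) \<le> \<bar>t\<bar> * (sqrt VC * e)"
  proof -
    have "EE n (\<lambda>x. \<bar>t\<bar> * norm (?u x - ?v x)) = \<bar>t\<bar> * EE n (\<lambda>x. norm (?u x - ?v x))" by simp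
    also have "\<dots> \<le> \<bar>t\<bar> * (sqrt VC * e)"
      using LS_diff_abs_dev[OF n f g e] unfolding F_def G_def real_norm_def by (intro mult_left_mono) auto
    finally show ?thesis .
  qed
  ultimately show ?thesis unfolding EE_diff[OF ni] by linarith
qed

text \<open>Three errors: \<open>f\<close> against \<open>g\<close> at finite \<open>n\<close>,
  uniformly in \<open>n\<close>; the limit for the resolvent combination \<open>g\<close>; and the
  two Gaussian limits, compared through \<open>sigma_sq_close\<close>.\<close>

lemma char_limit:
  fixes f fd :: "real \<Rightarrow> real"
  assumes f: "\<And>u. (f has_real_derivative fd u) (at u)" and fd: "continuous_on UNIV fd"
    and supp: "\<And>u. \<bar>u\<bar> > R0 \<Longrightarrow> f u = 0" and R0: "0 \<le> R0"
  shows "(\<lambda>n. EE n (\<lambda>x. iexp (t * (LS n (\<lambda>y. f (sc n y)) x - EE n (LS n (\<lambda>y. f (sc n y))))))) \<longlonglongrightarrow>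
     of_real (exp (- sigma_sq f * t\<^sup>2 / 2))"
    (is "(\<lambda>n. ?\<Phi> f n) \<longlonglongrightarrow> ?L f")
proof (rule LIMSEQ_I)
  fix r :: real assume r: "0 < r"
  have fc: "continuous_on UNIV f" using f by (meson DERIV_isCont continuous_at_imp_continuous_on)
  have fm: "f \<in> borel_measurable borel" by (intro borel_measurable_continuous_onI fc)
  \<comment> \<open>Approximation to within 1 already shows that \<open>f\<close> is Lipschitz for
    the chordal metric, since resolvent combinations are.\<close>
  obtain M where M: "chordal f M"
  proof -
    obtain I c pole g where "resolvent_combo I c pole g" and d: "chordal (\<lambda>u. f u - g u) 1"
      using resolvent_approx[OF f fd supp R0 zero_less_one] by auto
    then obtain M where "chordal g M" using resolvent_combo.f_chordal by blast
    from chordal_add[OF d this] show ?thesis using that by simp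
  qed
  have M0: "0 \<le> M" by (rule chordal_nonneg[OF M])
  \<comment> \<open>Large enough to dominate the two errors that are linear in \<open>e\<close>:
    that of the characteristic functions at finite \<open>n\<close> and that of the Gaussian
    limits.\<close>
  define K where "K = \<bar>t\<bar> * sqrt VC + (2 * M + 1) * t\<^sup>2 + 1"
  have K: "0 < K" using M0 VC(1) by (simp add: K_def add_nonneg_pos)
  define e where "e = min 1 (r / (3 * K))"
  have e: "0 < e" "e \<le> 1" using r K by (auto simp: e_def)
  have "e \<le> r / (3 * K)" by (simp add: e_def)
  then have eK: "e * K \<le> r / 3" using K by (simp add: pos_le_divide_eq mult_ac)
  obtain I c pole g where G: "resolvent_combo I c pole g" and d: "chordal (\<lambda>u. f u - g u) e"
    using resolvent_approx[OF f fd supp R0 e(1)] by blast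
  have gc: "continuous_on UNIV g" by (rule resolvent_combo.f_cont[OF G])
  have gm: "g \<in> borel_measurable borel" by (intro borel_measurable_continuous_onI gc)
  have "(\<lambda>n. ?\<Phi> g n) \<longlonglongrightarrow> ?L g"
    by (rule meso_combo.combo_char_limit[OF meso_combo.intro[OF meso_axioms G]])
  from LIMSEQ_D[OF this, of "r / 3"] r obtain n0 where n0: "\<And>n. n \<ge> n0 \<Longrightarrow> norm (?\<Phi> g n - ?L g) < r / 3" by auto
  have LL: "norm (?L g - ?L f) \<le> r / 3"
  proof -
    let ?a = "sigma_sq g * t\<^sup>2 / 2" and ?b = "sigma_sq f * t\<^sup>2 / 2"
    have "?L g - ?L f = complex_of_real (exp (- ?a) - exp (- ?b))" by simp
    then have "norm (?L g - ?L f) = \<bar>exp (- ?a) - exp (- ?b)\<bar>" by (simp only: norm_of_real)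
    also have "\<dots> \<le> \<bar>?a - ?b\<bar>" by (rule exp_minus_diff_le) (use sigma_sq_nonneg in auto)
    also have "\<dots> = \<bar>sigma_sq f - sigma_sq g\<bar> * (t\<^sup>2 / 2)"
      by (simp add: abs_mult abs_minus_commute flip: left_diff_distrib diff_divide_distrib)
    also have "\<dots> \<le> (e * (2 * M + e) / 4) * (t\<^sup>2 / 2)"
      by (intro mult_right_mono sigma_sq_close M d fm gm) simp
    also have "\<dots> = e * ((2 * M + e) * t\<^sup>2) / 8" by simp
    also have "\<dots> \<le> e * ((2 * M + e) * t\<^sup>2)" using e M0 by simp
    also have "\<dots> \<le> e * K"
    proof (rule mult_left_mono)
      have "(2 * M + e) * t\<^sup>2 \<le> (2 * M + 1) * t\<^sup>2" using e by (intro mult_right_mono) auto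
      moreover have "0 \<le> \<bar>t\<bar> * sqrt VC" using VC(1) by simp
      ultimately show "(2 * M + e) * t\<^sup>2 \<le> K" unfolding K_def by linarith
    qed (use e in simp)
    finally show ?thesis using eK by linarith
  qed
  show "\<exists>n0. \<forall>n\<ge>n0. norm (?\<Phi> f n - ?L f) < r"
  proof (intro exI allI impI)
    fix n assume n: "n \<ge> max 1 n0"
    have "norm (?\<Phi> f n - ?\<Phi> g n) \<le> \<bar>t\<bar> * (sqrt VC * e)"
      using n by (intro char_diff_le fc gc d) auto
    also have "\<dots> \<le> e * K"
    proof -
      have "\<bar>t\<bar> * sqrt VC \<le> K" using M0 by (simp add: K_def)
      then have "e * (\<bar>t\<bar> * sqrt VC) \<le> e * K" using e by (intro mult_left_mono) auto
      then show ?thesis by (simp add: mult_ac)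
    qed
    finally have A: "norm (?\<Phi> f n - ?\<Phi> g n) \<le> r / 3" using eK by linarith
    have B: "norm (?\<Phi> g n - ?L g) < r / 3" using n n0 by simp
    have tri: "norm (x - y) \<le> norm (x - z) + norm (z - w) + norm (w - y)" for x y z w :: complex
      by (metis add_mono_thms_linordered_semiring(3) dist_norm dist_triangle order_trans)
    from order.trans[OF tri add_mono[OF add_mono[OF A order.refl] LL]] B
    show "norm (?\<Phi> f n - ?L f) < r" by linarith
  qed
qed

theorem mesoscopic_clt:
  fixes f fd :: "real \<Rightarrow> real"
  assumes f: "\<And>u. (f has_real_derivative fd u) (at u)" and fd: "continuous_on UNIV fd"
    and supp: "\<And>u. \<bar>u\<bar> > R0 \<Longrightarrow> f u = 0" and R0: "0 \<le> R0"
  shows "weak_conv_m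
     (\<lambda>n. distr (OPE mu n) borel (\<lambda>x. meso_stat f \<alpha> x0 n x - EE n (meso_stat f \<alpha> x0 n)))
     (normal_measure (sigma_sq f))"
proof (rule levy_continuity)
  let ?X = "\<lambda>n x. LS n (\<lambda>y. f (sc n y)) x - EE n (LS n (\<lambda>y. f (sc n y)))"
  have fc: "continuous_on UNIV f" using f by (meson DERIV_isCont continuous_at_imp_continuous_on)
  have "continuous_on UNIV (\<lambda>y. f (sc n y))" for n
    by (intro continuous_on_compose2[OF fc] continuous_intros) simp
  then have "nice n (?X n)" for n by (intro nice_intros nice_LS)
  then have m [measurable]: "?X n \<in> borel_measurable (OPE mu n)" for n
    unfolding nice_def by (simp cong: measurable_cong_sets add: measurable_cong_sets[OF sets_OPE refl])
  have ms: "meso_stat f \<alpha> x0 n = LS n (\<lambda>y. f (sc n y))" for n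
    by (rule ext) (simp add: meso_stat_def LS_def Nn_def)
  show "real_distribution (distr (OPE mu n) borel (\<lambda>x. meso_stat f \<alpha> x0 n x - EE n (meso_stat f \<alpha> x0 n)))" for n
    unfolding ms by (rule prob_space.real_distribution_distr[OF prob_space_OPE m])
  show "real_distribution (normal_measure (sigma_sq f))"
    by (rule real_distribution_normal_measure[OF sigma_sq_nonneg])
  fix t
  have "char (distr (OPE mu n) borel (?X n)) t = EE n (\<lambda>x. iexp (t * ?X n x))" for n
    unfolding char_def by (subst integral_distr[OF m]) auto
  then show "(\<lambda>n. char (distr (OPE mu n) borel (\<lambda>x. meso_stat f \<alpha> x0 n x - EE n (meso_stat f \<alpha> x0 n))) t)
     \<longlonglongrightarrow> char (normal_measure (sigma_sq f)) t"
    unfolding ms char_normal_measure[OF sigma_sq_nonneg]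
    using char_limit[OF f fd supp R0, of t] by simp
qed

end

text \<open>Power series are differentiated term by term inside their interval of convergence; each
  expansion of \<open>h\<close> represents it on a whole interval, so \<open>deriv h\<close> is
  represented there by the differentiated series.\<close>

lemma real_analytic_on_deriv:
  assumes "real_analytic_on h U"
  shows "\<exists>h'. (\<forall>a\<in>U. (h has_real_derivative h' a) (at a)) \<and> real_analytic_on h' U"
proof -
  have *: "\<exists>c. \<exists>r>0. \<forall>y. \<bar>y - a\<bar> < r \<longrightarrow>
      (h has_real_derivative deriv h y) (at y) \<and> (\<lambda>k. c k * (y - a) ^ k) sums deriv h y" if "a \<in> U" for a
  proof -
    from assms that have "\<exists>c. \<exists>r>0. \<forall>y. \<bar>y - a\<bar> < r \<longrightarrow> (\<lambda>k. c k * (y - a) ^ k) sums h y"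
      unfolding real_analytic_on_def by (rule bspec)
    then obtain c r where r: "r > 0" and c: "\<And>y. \<bar>y - a\<bar> < r \<Longrightarrow> (\<lambda>k. c k * (y - a) ^ k) sums h y"
      by metis
    have cz: "(\<lambda>k. c k * z ^ k) sums h (a + z)" if "norm z < r" for z
      using c[of "a + z"] that by simp
    have "(h has_real_derivative deriv h y) (at y) \<and> (\<lambda>k. diffs c k * (y - a) ^ k) sums deriv h y"
      if y: "\<bar>y - a\<bar> < r" for y
    proof -
      have n: "norm (y - a) < r" using y by simp
      let ?S = "\<lambda>z. \<Sum>k. c k * z ^ k" and ?D = "\<Sum>k. diffs c k * (y - a) ^ k"
      have "(?S has_real_derivative ?D) (at (y - a))"
        by (rule termdiffs_strong'[OF sums_summable[OF cz] n])
      then have D: "((\<lambda>x. ?S (x - a)) has_real_derivative ?D) (at y)"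
        using DERIV_shift[of ?S ?D y "- a"] by simp
      have "\<forall>\<^sub>F x in nhds y. x \<in> {x. \<bar>x - a\<bar> < r}"
        using y by (intro eventually_nhds_in_open open_Collect_less continuous_intros) auto
      then have "\<forall>\<^sub>F x in nhds y. ?S (x - a) = h x"
        by eventually_elim (use c in \<open>auto simp: sums_iff\<close>)
      then have "(h has_real_derivative ?D) (at y)"
        using D by (rule DERIV_cong_ev[OF refl _ refl, THEN iffD1])
      moreover have "(\<lambda>k. diffs c k * (y - a) ^ k) sums ?D"
        by (intro summable_sums termdiff_converges[OF n] sums_summable[OF cz])
      ultimately show ?thesis using DERIV_imp_deriv by metis
    qed
    then show ?thesis using r by blast
  qed
  show ?thesis
  proof (intro exI[of _ "deriv h"] conjI ballI)
    show "real_analytic_on (deriv h) U" unfolding real_analytic_on_def using * by blast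
    fix a assume "a \<in> U"
    then obtain r where "r > 0" "\<forall>y. \<bar>y - a\<bar> < r \<longrightarrow> (h has_real_derivative deriv h y) (at y)" using * by blast
    then show "(h has_real_derivative deriv h a) (at a)" by simp
  qed
qed

lemma C1_imp_lipschitz_Icc:
  fixes h :: "real \<Rightarrow> real"
  assumes "\<And>x. x \<in> {a..b} \<Longrightarrow> (h has_real_derivative h' x) (at x)" "continuous_on {a..b} h'"
  shows "\<exists>L. \<forall>x\<in>{a..b}. \<forall>y\<in>{a..b}. \<bar>h x - h y\<bar> \<le> L * \<bar>x - y\<bar>"
proof -
  have "bounded (h' ` {a..b})" using assms(2) by (intro compact_imp_bounded compact_continuous_image) auto
  then obtain L where L: "\<forall>y\<in>h' ` {a..b}. norm y \<le> L" unfolding bounded_iff by blast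
  have "norm (h x - h y) \<le> L * norm (x - y)" if "x \<in> {a..b}" "y \<in> {a..b}" for x y
    by (rule field_differentiable_bound[of "{a..b}" h h' L])
       (use that L assms(1) in \<open>auto intro: has_field_derivative_at_within\<close>)
  then show ?thesis unfolding real_norm_def by blast
qed

theorem theorem1p1:
  fixes h f :: "real \<Rightarrow> real" and g1 g2 x0 \<alpha> :: real
  assumes "g1 > -1" and "g2 > -1"
    and "\<exists>U. open U \<and> {-1..1} \<subseteq> U \<and> real_analytic_on h U"
    and "\<forall>x\<in>{-1..1}. h x > 0"
    and "x0 \<in> {-1<..<1}"
    and "f C1_differentiable_on UNIV" and "bounded {x. f x \<noteq> 0}"
    and "0 < \<alpha>" and "\<alpha> < 1"
  shows "weak_conv_m
     (\<lambda>n. distr (OPE (jacobi_type_measure h g1 g2) n) borel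
        (\<lambda>x. meso_stat f \<alpha> x0 n x
             - integral\<^sup>L (OPE (jacobi_type_measure h g1 g2) n) (meso_stat f \<alpha> x0 n)))
     (normal_measure (sigma_sq f))"
proof -
  obtain U where U: "open U" "{-1..1} \<subseteq> U" "real_analytic_on h U" using assms(3) by blast
  obtain h' where h': "\<And>a. a \<in> U \<Longrightarrow> (h has_real_derivative h' a) (at a)" and "real_analytic_on h' U"
    using real_analytic_on_deriv[OF U(3)] by blast
  then obtain h'' where h'': "\<And>a. a \<in> U \<Longrightarrow> (h' has_real_derivative h'' a) (at a)" and "real_analytic_on h'' U"
    using real_analytic_on_deriv by blast
  \<comment> \<open>A third derivative makes \<open>h''\<close> continuous, hence bounded on the
    interval, which gives the Lipschitz bound for \<open>h'\<close>.\<close>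
  then obtain h3 where h3: "\<And>a. a \<in> U \<Longrightarrow> (h'' has_real_derivative h3 a) (at a)"
    using real_analytic_on_deriv by blast
  have c: "continuous_on {-1..1} h" "continuous_on {-1..1} h'" "continuous_on {-1..1} h''"
    using U(2) h' h'' h3 by (meson DERIV_isCont continuous_at_imp_continuous_on subsetD)+
  \<comment> \<open>Positivity and regularity of \<open>h\<close> are only known on \<open>{-1..1}\<close>, and the measure sees nothing else.\<close>
  define clamp :: "real \<Rightarrow> real" where "clamp x = max (- 1) (min 1 x)" for x
  have cl: "clamp x \<in> {-1..1}" for x by (auto simp: clamp_def)
  have cl_id: "clamp x = x" if "x \<in> {-1..1}" for x using that by (auto simp: clamp_def)
  have cc: "continuous_on UNIV clamp" unfolding clamp_def[abs_def] by (intro continuous_intros)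
  \<comment> \<open>Clamping may leave corners at the endpoints; the locale asks for
    differentiability in the open interval, where the clamped function agrees locally with
    \<open>h\<close>.\<close>
  interpret meso "h \<circ> clamp" "h' \<circ> clamp" g1 g2 x0 \<alpha>
  proof
    show "0 < (h \<circ> clamp) x" for x using assms(4) cl by auto
    show "continuous_on UNIV (h \<circ> clamp)" "continuous_on UNIV (h' \<circ> clamp)"
      unfolding o_def using cl by (auto intro!: continuous_on_compose2[OF c(1) cc] continuous_on_compose2[OF c(2) cc])
    show "(h \<circ> clamp has_real_derivative (h' \<circ> clamp) x) (at x)" if "x \<in> {-1<..<1}" for x
    proof -
      have "\<forall>\<^sub>F y in nhds x. y \<in> {-1<..<1}" by (rule eventually_nhds_in_open) (use that in auto)
      then have "\<forall>\<^sub>F y in nhds x. (h \<circ> clamp) y = h y" by eventually_elim (simp add: cl_id)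
      moreover have "(h' \<circ> clamp) x = h' x" using that by (simp add: cl_id)
      moreover have "(h has_real_derivative h' x) (at x)" using U(2) that by (intro h') (auto simp: subset_iff)
      ultimately show ?thesis using DERIV_cong_ev[OF refl] by metis
    qed
    obtain L where L: "\<forall>x\<in>{-1..1}. \<forall>y\<in>{-1..1}. \<bar>h' x - h' y\<bar> \<le> L * \<bar>x - y\<bar>"
      using C1_imp_lipschitz_Icc[of "- 1" 1 h' h''] h'' c(3) U(2) by blast
    then show "\<exists>L. \<forall>x\<in>{-1..1}. \<forall>y\<in>{-1..1}. \<bar>(h' \<circ> clamp) x - (h' \<circ> clamp) y\<bar> \<le> L * \<bar>x - y\<bar>"
      by (intro exI[of _ L]) (simp add: cl_id)
  qed (use assms in auto)
  have eq: "jacobi_type_measure h g1 g2 = jacobi_type_measure (h \<circ> clamp) g1 g2"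
  proof -
    have "indicator {-1..1} x * h x = indicator {-1..1} x * (h \<circ> clamp) x" for x :: real
      by (auto simp: indicator_def cl_id)
    then show ?thesis unfolding jacobi_type_measure_def by (simp only:)
  qed
  obtain fd where fd: "\<And>u. (f has_vector_derivative fd u) (at u)" "continuous_on UNIV fd"
    using assms(6) unfolding C1_differentiable_on_def by blast
  obtain R where R: "\<forall>x\<in>{x. f x \<noteq> 0}. norm x \<le> R" using assms(7) unfolding bounded_iff by blast
  have "f u = 0" if "\<bar>u\<bar> > \<bar>R\<bar>" for u
    using R that by force
  then show ?thesis unfolding eq
    by (intro mesoscopic_clt[of f fd "\<bar>R\<bar>"]) (use fd in \<open>auto simp: has_real_derivative_iff_has_vector_derivative\<close>)
qed

end
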